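(* Assume $d\geq 2$. Let $p,q\in(1,\infty]$ and $r\in(0,\infty)$ satisfy $\frac1r=\frac1p+\frac1q$. Then there is a constant $C$ (independent of $f,g$) such that for all $f\in L^p(\mathbb{R}^d)$ and $g\in L^q(\mathbb{R}^d)$, $$\|\mathcal{M}_{lac}(f,g)\|_{r}=\Big\|\sup_{l\in\mathbb{Z}}|\mathcal{A}_{2^{-l}}(f,g)|\Big\|_{r}\leq C\,\|f\|_p\|g\|_q .$$ Moreover, $\mathcal{M}_{lac}$ does not satisfy the strong bounds $L^1\times L^\infty\to L^1$ or $L^\infty\times L^1\to L^1$, but it satisfies the weak bounds $\mathcal{M}_{lac}:L^1\times L^\infty\to L^{1,\infty}$ and $\mathcal{M}_{lac}:L^\infty\times L^1\to L^{1,\infty}$.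
   Context: Let $\sigma=\sigma_{2d-1}$ be the natural surface measure on the unit sphere $S^{2d-1}\subset\mathbb{R}^{2d}=\mathbb{R}^d\times\mathbb{R}^d$. For $t>0$ and functions $f,g$ on $\mathbb{R}^d$, the bilinear spherical average is $$\mathcal{A}_t(f,g)(x)=\int_{S^{2d-1}}f(x-ty)\,g(x-tz)\,d\sigma(y,z),\qquad x\in\mathbb{R}^d,\ (y,z)\in\mathbb{R}^d\times\mathbb{R}^d,$$ (defined for a.e. $x$), and the lacunary bilinear spherical maximal function is $\mathcal{M}_{lac}(f,g)(x)=\sup_{l\in\mathbb{Z}}|\mathcal{A}_{2^{-l}}(f,g)(x)|$. For $0<r<\infty$, $\|f\|_r=(\int_{\mathbb{R}^d}|f|^r)^{1/r}$ (also when $r<1$). A bilinear-type operator $T$ is bounded $L^p\times L^q\to Y$ if $\|T(f,g)\|_{Y}\le C\|f\|_{L^p}\|g\|_{L^q}$ for all $f\in L^p(\mathbb{R}^d)$, $g\in L^q(\mathbb{R}^d)$, with $C$ independent of $f,g$; $L^{1,\infty}$ is weak $L^1$. *)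

theory Defs
  imports "HOL-Analysis.Analysis" "HOL-Probability.Essential_Supremum"
begin

section \<open>Surface measure on the unit sphere\<close>

text \<open>
  The surface measure of a Borel set \<open>A\<close> in the unit sphere of an \<open>n\<close>-dimensional
  Euclidean space is \<open>n\<close> times the Lebesgue measure of the cone
  \<open>{s *\<^sub>R \<theta> | s \<theta>. 0 < s \<and> s \<le> 1 \<and> \<theta> \<in> A}\<close>; this is the normalisation for which
  integration in polar coordinates has density \<open>s ^ (n - 1)\<close>.  The measure is completed, so that
  compositions of Lebesgue measurable functions with affine maps can be integrated against it.
\<close>

definition sphere_measure :: "'b::euclidean_space measure" where
  "sphere_measure =
     completion (scale_measure (of_nat DIM('b))
       (distr (restrict_space lborel (cball 0 1 - {0})) (restrict_space borel (sphere 0 1)) sgn))"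

lemma space_sphere_measure: "space (sphere_measure :: 'b::euclidean_space measure) = sphere 0 1"
  by (simp add: sphere_measure_def space_scale_measure space_restrict_space)

lemma emeasure_sphere_measure:
  fixes A :: "'b::euclidean_space set"
  assumes A: "A \<in> sets borel" "A \<subseteq> sphere 0 1"
  shows "emeasure sphere_measure A =
    of_nat DIM('b) * emeasure lborel {s *\<^sub>R \<theta> | s \<theta>. 0 < s \<and> s \<le> 1 \<and> \<theta> \<in> A}"
proof -
  let ?D = "cball 0 1 - {0} :: 'b set"
  let ?R = "restrict_space lborel ?D" and ?S = "restrict_space borel (sphere (0::'b) 1)"
  have D: "?D \<in> sets borel" by measurable
  have AS: "A \<in> sets ?S" using A by (auto simp: sets_restrict_space)
  have m: "sgn \<in> measurable ?R ?S"
  proof (rule measurable_restrict_space2)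
    show "sgn \<in> space ?R \<rightarrow> sphere (0::'b) 1"
      by (auto simp: space_restrict_space norm_sgn)
    have "(sgn :: 'b \<Rightarrow> 'b) = (\<lambda>x. inverse (norm x) *\<^sub>R x)" by (auto simp: sgn_div_norm)
    also have "\<dots> \<in> borel_measurable borel" by measurable
    finally show "sgn \<in> borel_measurable ?R" by (simp add: measurable_restrict_space1)
  qed
  have cone: "sgn -` A \<inter> ?D = {s *\<^sub>R \<theta> | s \<theta>. 0 < s \<and> s \<le> 1 \<and> \<theta> \<in> A}" (is "_ = ?C")
  proof (intro equalityI subsetI)
    fix x assume x: "x \<in> sgn -` A \<inter> ?D"
    then have "x = norm x *\<^sub>R sgn x" "0 < norm x" "norm x \<le> 1" "sgn x \<in> A"
      by (auto simp: sgn_div_norm)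
    then show "x \<in> ?C" by blast
  next
    fix x assume "x \<in> ?C"
    then obtain s \<theta> where s: "x = s *\<^sub>R \<theta>" "0 < s" "s \<le> 1" "\<theta> \<in> A" by blast
    then have "norm \<theta> = 1" using A(2) by auto
    with s show "x \<in> sgn -` A \<inter> ?D" by (auto simp: sgn_div_norm)
  qed
  have "emeasure sphere_measure A = of_nat DIM('b) * emeasure (distr ?R ?S sgn) A"
    using AS by (simp add: sphere_measure_def)
  also have "emeasure (distr ?R ?S sgn) A = emeasure ?R (sgn -` A \<inter> ?D)"
    using AS m by (simp add: emeasure_distr space_restrict_space)
  also have "\<dots> = emeasure lborel (sgn -` A \<inter> ?D)"
    using D by (intro emeasure_restrict_space) auto
  finally show ?thesis by (simp add: cone)
qed


section \<open>Lebesgue norms with exponents in \<open>(0, \<infinity>]\<close>\<close>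

text \<open>Positive real powers on \<open>[0, \<infinity>]\<close>; only used for positive exponents.\<close>

definition enn_powr :: "ennreal \<Rightarrow> real \<Rightarrow> ennreal" where
  "enn_powr x a = (if x = top then top else ennreal (enn2real x powr a))"

definition Lnorm :: "ennreal \<Rightarrow> ('a::euclidean_space \<Rightarrow> ennreal) \<Rightarrow> ennreal" where
  "Lnorm p h =
     (if p = top then esssup lebesgue h
      else enn_powr (\<integral>\<^sup>+ x. enn_powr (h x) (enn2real p) \<partial>lebesgue) (1 / enn2real p))"

definition weak_L1_norm :: "('a::euclidean_space \<Rightarrow> ennreal) \<Rightarrow> ennreal" where
  "weak_L1_norm h = (SUP s\<in>{0<..}. ennreal s * emeasure lebesgue {x. h x > ennreal s})"

abbreviation fun_Lnorm :: "ennreal \<Rightarrow> ('a::euclidean_space \<Rightarrow> complex) \<Rightarrow> ennreal" where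
  "fun_Lnorm p f \<equiv> Lnorm p (\<lambda>x. ennreal (norm (f x)))"

definition Lp :: "ennreal \<Rightarrow> ('a::euclidean_space \<Rightarrow> complex) set" where
  "Lp p = {f. f \<in> borel_measurable lebesgue \<and> fun_Lnorm p f < top}"

type_synonym 'a bilin_op = "('a \<Rightarrow> complex) \<Rightarrow> ('a \<Rightarrow> complex) \<Rightarrow> 'a \<Rightarrow> ennreal"

text \<open>
  \<open>bounded_bilin T p q N\<close>: the operator \<open>T\<close> is bounded from \<open>L\<^sup>p \<times> L\<^sup>q\<close> to the space
  whose (quasi-)norm is \<open>N\<close>, with a finite constant.
\<close>

definition bounded_bilin ::
  "'a::euclidean_space bilin_op \<Rightarrow> ennreal \<Rightarrow> ennreal \<Rightarrow> (('a \<Rightarrow> ennreal) \<Rightarrow> ennreal) \<Rightarrow> bool" where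
  "bounded_bilin T p q N \<longleftrightarrow>
     (\<exists>C::real. \<forall>f\<in>Lp p. \<forall>g\<in>Lp q. N (T f g) \<le> ennreal C * fun_Lnorm p f * fun_Lnorm q g)"


section \<open>Bilinear spherical averages\<close>

definition bisph_integrand ::
  "real \<Rightarrow> ('a::euclidean_space \<Rightarrow> complex) \<Rightarrow> ('a \<Rightarrow> complex) \<Rightarrow> 'a \<Rightarrow> 'a \<times> 'a \<Rightarrow> complex" where
  "bisph_integrand t f g x = (\<lambda>(y, z). f (x - t *\<^sub>R y) * g (x - t *\<^sub>R z))"

definition bisph_avg ::
  "real \<Rightarrow> ('a::euclidean_space \<Rightarrow> complex) \<Rightarrow> ('a \<Rightarrow> complex) \<Rightarrow> 'a \<Rightarrow> complex" where
  "bisph_avg t f g x = (\<integral>w. bisph_integrand t f g x w \<partial>sphere_measure)"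

definition lac_max :: "'a::euclidean_space bilin_op" where
  "lac_max f g x = (SUP l::int. ennreal (norm (bisph_avg (2 powi (- l)) f g x)))"

text \<open>
  The Bochner integral is \<open>0\<close> for non-integrable functions, \<open>emeasure\<close> is \<open>0\<close> on
  non-measurable sets, and \<open>nn_integral\<close> of a non-measurable function is a lower integral.
  The following predicate says that none of these conventions is in effect for \<open>f\<close> and \<open>g\<close>:
  every average is defined almost everywhere by an absolutely convergent integral, and the
  maximal function is measurable.
\<close>

definition bisph_well_defined ::
  "('a::euclidean_space \<Rightarrow> complex) \<Rightarrow> ('a \<Rightarrow> complex) \<Rightarrow> bool" where
  "bisph_well_defined f g \<longleftrightarrow>
     (\<forall>t>0. AE x in lebesgue. integrable sphere_measure (bisph_integrand t f g x)) \<and>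
     lac_max f g \<in> borel_measurable lebesgue"

end

theory Submission
  imports Defs
begin

text \<open>
  Slicing the sphere turns the average into
  \<open>d \<integral>\<^bsub>\<bar>u\<bar><1\<^esub> f(x - tu) (1 - \<bar>u\<bar>\<^sup>2)\<^bsup>(d-2)/2\<^esup> \<integral>\<^bsub>B\<^esub> g(x - t(1 - \<bar>u\<bar>\<^sup>2)\<^bsup>1/2\<^esup> z/\<bar>z\<bar>) dz du\<close>, and a rotation of
  \<open>\<real>\<^sup>d \<times> \<real>\<^sup>d\<close> gives \<open>L\<^sup>1 \<times> L\<^sup>1 \<rightarrow> L\<^sup>1\<close> bounds for a single scale.  At scale \<open>2\<^sup>-\<^sup>l\<close> the functions are replaced by their
  averages over dyadic cells of side \<open>2\<^bsup>-(l+m)\<^esup>\<close> and the maximal function is telescoped in \<open>m\<close>.  Every term of the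
  telescoping sum satisfies a weak \<open>L\<^sup>1 \<times> L\<^sup>1 \<rightarrow> L\<^bsup>1/2,\<infinity>\<^esup>\<close> type bound with a constant linear in \<open>m\<close> (stopping times and the
  single scale bound), and an \<open>L\<^sup>\<infinity> \<times> L\<^sup>2 \<rightarrow> L\<^sup>2\<close> bound with constant \<open>2\<^bsup>-m/4\<^esup>\<close>: the square of a difference
  of spherical means, averaged over radii, is an integral over the convolution kernel of two spheres, which is a
  superposition of balls, so that only thin shells see the oscillation of a function with mean zero on cells.
  Interpolation gives geometric decay in \<open>m\<close>.  When one exponent is \<open>\<infinity>\<close> the weak bound for one function suffices;
  the strong endpoint bounds fail for the indicator of a ball and the constant \<open>1\<close>.
\<close>

text \<open>Bounding the inner spherical mean by its supremum over radii would bring in the full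
  spherical maximal function, which is unbounded on L^q for q \<le> d/(d-1). The average over radii
  that the slicing supplies must therefore survive until the square has been opened; it makes the
  mixed products integrals over solid balls even for d = 2, and no Fourier transform is used. A
  second obstacle is that r may be smaller than 1, where neither duality nor the triangle inequality
  is available. For this reason the weak type bounds carry a sum, not a product, of the two L^1
  quantities: a sum can be added up over all scales 2^(-l), and the price is only the number of
  scales that separate l from l + m. All functions take values in [0, \<infinity>]; differences
  appear through truncated subtraction, identities are written with all terms positive, and each
  cancellation needs a finite cross term. That is the origin of the finiteness side conditions
  below.\<close>

abbreviation borel_fun :: "('a::topological_space \<Rightarrow> 'b::topological_space) \<Rightarrow> bool" where
  "borel_fun f \<equiv> f \<in> borel_measurable borel"

abbreviation nn_lborel :: "('a::euclidean_space \<Rightarrow> ennreal) \<Rightarrow> ennreal" (binder "NI " 10) where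
  "nn_lborel f \<equiv> nn_integral lborel f"

section \<open>Polar coordinates and other integral identities\<close>

lemma nn_integral_lborel_affine:
  fixes f :: "'a::euclidean_space \<Rightarrow> ennreal"
  assumes [measurable]: "borel_fun f" and c: "c \<noteq> 0"
  shows "(NI x. f x) = ennreal (\<bar>c\<bar> ^ DIM('a)) * (NI x. f (t + c *\<^sub>R x))"
  by (subst lborel_affine[OF c, of t])
     (simp add: nn_integral_density nn_integral_distr nn_integral_cmult)

lemma nn_integral_lborel_shift:
  fixes f :: "'a::euclidean_space \<Rightarrow> ennreal"
  assumes [measurable]: "borel_fun f"
  shows "(NI x. f (t + x)) = (NI x. f x)"
    "(NI x. f (x + t)) = (NI x. f x)"
    "(NI x. f (x - t)) = (NI x. f x)"
    "(NI x. f (t - x)) = (NI x. f x)"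
  using nn_integral_lborel_affine[of f 1 t] nn_integral_lborel_affine[of f 1 "-t"]
    nn_integral_lborel_affine[of f "-1" t]
  by (simp_all add: add.commute)

lemma nn_integral_lborel_swap:
  fixes f :: "'a::euclidean_space \<Rightarrow> 'b::euclidean_space \<Rightarrow> ennreal"
  assumes "(\<lambda>(x, y). f x y) \<in> borel_measurable (borel \<Otimes>\<^sub>M borel)"
  shows "(NI x. NI y. f x y) = (NI y. NI x. f x y)"
proof -
  have "(\<lambda>(x, y). f x y) \<in> borel_measurable (lborel \<Otimes>\<^sub>M lborel)"
    using assms by (simp add: measurable_cong_sets[OF sets_pair_measure_cong[OF sets_lborel sets_lborel] refl])
  from lborel_pair.Fubini'[OF this] show ?thesis by simp
qed

lemma nn_integral_lborel_pair:
  fixes f :: "'a::euclidean_space \<times> 'b::euclidean_space \<Rightarrow> ennreal"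
  assumes [measurable]: "borel_fun f"
  shows "(NI w. f w) = (NI y. NI z. f (y, z))"
    "(NI w. f w) = (NI z. NI y. f (y, z))"
proof -
  have f': "f \<in> borel_measurable (lborel \<Otimes>\<^sub>M lborel)"
    using assms by (simp add: lborel_prod)
  show "(NI w. f w) = (NI y. NI z. f (y, z))"
    using lborel.nn_integral_fst[OF f'] by (simp add: lborel_prod)
  show "(NI w. f w) = (NI z. NI y. f (y, z))"
    using lborel_pair.nn_integral_snd[of f] f' by (simp add: lborel_prod)
qed

lemma borel_measurable_sgn_vec [measurable (raw)]:
  "(sgn :: 'a::euclidean_space \<Rightarrow> 'a) \<in> borel_measurable borel"
proof -
  have "(sgn :: 'a \<Rightarrow> 'a) = (\<lambda>x. inverse (norm x) *\<^sub>R x)" by (auto simp: sgn_div_norm)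
  also have "borel_fun \<dots>" by measurable
  finally show ?thesis .
qed

lemma borel_cball [measurable]: "cball c r \<in> sets borel" "{x. x \<in> cball c r} \<in> sets borel"
  by (simp_all only: Collect_mem_eq borel_closed closed_cball)

lemma borel_ball [measurable]: "ball c r \<in> sets borel" "{x. x \<in> ball c r} \<in> sets borel"
  by (simp_all only: Collect_mem_eq borel_open open_ball)

lemma borel_measurable_indicator_atLeast [measurable (raw)]:
  fixes f g :: "'b \<Rightarrow> real"
  assumes [measurable]: "f \<in> borel_measurable M" "g \<in> borel_measurable M"
  shows "(\<lambda>x. indicator {f x..} (g x) :: ennreal) \<in> borel_measurable M"
  unfolding indicator_def atLeast_iff by measurable

lemma sgn_polar:
  fixes z :: "'a::real_normed_vector"
  assumes "0 < r" "z \<noteq> 0"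
  shows "sgn (r *\<^sub>R sgn z) = sgn z" "norm (r *\<^sub>R sgn z) = r"
  using assms by (simp_all add: sgn_scaleR norm_sgn sgn_div_norm[of "sgn z"])

lemma borel_measurable_orthogonal:
  fixes R :: "'a::euclidean_space \<Rightarrow> 'a"
  assumes "orthogonal_transformation R" shows "borel_fun R"
proof -
  have "bounded_linear R"
    using orthogonal_transformation_linear[OF assms] by (simp add: linear_conv_bounded_linear)
  then have "continuous_on UNIV R" by (rule linear_continuous_on)
  then show ?thesis by (rule borel_measurable_continuous_onI)
qed

section \<open>Rotation invariance and integration along lines\<close>

abbreviation unit_ball :: "'a::euclidean_space set" where "unit_ball \<equiv> cball 0 1"

lemma emeasure_unit_ball: 
  "0 < emeasure lborel (unit_ball::'a::euclidean_space set)" "emeasure lborel (unit_ball::'a set) < top"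
proof -
  have "box (0::'a) (One /\<^sub>R real DIM('a)) \<subseteq> cball 0 1"
  proof
    fix x :: 'a assume x: "x \<in> box 0 (One /\<^sub>R real DIM('a))"
    have "norm x \<le> (\<Sum>b\<in>Basis. \<bar>x \<bullet> b\<bar>)" by (rule norm_le_l1)
    also have "\<dots> \<le> (\<Sum>b\<in>(Basis::'a set). 1 / real DIM('a))"
      using x by (intro sum_mono) (auto simp: mem_box divide_inverse less_imp_le)
    finally show "x \<in> cball 0 1" by simp
  qed
  then have "emeasure lborel (box (0::'a) (One /\<^sub>R real DIM('a))) \<le> emeasure lborel (cball (0::'a) 1)"
    by (intro emeasure_mono) auto
  moreover have "0 < emeasure lborel (box (0::'a) (One /\<^sub>R real DIM('a)))"
    by (subst emeasure_lborel_box) (auto intro!: prod_pos)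
  ultimately show "0 < emeasure lborel (cball (0::'a) 1)" by (rule less_le_trans[rotated])
  show "emeasure lborel (cball (0::'a) 1) < top"
    using emeasure_compact_finite[of "cball (0::'a) 1"] by simp
qed

text \<open>No determinant is used; the argument is that of the uniqueness of Haar measure. Both
  sides are multiplied by the measure of the unit ball, whose indicator is inserted at
  \<open>R x + y\<close>. Tonelli and translations move y from the indicator to f, and the ball
  itself is invariant under R.\<close>

lemma nn_integral_lborel_orthogonal:
  fixes f :: "'a::euclidean_space \<Rightarrow> ennreal" and R :: "'a \<Rightarrow> 'a"
  assumes R: "orthogonal_transformation R" and [measurable]: "borel_fun f"
  shows "(NI x. f (R x)) = (NI x. f x)"
proof -
  have [measurable]: "borel_fun R" using R by (rule borel_measurable_orthogonal)
  let ?B = "unit_ball :: 'a set" and ?m = "emeasure lborel (unit_ball :: 'a set)"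
  have "(NI x. f (R x)) * ?m = (NI x. f (R x) * (NI y. indicator ?B y))"
    by (subst nn_integral_multc[symmetric]) auto
  also have "\<dots> = (NI x. f (R x) * (NI y. indicator ?B (R x + y)))"
    by (subst nn_integral_lborel_shift) auto
  also have "\<dots> = (NI x. NI y. f (R x) * indicator ?B (R x + y))"
    by (subst nn_integral_cmult) auto
  also have "\<dots> = (NI y. NI x. f (R x) * indicator ?B (R x + y))"
    by (rule nn_integral_lborel_swap) measurable
  also have "\<dots> = (NI y. NI x. f (R x - y) * indicator ?B (R x))"
  proof (rule nn_integral_cong)
    fix y :: 'a
    obtain z where z: "R z = y" using orthogonal_transformation_surj[OF R] by (metis surj_def)
    have "R (x - z) = R x - y" for x
      using linear_diff[OF orthogonal_transformation_linear[OF R]] z by metis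
    then show "(NI x. f (R x) * indicator ?B (R x + y)) = (NI x. f (R x - y) * indicator ?B (R x))"
      by (subst nn_integral_lborel_shift(3)[of _ z, symmetric]) auto
  qed
  also have "\<dots> = (NI x. NI y. f (R x - y) * indicator ?B (R x))"
    by (rule nn_integral_lborel_swap) measurable
  also have "\<dots> = (NI x. (NI y. f y) * indicator ?B x)"
    by (subst nn_integral_multc, measurable, subst nn_integral_lborel_shift(4), measurable)
       (simp add: indicator_def orthogonal_transformation_norm[OF R])
  also have "\<dots> = (NI y. f y) * ?m" by (subst nn_integral_cmult) auto
  finally have "?m * (NI x. f (R x)) = ?m * (NI y. f y)" by (simp only: mult.commute)
  then show ?thesis using emeasure_unit_ball[where 'a='a]
    by (auto simp: ennreal_mult_cancel_left)
qed

text \<open>Fubini along the direction w without coordinates on the orthogonal hyperplane: the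
  hyperplane is thickened to the slab where \<open>p \<bullet> w\<close> lies in [0,1), which every
  line parallel to w meets in a segment of length 1.\<close>

lemma nn_integral_lborel_lines:
  fixes F :: "'a::euclidean_space \<Rightarrow> ennreal"
  assumes [measurable]: "borel_fun F" and w: "norm w = 1"
  shows "(NI x. F x) =
    (NI p. indicator {0..<1} (p \<bullet> w) * (NI s. F ((p - (p \<bullet> w) *\<^sub>R w) + s *\<^sub>R w)))"
proof -
  have ww: "w \<bullet> w = 1" using w by (simp add: norm_eq_sqrt_inner)
  have "(NI p. indicator {0..<1} (p \<bullet> w) * (NI s. F ((p - (p \<bullet> w) *\<^sub>R w) + s *\<^sub>R w)))
     = (NI p. indicator {0..<1} (p \<bullet> w) * (NI s. F (p + s *\<^sub>R w)))"
  proof (rule nn_integral_cong)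
    fix p
    show "indicator {0..<1} (p \<bullet> w) * (NI s. F ((p - (p \<bullet> w) *\<^sub>R w) + s *\<^sub>R w)) =
      indicator {0..<1} (p \<bullet> w) * (NI s. F (p + s *\<^sub>R w))"
      by (subst nn_integral_lborel_shift(3)[of "\<lambda>s. F (p + s *\<^sub>R w)" "p \<bullet> w", symmetric])
         (auto simp: algebra_simps)
  qed
  also have "\<dots> = (NI p. NI s. indicator {0..<1} (p \<bullet> w) * F (p + s *\<^sub>R w))"
    by (subst nn_integral_cmult) auto
  also have "\<dots> = (NI s. NI p. indicator {0..<1} (p \<bullet> w) * F (p + s *\<^sub>R w))"
    by (rule nn_integral_lborel_swap) measurable
  also have "\<dots> = (NI s. NI p. indicator {0..<1} (p \<bullet> w - s) * F p)"
  proof (rule nn_integral_cong)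
    fix s :: real
    show "(NI p. indicator {0..<1} (p \<bullet> w) * F (p + s *\<^sub>R w)) = (NI p. indicator {0..<1} (p \<bullet> w - s) * F p)"
      by (subst nn_integral_lborel_shift(3)[of _ "s *\<^sub>R w", symmetric])
         (auto simp: inner_diff_left ww)
  qed
  also have "\<dots> = (NI p. NI s. indicator {0..<1} (p \<bullet> w - s) * F p)"
    by (rule nn_integral_lborel_swap) measurable
  also have "\<dots> = (NI p. F p)"
    by (subst nn_integral_multc, measurable, subst nn_integral_lborel_shift(4)) auto
  finally show ?thesis by simp
qed

lemma nn_integral_power_tail:
  fixes a :: real assumes "0 < a" "0 < n"
  shows "(NI \<tau>. ennreal (real n / \<tau> ^ Suc n) * indicator {a..} \<tau>) = ennreal (1 / a ^ n)"
proof -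
  have "(NI \<tau>. ennreal (real n / \<tau> ^ Suc n) * indicator {a..} \<tau>) = ennreal (0 - (- (1 / a ^ n)))"
  proof (rule nn_integral_FTC_atLeast)
    fix x assume "a \<le> x"
    with assms have "0 < x" by simp
    obtain m where n: "n = Suc m" using assms by (cases n) auto
    show "((\<lambda>x. - (1 / x ^ n)) has_real_derivative real n / x ^ Suc n) (at x)"
      unfolding n
      by (rule DERIV_cong[OF DERIV_minus[OF DERIV_divide[OF DERIV_const[of 1] DERIV_pow[of "Suc m" x]]]])
         (use \<open>0 < x\<close> in \<open>auto simp: field_simps\<close>)
    show "0 \<le> real n / x ^ Suc n" using \<open>0 < x\<close> by simp
  next
    have "((\<lambda>x::real. 1 / x ^ n) \<longlongrightarrow> 0) at_top"
      by (intro tendsto_divide_0[OF tendsto_const] filterlim_at_top_imp_at_infinity filterlim_pow_at_top assms filterlim_ident)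
    from tendsto_minus[OF this] show "((\<lambda>x::real. - (1 / x ^ n)) \<longlongrightarrow> 0) at_top" by simp
  qed measurable
  then show ?thesis by simp
qed

text \<open>Directions are sampled by \<open>sgn z\<close> with z in the solid ball, in agreement
  with the cone definition of the surface measure. For fixed z the radius is rescaled by |z|, so
  that \<open>r *\<^sub>R sgn z\<close> becomes \<open>r *\<^sub>R z\<close>. The substitution x = r
  z then leaves, for each x, the integral of d / r^(d+1) over r \<ge> |x|, and this cancels the
  factor |x|^d.\<close>

lemma nn_integral_polar:
  fixes h :: "'a::euclidean_space \<Rightarrow> ennreal"
  assumes [measurable]: "borel_fun h"
  shows "(NI x. h x) = (NI r. ennreal (real DIM('a) * r ^ (DIM('a) - 1)) * indicator {0<..} r *
      (NI z. indicator unit_ball z * h (r *\<^sub>R sgn z)))"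
proof -
  let ?d = "DIM('a)"
  have d: "Suc (?d - 1) = ?d" using DIM_positive[where 'a='a] by simp
  have dp: "x * x ^ (?d - 1) = x ^ ?d" for x :: real by (subst (2) d[symmetric]) (simp only: power_Suc)
  have "(NI r. ennreal (real ?d * r ^ (?d - 1)) * indicator {0<..} r *
      (NI z. indicator unit_ball z * h (r *\<^sub>R sgn z)))
    = (NI r. NI z. ennreal (real ?d * r ^ (?d - 1)) * indicator {0<..} r * (indicator unit_ball z * h (r *\<^sub>R sgn z)))"
    by (subst nn_integral_cmult) simp_all
  also have "\<dots> = (NI z. NI r. ennreal (real ?d * r ^ (?d - 1)) * indicator {0<..} r * (indicator unit_ball z * h (r *\<^sub>R sgn z)))"
    by (rule nn_integral_lborel_swap) measurable
  also have "\<dots> = (NI z. NI r. ennreal (real ?d * r ^ (?d - 1)) * indicator {0<..} r * (indicator unit_ball z * ennreal (norm z ^ ?d) * h (r *\<^sub>R z)))"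
  proof (rule nn_integral_cong_AE, use AE_lborel_singleton[of 0] in eventually_elim)
    fix z :: 'a assume z: "z \<noteq> 0"
    have z': "norm z *\<^sub>R sgn z = z" using z by (simp add: sgn_div_norm)
    have "(NI r. ennreal (real ?d * r ^ (?d - 1)) * indicator {0<..} r * (indicator unit_ball z * h (r *\<^sub>R sgn z)))
      = ennreal (norm z) * (NI r. ennreal (real ?d * (norm z * r) ^ (?d - 1)) * indicator {0<..} (norm z * r) * (indicator unit_ball z * h ((norm z * r) *\<^sub>R sgn z)))"
      using z by (subst nn_integral_real_affine[of _ "norm z" 0]) auto
    also have "\<dots> = (NI r. ennreal (norm z) * (ennreal (real ?d * (norm z * r) ^ (?d - 1)) * indicator {0<..} (norm z * r) * (indicator unit_ball z * h ((norm z * r) *\<^sub>R sgn z))))"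
      by (subst nn_integral_cmult) auto
    also have "\<dots> = (NI r. ennreal (real ?d * r ^ (?d - 1)) * indicator {0<..} r * (indicator unit_ball z * ennreal (norm z ^ ?d) * h (r *\<^sub>R z)))"
    proof (rule nn_integral_cong)
      fix r :: real
      have "(norm z * r) *\<^sub>R sgn z = r *\<^sub>R z" by (subst (3) z'[symmetric]) (simp add: mult.commute)
      moreover have "indicator {0<..} (norm z * r) = (indicator {0<..} r :: ennreal)" using z by (auto simp: indicator_def zero_less_mult_iff)
      moreover have "0 < r \<Longrightarrow> ennreal (norm z) * ennreal (real ?d * (norm z * r) ^ (?d - 1)) = ennreal (real ?d * r ^ (?d - 1)) * ennreal (norm z ^ ?d)"
      proof -
        assume "0 < r"
        have "norm z * (real ?d * (norm z * r) ^ (?d - 1)) = real ?d * r ^ (?d - 1) * norm z ^ ?d"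
          using dp[of "norm z"] by (simp add: power_mult_distrib)
        then show ?thesis using \<open>0 < r\<close> by (simp add: ennreal_mult[symmetric])
      qed
      moreover have "a * b = c * e \<Longrightarrow> a * (b * k * (i * h)) = c * k * (i * e * h)" for a b c e i h k :: ennreal
        by (simp only: mult.assoc[symmetric]) (simp only: mult_ac)
      ultimately show "ennreal (norm z) * (ennreal (real ?d * (norm z * r) ^ (?d - 1)) * indicator {0<..} (norm z * r) * (indicator unit_ball z * h ((norm z * r) *\<^sub>R sgn z)))
         = ennreal (real ?d * r ^ (?d - 1)) * indicator {0<..} r * (indicator unit_ball z * ennreal (norm z ^ ?d) * h (r *\<^sub>R z))"
        by (cases "0 < r") (simp_all only: indicator_simps greaterThan_iff mult_zero_left mult_zero_right not_True_eq_False not_False_eq_True)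
    qed
    finally show "(NI r. ennreal (real ?d * r ^ (?d - 1)) * indicator {0<..} r * (indicator unit_ball z * h (r *\<^sub>R sgn z)))
      = (NI r. ennreal (real ?d * r ^ (?d - 1)) * indicator {0<..} r * (indicator unit_ball z * ennreal (norm z ^ ?d) * h (r *\<^sub>R z)))" .
  qed
  also have "\<dots> = (NI r. NI z. ennreal (real ?d * r ^ (?d - 1)) * indicator {0<..} r * (indicator unit_ball z * ennreal (norm z ^ ?d) * h (r *\<^sub>R z)))"
    by (rule nn_integral_lborel_swap) measurable
  also have "\<dots> = (NI r. NI x. ennreal (real ?d / r ^ Suc ?d) * indicator {0<..} r * indicator {norm x..} r * ennreal (norm x ^ ?d) * h x)"
  proof (rule nn_integral_cong)
    fix r :: real
    show "(NI z. ennreal (real ?d * r ^ (?d - 1)) * indicator {0<..} r * (indicator unit_ball z * ennreal (norm z ^ ?d) * h (r *\<^sub>R z)))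
      = (NI x. ennreal (real ?d / r ^ Suc ?d) * indicator {0<..} r * indicator {norm x..} r * ennreal (norm x ^ ?d) * h x)"
    proof (cases "0 < r")
      case True
      have e: "ennreal (r ^ ?d) * ennreal (real ?d / r ^ Suc ?d) * ennreal ((r * norm z) ^ ?d) = ennreal (real ?d * r ^ (?d - 1)) * ennreal (norm z ^ ?d)" for z :: 'a
      proof -
        have "r ^ ?d * (real ?d / r ^ Suc ?d) * (r * norm z) ^ ?d = real ?d * r ^ (?d - 1) * norm z ^ ?d"
        proof -
          define q where "q = r ^ (?d - 1)"
          have q: "r ^ ?d = r * q" "q > 0" using True dp[of r] by (auto simp: q_def)
          show ?thesis using True q(2) unfolding power_mult_distrib power_Suc q(1) q_def[symmetric] by (simp add: field_simps)
        qed
        then show ?thesis using True by (simp add: ennreal_mult[symmetric])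
      qed
      have "(NI x. ennreal (real ?d / r ^ Suc ?d) * indicator {0<..} r * indicator {norm x..} r * ennreal (norm x ^ ?d) * h x)
        = ennreal (r ^ ?d) * (NI x. ennreal (real ?d / r ^ Suc ?d) * indicator {0<..} r * indicator {norm (r *\<^sub>R x)..} r * ennreal (norm (r *\<^sub>R x) ^ ?d) * h (r *\<^sub>R x))"
        by (subst nn_integral_lborel_affine[of _ r 0], measurable) (use True in auto)
      also have "\<dots> = (NI x. ennreal (r ^ ?d) * (ennreal (real ?d / r ^ Suc ?d) * indicator {0<..} r * indicator {norm (r *\<^sub>R x)..} r * ennreal (norm (r *\<^sub>R x) ^ ?d) * h (r *\<^sub>R x)))"
        by (subst nn_integral_cmult) auto
      also have "\<dots> = (NI z. ennreal (real ?d * r ^ (?d - 1)) * indicator {0<..} r * (indicator unit_ball z * ennreal (norm z ^ ?d) * h (r *\<^sub>R z)))"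
      proof (rule nn_integral_cong)
        fix z :: 'a
        have i: "indicator {norm (r *\<^sub>R z)..} r = (indicator unit_ball z :: ennreal)" using True by (auto simp: indicator_def)
        have "ennreal (r ^ ?d) * (ennreal (real ?d / r ^ Suc ?d) * indicator {0<..} r * indicator {norm (r *\<^sub>R z)..} r * ennreal (norm (r *\<^sub>R z) ^ ?d) * h (r *\<^sub>R z))
          = (ennreal (r ^ ?d) * ennreal (real ?d / r ^ Suc ?d) * ennreal ((r * norm z) ^ ?d)) * indicator {0<..} r * indicator unit_ball z * h (r *\<^sub>R z)"
          using True unfolding i by (simp add: mult_ac)
        then show "ennreal (r ^ ?d) * (ennreal (real ?d / r ^ Suc ?d) * indicator {0<..} r * indicator {norm (r *\<^sub>R z)..} r * ennreal (norm (r *\<^sub>R z) ^ ?d) * h (r *\<^sub>R z))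
          = ennreal (real ?d * r ^ (?d - 1)) * indicator {0<..} r * (indicator unit_ball z * ennreal (norm z ^ ?d) * h (r *\<^sub>R z))"
          unfolding e by (simp add: mult_ac)
      qed
      finally show ?thesis by simp
    qed simp
  qed
  also have "\<dots> = (NI x. NI r. ennreal (real ?d / r ^ Suc ?d) * indicator {0<..} r * indicator {norm x..} r * ennreal (norm x ^ ?d) * h x)"
    by (rule nn_integral_lborel_swap) measurable
  also have "\<dots> = (NI x. h x)"
  proof (rule nn_integral_cong_AE, use AE_lborel_singleton[of 0] in eventually_elim)
    fix x :: 'a assume x: "x \<noteq> 0"
    have "(NI r. ennreal (real ?d / r ^ Suc ?d) * indicator {0<..} r * indicator {norm x..} r * ennreal (norm x ^ ?d) * h x)
      = (NI r. ennreal (real ?d / r ^ Suc ?d) * indicator {norm x..} r * (ennreal (norm x ^ ?d) * h x))"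
    proof (rule nn_integral_cong)
      fix r :: real
      show "ennreal (real ?d / r ^ Suc ?d) * indicator {0<..} r * indicator {norm x..} r * ennreal (norm x ^ ?d) * h x
        = ennreal (real ?d / r ^ Suc ?d) * indicator {norm x..} r * (ennreal (norm x ^ ?d) * h x)"
        using x zero_less_norm_iff[of x] by (cases "0 < r") (auto simp: mult_ac indicator_def simp del: zero_less_norm_iff)
    qed
    also have "\<dots> = ennreal (1 / norm x ^ ?d) * (ennreal (norm x ^ ?d) * h x)"
      by (subst nn_integral_multc, measurable, subst nn_integral_power_tail) (use x in auto)
    also have "\<dots> = h x" using x by (simp add: mult.assoc[symmetric] ennreal_mult[symmetric])
    finally show "(NI r. ennreal (real ?d / r ^ Suc ?d) * indicator {0<..} r * indicator {norm x..} r * ennreal (norm x ^ ?d) * h x) = h x" .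
  qed
  finally show ?thesis by simp
qed

text \<open>Both sides are polar forms of the same radial average over the pair of directions.\<close>

lemma nn_integral_ball_radial_direction:
  fixes F :: "real \<Rightarrow> 'a::euclidean_space \<Rightarrow> ennreal"
  assumes [measurable]: "case_prod F \<in> borel_measurable (borel \<Otimes>\<^sub>M borel)"
  shows "(NI v. NI z. indicator (unit_ball::'a set) v * indicator unit_ball z * F (norm v) (sgn z))
    = emeasure lborel (unit_ball::'a set) * (NI u. indicator unit_ball u * F (norm u) (sgn u))"
proof -
  let ?d = "DIM('a)" and ?m = "emeasure lborel (unit_ball::'a set)"
  have s: "sgn (r *\<^sub>R sgn z) = sgn z" "norm (r *\<^sub>R sgn z) = r" if "0 < r" "z \<noteq> 0" for r and z :: 'a
    using sgn_polar[OF that] by blast+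
  define I where "I r = (NI z. indicator unit_ball z * F r (sgn z))" for r
  have [measurable]: "borel_fun I" unfolding I_def by measurable
  have "(NI v. NI z. indicator (unit_ball::'a set) v * indicator unit_ball z * F (norm v) (sgn z))
    = (NI v. indicator (unit_ball::'a set) v * I (norm v))"
    unfolding I_def by (subst nn_integral_cmult[symmetric]) (auto simp: mult.assoc)
  also have "\<dots> = (NI r. ennreal (real ?d * r ^ (?d - 1)) * indicator {0<..} r *
      (NI z. indicator unit_ball z * (indicator (unit_ball::'a set) (r *\<^sub>R sgn z) * I (norm (r *\<^sub>R sgn z)))))"
    by (rule nn_integral_polar) measurable
  also have "\<dots> = (NI r. ?m * (ennreal (real ?d * r ^ (?d - 1)) * indicator {0<..} r * (indicator {..1} r * I r)))"
  proof (rule nn_integral_cong)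
    fix r :: real
    have "(NI z. indicator unit_ball z * (indicator (unit_ball::'a set) (r *\<^sub>R sgn z) * I (norm (r *\<^sub>R sgn z))))
      = (NI z. indicator (unit_ball::'a set) z * (indicator {..1} r * I r))" if "0 < r"
      by (rule nn_integral_cong_AE, use AE_lborel_singleton[of 0] in eventually_elim)
         (use that s in \<open>auto simp: indicator_def\<close>)
    also have "(NI z. indicator (unit_ball::'a set) z * (indicator {..1} r * I r)) = ?m * (indicator {..1} r * I r)"
      by (subst nn_integral_multc) auto
    finally show "ennreal (real ?d * r ^ (?d - 1)) * indicator {0<..} r *
      (NI z. indicator unit_ball z * (indicator (unit_ball::'a set) (r *\<^sub>R sgn z) * I (norm (r *\<^sub>R sgn z))))
      = ?m * (ennreal (real ?d * r ^ (?d - 1)) * indicator {0<..} r * (indicator {..1} r * I r))"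
      by (cases "0 < r") (simp_all only: mult_ac mult_1_left indicator_simps greaterThan_iff mult_zero_left mult_zero_right not_False_eq_True)
  qed
  also have "\<dots> = ?m * (NI r. ennreal (real ?d * r ^ (?d - 1)) * indicator {0<..} r * (indicator {..1} r * I r))"
    by (subst nn_integral_cmult) auto
  also have "(NI r. ennreal (real ?d * r ^ (?d - 1)) * indicator {0<..} r * (indicator {..1} r * I r))
    = (NI r. ennreal (real ?d * r ^ (?d - 1)) * indicator {0<..} r *
      (NI z. indicator unit_ball z * (indicator unit_ball (r *\<^sub>R sgn z) * F (norm (r *\<^sub>R sgn z)) (sgn (r *\<^sub>R sgn z)))))"
  proof (rule nn_integral_cong)
    fix r :: real
    have "(NI z. indicator unit_ball z * (indicator (unit_ball::'a set) (r *\<^sub>R sgn z) * F (norm (r *\<^sub>R sgn z)) (sgn (r *\<^sub>R sgn z))))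
      = (NI z. indicator {..1} r * (indicator (unit_ball::'a set) z * F r (sgn z)))" if "0 < r"
      by (rule nn_integral_cong_AE, use AE_lborel_singleton[of 0] in eventually_elim)
         (use that s in \<open>auto simp: indicator_def\<close>)
    then show "ennreal (real ?d * r ^ (?d - 1)) * indicator {0<..} r * (indicator {..1} r * I r)
      = ennreal (real ?d * r ^ (?d - 1)) * indicator {0<..} r *
      (NI z. indicator unit_ball z * (indicator (unit_ball::'a set) (r *\<^sub>R sgn z) * F (norm (r *\<^sub>R sgn z)) (sgn (r *\<^sub>R sgn z))))"
      by (cases "0 < r") (auto simp: nn_integral_cmult I_def)
  qed
  also have "\<dots> = (NI u. indicator unit_ball u * F (norm u) (sgn u))"
    by (rule nn_integral_polar[symmetric]) measurable
  finally show ?thesis .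
qed

lemma nn_integral_power_unit_interval:
  assumes "0 < n"
  shows "(NI r. ennreal (r ^ (n - 1)) * indicator {0<..} r * indicator {..1} r) = ennreal (1 / real n)"
proof -
  obtain m where n: "n = Suc m" using assms by (cases n) auto
  have "(NI r. ennreal (r ^ m) * indicator {0..1} r) = ennreal (1 ^ Suc m / real (Suc m) - 0 ^ Suc m / real (Suc m))"
  proof (rule nn_integral_FTC_Icc)
    fix r :: real
    show "((\<lambda>r. r ^ Suc m / real (Suc m)) has_real_derivative r ^ m) (at r)"
      by (rule DERIV_cong[OF DERIV_cdivide[OF DERIV_pow[of "Suc m" r]]]) (simp del: of_nat_Suc)
  qed auto
  moreover have "(NI r. ennreal (r ^ (n - 1)) * indicator {0<..} r * indicator {..1} r)
     = (NI r. ennreal (r ^ m) * indicator {0..1} r)"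
    by (rule nn_integral_cong_AE, use AE_lborel_singleton[of 0] in eventually_elim) (auto simp: n indicator_def)
  ultimately show ?thesis by (simp add: n)
qed

text \<open>In polar coordinates the weight turns r^(d-1) on (0,1] into r^(2d-1), so the radial
  integral 1/d becomes 1/(2d).\<close>

lemma nn_integral_ball_norm_power:
  fixes G :: "'a::euclidean_space \<Rightarrow> ennreal"
  assumes [measurable]: "borel_fun G"
  shows "ennreal 2 * (NI z. indicator unit_ball z * ennreal (norm z ^ DIM('a)) * G (sgn z))
    = (NI z. indicator unit_ball z * G (sgn z))"
proof -
  let ?d = "DIM('a)"
  have s: "sgn (r *\<^sub>R sgn z) = sgn z" "norm (r *\<^sub>R sgn z) = r" if "0 < r" "z \<noteq> 0" for r and z :: 'a
    using sgn_polar[OF that] by blast+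
  define I where "I = (NI z. indicator unit_ball z * G (sgn z))"
  have "(NI z. indicator unit_ball z * ennreal (norm z ^ ?d) * G (sgn z))
    = (NI r. ennreal (real ?d * r ^ (?d - 1)) * indicator {0<..} r *
      (NI z. indicator unit_ball z * (indicator unit_ball (r *\<^sub>R sgn z) * ennreal (norm (r *\<^sub>R sgn z) ^ ?d) * G (sgn (r *\<^sub>R sgn z)))))"
    by (rule nn_integral_polar) measurable
  also have "\<dots> = (NI r. (ennreal ?d * I) * (ennreal (r ^ (2 * ?d - 1)) * indicator {0<..} r * indicator {..1} r))"
  proof (rule nn_integral_cong)
    fix r :: real
    have e: "ennreal (real ?d * r ^ (?d - 1)) * ennreal (r ^ ?d) = ennreal ?d * ennreal (r ^ (2 * ?d - 1))" if "0 < r"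
    proof -
      have "?d - 1 + ?d = 2 * ?d - 1" using DIM_positive[where 'a='a] by simp
      then have "r ^ (?d - 1) * r ^ ?d = r ^ (2 * ?d - 1)" by (simp only: power_add[symmetric])
      then show ?thesis using that by (simp add: ennreal_mult[symmetric] mult.assoc)
    qed
    have "(NI z. indicator unit_ball z * (indicator (unit_ball::'a set) (r *\<^sub>R sgn z) * ennreal (norm (r *\<^sub>R sgn z) ^ ?d) * G (sgn (r *\<^sub>R sgn z))))
      = (NI z. indicator {..1} r * ennreal (r ^ ?d) * (indicator (unit_ball::'a set) z * G (sgn z)))" if "0 < r"
      by (rule nn_integral_cong_AE, use AE_lborel_singleton[of 0] in eventually_elim)
         (use that s in \<open>auto simp: indicator_def\<close>)
    also have "\<dots> = indicator {..1} r * ennreal (r ^ ?d) * I" unfolding I_def by (subst nn_integral_cmult) auto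
    finally have "0 < r \<Longrightarrow> ennreal (real ?d * r ^ (?d - 1)) * indicator {0<..} r *
      (NI z. indicator unit_ball z * (indicator (unit_ball::'a set) (r *\<^sub>R sgn z) * ennreal (norm (r *\<^sub>R sgn z) ^ ?d) * G (sgn (r *\<^sub>R sgn z))))
      = (ennreal (real ?d * r ^ (?d - 1)) * ennreal (r ^ ?d)) * indicator {..1} r * I" by (simp add: mult_ac)
    then show "ennreal (real ?d * r ^ (?d - 1)) * indicator {0<..} r *
      (NI z. indicator unit_ball z * (indicator (unit_ball::'a set) (r *\<^sub>R sgn z) * ennreal (norm (r *\<^sub>R sgn z) ^ ?d) * G (sgn (r *\<^sub>R sgn z))))
      = (ennreal ?d * I) * (ennreal (r ^ (2 * ?d - 1)) * indicator {0<..} r * indicator {..1} r)"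
      using e by (cases "0 < r") (simp_all only: mult_ac mult_1_left indicator_simps greaterThan_iff mult_zero_left mult_zero_right not_False_eq_True)
  qed
  also have "\<dots> = ennreal ?d * I * ennreal (1 / real (2 * ?d))"
    by (subst nn_integral_cmult, measurable, subst nn_integral_power_unit_interval) auto
  finally have "ennreal 2 * (NI z. indicator unit_ball z * ennreal (norm z ^ ?d) * G (sgn z))
    = (ennreal 2 * ennreal ?d * ennreal (1 / real (2 * ?d))) * I" by (simp only: mult_ac)
  also have "ennreal 2 * ennreal ?d * ennreal (1 / real (2 * ?d)) = 1"
    by (simp add: ennreal_mult[symmetric] del: ennreal_numeral)
  finally show ?thesis by (simp add: I_def)
qed

text \<open>The substitutions below live on unbounded intervals or have a derivative that blows up
  at an end. They are therefore made on compact intervals and extended to the union by monotone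
  convergence.\<close>

lemma nn_integral_substitution_incseq:
  fixes f :: "real \<Rightarrow> ennreal" and g g' :: "real \<Rightarrow> real" and a b :: "nat \<Rightarrow> real"
  assumes [measurable]: "borel_fun f" "borel_fun g" "borel_fun g'"
    and ab: "\<And>n. a n < b n" "decseq a" "incseq b"
    and deriv: "\<And>n x. x \<in> {a n..b n} \<Longrightarrow> (g has_real_derivative g' x) (at x)"
    and cont: "\<And>n. continuous_on {a n..b n} g'"
    and nonneg: "\<And>n x. x \<in> {a n..b n} \<Longrightarrow> 0 \<le> g' x"
  shows "(NI x. f x * indicator (\<Union>n. {g (a n)..g (b n)}) x) =
    (NI x. f (g x) * ennreal (g' x) * indicator (\<Union>n. {a n..b n}) x)"
proof -
  have mono: "g x \<le> g y" if "x \<in> {a n..b n}" "y \<in> {a n..b n}" "x \<le> y" for x y n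
  proof (intro DERIV_nonneg_imp_nondecreasing[of x y g])
    fix u assume "x \<le> u" "u \<le> y"
    then have "u \<in> {a n..b n}" using that by auto
    then show "\<exists>v. (g has_real_derivative v) (at u) \<and> 0 \<le> v" using deriv nonneg by blast
  qed (use that in auto)
  have inc: "incseq (\<lambda>n. {a n..b n})" using ab(2,3) by (auto simp: incseq_def decseq_def intro: order_trans)
  have incg: "incseq (\<lambda>n. {g (a n)..g (b n)})"
  proof (rule incseq_SucI)
    fix n
    have "a (Suc n) \<le> a n" "b n \<le> b (Suc n)" "a n < b n" using ab by (auto simp: decseq_Suc_iff incseq_Suc_iff)
    then have "g (a (Suc n)) \<le> g (a n)" "g (b n) \<le> g (b (Suc n))" by (auto intro!: mono[of _ "Suc n"])
    then show "{g (a n)..g (b n)} \<subseteq> {g (a (Suc n))..g (b (Suc n))}" by auto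
  qed
  have ind: "(\<lambda>x. c x * indicator (\<Union>n. A n) x) = (\<lambda>x. SUP n. c x * indicator (A n) x)"
    if "incseq A" for A :: "nat \<Rightarrow> real set" and c :: "real \<Rightarrow> ennreal"
  proof (intro ext antisym)
    fix x
    show "c x * indicator (\<Union>n. A n) x \<le> (SUP n. c x * indicator (A n) x)"
    proof (cases "x \<in> (\<Union>n. A n)")
      case True
      then obtain k where "x \<in> A k" by auto
      then show ?thesis using True by (intro SUP_upper2[of k]) auto
    qed simp
    show "(SUP n. c x * indicator (A n) x) \<le> c x * indicator (\<Union>n. A n) x"
      by (intro SUP_least mult_left_mono indicator_leI) auto
  qed
  have "(NI x. f x * indicator (\<Union>n. {g (a n)..g (b n)}) x) = (SUP n. NI x. f x * indicator {g (a n)..g (b n)} x)"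
    unfolding ind[OF incg] using incg
    by (intro nn_integral_monotone_convergence_SUP incseq_SucI le_funI mult_left_mono indicator_leI)
       (auto intro: subsetD[OF incseq_SucD[OF incg]] simp del: atLeastAtMost_iff)
  also have "\<dots> = (SUP n. NI x. f (g x) * ennreal (g' x) * indicator {a n..b n} x)"
    by (intro SUP_cong refl nn_integral_substitution_aux) (use deriv cont nonneg ab in auto)
  also have "\<dots> = (NI x. f (g x) * ennreal (g' x) * indicator (\<Union>n. {a n..b n}) x)"
    unfolding ind[OF inc] using inc
    by (intro nn_integral_monotone_convergence_SUP[symmetric] incseq_SucI le_funI mult_left_mono indicator_leI)
       (auto intro: subsetD[OF incseq_SucD[OF inc]] simp del: atLeastAtMost_iff)
  finally show ?thesis .
qed

abbreviation height :: "'a::euclidean_space \<Rightarrow> real" where "height u \<equiv> sqrt (1 - (norm u)\<^sup>2)"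

lemma UN_atLeastAtMost_unit: "(\<Union>n::nat. {0..1 - 1 / (real n + 2)}) = {0..<1}"
proof (intro equalityI subsetI)
  fix x :: real assume "x \<in> {0..<1}"
  then obtain n where "1 / (real (Suc n)) < 1 - x" using nat_approx_posE[of "1 - x"] by auto
  moreover have "1 / (real n + 2) \<le> 1 / real (Suc n)" by (simp add: field_simps)
  ultimately have "x \<le> 1 - 1 / (real n + 2)" by linarith
  then show "x \<in> (\<Union>n::nat. {0..1 - 1 / (real n + 2)})" using \<open>x \<in> {0..<1}\<close> by auto
next
  fix x :: real assume "x \<in> (\<Union>n::nat. {0..1 - 1 / (real n + 2)})"
  then obtain n :: nat where "0 \<le> x" "x \<le> 1 - 1 / (real n + 2)" by auto
  moreover have "1 - 1 / (real n + 2) < 1" by simp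
  ultimately have "0 \<le> x" "x < 1" by linarith+
  then show "x \<in> {0..<1}" by simp
qed

text \<open>The substitution is r = s / sqrt (1 - s^2), inverted by s = r / sqrt (1 + r^2), with
  derivative (1 - s^2)^(-3/2). The singular end s = 1 is approached through 1 - 1/(n+2).\<close>

lemma nn_integral_gnomonic_radius:
  fixes f :: "real \<Rightarrow> ennreal"
  assumes [measurable]: "borel_fun f"
  shows "(NI r. f r * indicator {0<..} r) =
    (NI s. f (s / sqrt (1 - s\<^sup>2)) * ennreal (1 / sqrt (1 - s\<^sup>2) ^ 3) * indicator {0<..<1} s)"
proof -
  let ?g = "\<lambda>s::real. s / sqrt (1 - s\<^sup>2)" and ?g' = "\<lambda>s::real. 1 / sqrt (1 - s\<^sup>2) ^ 3"
  let ?b = "\<lambda>n::nat. 1 - 1 / (real n + 2)"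
  have lt: "x\<^sup>2 < 1" if "x \<in> {0..?b n}" for x n
  proof -
    have "?b n < 1" by simp
    moreover have "x \<le> ?b n" "0 \<le> x" using that by simp_all
    ultimately have "x < 1" "0 \<le> x" by linarith+
    then show ?thesis by (simp add: power_less_one_iff abs_square_less_1)
  qed
  have surj: "\<exists>s\<in>{0..<1}. ?g s = r" if "0 \<le> r" for r
  proof (intro bexI)
    define q where "q = sqrt (1 + r\<^sup>2)"
    have q: "q\<^sup>2 = 1 + r\<^sup>2" "0 < q" "r < q" unfolding q_def using that
      by (auto simp: real_less_rsqrt add_pos_nonneg)
    have "1 - (r / q)\<^sup>2 = (q\<^sup>2 - r\<^sup>2) / q\<^sup>2" using q(2) by (simp add: power_divide diff_divide_distrib)
    also have "\<dots> = (1 / q)\<^sup>2" using q(1) by (simp add: power_divide)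
    finally have "1 - (r / q)\<^sup>2 = (1 / q)\<^sup>2" .
    then have "sqrt (1 - (r / q)\<^sup>2) = 1 / q" using q by (simp add: real_sqrt_abs)
    then show "?g (r / q) = r" using q by simp
    show "r / q \<in> {0..<1}" using q that by simp
  qed
  have d: "(?g has_real_derivative ?g' x) (at x)" if "x \<in> {0..?b n}" for n x
  proof -
    have x: "0 < 1 - x\<^sup>2" using lt[OF that] by simp
    define c where "c = sqrt (1 - x\<^sup>2)"
    have c: "0 < c" "c * c = 1 - x * x" using x by (auto simp: c_def power2_eq_square)
    have "(?g has_real_derivative (1 * sqrt (1 - x\<^sup>2) - x * ((0 - 2 * x) * (inverse (sqrt (1 - x\<^sup>2)) / 2))) / (sqrt (1 - x\<^sup>2) * sqrt (1 - x\<^sup>2))) (at x)"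
      using x by (auto intro!: derivative_eq_intros simp: field_simps)
    moreover have "(1 * sqrt (1 - x\<^sup>2) - x * ((0 - 2 * x) * (inverse (sqrt (1 - x\<^sup>2)) / 2))) / (sqrt (1 - x\<^sup>2) * sqrt (1 - x\<^sup>2)) = ?g' x"
      unfolding c_def[symmetric] using c by (simp add: field_simps power3_eq_cube)
    ultimately show ?thesis by metis
  qed
  have mono: "?g x \<le> ?g y" if "0 \<le> x" "x \<le> y" "y < 1" for x y
    using that by (intro frac_le) (auto simp: abs_square_less_1 power_mono)
  have img: "(\<Union>n. {?g 0..?g (?b n)}) = {0..}"
  proof (intro equalityI subsetI)
    fix r :: real assume "r \<in> {0..}"
    then obtain s where s: "s \<in> {0..<1}" "?g s = r" using surj[of r] by auto
    then obtain n where "s \<in> {0..?b n}" using UN_atLeastAtMost_unit by blast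
    then show "r \<in> (\<Union>n. {?g 0..?g (?b n)})" using mono[of s "?b n"] s \<open>r \<in> {0..}\<close> by auto
  qed auto
  have "(NI r. f r * indicator {0<..} r) = (NI x. f x * indicator (\<Union>n. {?g 0..?g (?b n)}) x)"
    unfolding img by (rule nn_integral_cong_AE, use AE_lborel_singleton[of 0] in eventually_elim) (auto simp: indicator_def)
  also have "\<dots> = (NI x. f (?g x) * ennreal (?g' x) * indicator (\<Union>n. {0..?b n}) x)"
  proof (rule nn_integral_substitution_incseq)
    show "incseq (\<lambda>n. ?b n)" by (intro incseq_SucI) (simp add: field_simps)
    show "0 < ?b n" for n by (simp add: field_simps)
    show "continuous_on {0..?b n} ?g'" for n
      using lt[of _ n] by (intro continuous_intros) (auto simp: less_imp_neq)
    show "0 \<le> ?g' x" if "x \<in> {0..?b n}" for n x using lt[OF that] by simp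
  qed (use d in auto)
  also have "\<dots> = (NI s. f (?g s) * ennreal (?g' s) * indicator {0<..<1} s)"
    unfolding UN_atLeastAtMost_unit
    by (rule nn_integral_cong_AE, use AE_lborel_singleton[of 0] in eventually_elim) (auto simp: indicator_def)
  finally show ?thesis .
qed

text \<open>Central projection: u = y / sqrt (1 + |y|^2) maps the space onto the open unit ball.
  With h = \<open>height u\<close> the Jacobian consists of h^(-(d-1)) from the power of the radius
  and h^(-3) from the radial derivative, hence the exponent d + 2.\<close>

lemma nn_integral_gnomonic:
  fixes H :: "'a::euclidean_space \<Rightarrow> ennreal"
  assumes [measurable]: "borel_fun H"
  shows "(NI y. H y) = (NI u. indicator (ball 0 1) u * ennreal (1 / height u ^ (DIM('a) + 2)) * H (u /\<^sub>R height u))"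
proof -
  let ?d = "DIM('a)"
  define c where "c s = sqrt (1 - s\<^sup>2)" for s :: real
  have [measurable]: "borel_fun c" unfolding c_def by measurable
  have c: "0 < c s" if "s \<in> {0<..<1}" for s using that by (auto simp: c_def abs_square_less_1)
  have d: "Suc (?d - 1) = ?d" using DIM_positive[where 'a='a] by simp
  have "(NI y. H y) = (NI r. (ennreal (real ?d * r ^ (?d - 1)) * (NI z. indicator unit_ball z * H (r *\<^sub>R sgn z))) * indicator {0<..} r)"
    by (subst nn_integral_polar) (auto simp: mult_ac)
  also have "\<dots> = (NI s. (ennreal (real ?d * (s / c s) ^ (?d - 1)) * (NI z. indicator unit_ball z * H ((s / c s) *\<^sub>R sgn z))) * ennreal (1 / c s ^ 3) * indicator {0<..<1} s)"
    unfolding c_def by (rule nn_integral_gnomonic_radius) measurable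
  also have "\<dots> = (NI r. ennreal (real ?d * r ^ (?d - 1)) * indicator {0<..} r *
      (NI z. indicator unit_ball z * (indicator (ball 0 1) (r *\<^sub>R sgn z) * ennreal (1 / c (norm (r *\<^sub>R sgn z)) ^ (?d + 2)) * H ((r *\<^sub>R sgn z) /\<^sub>R c (norm (r *\<^sub>R sgn z))))))"
  proof (rule nn_integral_cong)
    fix r :: real
    let ?I = "NI z. indicator unit_ball z * H ((r / c r) *\<^sub>R sgn z)"
    have e: "ennreal (real ?d * (r / c r) ^ (?d - 1)) * ennreal (1 / c r ^ 3) = ennreal (real ?d * r ^ (?d - 1)) * ennreal (1 / c r ^ (?d + 2))" if "r \<in> {0<..<1}"
    proof -
      have "c r ^ (?d + 2) = c r ^ (?d - 1) * c r ^ 3" by (subst d[symmetric]) (simp add: power_add[symmetric])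
      then have "real ?d * (r / c r) ^ (?d - 1) * (1 / c r ^ 3) = real ?d * r ^ (?d - 1) * (1 / c r ^ (?d + 2))"
        using c[OF that] by (simp add: power_divide)
      then show ?thesis using c[OF that] that by (simp add: ennreal_mult[symmetric])
    qed
    have "(NI z. indicator unit_ball z * (indicator (ball 0 1) (r *\<^sub>R sgn z) * ennreal (1 / c (norm (r *\<^sub>R sgn z)) ^ (?d + 2)) * H ((r *\<^sub>R sgn z) /\<^sub>R c (norm (r *\<^sub>R sgn z)))))
      = (\<integral>\<^sup>+z. (indicator {..<1} r * ennreal (1 / c r ^ (?d + 2))) * (indicator unit_ball z * H ((r / c r) *\<^sub>R sgn z)) \<partial>(lborel::'a measure))" if "0 < r"
    proof (rule nn_integral_cong_AE, use AE_lborel_singleton[of 0] in eventually_elim)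
      fix z :: 'a assume "z \<noteq> 0"
      then have "norm (r *\<^sub>R sgn z) = r" using that by (rule sgn_polar(2)[rotated])
      then show "indicator unit_ball z * (indicator (ball 0 1) (r *\<^sub>R sgn z) * ennreal (1 / c (norm (r *\<^sub>R sgn z)) ^ (?d + 2)) * H ((r *\<^sub>R sgn z) /\<^sub>R c (norm (r *\<^sub>R sgn z))))
        = (indicator {..<1} r * ennreal (1 / c r ^ (?d + 2))) * (indicator unit_ball z * H ((r / c r) *\<^sub>R sgn z))"
        by (simp only: mem_ball_0 indicator_def lessThan_iff scaleR_scaleR) (simp add: divide_inverse mult_ac)
    qed
    also have "\<dots> = (indicator {..<1} r * ennreal (1 / c r ^ (?d + 2))) * ?I"
      by (subst nn_integral_cmult) auto
    finally have "0 < r \<Longrightarrow> (NI z. indicator unit_ball z * (indicator (ball 0 1) (r *\<^sub>R sgn z) * ennreal (1 / c (norm (r *\<^sub>R sgn z)) ^ (?d + 2)) * H ((r *\<^sub>R sgn z) /\<^sub>R c (norm (r *\<^sub>R sgn z)))))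
      = (indicator {..<1} r * ennreal (1 / c r ^ (?d + 2))) * ?I" .
    moreover have "ennreal (real ?d * (r / c r) ^ (?d - 1)) * ?I * ennreal (1 / c r ^ 3) * indicator {0<..<1} r
      = ennreal (real ?d * r ^ (?d - 1)) * indicator {0<..} r * ((indicator {..<1} r * ennreal (1 / c r ^ (?d + 2))) * ?I)"
    proof (cases "r \<in> {0<..<1}")
      case True
      have "ennreal (real ?d * (r / c r) ^ (?d - 1)) * ?I * ennreal (1 / c r ^ 3) * indicator {0<..<1} r
        = (ennreal (real ?d * (r / c r) ^ (?d - 1)) * ennreal (1 / c r ^ 3)) * ?I" using True by (simp add: mult_ac)
      also have "\<dots> = ennreal (real ?d * r ^ (?d - 1)) * indicator {0<..} r * ((indicator {..<1} r * ennreal (1 / c r ^ (?d + 2))) * ?I)"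
        unfolding e[OF True] using True by (simp add: mult_ac)
      finally show ?thesis .
    qed (auto simp: indicator_def)
    ultimately show "ennreal (real ?d * (r / c r) ^ (?d - 1)) * ?I * ennreal (1 / c r ^ 3) * indicator {0<..<1} r
      = ennreal (real ?d * r ^ (?d - 1)) * indicator {0<..} r *
      (NI z. indicator unit_ball z * (indicator (ball 0 1) (r *\<^sub>R sgn z) * ennreal (1 / c (norm (r *\<^sub>R sgn z)) ^ (?d + 2)) * H ((r *\<^sub>R sgn z) /\<^sub>R c (norm (r *\<^sub>R sgn z)))))"
      by (cases "0 < r") simp_all
  qed
  also have "\<dots> = (NI u. indicator (ball 0 1) u * ennreal (1 / c (norm u) ^ (?d + 2)) * H (u /\<^sub>R c (norm u)))"
    by (rule nn_integral_polar[symmetric]) measurable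
  finally show ?thesis unfolding c_def .
qed

section \<open>Slicing the sphere and single scale bounds\<close>

lemma nn_integral_sphere_measure:
  fixes F :: "'b::euclidean_space \<Rightarrow> ennreal"
  assumes F: "borel_fun F"
  shows "(\<integral>\<^sup>+w. F w \<partial>sphere_measure) = ennreal (real DIM('b)) * (NI w. indicator unit_ball w * F (sgn w))"
proof -
  let ?D = "cball 0 1 - {0} :: 'b set"
  let ?R = "restrict_space lborel ?D" and ?S = "restrict_space borel (sphere (0::'b) 1)"
  have D: "?D \<in> sets lborel" by simp
  have m: "sgn \<in> measurable ?R ?S"
    by (rule measurable_restrict_space2) (auto simp: space_restrict_space norm_sgn intro!: measurable_restrict_space1)
  have FS: "F \<in> borel_measurable ?S" using F by (rule measurable_restrict_space1)
  have "(\<integral>\<^sup>+w. F w \<partial>sphere_measure) = (\<integral>\<^sup>+w. F w \<partial>scale_measure (of_nat DIM('b)) (distr ?R ?S sgn))"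
    unfolding sphere_measure_def using FS by (subst nn_integral_completion) auto
  also have "\<dots> = of_nat DIM('b) * (\<integral>\<^sup>+w. F w \<partial>distr ?R ?S sgn)"
    using FS by (subst nn_integral_scale_measure) auto
  also have "(\<integral>\<^sup>+w. F w \<partial>distr ?R ?S sgn) = (\<integral>\<^sup>+w. F (sgn w) \<partial>?R)"
    using FS m by (subst nn_integral_distr) auto
  also have "\<dots> = (NI w. F (sgn w) * indicator ?D w)"
    using D by (subst nn_integral_restrict_space) auto
  also have "\<dots> = (NI w. indicator unit_ball w * F (sgn w))"
    by (rule nn_integral_cong_AE, use AE_lborel_singleton[of 0] in eventually_elim) (auto simp: indicator_def)
  finally show ?thesis by (simp add: ennreal_of_nat_eq_real_of_nat)
qed

lemma sgn_orthogonal: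
  fixes R :: "'a::euclidean_space \<Rightarrow> 'a"
  assumes "orthogonal_transformation R"
  shows "sgn (R x) = R (sgn x)"
  using linear_scale[OF orthogonal_transformation_linear[OF assms]] orthogonal_transformation_norm[OF assms]
  by (simp add: sgn_div_norm)

lemma nn_integral_sphere_orthogonal:
  fixes F :: "'b::euclidean_space \<Rightarrow> ennreal" and R :: "'b \<Rightarrow> 'b"
  assumes [measurable]: "borel_fun F" and R: "orthogonal_transformation R"
  shows "(\<integral>\<^sup>+w. F (R w) \<partial>sphere_measure) = (\<integral>\<^sup>+w. F w \<partial>sphere_measure)"
proof -
  have [measurable]: "borel_fun R" using R by (rule borel_measurable_orthogonal)
  have "(NI w. indicator unit_ball w * F (R (sgn w))) = (NI w. indicator unit_ball (R w) * F (sgn (R w)))"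
    by (simp add: sgn_orthogonal[OF R] orthogonal_transformation_norm[OF R] indicator_def)
  also have "\<dots> = (NI w. indicator unit_ball w * F (sgn w))"
    by (rule nn_integral_lborel_orthogonal[OF R]) measurable
  finally show ?thesis by (simp add: nn_integral_sphere_measure)
qed

lemma borel_measurable_fst_snd [measurable]:
  "fst \<in> borel_measurable (borel :: ('a::second_countable_topology \<times> 'b::second_countable_topology) measure)"
  "snd \<in> borel_measurable (borel :: ('a \<times> 'b) measure)"
  by (auto intro!: borel_measurable_continuous_onI continuous_intros)

lemma borel_sgn_pair: "sgn (w :: 'a::euclidean_space \<times> 'b::euclidean_space) = (fst w /\<^sub>R norm w, snd w /\<^sub>R norm w)"
  by (simp add: sgn_div_norm scaleR_prod_def)

lemma nn_integral_sphere_swap: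
  fixes F :: "'a::euclidean_space \<times> 'a \<Rightarrow> ennreal"
  assumes [measurable]: "borel_fun F"
  shows "(\<integral>\<^sup>+w. F (snd w, fst w) \<partial>sphere_measure) = (\<integral>\<^sup>+w. F w \<partial>sphere_measure)"
proof (rule nn_integral_sphere_orthogonal)
  have "linear (\<lambda>w::'a \<times> 'a. (snd w, fst w))" by (rule linearI) (auto simp: scaleR_prod_def)
  then show "orthogonal_transformation (\<lambda>w::'a \<times> 'a. (snd w, fst w))"
    by (auto simp: orthogonal_transformation_def inner_prod_def)
qed simp

lemma height_pos: "norm u < 1 \<Longrightarrow> 0 < height u"
  by (simp add: abs_square_less_1)

text \<open>The solid ball of the product space is parametrised by (|z| y, z), because the direction
  of this vector is (y, sgn z) / k with k = sqrt (1 + |y|^2) and no longer involves |z|. Rescaling z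
  by 1/k produces k^(-2d). The remaining weight |z|^d is removed by
  \<open>nn_integral_ball_norm_power\<close>, whose factor 2 turns the dimension 2d of the product
  into d. Central projection finally replaces y / k by u and 1 / k by \<open>height u\<close>; the
  exponent is 2d - (d + 2) = d - 2.\<close>

lemma nn_integral_sphere_slice:
  fixes F :: "'a::euclidean_space \<times> 'a \<Rightarrow> ennreal"
  assumes [measurable]: "borel_fun F" and d: "2 \<le> DIM('a)"
  shows "(\<integral>\<^sup>+w. F w \<partial>sphere_measure) = ennreal (real DIM('a)) *
    (NI u. indicator (ball 0 1) u * ennreal (height u ^ (DIM('a) - 2)) *
       (NI z. indicator unit_ball z * F (u, height u *\<^sub>R sgn z)))"
proof -
  let ?d = "DIM('a)"
  define k where "k y = sqrt (1 + (norm y)\<^sup>2)" for y :: 'a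
  have [measurable]: "borel_fun k" unfolding k_def by measurable
  have k: "0 < k y" for y by (simp add: k_def add_pos_nonneg)
  define H where "H y = ennreal (1 / k y ^ (2 * ?d)) * (NI z. indicator unit_ball z * F (y /\<^sub>R k y, sgn z /\<^sub>R k y))" for y
  have nP: "norm (norm z *\<^sub>R y, z) = norm z * k y" for y z :: 'a
  proof -
    have "norm (norm z *\<^sub>R y, z) = sqrt ((norm z)\<^sup>2 * (1 + (norm y)\<^sup>2))" by (simp add: norm_Pair power_mult_distrib algebra_simps)
    then show ?thesis by (simp add: real_sqrt_mult k_def)
  qed
  have "(NI w. indicator unit_ball w * F (sgn w))
    = (NI z. NI y. indicator unit_ball (y, z) * F (sgn (y, z)))"
    by (rule nn_integral_lborel_pair) measurable
  also have "\<dots> = (NI z. NI y. indicator {..1} (norm z * k y) * (ennreal (norm z ^ ?d) * F (y /\<^sub>R k y, sgn z /\<^sub>R k y)))"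
  proof (rule nn_integral_cong_AE, use AE_lborel_singleton[of 0] in eventually_elim)
    fix z :: 'a assume z: "z \<noteq> 0"
    have "(NI y. indicator unit_ball (y, z) * F (sgn (y, z)))
      = ennreal (norm z ^ ?d) * (NI y. indicator unit_ball (norm z *\<^sub>R y, z) * F (sgn (norm z *\<^sub>R y, z)))"
      using z by (subst nn_integral_lborel_affine[of _ "norm z" 0]) auto
    also have "\<dots> = (NI y. ennreal (norm z ^ ?d) * (indicator unit_ball (norm z *\<^sub>R y, z) * F (sgn (norm z *\<^sub>R y, z))))"
      by (subst nn_integral_cmult) auto
    also have "\<dots> = (NI y. indicator {..1} (norm z * k y) * (ennreal (norm z ^ ?d) * F (y /\<^sub>R k y, sgn z /\<^sub>R k y)))"
    proof (rule nn_integral_cong)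
      fix y
      have "sgn (norm z *\<^sub>R y, z) = (y /\<^sub>R k y, sgn z /\<^sub>R k y)"
        using z k[of y] by (simp add: borel_sgn_pair nP) (simp add: sgn_div_norm divide_inverse mult_ac)
      moreover have "indicator unit_ball (norm z *\<^sub>R y, z) = (indicator {..1} (norm z * k y) :: ennreal)"
        by (simp add: indicator_def nP)
      ultimately show "ennreal (norm z ^ ?d) * (indicator unit_ball (norm z *\<^sub>R y, z) * F (sgn (norm z *\<^sub>R y, z)))
        = indicator {..1} (norm z * k y) * (ennreal (norm z ^ ?d) * F (y /\<^sub>R k y, sgn z /\<^sub>R k y))"
        by (simp only: mult_ac)
    qed
    finally show "(NI y. indicator unit_ball (y, z) * F (sgn (y, z)))
      = (NI y. indicator {..1} (norm z * k y) * (ennreal (norm z ^ ?d) * F (y /\<^sub>R k y, sgn z /\<^sub>R k y)))" .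
  qed
  also have "\<dots> = (NI y. NI z. indicator {..1} (norm z * k y) * (ennreal (norm z ^ ?d) * F (y /\<^sub>R k y, sgn z /\<^sub>R k y)))"
    by (rule nn_integral_lborel_swap) measurable
  also have "\<dots> = (NI y. ennreal (1 / k y ^ (2 * ?d)) * (NI z. indicator unit_ball z * ennreal (norm z ^ ?d) * F (y /\<^sub>R k y, sgn z /\<^sub>R k y)))"
  proof (rule nn_integral_cong)
    fix y
    have i: "\<bar>inverse (k y)\<bar> = inverse (k y)" "inverse (k y) \<noteq> 0" using k[of y] by auto
    have "(NI z. indicator {..1} (norm z * k y) * (ennreal (norm z ^ ?d) * F (y /\<^sub>R k y, sgn z /\<^sub>R k y)))
      = ennreal (inverse (k y) ^ ?d) * (NI z. indicator {..1} (norm (inverse (k y) *\<^sub>R z) * k y) * (ennreal (norm (inverse (k y) *\<^sub>R z) ^ ?d) * F (y /\<^sub>R k y, sgn (inverse (k y) *\<^sub>R z) /\<^sub>R k y)))"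
      by (subst nn_integral_lborel_affine[of _ "inverse (k y)" 0]) (use i in simp_all)
    also have "\<dots> = ennreal (inverse (k y) ^ ?d) * (NI z. ennreal (inverse (k y) ^ ?d) * (indicator unit_ball z * ennreal (norm z ^ ?d) * F (y /\<^sub>R k y, sgn z /\<^sub>R k y)))"
    proof (rule arg_cong[where f="\<lambda>x. _ * x"], rule nn_integral_cong)
      fix z :: 'a
      have a: "norm (inverse (k y) *\<^sub>R z) = inverse (k y) * norm z" "sgn (inverse (k y) *\<^sub>R z) = sgn z" using k[of y] by (simp_all add: sgn_scaleR)
      have b: "inverse (k y) * norm z * k y = norm z" using k[of y] by simp
      have c: "ennreal ((inverse (k y) * norm z) ^ ?d) = ennreal (inverse (k y) ^ ?d) * ennreal (norm z ^ ?d)"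
        using k[of y] by (simp add: power_mult_distrib ennreal_mult)
      show "indicator {..1} (norm (inverse (k y) *\<^sub>R z) * k y) * (ennreal (norm (inverse (k y) *\<^sub>R z) ^ ?d) * F (y /\<^sub>R k y, sgn (inverse (k y) *\<^sub>R z) /\<^sub>R k y))
        = ennreal (inverse (k y) ^ ?d) * (indicator unit_ball z * ennreal (norm z ^ ?d) * F (y /\<^sub>R k y, sgn z /\<^sub>R k y))"
        unfolding a b c by (simp add: indicator_def mult_ac)
    qed
    also have "\<dots> = (ennreal (inverse (k y) ^ ?d) * ennreal (inverse (k y) ^ ?d)) * (NI z. indicator unit_ball z * ennreal (norm z ^ ?d) * F (y /\<^sub>R k y, sgn z /\<^sub>R k y))"
      by (subst nn_integral_cmult) (auto simp: mult.assoc)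
    also have "ennreal (inverse (k y) ^ ?d) * ennreal (inverse (k y) ^ ?d) = ennreal (1 / k y ^ (2 * ?d))"
      using k[of y] by (simp add: ennreal_mult[symmetric] power_add mult_2 divide_inverse power_inverse)
    finally show "(NI z. indicator {..1} (norm z * k y) * (ennreal (norm z ^ ?d) * F (y /\<^sub>R k y, sgn z /\<^sub>R k y)))
      = ennreal (1 / k y ^ (2 * ?d)) * (NI z. indicator unit_ball z * ennreal (norm z ^ ?d) * F (y /\<^sub>R k y, sgn z /\<^sub>R k y))" .
  qed
  finally have *: "(NI w. indicator unit_ball w * F (sgn w)) = 
    (NI y. ennreal (1 / k y ^ (2 * ?d)) * (NI z. indicator unit_ball z * ennreal (norm z ^ ?d) * F (y /\<^sub>R k y, sgn z /\<^sub>R k y)))" .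
  have "(\<integral>\<^sup>+w. F w \<partial>sphere_measure) = ennreal (real ?d) * (ennreal 2 * (NI w. indicator unit_ball w * F (sgn w)))"
    by (simp add: nn_integral_sphere_measure mult.assoc[symmetric] ennreal_mult[symmetric] mult.commute mult_2 del: ennreal_numeral)
  also have "ennreal 2 * (NI w. indicator unit_ball w * F (sgn w))
    = (NI y. ennreal (1 / k y ^ (2 * ?d)) * (ennreal 2 * (NI z. indicator unit_ball z * ennreal (norm z ^ ?d) * F (y /\<^sub>R k y, sgn z /\<^sub>R k y))))"
    unfolding * by (subst nn_integral_cmult[symmetric]) (auto simp: mult_ac)
  also have "\<dots> = (NI y. H y)"
    unfolding H_def by (intro nn_integral_cong arg_cong[where f="\<lambda>x. _ * x"] nn_integral_ball_norm_power[of "\<lambda>z. F (_, z /\<^sub>R _)"]) simp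
  also have "\<dots> = (NI u. indicator (ball 0 1) u * ennreal (1 / height u ^ (?d + 2)) * H (u /\<^sub>R height u))"
    by (rule nn_integral_gnomonic) (simp add: H_def)
  also have "\<dots> = (NI u. indicator (ball 0 1) u * ennreal (height u ^ (?d - 2)) *
       (NI z. indicator unit_ball z * F (u, height u *\<^sub>R sgn z)))"
  proof (rule nn_integral_cong)
    fix u :: 'a
    show "indicator (ball 0 1) u * ennreal (1 / height u ^ (?d + 2)) * H (u /\<^sub>R height u)
      = indicator (ball 0 1) u * ennreal (height u ^ (?d - 2)) * (NI z. indicator unit_ball z * F (u, height u *\<^sub>R sgn z))"
    proof (cases "norm u < 1")
      case True
      define h where "h = height u"
      have h: "0 < h" "h\<^sup>2 = 1 - (norm u)\<^sup>2" using height_pos[OF True] by (auto simp: h_def)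
      have "(norm (u /\<^sub>R h))\<^sup>2 = (norm u)\<^sup>2 / h\<^sup>2" using h(1) by (simp add: power_mult_distrib power_inverse divide_inverse mult.commute)
      then have "1 + (norm (u /\<^sub>R h))\<^sup>2 = (h\<^sup>2 + (norm u)\<^sup>2) / h\<^sup>2" using h(1) by (simp add: add_divide_distrib)
      also have "\<dots> = (1 / h)\<^sup>2" by (simp add: h(2) power_divide)
      finally have kh: "k (u /\<^sub>R h) = inverse h" using h(1) by (simp add: k_def inverse_eq_divide)
      have uh: "u /\<^sub>R h /\<^sub>R inverse h = u" "z /\<^sub>R inverse h = h *\<^sub>R z" for z :: 'a using h(1) by simp_all
      have "2 * ?d = (?d + 2) + (?d - 2)" using d by simp
      then have "h ^ (2 * ?d) = h ^ (?d + 2) * h ^ (?d - 2)" by (metis power_add)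
      then have e: "1 / h ^ (?d + 2) * (1 / inverse h ^ (2 * ?d)) = h ^ (?d - 2)"
        using h(1) by (simp add: power_inverse inverse_eq_divide field_simps)
      have "ennreal (1 / h ^ (?d + 2)) * H (u /\<^sub>R h) = ennreal (h ^ (?d - 2)) * (NI z. indicator unit_ball z * F (u, h *\<^sub>R sgn z))"
        unfolding H_def kh uh mult.assoc[symmetric] using h(1) by (subst ennreal_mult[symmetric]) (auto simp only: e, auto)
      then show ?thesis unfolding h_def by (simp add: mult.assoc)
    qed simp
  qed
  finally show ?thesis .
qed

section \<open>Bilinear averages and spherical means of nonnegative functions\<close>

definition bisph_nn :: "real \<Rightarrow> ('a::euclidean_space \<Rightarrow> ennreal) \<Rightarrow> ('a \<Rightarrow> ennreal) \<Rightarrow> 'a \<Rightarrow> ennreal" where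
  "bisph_nn t f g x = (\<integral>\<^sup>+w. f (x - t *\<^sub>R fst w) * g (x - t *\<^sub>R snd w) \<partial>sphere_measure)"

text \<open>Up to normalisation the mean over the sphere of radius r about x: by the cone definition
  of the surface measure it is 1/d times the integral over the unit sphere.\<close>

definition sph_nn :: "real \<Rightarrow> ('a::euclidean_space \<Rightarrow> ennreal) \<Rightarrow> 'a \<Rightarrow> ennreal" where
  "sph_nn r f x = (NI z. indicator unit_ball z * f (x - r *\<^sub>R sgn z))"

lemma sph_nn_measurable [measurable (raw)]:
  assumes [measurable]: "borel_fun f" "h \<in> borel_measurable M" "g \<in> borel_measurable M"
  shows "(\<lambda>w. sph_nn (h w) f (g w)) \<in> borel_measurable M"
  unfolding sph_nn_def by measurable

lemma bisph_nn_alt: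
  fixes f g :: "'a::euclidean_space \<Rightarrow> ennreal"
  assumes [measurable]: "borel_fun f" "borel_fun g"
  shows "bisph_nn t f g x = ennreal (2 * real DIM('a)) *
    (NI w. indicator unit_ball w * (f (x - t *\<^sub>R fst (sgn w)) * g (x - t *\<^sub>R snd (sgn w))))"
  unfolding bisph_nn_def by (subst nn_integral_sphere_measure) auto

lemma bisph_nn_measurable [measurable (raw)]:
  assumes [measurable]: "borel_fun f" "borel_fun g" "h \<in> borel_measurable M"
  shows "(\<lambda>w. bisph_nn t f g (h w)) \<in> borel_measurable M"
  by (subst bisph_nn_alt) auto

lemma bisph_nn_slice:
  fixes f g :: "'a::euclidean_space \<Rightarrow> ennreal"
  assumes [measurable]: "borel_fun f" "borel_fun g" and d: "2 \<le> DIM('a)"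
  shows "bisph_nn t f g x = ennreal (real DIM('a)) *
    (NI u. indicator (ball 0 1) u * ennreal (height u ^ (DIM('a) - 2)) * (f (x - t *\<^sub>R u) * sph_nn (t * height u) g x))"
proof -
  have "(NI z. indicator unit_ball z * (f (x - t *\<^sub>R fst (u, height u *\<^sub>R sgn z)) * g (x - t *\<^sub>R snd (u, height u *\<^sub>R sgn z))))
    = f (x - t *\<^sub>R u) * sph_nn (t * height u) g x" for u
    unfolding sph_nn_def by (subst nn_integral_cmult[symmetric]) (auto simp: mult_ac)
  then show ?thesis unfolding bisph_nn_def by (subst nn_integral_sphere_slice[OF _ d]) auto
qed

lemma bisph_nn_commute:
  fixes f g :: "'a::euclidean_space \<Rightarrow> ennreal"
  assumes [measurable]: "borel_fun f" "borel_fun g"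
  shows "bisph_nn t f g x = bisph_nn t g f x"
  unfolding bisph_nn_def by (subst nn_integral_sphere_swap[symmetric]) (auto simp: mult.commute)

lemma height_power_le_1: "norm u < 1 \<Longrightarrow> height u ^ n \<le> 1"
  by (rule power_le_one) (auto simp: abs_square_less_1 less_imp_le)

text \<open>Since d \<ge> 2, the slicing weight is at most 1, so the projection of the surface
  measure to the first factor has bounded density. The single scale L^1 bound rests on this.\<close>

lemma nn_integral_sphere_fst_le:
  fixes G :: "'a::euclidean_space \<Rightarrow> ennreal"
  assumes [measurable]: "borel_fun G" and d: "2 \<le> DIM('a)"
  shows "(\<integral>\<^sup>+w. G (fst w) \<partial>(sphere_measure :: ('a \<times> 'a) measure)) \<le>
    ennreal (real DIM('a)) * emeasure lborel (unit_ball :: 'a set) * (NI u. indicator (ball 0 1) u * G u)"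
proof -
  have "(\<integral>\<^sup>+w. G (fst w) \<partial>(sphere_measure :: ('a \<times> 'a) measure)) = ennreal (real DIM('a)) * 
    (NI u. indicator (ball 0 1) u * ennreal (height u ^ (DIM('a) - 2)) * (NI z. indicator (unit_ball::'a set) z * G u))"
    by (subst nn_integral_sphere_slice[OF _ d]) auto
  also have "\<dots> \<le> ennreal (real DIM('a)) * (NI u. emeasure lborel (unit_ball :: 'a set) * (indicator (ball 0 1) u * G u))"
  proof (intro mult_left_mono nn_integral_mono)
    fix u :: 'a
    have "ennreal (height u ^ (DIM('a) - 2)) \<le> 1" if "norm u < 1" 
      using height_power_le_1[OF that] by (simp add: ennreal_le_1)
    then show "indicator (ball 0 1) u * ennreal (height u ^ (DIM('a) - 2)) * (NI z. indicator (unit_ball::'a set) z * G u)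
      \<le> emeasure lborel (unit_ball :: 'a set) * (indicator (ball 0 1) u * G u)"
      using mult_right_mono[of "ennreal (height u ^ (DIM('a) - 2))" 1 "emeasure lborel (unit_ball :: 'a set) * G u"]
      by (cases "norm u < 1") (auto simp: nn_integral_multc)
  qed simp
  also have "\<dots> = ennreal (real DIM('a)) * emeasure lborel (unit_ball :: 'a set) * (NI u. indicator (ball 0 1) u * G u)"
    by (subst nn_integral_cmult) (auto simp: mult.assoc)
  finally show ?thesis .
qed

definition slice_const :: "'a::euclidean_space itself \<Rightarrow> ennreal" where
  "slice_const _ = ennreal (real DIM('a)) * emeasure lborel (unit_ball :: 'a set)"

lemma slice_const_finite: "slice_const TYPE('a::euclidean_space) < top"
  using emeasure_unit_ball(2)[where 'a='a] by (simp add: slice_const_def ennreal_mult_less_top)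

text \<open>After shifting x by t y only y - z enters, and (y - z) / sqrt 2 is the first component
  of a rotated point of the sphere, so its distribution has bounded density. Hence the average of g
  is, at every x, at most a multiple of t^(-d) times the integral of g.\<close>

lemma bisph_nn_L1:
  fixes f g :: "'a::euclidean_space \<Rightarrow> ennreal"
  assumes [measurable]: "borel_fun f" "borel_fun g" and d: "2 \<le> DIM('a)" and t: "0 < t"
  shows "(NI x. bisph_nn t f g x) \<le> slice_const TYPE('a) * ennreal (1 / t ^ DIM('a)) * 
    (NI x. f x) * (NI x. g x)"
proof -
  let ?d = "DIM('a)" and ?C = "slice_const TYPE('a)"
  define R :: "'a \<times> 'a \<Rightarrow> 'a \<times> 'a" where "R w = (1 / sqrt 2) *\<^sub>R (fst w - snd w, fst w + snd w)" for w
  have R: "orthogonal_transformation R"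
  proof -
    have "linear R" unfolding R_def by (rule linearI) (auto simp: algebra_simps scaleR_prod_def)
    then show ?thesis
      by (auto simp: orthogonal_transformation_def R_def inner_prod_def algebra_simps inner_add_left inner_add_right inner_diff_left inner_diff_right)
  qed
  have "(NI x. bisph_nn t f g x) = (NI x. NI w. ennreal (2 * real ?d) *
      (indicator unit_ball w * (f (x - t *\<^sub>R fst (sgn w)) * g (x - t *\<^sub>R snd (sgn w)))))"
    by (subst bisph_nn_alt, measurable, subst nn_integral_cmult) auto
  also have "\<dots> = (NI w. NI x. ennreal (2 * real ?d) *
      (indicator unit_ball w * (f (x - t *\<^sub>R fst (sgn w)) * g (x - t *\<^sub>R snd (sgn w)))))"
    by (rule nn_integral_lborel_swap) measurable
  also have "\<dots> = (NI w. NI x. ennreal (2 * real ?d) *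
      (indicator unit_ball w * (f x * g (x + t *\<^sub>R (fst (sgn w) - snd (sgn w))))))"
  proof (rule nn_integral_cong)
    fix w :: "'a \<times> 'a"
    have "x + t *\<^sub>R fst (sgn w) - t *\<^sub>R snd (sgn w) = x + t *\<^sub>R (fst (sgn w) - snd (sgn w))" for x
      by (simp add: algebra_simps)
    then show "(NI x. ennreal (2 * real ?d) * (indicator unit_ball w * (f (x - t *\<^sub>R fst (sgn w)) * g (x - t *\<^sub>R snd (sgn w)))))
      = (NI x. ennreal (2 * real ?d) * (indicator unit_ball w * (f x * g (x + t *\<^sub>R (fst (sgn w) - snd (sgn w))))))"
      by (subst nn_integral_lborel_shift(2)[of _ "t *\<^sub>R fst (sgn w)", symmetric], measurable) (simp only: add_diff_cancel_right')
  qed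
  also have "\<dots> = (NI x. NI w. ennreal (2 * real ?d) *
      (indicator unit_ball w * (f x * g (x + t *\<^sub>R (fst (sgn w) - snd (sgn w))))))"
    by (rule nn_integral_lborel_swap) measurable
  also have "\<dots> = (NI x. f x * (\<integral>\<^sup>+w. g (x + t *\<^sub>R (fst w - snd w)) \<partial>sphere_measure))"
  proof (rule nn_integral_cong)
    fix x
    have "f x * (\<integral>\<^sup>+w. g (x + t *\<^sub>R (fst w - snd w)) \<partial>sphere_measure)
      = (NI w. f x * (ennreal (2 * real ?d) * (indicator unit_ball w * g (x + t *\<^sub>R (fst (sgn w) - snd (sgn w))))))"
      by (subst nn_integral_sphere_measure, measurable, subst nn_integral_cmult[symmetric], measurable, subst nn_integral_cmult[symmetric]) auto
    then show "(NI w. ennreal (2 * real ?d) * (indicator unit_ball w * (f x * g (x + t *\<^sub>R (fst (sgn w) - snd (sgn w))))))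
      = f x * (\<integral>\<^sup>+w. g (x + t *\<^sub>R (fst w - snd w)) \<partial>sphere_measure)"
      by (simp add: mult_ac)
  qed
  also have "\<dots> \<le> (NI x. f x * (?C * ennreal (1 / t ^ ?d) * (NI x. g x)))"
  proof (intro nn_integral_mono mult_left_mono)
    fix x
    let ?s = "t * sqrt 2"
    have s: "0 < ?s" "t ^ ?d \<le> ?s ^ ?d" using t by (auto intro!: power_mono)
    have "(\<integral>\<^sup>+w. g (x + t *\<^sub>R (fst w - snd w)) \<partial>sphere_measure) = (\<integral>\<^sup>+w. g (x + ?s *\<^sub>R fst (R w)) \<partial>sphere_measure)"
      by (simp add: R_def)
    also have "\<dots> = (\<integral>\<^sup>+w. g (x + ?s *\<^sub>R fst w) \<partial>(sphere_measure::('a\<times>'a) measure))"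
      by (rule nn_integral_sphere_orthogonal[OF _ R]) measurable
    also have "\<dots> \<le> ?C * (NI u. indicator (ball 0 1) u * g (x + ?s *\<^sub>R u))"
      unfolding slice_const_def by (rule nn_integral_sphere_fst_le[OF _ d]) measurable
    also have "\<dots> \<le> ?C * (NI u. g (x + ?s *\<^sub>R u))"
      by (intro mult_left_mono nn_integral_mono) (auto simp: indicator_def)
    also have "(NI u. g (x + ?s *\<^sub>R u)) \<le> ennreal (1 / t ^ ?d) * (NI x. g x)"
    proof -
      have "ennreal (1 / t ^ ?d) * (NI x. g x) = (ennreal (1 / t ^ ?d) * ennreal (?s ^ ?d)) * (NI u. g (x + ?s *\<^sub>R u))"
        using s t by (subst nn_integral_lborel_affine[of g ?s x]) (auto simp: mult.assoc)
      moreover have "1 \<le> ennreal (1 / t ^ ?d) * ennreal (?s ^ ?d)"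
        using s(2) t by (simp add: ennreal_mult[symmetric] field_simps del: power_mult_distrib)
      ultimately show ?thesis by (metis mult_right_mono mult_1 zero_le)
    qed
    finally show "(\<integral>\<^sup>+w. g (x + t *\<^sub>R (fst w - snd w)) \<partial>sphere_measure) \<le> ?C * ennreal (1 / t ^ ?d) * (NI x. g x)"
      by (simp add: mult.assoc mult_left_mono)
  qed simp
  also have "\<dots> = ?C * ennreal (1 / t ^ ?d) * (NI x. f x) * (NI x. g x)"
    by (subst nn_integral_multc) (auto simp: mult_ac)
  finally show ?thesis .
qed

lemma emeasure_ball_scale:
  fixes c :: "'a::euclidean_space"
  assumes "0 < r"
  shows "(NI x. indicator (cball c r) x) = ennreal (r ^ DIM('a)) * emeasure lborel (unit_ball :: 'a set)"
proof -
  have "(NI x. indicator (cball c r) x) = ennreal (r ^ DIM('a)) * (NI x. indicator (cball c r) (c + r *\<^sub>R x))"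
    using assms by (subst nn_integral_lborel_affine[of _ r c]) auto
  also have "(\<lambda>x. indicator (cball c r) (c + r *\<^sub>R x) :: ennreal) = indicator unit_ball"
    using assms by (auto simp: indicator_def dist_norm)
  finally show ?thesis by simp
qed

lemma nn_integral_ball_averages:
  fixes F :: "'a::euclidean_space \<Rightarrow> ennreal"
  assumes [measurable]: "borel_fun F" and "0 < r"
  shows "(NI c. NI x. indicator {..r} (dist c x) * F x) =
    ennreal (r ^ DIM('a)) * emeasure lborel (unit_ball :: 'a set) * (NI x. F x)"
proof -
  have "(NI c. NI x. indicator {..r} (dist c x) * F x)
    = (NI x. NI c. indicator {..r} (dist c x) * F x)"
    by (rule nn_integral_lborel_swap) measurable
  also have "\<dots> = (NI x. ennreal (r ^ DIM('a)) * emeasure lborel (unit_ball :: 'a set) * F x)"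
  proof (rule nn_integral_cong)
    fix x :: 'a
    have "(NI c. indicator {..r} (dist c x) * F x) = (NI c. indicator (cball x r) c) * F x"
      by (subst nn_integral_multc[symmetric]) (auto simp: indicator_def dist_commute)
    then show "(NI c. indicator {..r} (dist c x) * F x) = ennreal (r ^ DIM('a)) * emeasure lborel (unit_ball :: 'a set) * F x"
      using emeasure_ball_scale[OF assms(2), of x] by simp
  qed
  also have "\<dots> = ennreal (r ^ DIM('a)) * emeasure lborel (unit_ball :: 'a set) * (NI x. F x)"
    by (subst nn_integral_cmult) auto
  finally show ?thesis .
qed

lemma ennreal_square_le_imp_le: 
  fixes x y :: ennreal assumes "x * x \<le> y * y" shows "x \<le> y"
proof (rule ccontr)
  assume "\<not> x \<le> y"
  then have "y < x" by simp
  then obtain r where y: "y = ennreal r" "0 \<le> r" by (cases y) auto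
  show False
  proof (cases x)
    case (real s)
    then have "r * r < s * s" using \<open>y < x\<close> y by (intro mult_strict_mono') (auto simp: ennreal_less_iff)
    then show False using assms real y by (simp add: ennreal_mult[symmetric] ennreal_le_iff)
  next
    case top
    then show False using assms y by (simp add: ennreal_mult[symmetric] top_unique)
  qed
qed

lemma sphere_measure_norm_le:
  fixes w :: "'a::euclidean_space \<times> 'a"
  shows "norm (fst (sgn w)) \<le> 1" "norm (snd (sgn w)) \<le> 1"
proof -
  have "norm (sgn w) \<le> 1" by (simp add: norm_sgn)
  then show "norm (fst (sgn w)) \<le> 1" "norm (snd (sgn w)) \<le> 1"
    using norm_fst_le[of "fst (sgn w)" "snd (sgn w)"] norm_snd_le[of "snd (sgn w)" "fst (sgn w)"] by auto
qed

lemma bisph_nn_mono_local: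
  fixes f g :: "'a::euclidean_space \<Rightarrow> ennreal"
  assumes [measurable]: "borel_fun f" "borel_fun g" "borel_fun f'" "borel_fun g'"
    and t: "0 \<le> t" and le: "\<And>y. dist x y \<le> t \<Longrightarrow> f y \<le> f' y" "\<And>y. dist x y \<le> t \<Longrightarrow> g y \<le> g' y"
  shows "bisph_nn t f g x \<le> bisph_nn t f' g' x"
  using sphere_measure_norm_le[where 'a='a] t
  by (subst (1 2) bisph_nn_alt, measurable)
     (intro mult_left_mono nn_integral_mono mult_mono le, auto simp: dist_norm intro!: mult_left_le)

lemma bisph_nn_mono:
  fixes f g :: "'a::euclidean_space \<Rightarrow> ennreal"
  assumes "\<And>y. f y \<le> f' y" "\<And>y. g y \<le> g' y"
  shows "bisph_nn t f g x \<le> bisph_nn t f' g' x"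
  unfolding bisph_nn_def by (intro nn_integral_mono mult_mono assms) auto

text \<open>An L^1 \<times> L^1 to weak L^(1/2) bound, uniform in t, in a form that can be summed
  over scales. On a ball of radius t the level set has measure M at most a multiple of t^d, while
  \<alpha> \<beta> M is at most a multiple of t^(-d) times the two local integrals. Multiplying the
  two bounds removes t and gives M^2 \<le> k X Y, so M is at most a multiple of X + Y. Averaging
  over the centres c makes this global.\<close>

lemma bisph_nn_weak:
  assumes d: "2 \<le> DIM('a::euclidean_space)"
  obtains K :: real where "0 < K"
    "\<And>t \<alpha> \<beta> F G. 0 < t \<Longrightarrow> 0 < \<alpha> \<Longrightarrow> 0 < \<beta> \<Longrightarrow> borel_fun F \<Longrightarrow> borel_fun G \<Longrightarrow>
      emeasure lborel {x::'a. ennreal (\<alpha> * \<beta>) < bisph_nn t F G x} \<le>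
        ennreal K * (ennreal (1 / \<alpha>) * (NI x. F x) + ennreal (1 / \<beta>) * (NI x. G x))"
proof -
  let ?d = "DIM('a)" and ?m = "emeasure lborel (unit_ball :: 'a set)" and ?C = "slice_const TYPE('a)"
  obtain k where k: "?C * ?m = ennreal k" "0 \<le> k"
    using slice_const_finite[where 'a='a] emeasure_unit_ball(2)[where 'a='a]
    by (metis ennreal_cases ennreal_mult_eq_top_iff less_irrefl)
  \<comment> \<open>Large enough that k is at most the square of this constant, so that the square
    root of M^2 \<le> k X Y can be taken.\<close>
  define K' where "K' = 1 + k"
  have K': "1 \<le> K'" "k \<le> K' * K'" using k by (auto simp: K'_def algebra_simps)
  show thesis
  proof (rule that[of "K' * 2 ^ ?d"])
    show "0 < K' * 2 ^ ?d" using K' by simp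
    fix t \<alpha> \<beta> :: real and F G :: "'a \<Rightarrow> ennreal"
    assume t: "0 < t" and ab: "0 < \<alpha>" "0 < \<beta>" and [measurable]: "borel_fun F" "borel_fun G"
    let ?E = "{x. ennreal (\<alpha> * \<beta>) < bisph_nn t F G x}"
    have E[measurable]: "?E \<in> sets borel" "{x. x \<in> ?E} \<in> sets borel" by simp_all
    define X where "X c = ennreal (1 / \<alpha>) * (NI x. indicator {..2*t} (dist c x) * F x)" for c
    define Y where "Y c = ennreal (1 / \<beta>) * (NI x. indicator {..2*t} (dist c x) * G x)" for c
    have [measurable]: "borel_fun X" "borel_fun Y" unfolding X_def Y_def by measurable
    have loc: "(NI x. indicator {..t} (dist c x) * indicator ?E x) \<le> ennreal K' * (X c + Y c)" for c
    proof (rule ennreal_square_le_imp_le)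
      let ?M = "NI x. indicator {..t} (dist c x) * indicator ?E x"
      let ?F = "\<lambda>x. indicator {..2*t} (dist c x) * F x" and ?G = "\<lambda>x. indicator {..2*t} (dist c x) * G x"
      have M1: "?M \<le> ennreal (t ^ ?d) * ?m"
      proof -
        have "?M \<le> (NI x. indicator (cball c t) x)"
          by (intro nn_integral_mono) (auto simp: indicator_def)
        then show ?thesis using emeasure_ball_scale[OF t, of c] by simp
      qed
      have "ennreal (\<alpha> * \<beta>) * ?M = (NI x. ennreal (\<alpha> * \<beta>) * (indicator {..t} (dist c x) * indicator ?E x))"
        by (subst nn_integral_cmult) auto
      also have "\<dots> \<le> (NI x. bisph_nn t ?F ?G x)"
      proof (rule nn_integral_mono)
        fix x
        have "bisph_nn t F G x \<le> bisph_nn t ?F ?G x" if "dist c x \<le> t"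
        proof (rule bisph_nn_mono_local)
          fix y assume "dist x y \<le> t"
          then have "dist c y \<le> 2 * t" using dist_triangle[of c y x] that by simp
          then show "F y \<le> ?F y" "G y \<le> ?G y" by simp_all
        qed (use t in auto)
        then show "ennreal (\<alpha> * \<beta>) * (indicator {..t} (dist c x) * indicator ?E x) \<le> bisph_nn t ?F ?G x"
          by (auto simp: indicator_def intro: order_trans[OF less_imp_le])
      qed
      also have "\<dots> \<le> ?C * ennreal (1 / t ^ ?d) * (NI x. ?F x) * (NI x. ?G x)"
        by (rule bisph_nn_L1[OF _ _ d t]) measurable
      finally have M2: "ennreal (\<alpha> * \<beta>) * ?M \<le> ?C * ennreal (1 / t ^ ?d) * (NI x. ?F x) * (NI x. ?G x)" .
      have "?M = (ennreal (1 / \<alpha>) * ennreal (1 / \<beta>) * ennreal (\<alpha> * \<beta>)) * ?M" using ab by (simp add: ennreal_mult[symmetric])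
      also have "\<dots> \<le> ennreal (1 / \<alpha>) * ennreal (1 / \<beta>) * (?C * ennreal (1 / t ^ ?d) * (NI x. ?F x) * (NI x. ?G x))"
        unfolding mult.assoc[of _ _ ?M] by (intro mult_left_mono M2) simp
      also have "\<dots> = ?C * ennreal (1 / t ^ ?d) * (X c * Y c)" unfolding X_def Y_def by (simp add: mult_ac)
      finally have M3: "?M \<le> ?C * ennreal (1 / t ^ ?d) * (X c * Y c)" .
      have "?M * ?M \<le> (ennreal (t ^ ?d) * ?m) * (?C * ennreal (1 / t ^ ?d) * (X c * Y c))"
        by (intro mult_mono M1 M3) auto
      also have "\<dots> = (ennreal (t ^ ?d) * ennreal (1 / t ^ ?d)) * (?C * ?m) * (X c * Y c)" by (simp only: mult_ac)
      also have "\<dots> = ennreal k * (X c * Y c)" unfolding k(1) using t by (simp add: ennreal_mult[symmetric])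
      also have "\<dots> \<le> ennreal (K' * K') * ((X c + Y c) * (X c + Y c))"
        using K' by (intro mult_mono ennreal_leI) auto
      also have "\<dots> = ennreal K' * (X c + Y c) * (ennreal K' * (X c + Y c))"
        using K' by (simp add: ennreal_mult mult_ac)
      finally show "?M * ?M \<le> ennreal K' * (X c + Y c) * (ennreal K' * (X c + Y c))" .
    qed
    have "(ennreal (t ^ ?d) * ?m) * emeasure lborel ?E = (NI c. NI x. indicator {..t} (dist c x) * indicator ?E x)"
      using nn_integral_ball_averages[of "indicator ?E" t] t by simp
    also have "\<dots> \<le> (NI c. ennreal K' * (X c + Y c))" by (intro nn_integral_mono loc)
    also have "\<dots> = ennreal K' * ((NI c. X c) + (NI c. Y c))"
      by (subst nn_integral_cmult, measurable, subst nn_integral_add) auto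
    also have "(NI c. X c) = ennreal (1 / \<alpha>) * (ennreal ((2*t) ^ ?d) * ?m * (NI x. F x))"
      unfolding X_def using t by (subst nn_integral_cmult, measurable, subst nn_integral_ball_averages) auto
    also have "(NI c. Y c) = ennreal (1 / \<beta>) * (ennreal ((2*t) ^ ?d) * ?m * (NI x. G x))"
      unfolding Y_def using t by (subst nn_integral_cmult, measurable, subst nn_integral_ball_averages) auto
    also have "ennreal ((2*t) ^ ?d) = ennreal (2 ^ ?d) * ennreal (t ^ ?d)" using t by (simp add: power_mult_distrib ennreal_mult)
    also have "ennreal K' * (ennreal (1 / \<alpha>) * (ennreal (2 ^ ?d) * ennreal (t ^ ?d) * ?m * (NI x. F x)) +
        ennreal (1 / \<beta>) * (ennreal (2 ^ ?d) * ennreal (t ^ ?d) * ?m * (NI x. G x)))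
      = (ennreal (t ^ ?d) * ?m) * (ennreal (K' * 2 ^ ?d) * (ennreal (1 / \<alpha>) * (NI x. F x) + ennreal (1 / \<beta>) * (NI x. G x)))"
      using K' by (simp add: ennreal_mult distrib_left distrib_right mult_ac)
    finally have "(ennreal (t ^ ?d) * ?m) * emeasure lborel ?E \<le> (ennreal (t ^ ?d) * ?m) * (ennreal (K' * 2 ^ ?d) * (ennreal (1 / \<alpha>) * (NI x. F x) + ennreal (1 / \<beta>) * (NI x. G x)))" .
    moreover have "0 < ennreal (t ^ ?d) * ?m" "ennreal (t ^ ?d) * ?m < top"
      using t emeasure_unit_ball[where 'a='a] by (auto simp: ennreal_mult_less_top ennreal_zero_less_mult_iff)
    ultimately show "emeasure lborel ?E \<le> ennreal (K' * 2 ^ ?d) * (ennreal (1 / \<alpha>) * (NI x. F x) + ennreal (1 / \<beta>) * (NI x. G x))"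
      by (subst (asm) ennreal_mult_le_mult_iff) auto
  qed
qed

section \<open>The convolution kernel of two spheres\<close>

text \<open>On a line at distance P from the origin, the point with coordinate s has norm sqrt (P^2
  + s^2). The new variable is v = s - sqrt (P^2 + s^2), which runs through the negative reals;
  solving (v - s)^2 = P^2 + s^2 for s gives s = v/2 - P^2/(2v).\<close>

lemma nn_integral_hyperbola_substitution:
  fixes f :: "real \<Rightarrow> ennreal"
  assumes [measurable]: "borel_fun f" and P: "0 < P"
  shows "(NI s. f s) = (NI v. indicator {..<0} v * ennreal ((v\<^sup>2 + P\<^sup>2) / (2 * v\<^sup>2)) * f (v / 2 - P\<^sup>2 / (2 * v)))"
proof -
  let ?g = "\<lambda>v::real. v / 2 - P\<^sup>2 / (2 * v)" and ?g' = "\<lambda>v::real. (v\<^sup>2 + P\<^sup>2) / (2 * v\<^sup>2)"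
  let ?a = "\<lambda>n::nat. - (real n + 2)" and ?b = "\<lambda>n::nat. - (1 / (real n + 2))"
  have bneg: "?b n < 0" for n by simp
  have neg: "x < 0" if "x \<in> {?a n..?b n}" for x n
  proof -
    have "x \<le> ?b n" using that by simp
    then show ?thesis using bneg[of n] by linarith
  qed
  have un: "(\<Union>n. {?a n..?b n}) = {..<0}"
  proof (intro equalityI subsetI)
    fix x :: real assume "x \<in> {..<0}"
    then have x: "x < 0" by simp
    obtain n :: nat where n: "max (- x) (1 / (- x)) < real n" using reals_Archimedean2 by blast
    then have n2: "- x \<le> real n + 2" "1 / (- x) \<le> real n + 2" by auto
    then have "1 \<le> (- x) * (real n + 2)" using x by (subst (asm) pos_divide_le_eq) (auto simp: mult.commute)
    then have "1 / (real n + 2) \<le> - x" by (subst pos_divide_le_eq) auto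
    then have "x \<in> {?a n..?b n}" using n2(1) by auto
    then show "x \<in> (\<Union>n. {?a n..?b n})" by blast
  qed (use neg in blast)
  have d: "(?g has_real_derivative ?g' x) (at x)" if "x \<in> {?a n..?b n}" for n x
  proof -
    have x: "x \<noteq> 0" using neg[OF that] by simp
    have "(?g has_real_derivative (1 / 2 - (0 * (2 * x) - P\<^sup>2 * 2) / ((2 * x) * (2 * x)))) (at x)"
      using x by (intro DERIV_diff DERIV_divide DERIV_const DERIV_cmult_Id DERIV_cdivide DERIV_ident) auto
    moreover have "1 / 2 - (0 * (2 * x) - P\<^sup>2 * 2) / ((2 * x) * (2 * x)) = ?g' x"
      using x by (simp add: power2_eq_square add_divide_distrib)
    ultimately show ?thesis by simp
  qed
  have nn: "0 \<le> ?g' x" for x by simp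
  have mono: "?g x \<le> ?g y" if "x \<le> y" "y < 0" for x y
  proof (rule DERIV_nonneg_imp_nondecreasing[OF that(1)])
    fix u assume "x \<le> u" "u \<le> y"
    then have "u \<in> (\<Union>n. {?a n..?b n})" using that un by auto
    then show "\<exists>v. (?g has_real_derivative v) (at u) \<and> 0 \<le> v" using d nn by blast
  qed
  have img: "(\<Union>n. {?g (?a n)..?g (?b n)}) = UNIV"
  proof (intro equalityI subsetI)
    fix s :: real
    define q where "q = sqrt (P\<^sup>2 + s\<^sup>2)"
    have q: "q\<^sup>2 = P\<^sup>2 + s\<^sup>2" "s < q" using P by (auto simp: q_def real_less_rsqrt)
    have "?g (s - q) = s"
    proof -
      have "(s - q) * (s - q) - P\<^sup>2 = s * (2 * (s - q))" using q(1) by (simp add: power2_eq_square algebra_simps)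
      then show ?thesis using q(2) by (simp add: field_simps power2_eq_square)
    qed
    moreover have "s - q \<in> (\<Union>n. {?a n..?b n})" unfolding un using q(2) by simp
    then obtain n where "s - q \<in> {?a n..?b n}" by blast
    ultimately have "s \<in> {?g (?a n)..?g (?b n)}" using mono[of "?a n" "s - q"] mono[of "s - q" "?b n"] neg[of "s - q" n] bneg[of n] by auto
    then show "s \<in> (\<Union>n. {?g (?a n)..?g (?b n)})" by blast
  qed auto
  have "(NI s. f s) = (NI x. f x * indicator (\<Union>n. {?g (?a n)..?g (?b n)}) x)"
    unfolding img by simp
  also have "\<dots> = (NI x. f (?g x) * ennreal (?g' x) * indicator (\<Union>n. {?a n..?b n}) x)"
  proof (rule nn_integral_substitution_incseq)
    show "?a n < ?b n" for n
    proof -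
      have "1 / (real n + 2) < 1" by simp
      then show ?thesis by linarith
    qed
    show "decseq ?a" by (intro decseq_SucI) simp
    show "incseq ?b" by (intro incseq_SucI) (simp add: field_simps)
    show "continuous_on {?a n..?b n} ?g'" for n
      using neg[of _ n] by (intro continuous_intros) auto
  qed (use d nn in auto)
  finally show ?thesis unfolding un by (simp add: mult_ac)
qed

text \<open>A line is a null set as soon as d \<ge> 2. Off it the distance P of the preceding
  substitution is positive.\<close>

lemma AE_not_on_line:
  fixes w :: "'a::euclidean_space"
  assumes d: "2 \<le> DIM('a)"
  shows "AE p in lborel. p \<noteq> (p \<bullet> w) *\<^sub>R w"
proof -
  have "dim (span {w}) < DIM('a)" using d dim_le_card[of "span {w}" "{w}"] by (simp add: dim_span)
  then have "negligible (span {w})" by (rule negligible_lowdim)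
  then have "span {w} \<in> null_sets lborel"
    by (simp add: negligible_iff_null_sets null_sets_completion_iff closed_subspace)
  then have "AE p in lborel. p \<notin> span {w}" by (rule AE_not_in)
  then show ?thesis by eventually_elim (metis span_base span_scale singletonI)
qed

text \<open>The density of v = u - |u| w for u in the unit ball, in terms of s = |v| and the cosine
  c of the angle between v and w. Because |u - v| = |u|, the point u lies on the perpendicular
  bisector of the segment from 0 to v; hence |u| = |v| / (-2c), and |u| \<le> 1 becomes s \<le> - 2
  c. For fixed c the density is a multiple of the indicator of a ball: this is the decomposition
  into balls.\<close>

definition bisector_kernel :: "real \<Rightarrow> real \<Rightarrow> ennreal" where
  "bisector_kernel s c = (if c < 0 \<and> s \<le> - 2 * c then ennreal (1 / (2 * c\<^sup>2)) else 0)"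

lemma bisector_kernel_measurable [measurable (raw)]:
  assumes [measurable]: "f \<in> borel_measurable M" "g \<in> borel_measurable M"
  shows "(\<lambda>x. bisector_kernel (f x) (g x)) \<in> borel_measurable M"
  unfolding bisector_kernel_def by measurable

text \<open>The map \<open>u \<mapsto> u - norm u *\<^sub>R w\<close> moves \<open>u\<close> along the direction \<open>w\<close> only, so its Jacobian can be
  computed on lines.\<close>

lemma nn_integral_ball_minus_norm:
  fixes \<phi> :: "'a::euclidean_space \<Rightarrow> ennreal"
  assumes [measurable]: "borel_fun \<phi>" and d: "2 \<le> DIM('a)" and w: "norm w = 1"
  shows "(NI u. indicator unit_ball u * \<phi> (u - norm u *\<^sub>R w)) =
    (NI v. bisector_kernel (norm v) (sgn v \<bullet> w) * \<phi> v)"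
proof -
  have ww: "w \<bullet> w = 1" using w by (simp add: norm_eq_sqrt_inner)
  let ?q = "\<lambda>p. p - (p \<bullet> w) *\<^sub>R w"
  have "(NI s. indicator unit_ball (?q p + s *\<^sub>R w) * \<phi> (?q p + s *\<^sub>R w - norm (?q p + s *\<^sub>R w) *\<^sub>R w))
    = (NI v. bisector_kernel (norm (?q p + v *\<^sub>R w)) (sgn (?q p + v *\<^sub>R w) \<bullet> w) * \<phi> (?q p + v *\<^sub>R w))"
    if p: "p \<noteq> (p \<bullet> w) *\<^sub>R w" for p
  proof -
    define P where "P = norm (?q p)"
    have P: "0 < P" using p by (simp add: P_def)
    have qw: "?q p \<bullet> w = 0" by (simp add: inner_diff_left ww)
    have n: "norm (?q p + s *\<^sub>R w) = sqrt (P\<^sup>2 + s\<^sup>2)" for s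
    proof -
      have "(norm (?q p + s *\<^sub>R w))\<^sup>2 = P\<^sup>2 + s\<^sup>2"
        unfolding P_def power2_norm_eq_inner using qw ww
        by (simp add: inner_add_left inner_add_right inner_commute power2_eq_square)
      then show ?thesis by (metis norm_ge_zero real_sqrt_unique)
    qed
    have "(NI s. indicator unit_ball (?q p + s *\<^sub>R w) * \<phi> (?q p + s *\<^sub>R w - norm (?q p + s *\<^sub>R w) *\<^sub>R w))
      = (NI s. indicator {..1} (sqrt (P\<^sup>2 + s\<^sup>2)) * \<phi> (?q p + (s - sqrt (P\<^sup>2 + s\<^sup>2)) *\<^sub>R w))"
      by (rule nn_integral_cong) (simp add: n indicator_def scaleR_diff_left add_diff_eq)
    also have "\<dots> = (NI v. indicator {..<0} v * ennreal ((v\<^sup>2 + P\<^sup>2) / (2 * v\<^sup>2)) *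
       (indicator {..1} (sqrt (P\<^sup>2 + (v / 2 - P\<^sup>2 / (2 * v))\<^sup>2)) * \<phi> (?q p + ((v / 2 - P\<^sup>2 / (2 * v)) - sqrt (P\<^sup>2 + (v / 2 - P\<^sup>2 / (2 * v))\<^sup>2)) *\<^sub>R w)))"
      by (rule nn_integral_hyperbola_substitution[OF _ P]) measurable
    also have "\<dots> = (NI v. bisector_kernel (norm (?q p + v *\<^sub>R w)) (sgn (?q p + v *\<^sub>R w) \<bullet> w) * \<phi> (?q p + v *\<^sub>R w))"
    proof (rule nn_integral_cong)
      fix v :: real
      define N where "N = sqrt (P\<^sup>2 + v\<^sup>2)"
      have N: "0 < N" "N\<^sup>2 = P\<^sup>2 + v\<^sup>2" using P by (auto simp: N_def add_pos_nonneg)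
      have sg: "sgn (?q p + v *\<^sub>R w) \<bullet> w = v / N"
        using qw ww n[of v] by (simp add: sgn_div_norm N_def inner_add_left divide_inverse mult.commute)
      show "indicator {..<0} v * ennreal ((v\<^sup>2 + P\<^sup>2) / (2 * v\<^sup>2)) *
       (indicator {..1} (sqrt (P\<^sup>2 + (v / 2 - P\<^sup>2 / (2 * v))\<^sup>2)) * \<phi> (?q p + ((v / 2 - P\<^sup>2 / (2 * v)) - sqrt (P\<^sup>2 + (v / 2 - P\<^sup>2 / (2 * v))\<^sup>2)) *\<^sub>R w))
       = bisector_kernel (norm (?q p + v *\<^sub>R w)) (sgn (?q p + v *\<^sub>R w) \<bullet> w) * \<phi> (?q p + v *\<^sub>R w)"
      proof (cases "v < 0")
        case True
        have "P\<^sup>2 + (v / 2 - P\<^sup>2 / (2 * v))\<^sup>2 = (- (v / 2 + P\<^sup>2 / (2 * v)))\<^sup>2"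
          using True by (simp add: power2_eq_square algebra_simps)
        moreover have "v / 2 + P\<^sup>2 / (2 * v) \<le> 0" using True by (simp add: add_nonpos_nonpos divide_nonneg_neg)
        ultimately have sq: "sqrt (P\<^sup>2 + (v / 2 - P\<^sup>2 / (2 * v))\<^sup>2) = - (v / 2 + P\<^sup>2 / (2 * v))"
          by (simp only: real_sqrt_abs)
        have "v / 2 + P\<^sup>2 / (2 * v) = N\<^sup>2 / (2 * v)" using True N(2) by (simp add: field_simps power2_eq_square)
        then have c1: "- (v / 2 + P\<^sup>2 / (2 * v)) \<le> 1 \<longleftrightarrow> N\<^sup>2 \<le> - 2 * v" using True by (simp add: field_simps)
        have c2: "N \<le> - 2 * (v / N) \<longleftrightarrow> N\<^sup>2 \<le> - 2 * v" using N(1) by (simp add: field_simps power2_eq_square)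
        have c3: "(v\<^sup>2 + P\<^sup>2) / (2 * v\<^sup>2) = 1 / (2 * (v / N)\<^sup>2)" using True N by (simp add: power_divide add.commute)
        have c4: "v / N < 0" using True N(1) by (simp add: divide_neg_pos)
        have c5: "v / 2 - P\<^sup>2 / (2 * v) - - (v / 2 + P\<^sup>2 / (2 * v)) = v" by simp
        show ?thesis unfolding sq sg n N_def[symmetric] c5 bisector_kernel_def c2 c3 indicator_def atMost_iff lessThan_iff c1 using True c4
          by simp
      next
        case False
        then have "\<not> v / N < 0" using N(1) by (simp add: divide_less_0_iff)
        then show ?thesis using False by (simp add: bisector_kernel_def sg)
      qed
    qed
    finally show ?thesis .
  qed
  then have "AE p in lborel. (NI s. indicator unit_ball (?q p + s *\<^sub>R w) * \<phi> (?q p + s *\<^sub>R w - norm (?q p + s *\<^sub>R w) *\<^sub>R w))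
    = (NI v. bisector_kernel (norm (?q p + v *\<^sub>R w)) (sgn (?q p + v *\<^sub>R w) \<bullet> w) * \<phi> (?q p + v *\<^sub>R w))"
    using AE_not_on_line[OF d, of w] by (rule eventually_mono[rotated]) blast
  then show ?thesis
    by (subst (1 2) nn_integral_lborel_lines[OF _ w], measurable) (intro nn_integral_cong_AE, auto)
qed

text \<open>The reflection in the hyperplane orthogonal to e - e' does it.\<close>

lemma orthogonal_transformation_exists_unit:
  fixes e e' :: "'a::euclidean_space"
  assumes "norm e = 1" "norm e' = 1"
  obtains R :: "'a \<Rightarrow> 'a" where "orthogonal_transformation R" "R e = e'"
proof (cases "e = e'")
  case True
  then show thesis using that[of "\<lambda>x. x"] by simp
next
  case False
  define n where "n = e - e'"
  have n: "n \<bullet> n \<noteq> 0" using False by (simp add: n_def)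
  have ee: "e \<bullet> e = 1" "e' \<bullet> e' = 1" using assms by (simp_all add: norm_eq_sqrt_inner)
  define R where "R x = x - (2 * (x \<bullet> n) / (n \<bullet> n)) *\<^sub>R n" for x
  have "linear R" unfolding R_def by (rule linearI) (simp_all add: inner_add_left algebra_simps add_divide_distrib)
  moreover have "R v \<bullet> R w = v \<bullet> w" for v w
    using n unfolding R_def by (simp add: inner_diff_left inner_diff_right inner_commute field_simps)
  ultimately have "orthogonal_transformation R" by (simp add: orthogonal_transformation_def)
  moreover have "2 * (e \<bullet> n) = n \<bullet> n" using ee by (simp add: n_def inner_diff_left inner_diff_right inner_commute)
  then have "R e = e'" using n by (simp add: R_def n_def)
  ultimately show thesis by (rule that)
qed

lemma nn_integral_ball_inner_unit:
  fixes e e' :: "'a::euclidean_space" and G :: "real \<Rightarrow> ennreal"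
  assumes e: "norm e = 1" "norm e' = 1" and [measurable]: "borel_fun G"
  shows "(NI z. indicator unit_ball z * G (e \<bullet> sgn z)) = (NI z. indicator unit_ball z * G (e' \<bullet> sgn z))"
proof -
  obtain R :: "'a \<Rightarrow> 'a" where R: "orthogonal_transformation R" "R e = e'"
    using orthogonal_transformation_exists_unit[OF e] .
  have "e' \<bullet> sgn (R z) = e \<bullet> sgn z" for z
    using R by (metis orthogonal_transformation_def sgn_orthogonal)
  then have "(NI z. indicator unit_ball z * G (e \<bullet> sgn z)) = (NI z. indicator unit_ball (R z) * G (e' \<bullet> sgn (R z)))"
    by (simp add: indicator_def orthogonal_transformation_norm[OF R(1)])
  also have "\<dots> = (NI z. indicator unit_ball z * G (e' \<bullet> sgn z))"
    by (rule nn_integral_lborel_orthogonal[OF R(1)]) measurable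
  finally show ?thesis .
qed

text \<open>The kernel sees v and z only through |v| and the angle between them, so by rotation
  invariance in z the direction of v may be replaced by the fixed vector e. Afterwards the inner
  integral over v is, for each z, a multiple of the integral of \<phi> over a ball centred at
  0.\<close>

lemma nn_integral_ball_difference:
  fixes \<phi> :: "'a::euclidean_space \<Rightarrow> ennreal" and e :: 'a
  assumes [measurable]: "borel_fun \<phi>" and d: "2 \<le> DIM('a)" and e: "norm e = 1"
  shows "(NI z. NI u. indicator unit_ball z * (indicator unit_ball u * \<phi> (u - norm u *\<^sub>R sgn z))) =
    (NI z. indicator unit_ball z * (NI v. bisector_kernel (norm v) (e \<bullet> sgn z) * \<phi> v))"
proof -
  have "(NI z. NI u. indicator unit_ball z * (indicator unit_ball u * \<phi> (u - norm u *\<^sub>R sgn z)))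
    = (NI z. NI v. indicator unit_ball z * (bisector_kernel (norm v) (sgn v \<bullet> sgn z) * \<phi> v))"
  proof (rule nn_integral_cong_AE, use AE_lborel_singleton[of 0] in eventually_elim)
    fix z :: 'a assume "z \<noteq> 0"
    then have "norm (sgn z) = 1" by (simp add: norm_sgn)
    from nn_integral_ball_minus_norm[OF _ d this, of \<phi>]
    show "(NI u. indicator unit_ball z * (indicator unit_ball u * \<phi> (u - norm u *\<^sub>R sgn z)))
      = (NI v. indicator unit_ball z * (bisector_kernel (norm v) (sgn v \<bullet> sgn z) * \<phi> v))"
      by (subst (1 2) nn_integral_cmult) auto
  qed
  also have "\<dots> = (NI v. NI z. indicator unit_ball z * (bisector_kernel (norm v) (sgn v \<bullet> sgn z) * \<phi> v))"
    by (rule nn_integral_lborel_swap) measurable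
  also have "\<dots> = (NI v. NI z. indicator unit_ball z * (bisector_kernel (norm v) (e \<bullet> sgn z) * \<phi> v))"
  proof (rule nn_integral_cong_AE, use AE_lborel_singleton[of 0] in eventually_elim)
    fix v :: 'a assume "v \<noteq> 0"
    then have "norm (sgn v) = 1" by (simp add: norm_sgn)
    from nn_integral_ball_inner_unit[OF this e, of "bisector_kernel (norm v)"]
    show "(NI z. indicator unit_ball z * (bisector_kernel (norm v) (sgn v \<bullet> sgn z) * \<phi> v))
      = (NI z. indicator unit_ball z * (bisector_kernel (norm v) (e \<bullet> sgn z) * \<phi> v))"
      unfolding mult.assoc[symmetric] by (subst (1 2) nn_integral_multc) auto
  qed
  also have "\<dots> = (NI z. NI v. indicator unit_ball z * (bisector_kernel (norm v) (e \<bullet> sgn z) * \<phi> v))"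
    by (rule nn_integral_lborel_swap) measurable
  also have "\<dots> = (NI z. indicator unit_ball z * (NI v. bisector_kernel (norm v) (e \<bullet> sgn z) * \<phi> v))"
    by (subst nn_integral_cmult) auto
  finally show ?thesis .
qed

text \<open>The radius t |v| and the direction from the first mean combine into a single point u of
  the solid ball. Shifting x by t u frees the first function of all parameters and leaves the second
  at x + t (u - |u| sgn z), which is the situation of
  \<open>nn_integral_ball_difference\<close>.\<close>

lemma nn_integral_sph_nn_product:
  fixes a b :: "'a::euclidean_space \<Rightarrow> ennreal"
  assumes [measurable]: "borel_fun a" "borel_fun b" and d: "2 \<le> DIM('a)" and e: "norm e = 1"
  shows "(NI x. NI v. indicator (unit_ball::'a set) v * (sph_nn (t * norm v) a x * sph_nn (t * norm v) b x)) =
    emeasure lborel (unit_ball :: 'a set) * (NI z. indicator (unit_ball::'a set) z *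
      (NI x. a x * (NI v. bisector_kernel (norm v) (e \<bullet> sgn z) * b (x + t *\<^sub>R v))))"
proof -
  let ?m = "emeasure lborel (unit_ball :: 'a set)"
  have "(NI x. NI v. indicator (unit_ball::'a set) v * (sph_nn (t * norm v) a x * sph_nn (t * norm v) b x))
    = (NI x. ?m * (NI u. indicator unit_ball u * (a (x - t *\<^sub>R u) * sph_nn (t * norm u) b x)))"
  proof (rule nn_integral_cong)
    fix x
    have "(NI v. indicator (unit_ball::'a set) v * (sph_nn (t * norm v) a x * sph_nn (t * norm v) b x))
      = (NI v. NI z. indicator (unit_ball::'a set) v * indicator unit_ball z * (a (x - (t * norm v) *\<^sub>R sgn z) * sph_nn (t * norm v) b x))"
    proof (rule nn_integral_cong)
      fix v :: 'a
      show "indicator (unit_ball::'a set) v * (sph_nn (t * norm v) a x * sph_nn (t * norm v) b x)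
        = (NI z. indicator (unit_ball::'a set) v * indicator unit_ball z * (a (x - (t * norm v) *\<^sub>R sgn z) * sph_nn (t * norm v) b x))"
        unfolding sph_nn_def[of _ a] mult.assoc
        by (subst nn_integral_cmult, measurable) (simp add: nn_integral_multc mult.assoc[symmetric])
    qed
    also have "\<dots> = ?m * (NI u. indicator unit_ball u * (a (x - (t * norm u) *\<^sub>R sgn u) * sph_nn (t * norm u) b x))"
      by (rule nn_integral_ball_radial_direction) measurable
    also have "(\<lambda>u. (t * norm u) *\<^sub>R sgn u) = (\<lambda>u::'a. t *\<^sub>R u)"
    proof
      fix u :: 'a show "(t * norm u) *\<^sub>R sgn u = t *\<^sub>R u" by (cases "u = 0") (simp_all add: sgn_div_norm)
    qed
    finally show "(NI v. indicator (unit_ball::'a set) v * (sph_nn (t * norm v) a x * sph_nn (t * norm v) b x))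
      = ?m * (NI u. indicator unit_ball u * (a (x - t *\<^sub>R u) * sph_nn (t * norm u) b x))" by simp
  qed
  also have "\<dots> = ?m * (NI x. NI u. indicator unit_ball u * (a (x - t *\<^sub>R u) * sph_nn (t * norm u) b x))"
    by (subst nn_integral_cmult) auto
  also have "(NI x. NI u. indicator unit_ball u * (a (x - t *\<^sub>R u) * sph_nn (t * norm u) b x))
    = (NI u. NI x. indicator unit_ball u * (a (x - t *\<^sub>R u) * sph_nn (t * norm u) b x))"
    by (rule nn_integral_lborel_swap) measurable
  also have "\<dots> = (NI u. NI x. indicator unit_ball u * (a x * sph_nn (t * norm u) b (x + t *\<^sub>R u)))"
  proof (rule nn_integral_cong)
    fix u :: 'a
    show "(NI x. indicator unit_ball u * (a (x - t *\<^sub>R u) * sph_nn (t * norm u) b x))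
      = (NI x. indicator unit_ball u * (a x * sph_nn (t * norm u) b (x + t *\<^sub>R u)))"
      by (subst nn_integral_lborel_shift(2)[of _ "t *\<^sub>R u", symmetric]) auto
  qed
  also have "\<dots> = (NI x. NI u. indicator unit_ball u * (a x * sph_nn (t * norm u) b (x + t *\<^sub>R u)))"
    by (rule nn_integral_lborel_swap) measurable
  also have "\<dots> = (NI x. a x * (NI z. indicator (unit_ball::'a set) z * (NI v. bisector_kernel (norm v) (e \<bullet> sgn z) * b (x + t *\<^sub>R v))))"
  proof (rule nn_integral_cong)
    fix x
    have "(NI u. indicator unit_ball u * (a x * sph_nn (t * norm u) b (x + t *\<^sub>R u)))
      = a x * (NI u. indicator unit_ball u * sph_nn (t * norm u) b (x + t *\<^sub>R u))"
      by (subst nn_integral_cmult[symmetric]) (auto simp: mult_ac)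
    also have "(NI u. indicator unit_ball u * sph_nn (t * norm u) b (x + t *\<^sub>R u))
      = (NI u. NI z. indicator (unit_ball::'a set) z * (indicator unit_ball u * b (x + t *\<^sub>R (u - norm u *\<^sub>R sgn z))))"
      unfolding sph_nn_def by (subst nn_integral_cmult[symmetric]) (auto simp: mult_ac algebra_simps)
    also have "\<dots> = (NI z. NI u. indicator (unit_ball::'a set) z * (indicator unit_ball u * b (x + t *\<^sub>R (u - norm u *\<^sub>R sgn z))))"
      by (rule nn_integral_lborel_swap) measurable
    also have "\<dots> = (NI z. indicator (unit_ball::'a set) z * (NI v. bisector_kernel (norm v) (e \<bullet> sgn z) * b (x + t *\<^sub>R v)))"
      by (rule nn_integral_ball_difference[OF _ d e]) measurable
    finally show "(NI u. indicator unit_ball u * (a x * sph_nn (t * norm u) b (x + t *\<^sub>R u)))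
      = a x * (NI z. indicator (unit_ball::'a set) z * (NI v. bisector_kernel (norm v) (e \<bullet> sgn z) * b (x + t *\<^sub>R v)))" .
  qed
  also have "\<dots> = (NI x. NI z. indicator (unit_ball::'a set) z * (a x * (NI v. bisector_kernel (norm v) (e \<bullet> sgn z) * b (x + t *\<^sub>R v))))"
    by (subst nn_integral_cmult[symmetric]) (auto simp: mult_ac)
  also have "\<dots> = (NI z. NI x. indicator (unit_ball::'a set) z * (a x * (NI v. bisector_kernel (norm v) (e \<bullet> sgn z) * b (x + t *\<^sub>R v))))"
    by (rule nn_integral_lborel_swap) measurable
  also have "\<dots> = (NI z. indicator (unit_ball::'a set) z *
      (NI x. a x * (NI v. bisector_kernel (norm v) (e \<bullet> sgn z) * b (x + t *\<^sub>R v))))"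
    by (subst nn_integral_cmult) auto
  finally show ?thesis .
qed

section \<open>Differences of spherical means\<close>

text \<open>The distance on [0, \<infinity>]: truncated subtraction makes one of the two summands
  vanish for finite arguments. It is infinite as soon as one argument is, even for two infinite
  ones, so that the inequalities of triangle type hold unconditionally.\<close>

definition absdiff :: "ennreal \<Rightarrow> ennreal \<Rightarrow> ennreal" where
  "absdiff x y = (x - y) + (y - x)"

lemma absdiff_measurable [measurable (raw)]:
  assumes [measurable]: "f \<in> borel_measurable M" "g \<in> borel_measurable M"
  shows "(\<lambda>x. absdiff (f x) (g x)) \<in> borel_measurable M"
  unfolding absdiff_def by measurable

lemma absdiff_commute: "absdiff x y = absdiff y x"
  by (simp add: absdiff_def add.commute)

lemma absdiff_ennreal: "0 \<le> r \<Longrightarrow> 0 \<le> s \<Longrightarrow> absdiff (ennreal r) (ennreal s) = ennreal \<bar>r - s\<bar>"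
proof -
  assume rs: "0 \<le> r" "0 \<le> s"
  have "absdiff (ennreal r) (ennreal s) = ennreal (r - s) + ennreal (s - r)"
    unfolding absdiff_def by (simp only: ennreal_minus rs)
  also have "\<dots> = ennreal \<bar>r - s\<bar>"
  proof (cases "r \<le> s")
    case True
    then have "ennreal (r - s) = 0" "\<bar>r - s\<bar> = s - r" by (auto intro: ennreal_neg)
    then show ?thesis by simp
  next
    case False
    then have "ennreal (s - r) = 0" "\<bar>r - s\<bar> = r - s" by (auto intro: ennreal_neg)
    then show ?thesis by simp
  qed
  finally show ?thesis .
qed

lemma absdiff_top [simp]: "absdiff top y = top" "absdiff x top = top"
  by (simp_all add: absdiff_def)

lemma absdiff_cases:
  obtains "x = top \<or> y = top" "absdiff x y = top"
  | r s where "x = ennreal r" "y = ennreal s" "0 \<le> r" "0 \<le> s" "absdiff x y = ennreal \<bar>r - s\<bar>"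
  by (cases x; cases y) (auto simp: absdiff_ennreal)

lemma absdiff_le_add: "absdiff x y \<le> x + y"
  by (cases rule: absdiff_cases[of x y]) (auto simp: ennreal_plus[symmetric] ennreal_leI simp del: ennreal_plus)

lemma le_add_absdiff: "x \<le> y + absdiff x y"
  by (cases rule: absdiff_cases[of x y]) (auto simp: ennreal_plus[symmetric] ennreal_leI simp del: ennreal_plus)

lemma absdiff_triangle: "absdiff (x1 + x2) (y1 + y2) \<le> absdiff x1 y1 + absdiff x2 y2"
proof (cases rule: absdiff_cases[of x1 y1])
  case (2 r s)
  note a = this
  show ?thesis
  proof (cases rule: absdiff_cases[of x2 y2])
    case (2 r' s')
    then show ?thesis using a
      by (simp add: ennreal_plus[symmetric] absdiff_ennreal ennreal_leI del: ennreal_plus)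
  qed auto
qed auto

lemma absdiff_square:
  assumes "x < top" "y < top"
  shows "absdiff x y * absdiff x y + (x * y + y * x) = x * x + y * y"
proof (cases rule: absdiff_cases[of x y])
  case (2 r s)
  have "\<bar>r - s\<bar> * \<bar>r - s\<bar> + (r * s + s * r) = r * r + s * s" by (simp add: abs_if algebra_simps)
  then have "ennreal (\<bar>r - s\<bar> * \<bar>r - s\<bar> + (r * s + s * r)) = ennreal (r * r + s * s)" by (simp only:)
  then show ?thesis using 2(3,4) unfolding 2(5) unfolding 2(1,2)
    by (simp only: ennreal_mult ennreal_plus mult_nonneg_nonneg add_nonneg_nonneg abs_ge_zero)
qed (use assms in auto)

lemma add_absdiff_eq: "a \<le> b \<Longrightarrow> a + absdiff a b = b"
  by (cases rule: absdiff_cases[of a b]) (auto simp: ennreal_plus[symmetric] top_unique simp del: ennreal_plus)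

text \<open>The inequality (a - b) (A - B) \<le> |a - b| S without subtraction. It serves twice: for
  functions against their ball averages, and for two cell averages against the indicator of a ball
  and its own cell average.\<close>

lemma absdiff_rearrange:
  fixes a b A B S :: ennreal
  assumes "A \<le> B + S" "B \<le> A + S"
  shows "a * A + b * B \<le> a * B + b * A + absdiff a b * S"
proof -
  have *: "a * A + b * B \<le> a * B + b * A + absdiff a b * S" if "a \<le> b" "B \<le> A + S" for a b A B :: ennreal
  proof -
    let ?h = "absdiff a b"
    have b: "b = a + ?h" using add_absdiff_eq[OF that(1)] by simp
    have "a * A + b * B = a * A + a * B + ?h * B" by (subst b) (simp add: distrib_right add.assoc)
    also have "\<dots> \<le> a * A + a * B + ?h * (A + S)" by (intro add_left_mono mult_left_mono that) auto
    also have "\<dots> = a * B + (a + ?h) * A + ?h * S" by (simp add: distrib_left distrib_right add_ac)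
    finally show ?thesis using b by simp
  qed
  show ?thesis
  proof (cases "a \<le> b")
    case True then show ?thesis using *[OF True assms(2)] by simp
  next
    case False
    then have "b * B + a * A \<le> b * A + a * B + absdiff b a * S" using assms by (intro *) auto
    then show ?thesis by (simp add: add_ac absdiff_commute)
  qed
qed

section \<open>Thin shells and the singularity of the kernel\<close>

lemma power_diff_le:
  fixes x y :: real
  assumes "0 \<le> y" "y \<le> x"
  shows "x ^ n - y ^ n \<le> real n * x ^ (n - 1) * (x - y)"
proof (induction n)
  case (Suc n)
  have "x ^ Suc n - y ^ Suc n = x * (x ^ n - y ^ n) + y ^ n * (x - y)" by (simp add: algebra_simps)
  also have "\<dots> \<le> x * (real n * x ^ (n - 1) * (x - y)) + x ^ n * (x - y)"
    using assms Suc.IH by (intro add_mono mult_left_mono mult_right_mono power_mono) auto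
  also have "x * (real n * x ^ (n - 1) * (x - y)) = real n * x ^ n * (x - y)"
    by (cases n) auto
  finally show ?case by (simp add: algebra_simps)
qed simp

text \<open>For \<delta> > \<rho> the whole ball is taken, so that the measure bound and the
  comparison of ball averages cover both cases.\<close>

definition shell :: "real \<Rightarrow> real \<Rightarrow> 'a::euclidean_space set" where
  "shell \<delta> \<rho> = {v. if \<delta> \<le> \<rho> then \<bar>norm v - \<rho>\<bar> \<le> \<delta> else norm v \<le> \<rho>}"

lemma shell_sets [measurable]: "shell \<delta> \<rho> \<in> sets borel" "{x. x \<in> shell \<delta> \<rho>} \<in> sets borel"
  unfolding shell_def by measurable

text \<open>The square root of \<delta> leaves an integrable singularity. The bound is used with
  \<rho> = - 2 c and the weight 1/(2 c^2): the natural bound \<rho>^(d-1) \<delta> would leave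
  |c|^(d-3), which for d = 2 is not integrable over the directions, whereas \<rho>^(d-1) sqrt
  (\<rho> \<delta>) leaves |c|^(d-5/2), at most |c|^(-1/2).\<close>

lemma emeasure_shell:
  assumes "0 < \<delta>" "0 < \<rho>"
  shows "emeasure lborel (shell \<delta> \<rho> :: 'a::euclidean_space set) \<le>
    ennreal (real DIM('a) * 2 ^ DIM('a) * \<rho> ^ (DIM('a) - 1) * sqrt \<rho> * sqrt \<delta>) * emeasure lborel (unit_ball :: 'a set)"
proof -
  let ?d = "DIM('a)" and ?m = "emeasure lborel (unit_ball :: 'a set)"
  have d1: "1 \<le> ?d" using DIM_positive[where 'a='a] by (simp add: Suc_le_eq)
  have dS: "Suc (?d - 1) = ?d" using DIM_positive[where 'a='a] by (rule Suc_diff_1)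
  have dp: "x * x ^ (?d - 1) = x ^ ?d" for x :: real by (subst (2) dS[symmetric]) (simp only: power_Suc)
  have cb: "emeasure lborel (cball (0::'a) r) = ennreal (r ^ ?d) * ?m" if "0 < r" for r
    using emeasure_ball_scale[OF that, of "0::'a"] by simp
  have bb: "ennreal (r ^ ?d) * ?m \<le> emeasure lborel (ball (0::'a) r)" if "0 \<le> r" for r
  proof (cases "r = 0")
    case False
    have "(NI z. indicator (ball (0::'a) r) z) = ennreal (r ^ ?d) * (NI z. indicator (ball (0::'a) r) (r *\<^sub>R z))"
      using False that by (subst nn_integral_lborel_affine[of _ r 0]) auto
    moreover have "(NI z. indicator (ball (0::'a) r) (r *\<^sub>R z)) = (NI z. indicator (ball (0::'a) 1) z)"
      using False that by (intro nn_integral_cong) (auto simp: indicator_def)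
    moreover have "?m \<le> emeasure lborel (ball (0::'a) 1)"
    proof -
      have "AE z in lborel. (z::'a) \<in> cball 0 1 \<longrightarrow> z \<in> ball 0 1"
      proof -
        have "sphere (0::'a) 1 \<in> null_sets lborel"
          using negligible_sphere[of "0::'a" 1] by (simp add: negligible_iff_null_sets null_sets_completion_iff)
        then have "AE z in lborel. (z::'a) \<notin> sphere 0 1" by (rule AE_not_in)
        then show ?thesis by eventually_elim (simp add: less_le)
      qed
      then show ?thesis by (rule emeasure_mono_AE) simp
    qed
    ultimately show ?thesis by (simp add: mult_left_mono)
  qed (simp add: zero_power)
  show ?thesis
  proof (cases "\<delta> \<le> \<rho>")
    case False
    have "emeasure lborel (shell \<delta> \<rho> :: 'a set) = ennreal (\<rho> ^ ?d) * ?m"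
      using False cb[OF assms(2)] by (simp add: shell_def cball_def)
    also have "\<dots> \<le> ennreal (real ?d * 2 ^ ?d * \<rho> ^ (?d - 1) * sqrt \<rho> * sqrt \<delta>) * ?m"
    proof (intro mult_right_mono ennreal_leI)
      have "\<rho> ^ ?d = \<rho> ^ (?d - 1) * (sqrt \<rho> * sqrt \<rho>)" using assms dp[of \<rho>] by (simp add: mult.commute)
      also have "\<dots> \<le> \<rho> ^ (?d - 1) * (sqrt \<rho> * sqrt \<delta>)"
        using False assms by (intro mult_left_mono) auto
      also have "\<dots> \<le> (real ?d * 2 ^ ?d) * (\<rho> ^ (?d - 1) * (sqrt \<rho> * sqrt \<delta>))"
      proof -
        have "1 * 1 \<le> real ?d * 2 ^ ?d" using d1 by (intro mult_mono) auto
        then show ?thesis using assms mult_right_mono[of 1 "real ?d * 2 ^ ?d" "\<rho> ^ (?d - 1) * (sqrt \<rho> * sqrt \<delta>)"] by simp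
      qed
      finally show "\<rho> ^ ?d \<le> real ?d * 2 ^ ?d * \<rho> ^ (?d - 1) * sqrt \<rho> * sqrt \<delta>" by (simp add: mult_ac)
    qed simp
    finally show ?thesis .
  next
    case True
    obtain \<mu> where \<mu>: "?m = ennreal \<mu>" "0 \<le> \<mu>"
      using emeasure_unit_ball(2)[where 'a='a] by (cases ?m) auto
    let ?S = "emeasure lborel (shell \<delta> \<rho> :: 'a set)"
    have "?S + ennreal ((\<rho> - \<delta>) ^ ?d) * ?m \<le> ?S + emeasure lborel (ball (0::'a) (\<rho> - \<delta>))"
      using True by (intro add_left_mono bb) auto
    also have "\<dots> = emeasure lborel (shell \<delta> \<rho> \<union> ball (0::'a) (\<rho> - \<delta>))"
      using True by (intro plus_emeasure) (auto simp: shell_def)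
    also have "\<dots> \<le> emeasure lborel (cball (0::'a) (\<rho> + \<delta>))"
      using True assms by (intro emeasure_mono) (auto simp: shell_def)
    also have "\<dots> = ennreal ((\<rho> + \<delta>) ^ ?d) * ?m" using assms by (intro cb) simp
    finally have le: "?S + ennreal ((\<rho> - \<delta>) ^ ?d) * ?m \<le> ennreal ((\<rho> + \<delta>) ^ ?d) * ?m" .
    have e: "ennreal (x ^ ?d * \<mu>) = ennreal (x ^ ?d) * ?m" if "0 \<le> x" for x
      unfolding \<mu>(1) using that \<mu>(2) by (intro ennreal_mult) auto
    have pm: "0 \<le> \<rho> - \<delta>" "0 \<le> \<rho> + \<delta>" using True assms by auto
    have S: "?S + ennreal ((\<rho> - \<delta>) ^ ?d * \<mu>) \<le> ennreal ((\<rho> + \<delta>) ^ ?d * \<mu>)"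
      unfolding e[OF pm(1)] e[OF pm(2)] by (rule le)
    have "?S \<le> ?S + ennreal ((\<rho> - \<delta>) ^ ?d * \<mu>)" by (rule add_increasing2) simp_all
    also note S
    also have "ennreal ((\<rho> + \<delta>) ^ ?d * \<mu>) < top" by (rule ennreal_less_top)
    finally obtain \<sigma> where \<sigma>: "?S = ennreal \<sigma>" "0 \<le> \<sigma>" using less_top_ennreal by blast
    have nn: "0 \<le> (\<rho> - \<delta>) ^ ?d * \<mu>" "0 \<le> (\<rho> + \<delta>) ^ ?d * \<mu>" using pm \<mu>(2) by simp_all
    have "ennreal (\<sigma> + (\<rho> - \<delta>) ^ ?d * \<mu>) \<le> ennreal ((\<rho> + \<delta>) ^ ?d * \<mu>)"
      using S unfolding \<sigma>(1) ennreal_plus[OF \<sigma>(2) nn(1)] .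
    then have "\<sigma> + (\<rho> - \<delta>) ^ ?d * \<mu> \<le> (\<rho> + \<delta>) ^ ?d * \<mu>"
      by (rule iffD1[OF ennreal_le_iff[OF nn(2)]])
    then have "\<sigma> \<le> ((\<rho> + \<delta>) ^ ?d - (\<rho> - \<delta>) ^ ?d) * \<mu>" by (simp add: left_diff_distrib)
    also have "\<dots> \<le> (real ?d * 2 ^ ?d * \<rho> ^ (?d - 1) * sqrt \<rho> * sqrt \<delta>) * \<mu>"
    proof (rule mult_right_mono[OF _ \<mu>(2)])
      have "(\<rho> + \<delta>) ^ ?d - (\<rho> - \<delta>) ^ ?d \<le> real ?d * (\<rho> + \<delta>) ^ (?d - 1) * ((\<rho> + \<delta>) - (\<rho> - \<delta>))"
        using True assms by (intro power_diff_le) auto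
      also have "\<dots> = real ?d * (\<rho> + \<delta>) ^ (?d - 1) * (2 * \<delta>)" by simp
      also have "\<dots> \<le> real ?d * (2 * \<rho>) ^ (?d - 1) * (2 * \<delta>)"
        using True assms by (intro mult_right_mono mult_left_mono power_mono) auto
      also have "\<dots> = real ?d * (2 * 2 ^ (?d - 1)) * \<rho> ^ (?d - 1) * \<delta>" by (simp only: power_mult_distrib mult_ac)
      also have "\<dots> = real ?d * 2 ^ ?d * \<rho> ^ (?d - 1) * \<delta>" by (simp only: dp)
      also have "\<dots> = real ?d * 2 ^ ?d * \<rho> ^ (?d - 1) * (sqrt \<delta> * sqrt \<delta>)" using assms by simp
      also have "\<dots> \<le> real ?d * 2 ^ ?d * \<rho> ^ (?d - 1) * (sqrt \<rho> * sqrt \<delta>)"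
        using True assms by (intro mult_left_mono mult_right_mono) auto
      finally show "(\<rho> + \<delta>) ^ ?d - (\<rho> - \<delta>) ^ ?d \<le> real ?d * 2 ^ ?d * \<rho> ^ (?d - 1) * sqrt \<rho> * sqrt \<delta>"
        by (simp add: mult_ac)
    qed
    finally have fin: "\<sigma> \<le> (real ?d * 2 ^ ?d * \<rho> ^ (?d - 1) * sqrt \<rho> * sqrt \<delta>) * \<mu>" .
    have "?S \<le> ennreal ((real ?d * 2 ^ ?d * \<rho> ^ (?d - 1) * sqrt \<rho> * sqrt \<delta>) * \<mu>)"
      using fin by (simp only: \<sigma>(1) ennreal_leI)
    also have "\<dots> = ennreal (real ?d * 2 ^ ?d * \<rho> ^ (?d - 1) * sqrt \<rho> * sqrt \<delta>) * ?m"
      unfolding \<mu>(1) using assms \<mu>(2) by (intro ennreal_mult) auto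
    finally show ?thesis .
  qed
qed

text \<open>Integration over the heights \<tau> below the graph: heights up to 1 contribute at most
  1, and heights above 1 the integral of 1/\<tau>^2, which is 1 again.\<close>

lemma nn_integral_inverse_sqrt: "(NI s. indicator {0<..1} s * ennreal (1 / sqrt s)) \<le> 2"
proof -
  have "(NI s. indicator {0<..1} s * ennreal (1 / sqrt s))
    = (NI s. NI \<tau>. indicator {0<..1} s * indicator {\<tau>..} (1 / sqrt s) * indicator {0..} \<tau>)"
  proof (rule nn_integral_cong)
    fix s :: real
    have "(NI \<tau>. indicator {0<..1} s * indicator {\<tau>..} (1 / sqrt s) * indicator {0..} \<tau>)
      = (NI \<tau>. indicator {0<..1} s * indicator {0..1 / sqrt s} \<tau>)"
      by (rule nn_integral_cong) (auto simp: indicator_def)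
    also have "\<dots> = indicator {0<..1} s * ennreal (1 / sqrt s)" 
      by (subst nn_integral_cmult) (cases "0 < s"; simp)+
    finally show "indicator {0<..1} s * ennreal (1 / sqrt s) = (NI \<tau>. indicator {0<..1} s * indicator {\<tau>..} (1 / sqrt s) * indicator {0..} \<tau>)" by simp
  qed
  also have "\<dots> = (NI \<tau>. NI s. indicator {0<..1} s * indicator {\<tau>..} (1 / sqrt s) * indicator {0..} \<tau>)"
    by (rule nn_integral_lborel_swap) measurable
  also have "\<dots> \<le> (NI \<tau>. indicator {0..1} \<tau> + ennreal (real 1 / \<tau> ^ Suc 1) * indicator {1..} \<tau>)"
  proof (rule nn_integral_mono)
    fix \<tau> :: real
    have "(NI s. indicator {0<..1} s * indicator {\<tau>..} (1 / sqrt s) * indicator {0..} \<tau>)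
      \<le> (NI s. indicator {0..1::real} s * indicator {0..} \<tau>)"
      by (rule nn_integral_mono) (auto simp: indicator_def)
    also have "\<dots> = indicator {0..} \<tau>" by (subst nn_integral_multc) auto
    finally have 1: "(NI s. indicator {0<..1} s * indicator {\<tau>..} (1 / sqrt s) * indicator {0..} \<tau>) \<le> indicator {0..} \<tau>" .
    have 2: "(NI s. indicator {0<..1} s * indicator {\<tau>..} (1 / sqrt s) * indicator {0..} \<tau>) \<le> ennreal (1 / \<tau>\<^sup>2)" if \<tau>: "1 \<le> \<tau>"
    proof -
      have "(NI s. indicator {0<..1} s * indicator {\<tau>..} (1 / sqrt s) * indicator {0..} \<tau>)
        \<le> (NI s. indicator {0..1 / \<tau>\<^sup>2} s)"
      proof (rule nn_integral_mono)
        fix s :: real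
        have "s \<le> 1 / \<tau>\<^sup>2" if "0 < s" "\<tau> \<le> 1 / sqrt s"
        proof -
          have "\<tau>\<^sup>2 \<le> (1 / sqrt s)\<^sup>2" using that \<tau> by (intro power_mono) auto
          then have "\<tau>\<^sup>2 \<le> 1 / s" using that by (simp add: power_divide)
          then show ?thesis using that \<tau> by (simp add: field_simps)
        qed
        then show "indicator {0<..1} s * indicator {\<tau>..} (1 / sqrt s) * indicator {0..} \<tau> \<le> (indicator {0..1 / \<tau>\<^sup>2} s :: ennreal)"
          by (auto simp: indicator_def)
      qed
      also have "\<dots> = ennreal (1 / \<tau>\<^sup>2)" by simp
      finally show ?thesis .
    qed
    show "(NI s. indicator {0<..1} s * indicator {\<tau>..} (1 / sqrt s) * indicator {0..} \<tau>)
      \<le> indicator {0..1} \<tau> + ennreal (real 1 / \<tau> ^ Suc 1) * indicator {1..} \<tau>"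
    proof (cases "1 \<le> \<tau>")
      case True
      note 2[OF True]
      also have "ennreal (1 / \<tau>\<^sup>2) = ennreal (real 1 / \<tau> ^ Suc 1) * indicator {1..} \<tau>" using True by (simp add: power2_eq_square)
      also have "\<dots> \<le> indicator {0..1} \<tau> + \<dots>" by simp
      finally show ?thesis .
    next
      case False
      note 1
      also have "indicator {0..} \<tau> = (indicator {0..1} \<tau> :: ennreal)" using False by (simp add: indicator_def)
      also have "\<dots> \<le> \<dots> + ennreal (real 1 / \<tau> ^ Suc 1) * indicator {1..} \<tau>" by simp
      finally show ?thesis .
    qed
  qed
  also have "\<dots> = 1 + ennreal (1 / 1 ^ 1)"
    by (subst nn_integral_add, measurable, subst nn_integral_power_tail) auto
  also have "\<dots> = 2" by simp
  finally show ?thesis .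
qed

lemma nn_integral_cmult_add:
  fixes f h :: "'b \<Rightarrow> ennreal"
  assumes "f \<in> borel_measurable M" "h \<in> borel_measurable M"
  shows "(\<integral>\<^sup>+s. c * (f s + h s) \<partial>M) = c * ((\<integral>\<^sup>+s. f s \<partial>M) + (\<integral>\<^sup>+s. h s \<partial>M))"
  using assms by (simp add: nn_integral_cmult nn_integral_add)

text \<open>In the unit ball |z \<bullet> e| \<le> |e \<bullet> sgn z|, so the integrand is at most
  1 / sqrt |z \<bullet> e| and can be integrated along lines parallel to e. Each half-line
  contributes at most 2.\<close>

lemma nn_integral_ball_inner_inverse_sqrt:
  fixes e :: "'a::euclidean_space"
  assumes e: "norm e = 1"
  shows "(NI z. indicator unit_ball z * ennreal (1 / sqrt \<bar>e \<bullet> sgn z\<bar>)) < top"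
proof -
  let ?q = "\<lambda>p. p - (p \<bullet> e) *\<^sub>R e"
  have ee: "e \<bullet> e = 1" using e by (simp add: norm_eq_sqrt_inner)
  have "(NI z. indicator unit_ball z * ennreal (1 / sqrt \<bar>e \<bullet> sgn z\<bar>))
    \<le> (NI z. indicator unit_ball z * ennreal (1 / sqrt \<bar>z \<bullet> e\<bar>))"
  proof (rule nn_integral_mono)
    fix z :: 'a
    have "1 / sqrt \<bar>e \<bullet> sgn z\<bar> \<le> 1 / sqrt \<bar>z \<bullet> e\<bar>" if z: "norm z \<le> 1"
    proof (cases "z \<bullet> e = 0")
      case False
      then have z0: "0 < norm z" by auto
      have eq: "\<bar>z \<bullet> e\<bar> = norm z * \<bar>e \<bullet> sgn z\<bar>" using z0 by (simp add: sgn_div_norm inner_commute abs_mult)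
      then have nz: "e \<bullet> sgn z \<noteq> 0" using False by auto
      from eq have "\<bar>z \<bullet> e\<bar> \<le> \<bar>e \<bullet> sgn z\<bar>" using z by (simp add: mult_left_le_one_le)
      then show ?thesis using False nz by (intro divide_left_mono) (auto intro!: mult_pos_pos)
    qed (simp add: sgn_div_norm inner_commute)
    then show "indicator unit_ball z * ennreal (1 / sqrt \<bar>e \<bullet> sgn z\<bar>) \<le> indicator unit_ball z * ennreal (1 / sqrt \<bar>z \<bullet> e\<bar>)"
      by (auto simp: indicator_def intro!: ennreal_leI)
  qed
  also have "\<dots> = (NI p. indicator {0..<1} (p \<bullet> e) * (NI s. indicator unit_ball (?q p + s *\<^sub>R e) * ennreal (1 / sqrt \<bar>(?q p + s *\<^sub>R e) \<bullet> e\<bar>)))"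
    by (rule nn_integral_lborel_lines[OF _ e]) measurable
  also have "\<dots> \<le> (NI p. indicator (cball (0::'a) 2) p * 4)"
  proof (rule nn_integral_mono)
    fix p :: 'a
    have ip: "(?q p + s *\<^sub>R e) \<bullet> e = s" for s by (simp add: inner_diff_left inner_add_left ee)
    have n2: "norm (?q p) \<le> 1" "\<bar>s\<bar> \<le> 1" if "norm (?q p + s *\<^sub>R e) \<le> 1" for s
    proof -
      have "\<bar>s\<bar> \<le> norm (?q p + s *\<^sub>R e)" using Cauchy_Schwarz_ineq2[of "?q p + s *\<^sub>R e" e] ip e by simp
      then show "\<bar>s\<bar> \<le> 1" using that by simp
      have "(norm (?q p + s *\<^sub>R e))\<^sup>2 = (norm (?q p))\<^sup>2 + s\<^sup>2"
        unfolding power2_norm_eq_inner using ee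
        by (simp add: inner_add_left inner_add_right inner_diff_left inner_diff_right inner_commute power2_eq_square)
      then have "(norm (?q p))\<^sup>2 \<le> (norm (?q p + s *\<^sub>R e))\<^sup>2" by simp
      then have "norm (?q p) \<le> norm (?q p + s *\<^sub>R e)" by (rule power2_le_imp_le) simp
      then show "norm (?q p) \<le> 1" using that by simp
    qed
    have "indicator {0..<1} (p \<bullet> e) * (NI s. indicator unit_ball (?q p + s *\<^sub>R e) * ennreal (1 / sqrt \<bar>(?q p + s *\<^sub>R e) \<bullet> e\<bar>))
      \<le> indicator {0..<1} (p \<bullet> e) * (NI s. indicator unit_ball (?q p) * (indicator {0<..1} s * ennreal (1 / sqrt s) + indicator {0<..1} (-s) * ennreal (1 / sqrt (-s))))"
    proof (intro mult_left_mono nn_integral_mono)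
      fix s :: real
      show "indicator unit_ball (?q p + s *\<^sub>R e) * ennreal (1 / sqrt \<bar>(?q p + s *\<^sub>R e) \<bullet> e\<bar>)
        \<le> indicator unit_ball (?q p) * (indicator {0<..1} s * ennreal (1 / sqrt s) + indicator {0<..1} (-s) * ennreal (1 / sqrt (-s)))"
        unfolding ip using n2[of s] by (cases "s = 0"; cases "0 < s") (auto simp: indicator_def)
    qed simp
    also have "\<dots> \<le> indicator {0..<1} (p \<bullet> e) * (indicator unit_ball (?q p) * (2 + 2))"
    proof (intro mult_left_mono)
      let ?J = "NI s. indicator {0<..1} s * ennreal (1 / sqrt s)"
      have J: "(NI s. indicator {0<..1} (-s) * ennreal (1 / sqrt (-s))) = ?J"
        unfolding diff_0[symmetric] by (rule nn_integral_lborel_shift(4)) measurable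
      have J2: "(NI s. indicator {0<..1} (-s) * ennreal (1 / sqrt (-s))) \<le> 2"
        unfolding J by (rule nn_integral_inverse_sqrt)
      have "(NI s. indicator unit_ball (?q p) * (indicator {0<..1} s * ennreal (1 / sqrt s) + indicator {0<..1} (-s) * ennreal (1 / sqrt (-s))))
        = indicator unit_ball (?q p) * (?J + (NI s. indicator {0<..1} (-s) * ennreal (1 / sqrt (-s))))"
        by (rule nn_integral_cmult_add) measurable
      also have "\<dots> \<le> indicator unit_ball (?q p) * (2 + 2)"
        by (intro mult_left_mono add_mono nn_integral_inverse_sqrt J2) simp
      finally show "(NI s. indicator unit_ball (?q p) * (indicator {0<..1} s * ennreal (1 / sqrt s) + indicator {0<..1} (-s) * ennreal (1 / sqrt (-s))))
        \<le> indicator unit_ball (?q p) * (2 + 2)" .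
    qed simp
    also have "\<dots> \<le> indicator (cball 0 2) p * 4"
    proof -
      have *: "norm p \<le> 2" if "0 \<le> p \<bullet> e" "p \<bullet> e < 1" "norm (?q p) \<le> 1"
      proof -
        have "norm p = norm (?q p + (p \<bullet> e) *\<^sub>R e)" by simp
        also have "\<dots> \<le> norm (?q p) + norm ((p \<bullet> e) *\<^sub>R e)" by (rule norm_triangle_ineq)
        also have "norm ((p \<bullet> e) *\<^sub>R e) = \<bar>p \<bullet> e\<bar>" using e by simp
        finally show ?thesis using that by linarith
      qed
      show ?thesis
      proof (cases "p \<bullet> e \<in> {0..<1} \<and> ?q p \<in> unit_ball")
        case True
        then have "p \<in> cball 0 2" using * by simp
        then show ?thesis using True by simp
      qed (auto split: split_indicator)
    qed
    finally show "indicator {0..<1} (p \<bullet> e) * (NI s. indicator unit_ball (?q p + s *\<^sub>R e) * ennreal (1 / sqrt \<bar>(?q p + s *\<^sub>R e) \<bullet> e\<bar>))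
      \<le> indicator (cball 0 2) p * 4" .
  qed
  also have "\<dots> = emeasure lborel (cball (0::'a) 2) * 4" by (subst nn_integral_multc) simp_all
  also have "\<dots> < top" using emeasure_compact_finite[of "cball (0::'a) 2"] by (simp add: ennreal_mult_less_top)
  finally show ?thesis .
qed

text \<open>A rescaled form of the hypothesis \<open>H\<close>: y = x + t v turns the radius t
  \<rho> into \<rho> and the tolerance \<delta> into \<delta> / t. When the shell is the whole ball,
  the pointwise inequality a \<le> b + |a - b| is enough.\<close>

lemma nn_integral_shell_compare:
  fixes a b :: "'a::euclidean_space \<Rightarrow> ennreal"
  assumes [measurable]: "borel_fun a" "borel_fun b"
    and t: "0 < t" and \<delta>: "0 < \<delta>" and \<rho>: "0 < \<rho>"
    and H: "\<And>r. 0 < r \<Longrightarrow> (NI y. indicator {..r} (dist x y) * a y) \<le>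
      (NI y. indicator {..r} (dist x y) * b y) + (NI y. indicator {..\<delta>} \<bar>dist x y - r\<bar> * absdiff (a y) (b y))"
  shows "(NI v. indicator {..\<rho>} (norm v) * a (x + t *\<^sub>R v)) \<le>
    (NI v. indicator {..\<rho>} (norm v) * b (x + t *\<^sub>R v)) +
    (NI v. indicator (shell (\<delta> / t) \<rho>) v * absdiff (a (x + t *\<^sub>R v)) (b (x + t *\<^sub>R v)))"
proof (cases "\<delta> / t \<le> \<rho>")
  case True
  let ?T = "ennreal (\<bar>t\<bar> ^ DIM('a))"
  have sc: "(NI y. G y) = ?T * (NI v. G (x + t *\<^sub>R v))" if "borel_fun G" for G :: "'a \<Rightarrow> ennreal"
    using that t by (intro nn_integral_lborel_affine) auto
  have i1: "indicator {..t * \<rho>} (dist x (x + t *\<^sub>R v)) = (indicator {..\<rho>} (norm v) :: ennreal)" for v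
    using t by (simp add: indicator_def dist_norm)
  have i2: "indicator {..\<delta>} \<bar>dist x (x + t *\<^sub>R v) - t * \<rho>\<bar> = (indicator (shell (\<delta> / t) \<rho>) v :: ennreal)" for v
  proof -
    have "\<bar>dist x (x + t *\<^sub>R v) - t * \<rho>\<bar> = \<bar>t * (norm v - \<rho>)\<bar>" using t by (simp add: dist_norm right_diff_distrib)
    also have "\<dots> = t * \<bar>norm v - \<rho>\<bar>" using t by (simp only: abs_mult abs_of_pos)
    finally have "\<bar>dist x (x + t *\<^sub>R v) - t * \<rho>\<bar> \<le> \<delta> \<longleftrightarrow> \<bar>norm v - \<rho>\<bar> \<le> \<delta> / t"
      using t by (simp only: pos_le_divide_eq mult.commute)
    then show ?thesis using True by (simp add: indicator_def shell_def)
  qed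
  have "?T * (NI v. indicator {..\<rho>} (norm v) * a (x + t *\<^sub>R v)) =
     (NI y. indicator {..t * \<rho>} (dist x y) * a y)"
    by (subst sc, measurable) (simp only: i1)
  also have "\<dots> \<le> (NI y. indicator {..t * \<rho>} (dist x y) * b y) + (NI y. indicator {..\<delta>} \<bar>dist x y - t * \<rho>\<bar> * absdiff (a y) (b y))"
    using t \<rho> by (intro H) simp
  also have "(NI y. indicator {..t * \<rho>} (dist x y) * b y) = ?T * (NI v. indicator {..\<rho>} (norm v) * b (x + t *\<^sub>R v))"
    by (subst sc, measurable) (simp only: i1)
  also have "(NI y. indicator {..\<delta>} \<bar>dist x y - t * \<rho>\<bar> * absdiff (a y) (b y)) =
     ?T * (NI v. indicator (shell (\<delta> / t) \<rho>) v * absdiff (a (x + t *\<^sub>R v)) (b (x + t *\<^sub>R v)))"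
    by (subst sc, measurable) (simp only: i2)
  finally have "?T * (NI v. indicator {..\<rho>} (norm v) * a (x + t *\<^sub>R v)) \<le> ?T * ((NI v. indicator {..\<rho>} (norm v) * b (x + t *\<^sub>R v)) +
    (NI v. indicator (shell (\<delta> / t) \<rho>) v * absdiff (a (x + t *\<^sub>R v)) (b (x + t *\<^sub>R v))))"
    by (simp only: distrib_left)
  moreover have "?T \<noteq> 0" "?T < top" using t by auto
  ultimately show ?thesis by (subst (asm) ennreal_mult_le_mult_iff) auto
next
  case False
  have "(NI v. indicator {..\<rho>} (norm v) * a (x + t *\<^sub>R v)) \<le>
    (NI v. indicator {..\<rho>} (norm v) * b (x + t *\<^sub>R v) + indicator (shell (\<delta> / t) \<rho>) v * absdiff (a (x + t *\<^sub>R v)) (b (x + t *\<^sub>R v)))"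
  proof (rule nn_integral_mono)
    fix v :: 'a
    have "indicator (shell (\<delta> / t) \<rho>) v = (indicator {..\<rho>} (norm v) :: ennreal)" using False by (simp add: shell_def indicator_def)
    then show "indicator {..\<rho>} (norm v) * a (x + t *\<^sub>R v) \<le> indicator {..\<rho>} (norm v) * b (x + t *\<^sub>R v) + indicator (shell (\<delta> / t) \<rho>) v * absdiff (a (x + t *\<^sub>R v)) (b (x + t *\<^sub>R v))"
      by (simp only: distrib_left[symmetric]) (intro mult_left_mono le_add_absdiff zero_le)
  qed
  also have "\<dots> = (NI v. indicator {..\<rho>} (norm v) * b (x + t *\<^sub>R v)) +
    (NI v. indicator (shell (\<delta> / t) \<rho>) v * absdiff (a (x + t *\<^sub>R v)) (b (x + t *\<^sub>R v)))"
    by (rule nn_integral_add) measurable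
  finally show ?thesis .
qed

text \<open>Cauchy-Schwarz for h and each of its translates, integrated over the translations in
  A.\<close>

lemma nn_integral_autocorrelation_le:
  fixes h :: "'a::euclidean_space \<Rightarrow> ennreal"
  assumes [measurable]: "borel_fun h" "A \<in> sets borel"
  shows "(NI x. h x * (NI v. indicator A v * h (x + t *\<^sub>R v))) \<le> emeasure lborel A * (NI x. h x * h x)"
proof -
  have "(NI x. h x * (NI v. indicator A v * h (x + t *\<^sub>R v)))
    = (NI x. NI v. h x * (indicator A v * h (x + t *\<^sub>R v)))"
    by (subst nn_integral_cmult) auto
  also have "\<dots> = (NI v. NI x. h x * (indicator A v * h (x + t *\<^sub>R v)))"
    by (rule nn_integral_lborel_swap) measurable
  also have "\<dots> \<le> (NI v. indicator A v * (NI x. h x * h x))"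
  proof (rule nn_integral_mono)
    fix v :: 'a
    have "(NI x. h x * h (x + t *\<^sub>R v)) \<le> (NI x. h x * h x)"
    proof (rule ennreal_square_le_imp_le)
      have "(NI x. h (x + t *\<^sub>R v) ^ 2) = (NI x. h x ^ 2)"
        by (rule nn_integral_lborel_shift(2)) measurable
      then show "(NI x. h x * h (x + t *\<^sub>R v)) * (NI x. h x * h (x + t *\<^sub>R v))
        \<le> (NI x. h x * h x) * (NI x. h x * h x)"
        using Cauchy_Schwarz_nn_integral[of h lborel "\<lambda>x. h (x + t *\<^sub>R v)"] by (simp add: power2_eq_square)
    qed
    then have "indicator A v * (NI x. h x * h (x + t *\<^sub>R v)) \<le> indicator A v * (NI x. h x * h x)"
      by (rule mult_left_mono) simp
    moreover have "(NI x. h x * (indicator A v * h (x + t *\<^sub>R v))) = indicator A v * (NI x. h x * h (x + t *\<^sub>R v))"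
      by (subst nn_integral_cmult[symmetric], measurable) (simp only: mult_ac)
    ultimately show "(NI x. h x * (indicator A v * h (x + t *\<^sub>R v))) \<le> indicator A v * (NI x. h x * h x)" by simp
  qed
  also have "\<dots> = emeasure lborel A * (NI x. h x * h x)"
    by (subst nn_integral_multc) simp_all
  finally show ?thesis .
qed

lemma bisector_kernel_eq:
  "c < 0 \<Longrightarrow> bisector_kernel s c = ennreal (1 / (2 * c\<^sup>2)) * indicator {..- 2 * c} s"
  by (simp add: bisector_kernel_def indicator_def)

lemma bisector_kernel_shell:
  assumes c: "c < 0" "- 1 \<le> c" and d: "2 \<le> DIM('a::euclidean_space)" and \<delta>: "0 < \<delta>"
  shows "ennreal (1 / (2 * c\<^sup>2)) * emeasure lborel (shell \<delta> (- 2 * c) :: 'a set) \<le>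
    ennreal (real DIM('a) * 2 ^ DIM('a) * 2 ^ (DIM('a) - 1)) * emeasure lborel (unit_ball :: 'a set) * ennreal (sqrt \<delta>) * ennreal (1 / sqrt \<bar>c\<bar>)"
proof -
  let ?d = "DIM('a)" and ?m = "emeasure lborel (unit_ball :: 'a set)"
  define \<rho> where "\<rho> = - 2 * c"
  have \<rho>: "0 < \<rho>" "\<rho> \<le> 2" "\<bar>c\<bar> \<le> \<rho>" "c = - \<rho> / 2" using c by (auto simp: \<rho>_def)
  obtain n where n: "?d = Suc (Suc n)" using d by (metis Suc_le_D numeral_2_eq_2 Suc_le_mono le_Suc_ex add_2_eq_Suc)
  have q: "1 / (2 * c\<^sup>2) = 2 / \<rho>\<^sup>2" unfolding \<rho>(4) by (simp add: power2_eq_square field_simps)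
  have "ennreal (1 / (2 * c\<^sup>2)) * emeasure lborel (shell \<delta> \<rho> :: 'a set)
    \<le> ennreal (2 / \<rho>\<^sup>2) * (ennreal (real ?d * 2 ^ ?d * \<rho> ^ (?d - 1) * sqrt \<rho> * sqrt \<delta>) * ?m)"
    unfolding q by (intro mult_left_mono emeasure_shell \<delta> \<rho> zero_le)
  also have "\<dots> = ennreal ((2 / \<rho>\<^sup>2) * (real ?d * 2 ^ ?d * \<rho> ^ (?d - 1) * sqrt \<rho> * sqrt \<delta>)) * ?m"
    using \<rho> \<delta> by (subst ennreal_mult) (auto simp: mult.assoc)
  also have "\<dots> \<le> ennreal ((real ?d * 2 ^ ?d * 2 ^ (?d - 1)) * sqrt \<delta> * (1 / sqrt \<bar>c\<bar>)) * ?m"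
  proof (intro mult_right_mono ennreal_leI)
    have "\<rho> ^ (?d - 1) = \<rho> * \<rho> ^ n" by (simp add: n)
    moreover have "(2 / \<rho>\<^sup>2) * (\<rho> * \<rho> ^ n * w) = 2 * \<rho> ^ n / w" if "0 < w" "\<rho> = w * w" for w
      using that \<rho>(1) by (simp add: power2_eq_square field_simps)
    from this[of "sqrt \<rho>"] have "(2 / \<rho>\<^sup>2) * (\<rho> * \<rho> ^ n * sqrt \<rho>) = 2 * \<rho> ^ n / sqrt \<rho>" using \<rho>(1) by simp
    ultimately have e: "(2 / \<rho>\<^sup>2) * (\<rho> ^ (?d - 1) * sqrt \<rho>) = 2 * \<rho> ^ n / sqrt \<rho>" by (simp only:)
    have "2 * \<rho> ^ n / sqrt \<rho> \<le> 2 * 2 ^ n / sqrt \<bar>c\<bar>"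
      using \<rho> c by (intro frac_le mult_left_mono power_mono) auto
    also have "\<dots> = 2 ^ (?d - 1) * (1 / sqrt \<bar>c\<bar>)" by (simp add: n)
    finally have "(2 / \<rho>\<^sup>2) * (\<rho> ^ (?d - 1) * sqrt \<rho>) \<le> 2 ^ (?d - 1) * (1 / sqrt \<bar>c\<bar>)" unfolding e .
    then have "(real ?d * 2 ^ ?d * sqrt \<delta>) * ((2 / \<rho>\<^sup>2) * (\<rho> ^ (?d - 1) * sqrt \<rho>)) \<le> (real ?d * 2 ^ ?d * sqrt \<delta>) * (2 ^ (?d - 1) * (1 / sqrt \<bar>c\<bar>))"
      using \<delta> by (intro mult_left_mono) auto
    then show "(2 / \<rho>\<^sup>2) * (real ?d * 2 ^ ?d * \<rho> ^ (?d - 1) * sqrt \<rho> * sqrt \<delta>) \<le> (real ?d * 2 ^ ?d * 2 ^ (?d - 1)) * sqrt \<delta> * (1 / sqrt \<bar>c\<bar>)"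
      by (simp only: mult_ac)
  qed simp
  also have "ennreal ((real ?d * 2 ^ ?d * 2 ^ (?d - 1)) * sqrt \<delta> * (1 / sqrt \<bar>c\<bar>)) = ennreal (real ?d * 2 ^ ?d * 2 ^ (?d - 1)) * ennreal (sqrt \<delta>) * ennreal (1 / sqrt \<bar>c\<bar>)"
    using \<delta> by (subst ennreal_mult, simp, simp, subst ennreal_mult) auto
  finally show ?thesis unfolding \<rho>_def by (simp only: mult_ac)
qed

definition cap_const :: "'a::euclidean_space \<Rightarrow> ennreal" where
  "cap_const e = emeasure lborel (unit_ball :: 'a set) * (ennreal (real DIM('a) * 2 ^ DIM('a) * 2 ^ (DIM('a) - 1)) *
     emeasure lborel (unit_ball :: 'a set) * (NI z. indicator (unit_ball::'a set) z * ennreal (1 / sqrt \<bar>e \<bullet> sgn z\<bar>)))"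

lemma cap_const_finite: "norm e = 1 \<Longrightarrow> cap_const e < top"
  using nn_integral_ball_inner_inverse_sqrt[of e] emeasure_unit_ball(2)[where 'a='a]
  unfolding cap_const_def by (simp add: ennreal_mult_less_top)

text \<open>The square of a difference of spherical means is controlled by the values in a thin shell only, since
  the averages of \<open>a\<close> and \<open>b\<close> over balls nearly agree.\<close>

lemma sph_nn_difference_L2:
  fixes a b :: "'a::euclidean_space \<Rightarrow> ennreal"
  assumes [measurable]: "borel_fun a" "borel_fun b" and d: "2 \<le> DIM('a)" and e: "norm (e::'a) = 1"
    and t: "0 < t" and \<delta>: "0 < \<delta>"
    and fin: "\<And>r x. sph_nn r a x < top" "\<And>r x. sph_nn r b x < top"
      "(NI x. NI v. indicator (unit_ball::'a set) v * (sph_nn (t * norm v) a x * sph_nn (t * norm v) b x)) < top"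
    and H1: "\<And>x r. 0 < r \<Longrightarrow> (NI y. indicator {..r} (dist x y) * a y) \<le>
      (NI y. indicator {..r} (dist x y) * b y) + (NI y. indicator {..\<delta>} \<bar>dist x y - r\<bar> * absdiff (a y) (b y))"
    and H2: "\<And>x r. 0 < r \<Longrightarrow> (NI y. indicator {..r} (dist x y) * b y) \<le>
      (NI y. indicator {..r} (dist x y) * a y) + (NI y. indicator {..\<delta>} \<bar>dist x y - r\<bar> * absdiff (a y) (b y))"
  shows "(NI x. NI v. indicator (unit_ball::'a set) v *
      (absdiff (sph_nn (t * norm v) a x) (sph_nn (t * norm v) b x) * absdiff (sph_nn (t * norm v) a x) (sph_nn (t * norm v) b x)))
    \<le> cap_const e * ennreal (sqrt (\<delta> / t)) * (NI x. absdiff (a x) (b x) * absdiff (a x) (b x))"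
proof -
  let ?m = "emeasure lborel (unit_ball :: 'a set)"
  define h where "h x = absdiff (a x) (b x)" for x
  have [measurable]: "borel_fun h" unfolding h_def by measurable
  define H where "H = (NI x. h x * h x)"
  define N where "N c f x = (\<integral>\<^sup>+v. bisector_kernel (norm v) c * f (x + t *\<^sub>R v) \<partial>(lborel::'a measure))" for c and f :: "'a \<Rightarrow> ennreal" and x
  have N_meas: "(\<lambda>x. N c f x) \<in> borel_measurable borel" if [measurable]: "borel_fun f" for c f
    unfolding N_def by measurable
  have N_meas2: "(\<lambda>(z, x). N (e \<bullet> sgn z) f x) \<in> borel_measurable (borel \<Otimes>\<^sub>M borel)" if [measurable]: "borel_fun f" for f
    unfolding N_def by measurable
  note [measurable] = N_meas[OF assms(1)] N_meas[OF assms(2)]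
  let ?K = "ennreal (real DIM('a) * 2 ^ DIM('a) * 2 ^ (DIM('a) - 1)) * ?m * ennreal (sqrt (\<delta> / t))"
  \<comment> \<open>For fixed c: the quadratic form of a - b under the ball average
    \<open>N c\<close> is at most the autocorrelation of |a - b| over the shell. The averages of a
    and of b differ by at most q S, and \<open>absdiff_rearrange\<close> takes the place of
    expanding the form.\<close>
  have one: "(NI x. a x * N c a x) + (NI x. b x * N c b x)
    \<le> ((NI x. a x * N c b x) + (NI x. b x * N c a x)) + ?K * ennreal (1 / sqrt \<bar>c\<bar>) * H" if c1: "- 1 \<le> c" for c
  proof (cases "c < 0")
    case False
    then have "bisector_kernel s c = 0" for s by (simp add: bisector_kernel_def)
    then have "N c f x = 0" for f x by (simp add: N_def)
    then show ?thesis by simp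
  next
    case True
    define q where "q = ennreal (1 / (2 * c\<^sup>2))"
    define S where "S x = (NI v. indicator (shell (\<delta> / t) (- 2 * c)) v * h (x + t *\<^sub>R v))" for x
    have [measurable]: "borel_fun S" unfolding S_def by measurable
    have Nq: "N c f x = q * (NI v. indicator {..- 2 * c} (norm v) * f (x + t *\<^sub>R v))" if [measurable]: "borel_fun f" for f x
      unfolding N_def bisector_kernel_eq[OF True] q_def mult.assoc by (rule nn_integral_cmult) measurable
    have cmp1: "N c a x \<le> N c b x + q * S x" for x
      unfolding Nq[OF assms(1)] Nq[OF assms(2)] S_def h_def distrib_left[symmetric]
      by (intro mult_left_mono nn_integral_shell_compare[OF assms(1,2) t \<delta>] H1) (use True in auto)
    have cmp2: "N c b x \<le> N c a x + q * S x" for x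
      unfolding Nq[OF assms(1)] Nq[OF assms(2)] S_def h_def distrib_left[symmetric] absdiff_commute[of "a _"]
      by (intro mult_left_mono nn_integral_shell_compare[OF assms(2,1) t \<delta>] H2[unfolded absdiff_commute[of "a _"]]) (use True in auto)
    have "(NI x. a x * N c a x) + (NI x. b x * N c b x) = (NI x. a x * N c a x + b x * N c b x)"
      by (rule nn_integral_add[symmetric]) measurable
    also have "\<dots> \<le> (NI x. (a x * N c b x + b x * N c a x) + h x * (q * S x))"
      unfolding h_def by (intro nn_integral_mono absdiff_rearrange cmp1[unfolded h_def] cmp2[unfolded h_def])
    also have "\<dots> = (NI x. a x * N c b x + b x * N c a x) + (NI x. h x * (q * S x))"
      by (rule nn_integral_add) measurable
    also have "(NI x. a x * N c b x + b x * N c a x) = (NI x. a x * N c b x) + (NI x. b x * N c a x)"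
      by (rule nn_integral_add) measurable
    also have "(NI x. h x * (q * S x)) = q * (NI x. h x * S x)"
      by (subst nn_integral_cmult[symmetric], measurable) (simp only: mult_ac)
    also have "q * (NI x. h x * S x) \<le> q * (emeasure lborel (shell (\<delta> / t) (- 2 * c) :: 'a set) * H)"
      unfolding S_def H_def by (intro mult_left_mono nn_integral_autocorrelation_le) auto
    also have "\<dots> = q * emeasure lborel (shell (\<delta> / t) (- 2 * c) :: 'a set) * H" by (simp only: mult.assoc)
    also have "\<dots> \<le> ?K * ennreal (1 / sqrt \<bar>c\<bar>) * H"
      unfolding q_def by (rule mult_right_mono[OF bisector_kernel_shell[OF True c1 d]]) (use t \<delta> in auto)
    finally show ?thesis by (simp add: add_left_mono)
  qed
  let ?Q = "\<lambda>f g. NI x. NI v. indicator (unit_ball::'a set) v * (sph_nn (t * norm v) f x * sph_nn (t * norm v) g x)"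
  let ?I = "\<lambda>f g. NI z. indicator (unit_ball::'a set) z * (NI x. f x * N (e \<bullet> sgn z) g x)"
  have Q: "?Q f g = ?m * ?I f g" if "borel_fun f" "borel_fun g" for f g
    unfolding N_def by (rule nn_integral_sph_nn_product[OF that d e])
  have Im: "(\<lambda>z. indicator (unit_ball::'a set) z * (NI x. f x * N (e \<bullet> sgn z) g x)) \<in> borel_measurable lborel"
    if [measurable]: "borel_fun f" "borel_fun g" for f g
    using N_meas2[OF that(2)] by measurable
  have "?I a a + ?I b b = (NI z. indicator (unit_ball::'a set) z * (NI x. a x * N (e \<bullet> sgn z) a x) + indicator (unit_ball::'a set) z * (NI x. b x * N (e \<bullet> sgn z) b x))"
    by (rule nn_integral_add[symmetric]) (intro Im assms(1,2))+
  also have "\<dots> \<le> (NI z. (indicator (unit_ball::'a set) z * (NI x. a x * N (e \<bullet> sgn z) b x) + indicator (unit_ball::'a set) z * (NI x. b x * N (e \<bullet> sgn z) a x))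
      + (?K * H) * (indicator (unit_ball::'a set) z * ennreal (1 / sqrt \<bar>e \<bullet> sgn z\<bar>)))"
  proof (rule nn_integral_mono)
    fix z :: 'a
    have "\<bar>e \<bullet> sgn z\<bar> \<le> norm e * norm (sgn z)" by (rule Cauchy_Schwarz_ineq2)
    also have "\<dots> \<le> 1" using e by (simp add: norm_sgn)
    finally have "- 1 \<le> e \<bullet> sgn z" by linarith
    from mult_left_mono[OF one[OF this], of "indicator (unit_ball::'a set) z"]
    show "indicator (unit_ball::'a set) z * (NI x. a x * N (e \<bullet> sgn z) a x) + indicator (unit_ball::'a set) z * (NI x. b x * N (e \<bullet> sgn z) b x)
      \<le> (indicator (unit_ball::'a set) z * (NI x. a x * N (e \<bullet> sgn z) b x) + indicator (unit_ball::'a set) z * (NI x. b x * N (e \<bullet> sgn z) a x))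
      + (?K * H) * (indicator (unit_ball::'a set) z * ennreal (1 / sqrt \<bar>e \<bullet> sgn z\<bar>))"
      by (simp only: distrib_left mult_ac zero_le)
  qed
  also have "\<dots> = (NI z. indicator (unit_ball::'a set) z * (NI x. a x * N (e \<bullet> sgn z) b x) + indicator (unit_ball::'a set) z * (NI x. b x * N (e \<bullet> sgn z) a x))
     + (NI z. (?K * H) * (indicator (unit_ball::'a set) z * ennreal (1 / sqrt \<bar>e \<bullet> sgn z\<bar>)))"
    by (rule nn_integral_add) (intro borel_measurable_add Im assms(1,2), measurable)
  also have "(NI z. indicator (unit_ball::'a set) z * (NI x. a x * N (e \<bullet> sgn z) b x) + indicator (unit_ball::'a set) z * (NI x. b x * N (e \<bullet> sgn z) a x))
     = ?I a b + ?I b a"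
    by (rule nn_integral_add) (intro Im assms(1,2))+
  also have "(NI z. (?K * H) * (indicator (unit_ball::'a set) z * ennreal (1 / sqrt \<bar>e \<bullet> sgn z\<bar>)))
     = (?K * H) * (NI z. indicator (unit_ball::'a set) z * ennreal (1 / sqrt \<bar>e \<bullet> sgn z\<bar>))"
    by (rule nn_integral_cmult) measurable
  finally have "?m * (?I a a + ?I b b) \<le> ?m * ((?I a b + ?I b a) + (?K * H) * (NI z. indicator (unit_ball::'a set) z * ennreal (1 / sqrt \<bar>e \<bullet> sgn z\<bar>)))"
    by (rule mult_left_mono) simp
  then have "?Q a a + ?Q b b \<le> (?Q a b + ?Q b a) + ?m * ((?K * H) * (NI z. indicator (unit_ball::'a set) z * ennreal (1 / sqrt \<bar>e \<bullet> sgn z\<bar>)))"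
    unfolding Q[OF assms(1,1)] Q[OF assms(2,2)] Q[OF assms(1,2)] Q[OF assms(2,1)] by (simp only: distrib_left)
  also have "?m * ((?K * H) * (NI z. indicator (unit_ball::'a set) z * ennreal (1 / sqrt \<bar>e \<bullet> sgn z\<bar>))) = cap_const e * ennreal (sqrt (\<delta> / t)) * H"
    unfolding cap_const_def by (simp only: mult_ac)
  finally have main: "?Q a a + ?Q b b \<le> (?Q a b + ?Q b a) + cap_const e * ennreal (sqrt (\<delta> / t)) * H" .
  let ?A = "\<lambda>v x. sph_nn (t * norm (v::'a)) a x" and ?B = "\<lambda>v x. sph_nn (t * norm (v::'a)) b x"
  let ?W = "NI x. NI v. indicator (unit_ball::'a set) v * (absdiff (?A v x) (?B v x) * absdiff (?A v x) (?B v x))"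
  have add2: "(NI x. NI v. f x v) + (NI x. NI v. g x v) = (NI x. NI v. f x v + g x v)"
    if [measurable]: "(\<lambda>(x, v). f x v) \<in> borel_measurable (borel \<Otimes>\<^sub>M borel)" "(\<lambda>(x, v). g x v) \<in> borel_measurable (borel \<Otimes>\<^sub>M borel)"
    for f g :: "'a \<Rightarrow> 'a \<Rightarrow> ennreal"
  proof -
    have [measurable]: "f x \<in> borel_measurable borel" "g x \<in> borel_measurable borel" for x
      using measurable_Pair2[OF that(1)] measurable_Pair2[OF that(2)] by simp_all
    show ?thesis by (subst nn_integral_add[symmetric], measurable, subst nn_integral_add) auto
  qed
  have "?W + (?Q a b + ?Q b a) = (NI x. NI v. indicator (unit_ball::'a set) v * (absdiff (?A v x) (?B v x) * absdiff (?A v x) (?B v x))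
     + (indicator (unit_ball::'a set) v * (?A v x * ?B v x) + indicator (unit_ball::'a set) v * (?B v x * ?A v x)))"
    by (subst add2, measurable, subst add2, measurable)
  also have "\<dots> = (NI x. NI v. indicator (unit_ball::'a set) v * (?A v x * ?A v x) + indicator (unit_ball::'a set) v * (?B v x * ?B v x))"
    by (intro nn_integral_cong) (simp only: distrib_left[symmetric] absdiff_square[OF fin(1,2)])
  also have "\<dots> = ?Q a a + ?Q b b" by (rule add2[symmetric]) measurable
  finally have "?W + (?Q a b + ?Q b a) \<le> (?Q a b + ?Q b a) + cap_const e * ennreal (sqrt (\<delta> / t)) * H" using main by simp
  moreover have "?Q b a = ?Q a b" by (simp only: mult.commute[of "sph_nn _ b _"])
  ultimately have "(?Q a b + ?Q a b) + ?W \<le> (?Q a b + ?Q a b) + cap_const e * ennreal (sqrt (\<delta> / t)) * H" by (simp only: add.commute)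
  \<comment> \<open>The mixed forms stand on both sides of the inequality for \<open>?W\<close>.
    Their finiteness, which is \<open>fin(3)\<close>, allows them to be cancelled.\<close>
  moreover have "?Q a b + ?Q a b < top" using fin(3) by simp
  ultimately have "?W \<le> cap_const e * ennreal (sqrt (\<delta> / t)) * H"
    using ennreal_add_left_cancel_le[of "?Q a b + ?Q a b" ?W] by auto
  then show ?thesis unfolding H_def h_def .
qed

section \<open>Averages over dyadic cells\<close>

definition cell_eq :: "int \<Rightarrow> 'a::euclidean_space \<Rightarrow> 'a \<Rightarrow> bool" where
  "cell_eq k x y \<longleftrightarrow> (\<forall>b\<in>Basis. \<lfloor>2 powi k * (x \<bullet> b)\<rfloor> = \<lfloor>2 powi k * (y \<bullet> b)\<rfloor>)"

text \<open>Holds for the 3^d cells that coincide with the cell of x or touch it; they contain every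
  point within distance 2^(-k) of x.\<close>

definition cell_near :: "int \<Rightarrow> 'a::euclidean_space \<Rightarrow> 'a \<Rightarrow> bool" where
  "cell_near k x y \<longleftrightarrow> (\<forall>b\<in>Basis. \<bar>\<lfloor>2 powi k * (x \<bullet> b)\<rfloor> - \<lfloor>2 powi k * (y \<bullet> b)\<rfloor>\<bar> \<le> 1)"

lemma cell_eq_measurable [measurable (raw)]:
  fixes f g :: "'b \<Rightarrow> 'a::euclidean_space"
  assumes [measurable]: "f \<in> borel_measurable M" "g \<in> borel_measurable M"
  shows "Measurable.pred M (\<lambda>w. cell_eq k (f w) (g w))"
  unfolding cell_eq_def by (intro pred_intros_finite) (simp, measurable)

lemma cell_near_measurable [measurable (raw)]:
  fixes f g :: "'b \<Rightarrow> 'a::euclidean_space"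
  assumes [measurable]: "f \<in> borel_measurable M" "g \<in> borel_measurable M"
  shows "Measurable.pred M (\<lambda>w. cell_near k (f w) (g w))"
proof -
  have e: "\<bar>i - j\<bar> \<le> 1 \<longleftrightarrow> i = j \<or> i = j + 1 \<or> j = i + 1" for i j :: int by linarith
  show ?thesis unfolding cell_near_def e by (intro pred_intros_finite pred_intros_logic) (simp, measurable)
qed

lemma cell_eq_sym: "cell_eq k x y \<longleftrightarrow> cell_eq k y x"
  by (auto simp: cell_eq_def)

lemma cell_eq_trans: "cell_eq k x y \<Longrightarrow> cell_eq k y z \<Longrightarrow> cell_eq k x z"
  by (auto simp: cell_eq_def)

lemma cell_near_trans: "cell_near k x y \<Longrightarrow> cell_eq k y z \<Longrightarrow> cell_near k x z"
  by (auto simp: cell_eq_def cell_near_def)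

lemma cell_near_sym: "cell_near k x y \<longleftrightarrow> cell_near k y x"
  by (auto simp: cell_near_def abs_minus_commute)

lemma floor_coarser:
  assumes "k' \<le> k"
  obtains m :: int where "0 < m" "\<And>s::real. \<lfloor>2 powi k' * s\<rfloor> = \<lfloor>2 powi k * s\<rfloor> div m"
proof (rule that[of "2 ^ nat (k - k')"])
  fix s :: real
  have "(2::real) powi k = 2 powi k' * 2 ^ nat (k - k')"
    using assms by (simp add: power_int_add[symmetric] power_int_of_nat[symmetric] del: power_int_of_nat)
  then have "2 powi k' * s = (2 powi k * s) / real_of_int (2 ^ nat (k - k'))" by simp
  then show "\<lfloor>2 powi k' * s\<rfloor> = \<lfloor>2 powi k * s\<rfloor> div 2 ^ nat (k - k')"
    by (simp only: floor_divide_real_eq_div zero_le_power zero_le_numeral)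
qed simp

lemma cell_eq_coarser: "k' \<le> k \<Longrightarrow> cell_eq k x y \<Longrightarrow> cell_eq k' x y"
proof -
  assume k: "k' \<le> k" "cell_eq k x y"
  obtain m :: int where "\<And>s::real. \<lfloor>2 powi k' * s\<rfloor> = \<lfloor>2 powi k * s\<rfloor> div m" using floor_coarser[OF k(1)] by metis
  then show "cell_eq k' x y" using k(2) by (simp add: cell_eq_def)
qed

lemma cell_near_coarser: "k' \<le> k \<Longrightarrow> cell_near k x y \<Longrightarrow> cell_near k' x y"
proof -
  assume k: "k' \<le> k" "cell_near k x y"
  obtain m :: int where m: "0 < m" "\<And>s::real. \<lfloor>2 powi k' * s\<rfloor> = \<lfloor>2 powi k * s\<rfloor> div m" using floor_coarser[OF k(1)] by metis
  have *: "i div m \<le> j div m + 1" if "i \<le> j + 1" for i j :: int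
  proof -
    have "i div m \<le> (j + m) div m" using that m(1) by (intro zdiv_mono1) auto
    then show ?thesis using m(1) by simp
  qed
  have "\<bar>i div m - j div m\<bar> \<le> 1" if "\<bar>i - j\<bar> \<le> 1" for i j :: int
    using *[of i j] *[of j i] that by linarith
  then show "cell_near k' x y" using k(2) unfolding cell_near_def m(2) by blast
qed

lemma cell_near_dist:
  assumes "dist x y \<le> 2 powi (- k)"
  shows "cell_near k x y"
  unfolding cell_near_def
proof
  fix b :: 'a assume b: "b \<in> Basis"
  have "\<bar>x \<bullet> b - y \<bullet> b\<bar> \<le> 2 powi (- k)"
    using Basis_le_norm[OF b, of "x - y"] assms by (simp add: dist_norm inner_diff_left)
  then have "2 powi k * \<bar>x \<bullet> b - y \<bullet> b\<bar> \<le> 2 powi k * 2 powi (- k)" by (intro mult_left_mono) auto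
  also have "(2::real) powi k * 2 powi (- k) = 1" by (simp add: power_int_minus)
  finally have "\<bar>2 powi k * (x \<bullet> b) - 2 powi k * (y \<bullet> b)\<bar> \<le> 1"
    by (simp add: right_diff_distrib[symmetric] abs_mult)
  then show "\<bar>\<lfloor>2 powi k * (x \<bullet> b)\<rfloor> - \<lfloor>2 powi k * (y \<bullet> b)\<rfloor>\<bar> \<le> 1" by linarith
qed

lemma cell_eq_dist:
  fixes x y :: "'a::euclidean_space"
  assumes "cell_eq k x y"
  shows "dist x y \<le> real DIM('a) * 2 powi (- k)"
proof -
  have "dist x y \<le> (\<Sum>b\<in>Basis. \<bar>(x - y) \<bullet> b\<bar>)" unfolding dist_norm by (rule norm_le_l1)
  also have "\<dots> \<le> (\<Sum>b\<in>(Basis::'a set). 2 powi (- k))"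
  proof (rule sum_mono)
    fix b :: 'a assume "b \<in> Basis"
    then have "\<lfloor>2 powi k * (x \<bullet> b)\<rfloor> = \<lfloor>2 powi k * (y \<bullet> b)\<rfloor>" using assms by (simp add: cell_eq_def)
    then have "\<bar>2 powi k * (x \<bullet> b) - 2 powi k * (y \<bullet> b)\<bar> \<le> 1" by linarith
    then have "2 powi k * \<bar>(x - y) \<bullet> b\<bar> \<le> 1" by (simp add: inner_diff_left right_diff_distrib[symmetric] abs_mult)
    then show "\<bar>(x - y) \<bullet> b\<bar> \<le> 2 powi (- k)" by (simp add: power_int_minus field_simps)
  qed
  finally show ?thesis by simp
qed

lemma emeasure_cells:
  fixes x :: "'a::euclidean_space"
  shows "(NI y. indicator {y. cell_eq k x y} y) = ennreal (1 / (2 powi k) ^ DIM('a))"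
    "(NI y. indicator {y. cell_near k x y} y) = ennreal (3 ^ DIM('a) / (2 powi k) ^ DIM('a))"
proof -
  define c :: real where "c = 2 powi k"
  have c: "0 < c" by (simp add: c_def)
  define n where "n b = \<lfloor>c * (x \<bullet> b)\<rfloor>" for b
  have prod_ind: "(\<Prod>b\<in>B. indicator (I b) (y b) :: ennreal) = of_bool (\<forall>b\<in>B. y b \<in> I b)" if "finite B" for B :: "'a set" and I :: "'a \<Rightarrow> real set" and y
    using that by (induction B) (auto simp: indicator_def)
  have "(NI y. indicator {y. cell_eq k x y} y) = (NI y. (\<Prod>b\<in>Basis. indicator {n b / c..<(n b + 1) / c} (y \<bullet> b)))"
  proof (rule nn_integral_cong)
    fix y :: 'a
    have "cell_eq k x y \<longleftrightarrow> (\<forall>b\<in>Basis. y \<bullet> b \<in> {n b / c..<(n b + 1) / c})"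
      unfolding cell_eq_def c_def[symmetric] n_def[symmetric]
    proof (intro ball_cong refl)
      fix b :: 'a
      have "(n b = \<lfloor>c * (y \<bullet> b)\<rfloor>) \<longleftrightarrow> real_of_int (n b) \<le> c * (y \<bullet> b) \<and> c * (y \<bullet> b) < real_of_int (n b) + 1" by linarith
      then show "(n b = \<lfloor>c * (y \<bullet> b)\<rfloor>) \<longleftrightarrow> y \<bullet> b \<in> {n b / c..<(n b + 1) / c}"
        using c by (simp add: pos_divide_le_eq pos_less_divide_eq mult.commute)
    qed
    then show "indicator {y. cell_eq k x y} y = (\<Prod>b\<in>Basis. indicator {n b / c..<(n b + 1) / c} (y \<bullet> b) :: ennreal)"
      by (subst prod_ind) (simp_all add: indicator_def)
  qed
  also have "\<dots> = (\<Prod>b\<in>(Basis::'a set). NI s. indicator {n b / c..<(n b + 1) / c} s)"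
    by (rule nn_integral_lborel_prod) auto
  also have "\<dots> = (\<Prod>b\<in>(Basis::'a set). ennreal (1 / c))"
  proof (intro prod.cong refl)
    fix b :: 'a
    have "n b / c \<le> (n b + 1) / c" using c by (intro divide_right_mono) auto
    moreover have "(n b + 1) / c - n b / c = 1 / c" by (simp add: diff_divide_distrib[symmetric])
    ultimately show "(NI s. indicator {n b / c..<(n b + 1) / c} s) = ennreal (1 / c)" by (simp only: nn_integral_indicator sets_lborel atLeastLessThan_borel emeasure_lborel_Ico)
  qed
  also have "\<dots> = ennreal (1 / c ^ DIM('a))" using c by (simp add: ennreal_power power_one_over)
  finally show "(NI y. indicator {y. cell_eq k x y} y) = ennreal (1 / (2 powi k) ^ DIM('a))" by (simp only: c_def)
  have "(NI y. indicator {y. cell_near k x y} y) = (NI y. (\<Prod>b\<in>Basis. indicator {(n b - 1) / c..<(n b + 2) / c} (y \<bullet> b)))"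
  proof (rule nn_integral_cong)
    fix y :: 'a
    have "cell_near k x y \<longleftrightarrow> (\<forall>b\<in>Basis. y \<bullet> b \<in> {(n b - 1) / c..<(n b + 2) / c})"
      unfolding cell_near_def c_def[symmetric] n_def[symmetric]
    proof (intro ball_cong refl)
      fix b :: 'a
      have "(\<bar>n b - \<lfloor>c * (y \<bullet> b)\<rfloor>\<bar> \<le> 1) \<longleftrightarrow> real_of_int (n b) - 1 \<le> c * (y \<bullet> b) \<and> c * (y \<bullet> b) < real_of_int (n b) + 2" by linarith
      then show "(\<bar>n b - \<lfloor>c * (y \<bullet> b)\<rfloor>\<bar> \<le> 1) \<longleftrightarrow> y \<bullet> b \<in> {(n b - 1) / c..<(n b + 2) / c}"
        using c by (simp add: pos_divide_le_eq pos_less_divide_eq mult.commute)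
    qed
    then show "indicator {y. cell_near k x y} y = (\<Prod>b\<in>Basis. indicator {(n b - 1) / c..<(n b + 2) / c} (y \<bullet> b) :: ennreal)"
      by (subst prod_ind) (simp_all add: indicator_def)
  qed
  also have "\<dots> = (\<Prod>b\<in>(Basis::'a set). NI s. indicator {(n b - 1) / c..<(n b + 2) / c} s)"
    by (rule nn_integral_lborel_prod) auto
  also have "\<dots> = (\<Prod>b\<in>(Basis::'a set). ennreal (3 / c))"
  proof (intro prod.cong refl)
    fix b :: 'a
    have "(n b - 1) / c \<le> (n b + 2) / c" using c by (intro divide_right_mono) auto
    moreover have "(n b + 2) / c - (n b - 1) / c = 3 / c" by (simp add: diff_divide_distrib[symmetric])
    ultimately show "(NI s. indicator {(n b - 1) / c..<(n b + 2) / c} s) = ennreal (3 / c)" by (simp only: nn_integral_indicator sets_lborel atLeastLessThan_borel emeasure_lborel_Ico)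
  qed
  also have "\<dots> = ennreal (3 ^ DIM('a) / c ^ DIM('a))" using c by (simp add: ennreal_power power_divide)
  finally show "(NI y. indicator {y. cell_near k x y} y) = ennreal (3 ^ DIM('a) / (2 powi k) ^ DIM('a))" by (simp only: c_def)
qed

text \<open>The conditional expectation with respect to the \<sigma>-algebra generated by the dyadic
  cells of side 2^(-k).\<close>

definition cell_avg :: "int \<Rightarrow> ('a::euclidean_space \<Rightarrow> ennreal) \<Rightarrow> 'a \<Rightarrow> ennreal" where
  "cell_avg k f x = ennreal ((2 powi k) ^ DIM('a)) * (NI y. indicator {y. cell_eq k x y} y * f y)"

lemma cell_avg_measurable [measurable (raw)]:
  assumes [measurable]: "borel_fun f" "g \<in> borel_measurable M"
  shows "(\<lambda>w. cell_avg k f (g w)) \<in> borel_measurable M"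
proof -
  have "(\<lambda>w. NI y. (if cell_eq k (g w) y then 1 else 0) * f y) \<in> borel_measurable M" by measurable
  then show ?thesis unfolding cell_avg_def indicator_def mem_Collect_eq of_bool_def by measurable
qed

lemma cell_avg_cong_cell: "cell_eq k x x' \<Longrightarrow> cell_avg k f x = cell_avg k f x'"
proof -
  assume "cell_eq k x x'"
  then have "cell_eq k x y \<longleftrightarrow> cell_eq k x' y" for y using cell_eq_trans cell_eq_sym by blast
  then show ?thesis by (simp add: cell_avg_def)
qed

lemma cell_volume_cancel: "ennreal ((2 powi k) ^ n) * ennreal (1 / (2 powi k) ^ n) = 1"
  by (subst ennreal_mult[symmetric]) auto

lemma cell_avg_of_cell_const:
  assumes [measurable]: "borel_fun \<phi>" and c: "\<And>y. cell_eq k x y \<Longrightarrow> \<phi> y = \<phi> x"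
  shows "cell_avg k \<phi> x = \<phi> x"
proof -
  have "(NI y. indicator {y. cell_eq k x y} y * \<phi> y) = (NI y. indicator {y. cell_eq k x y} y * \<phi> x)"
  proof (rule nn_integral_cong)
    fix y show "indicator {y. cell_eq k x y} y * \<phi> y = indicator {y. cell_eq k x y} y * \<phi> x"
      using c[of y] by (cases "cell_eq k x y") simp_all
  qed
  also have "\<dots> = ennreal (1 / (2 powi k) ^ DIM('a)) * \<phi> x"
    by (subst nn_integral_multc, measurable) (simp only: emeasure_cells(1))
  finally show ?thesis unfolding cell_avg_def by (simp only: mult.assoc[symmetric] cell_volume_cancel mult_1)
qed

lemma cell_avg_const: "cell_avg k (\<lambda>_. c) x = c"
  by (rule cell_avg_of_cell_const) auto

lemma cell_avg_mono: "(\<And>y. f y \<le> g y) \<Longrightarrow> cell_avg k f x \<le> cell_avg k g x"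
  unfolding cell_avg_def by (intro mult_left_mono nn_integral_mono) auto

lemma cell_avg_le: "(\<And>y. f y \<le> c) \<Longrightarrow> cell_avg k f x \<le> c"
  using cell_avg_mono[of f "\<lambda>_. c" k x] by (simp add: cell_avg_const)

lemma cell_avg_add:
  assumes [measurable]: "borel_fun f" "borel_fun g"
  shows "cell_avg k (\<lambda>y. f y + g y) x = cell_avg k f x + cell_avg k g x"
  unfolding cell_avg_def distrib_left by (subst nn_integral_add) (auto simp: distrib_left)

text \<open>Self-adjointness, from the symmetry of \<open>cell_eq\<close> and Tonelli.\<close>

lemma cell_avg_adjoint:
  fixes f \<phi> :: "'a::euclidean_space \<Rightarrow> ennreal"
  assumes [measurable]: "borel_fun f" "borel_fun \<phi>"
  shows "(NI x. \<phi> x * cell_avg k f x) = (NI x. cell_avg k \<phi> x * f x)"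
proof -
  let ?V = "ennreal ((2 powi k) ^ DIM('a))"
  have [measurable]: "(\<lambda>(x, y). indicator {y. cell_eq k x y} y :: ennreal) \<in> borel_measurable (borel \<Otimes>\<^sub>M borel)"
    unfolding indicator_def mem_Collect_eq of_bool_def by measurable
  have [measurable]: "(\<lambda>(x, y). indicator {x. cell_eq k y x} x :: ennreal) \<in> borel_measurable (borel \<Otimes>\<^sub>M borel)"
    unfolding indicator_def mem_Collect_eq of_bool_def by measurable
  have [measurable]: "(\<lambda>y. indicator {y. cell_eq k x y} y :: ennreal) \<in> borel_measurable borel" for x :: 'a
    by measurable
  have "(NI x. \<phi> x * cell_avg k f x) = (NI x. NI y. \<phi> x * (?V * (indicator {y. cell_eq k x y} y * f y)))"
    unfolding cell_avg_def by (subst nn_integral_cmult, measurable, subst nn_integral_cmult, measurable)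
  also have "\<dots> = (NI y. NI x. \<phi> x * (?V * (indicator {y. cell_eq k x y} y * f y)))"
    by (rule nn_integral_lborel_swap) measurable
  also have "\<dots> = (NI y. NI x. f y * (?V * (indicator {x. cell_eq k y x} x * \<phi> x)))"
    by (intro nn_integral_cong) (simp only: indicator_def mem_Collect_eq cell_eq_sym[of k] mult_ac)
  also have "\<dots> = (NI y. f y * cell_avg k \<phi> y)"
    unfolding cell_avg_def by (subst nn_integral_cmult, measurable, subst nn_integral_cmult, measurable)
  finally show ?thesis by (simp only: mult.commute)
qed

lemma cell_avg_adjoint_const:
  fixes f \<phi> :: "'a::euclidean_space \<Rightarrow> ennreal"
  assumes [measurable]: "borel_fun f" "borel_fun \<phi>"
    and c: "\<And>x y. cell_eq k x y \<Longrightarrow> \<phi> x = \<phi> y"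
  shows "(NI x. \<phi> x * cell_avg k f x) = (NI x. \<phi> x * f x)"
proof -
  have "cell_avg k \<phi> x = \<phi> x" for x by (rule cell_avg_of_cell_const) (auto intro: c[symmetric])
  then show ?thesis by (subst cell_avg_adjoint) auto
qed

lemma nn_integral_cell_avg:
  assumes "borel_fun f"
  shows "(NI x. cell_avg k f x) = (NI x. f x)"
  using cell_avg_adjoint_const[OF assms, of "\<lambda>_. 1" k] by simp

lemma cell_avg_le_L1:
  "cell_avg k f (x::'a::euclidean_space) \<le> ennreal ((2 powi k) ^ DIM('a)) * (NI y. f y)"
  unfolding cell_avg_def by (intro mult_left_mono nn_integral_mono) (auto simp: indicator_def)

section \<open>Sums over all integer scales\<close>

lemma nn_integral_int_le:
  fixes f :: "int \<Rightarrow> ennreal"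
  assumes "\<And>N::nat. (\<Sum>k\<in>{- int N..int N}. f k) \<le> C"
  shows "(\<integral>\<^sup>+k. f k \<partial>count_space UNIV) \<le> C"
proof -
  have sup: "f k = (SUP N::nat. f k * indicator {- int N..int N} k)" for k
  proof (rule antisym)
    show "f k \<le> (SUP N::nat. f k * indicator {- int N..int N} k)"
    proof (rule SUP_upper2[of "nat \<bar>k\<bar>"])
      have "k \<in> {- int (nat \<bar>k\<bar>)..int (nat \<bar>k\<bar>)}" by (simp add: abs_if)
      then show "f k \<le> f k * indicator {- int (nat \<bar>k\<bar>)..int (nat \<bar>k\<bar>)} k" by (simp only: indicator_simps mult_1_right order_refl)
    qed simp
    show "(SUP N::nat. f k * indicator {- int N..int N} k) \<le> f k"
      by (rule SUP_least) (auto simp: indicator_def)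
  qed
  have "(\<integral>\<^sup>+k. f k \<partial>count_space UNIV) = (\<integral>\<^sup>+k. (SUP N::nat. f k * indicator {- int N..int N} k) \<partial>count_space UNIV)"
    using sup by simp
  also have "\<dots> = (SUP N::nat. \<integral>\<^sup>+k. f k * indicator {- int N..int N} k \<partial>count_space UNIV)"
    by (rule nn_integral_monotone_convergence_SUP) (auto intro!: incseq_SucI le_funI mult_left_mono indicator_leI)
  also have "\<dots> \<le> C"
  proof (rule SUP_least)
    fix N :: nat
    have "(\<integral>\<^sup>+k. f k * indicator {- int N..int N} k \<partial>count_space UNIV) = (\<integral>\<^sup>+k. f k \<partial>count_space {- int N..int N})"
      by (simp add: nn_integral_count_space_indicator)
    also have "\<dots> = (\<Sum>k\<in>{- int N..int N}. f k)" by (rule nn_integral_count_space_finite) simp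
    finally show "(\<integral>\<^sup>+k. f k * indicator {- int N..int N} k \<partial>count_space UNIV) \<le> C" using assms by simp
  qed
  finally show ?thesis .
qed

lemma le_nn_integral_int: "f k \<le> (\<integral>\<^sup>+k. f k \<partial>count_space (UNIV :: int set))"
proof -
  have "f k = (\<integral>\<^sup>+j. f k * indicator {k} j \<partial>count_space (UNIV :: int set))" by simp
  also have "\<dots> \<le> (\<integral>\<^sup>+k. f k \<partial>count_space (UNIV :: int set))"
    by (rule nn_integral_mono) (auto simp: indicator_def)
  finally show ?thesis .
qed

lemma emeasure_UN_int_le:
  fixes A :: "int \<Rightarrow> 'a set"
  assumes [measurable]: "\<And>l. A l \<in> sets M"
  shows "emeasure M (\<Union>l. A l) \<le> (\<integral>\<^sup>+l. emeasure M (A l) \<partial>count_space UNIV)"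
proof -
  have "emeasure M (\<Union>l. A l) = (\<integral>\<^sup>+x. indicator (\<Union>l. A l) x \<partial>M)" by simp
  also have "\<dots> \<le> (\<integral>\<^sup>+x. \<integral>\<^sup>+l. indicator (A l) x \<partial>count_space UNIV \<partial>M)"
  proof (rule nn_integral_mono)
    fix x
    show "indicator (\<Union>l. A l) x \<le> (\<integral>\<^sup>+l. indicator (A l) x \<partial>count_space UNIV)"
    proof (cases "x \<in> (\<Union>l. A l)")
      case True
      then obtain l where "x \<in> A l" by blast
      then have "1 \<le> (\<integral>\<^sup>+l. indicator (A l) x \<partial>count_space UNIV)"
        using le_nn_integral_int[of "\<lambda>l. indicator (A l) x" l] by simp
      then show ?thesis using True by simp
    qed simp
  qed
  also have "\<dots> = (\<integral>\<^sup>+l. \<integral>\<^sup>+x. indicator (A l) x \<partial>M \<partial>count_space UNIV)"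
    by (rule nn_integral_count_space_nn_integral) auto
  finally show ?thesis by simp
qed

text \<open>If l and l' are both counted, then \<open>P (l + m)\<close> holds and
  \<open>P l'\<close> fails, so l' < l + m by monotonicity; thus all counted integers fit into an
  interval of m integers. This is the source of the factor m in the weak type bounds.\<close>

lemma count_int_window:
  fixes P :: "int \<Rightarrow> bool"
  assumes mono: "\<And>k k'. k \<le> k' \<Longrightarrow> P k \<Longrightarrow> P k'"
  shows "(\<integral>\<^sup>+l. indicator {l. P (l + int m) \<and> \<not> P l} l \<partial>count_space UNIV) \<le> ennreal (real m)"
proof -
  let ?S = "{l. P (l + int m) \<and> \<not> P l}"
  have near: "l' < l + int m" if "l \<in> ?S" "l' \<in> ?S" for l l'
    using that mono[of "l + int m" l'] by force
  have "finite ?S \<and> card ?S \<le> m"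
  proof (cases "?S = {}")
    case True
    show ?thesis unfolding True by simp
  next
    case False
    then obtain l0 where l0: "l0 \<in> ?S" by blast
    have "?S \<subseteq> {l0 - int m..l0 + int m}" using near[OF l0] near[OF _ l0] by force
    then have fin: "finite ?S" by (rule finite_subset) simp
    have "?S \<subseteq> {Min ?S..<Min ?S + int m}"
      using near[OF Min_in[OF fin False]] Min_le[OF fin] by auto
    then have "card ?S \<le> card {Min ?S..<Min ?S + int m}" by (intro card_mono) auto
    then show ?thesis using fin by simp
  qed
  then show ?thesis
    by (subst nn_integral_indicator) (auto simp: ennreal_of_nat_eq_real_of_nat)
qed

section \<open>Orthogonality of the differences of cell averages\<close>

lemma nn_integral_cell_avg_product:
  assumes [measurable]: "borel_fun g" and k: "k \<le> j"
  shows "(NI x. cell_avg k g x * cell_avg j g x) = (NI x. cell_avg k g x * g x)"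
  by (rule cell_avg_adjoint_const) (auto intro: cell_avg_cong_cell cell_eq_coarser[OF k])

lemma cell_avg_L2_finite:
  assumes [measurable]: "borel_fun g" and M: "\<And>x. g x \<le> ennreal M" and fin: "(NI x. g x) < top"
  shows "(NI x. cell_avg k g x * g x) < top"
proof -
  have "(NI x. cell_avg k g x * g x) \<le> (NI x. ennreal M * g x)"
    by (intro nn_integral_mono mult_right_mono cell_avg_le M) simp
  also have "\<dots> = ennreal M * (NI x. g x)" by (rule nn_integral_cmult) measurable
  also have "\<dots> < top" using fin by (simp add: ennreal_mult_less_top)
  finally show ?thesis .
qed

lemma cell_avg_L2_le:
  assumes [measurable]: "borel_fun g" and M: "\<And>x. g x \<le> ennreal M" and fin: "(NI x. g x) < top"
  shows "(NI x. cell_avg k g x * cell_avg k g x) \<le> (NI x. g x * g x)"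
proof -
  let ?A = "NI x. cell_avg k g x * cell_avg k g x" and ?B = "NI x. g x * g x"
  have eq: "?A = (NI x. cell_avg k g x * g x)" by (rule nn_integral_cell_avg_product) auto
  then have Af: "?A < top" using cell_avg_L2_finite[OF assms] by simp
  have "?A * ?A \<le> ?A * ?B"
    using Cauchy_Schwarz_nn_integral[of "cell_avg k g" lborel g] eq by (simp add: power2_eq_square)
  then show ?thesis using Af by (cases "?A = 0") (auto simp: ennreal_mult_le_mult_iff)
qed

text \<open>Pythagoras for martingale differences. All cross terms reduce to the integral of the
  coarse average against g; it is finite because g is bounded and integrable, and it is cancelled at
  the end.\<close>

lemma cell_avg_L2_increment:
  assumes [measurable]: "borel_fun g" and M: "\<And>x. g x \<le> ennreal M" and fin: "(NI x. g x) < top"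
  shows "(NI x. absdiff (cell_avg k g x) (cell_avg (k - 1) g x) * absdiff (cell_avg k g x) (cell_avg (k - 1) g x))
    + (NI x. cell_avg (k - 1) g x * cell_avg (k - 1) g x) = (NI x. cell_avg k g x * cell_avg k g x)"
proof -
  let ?a = "\<lambda>x. cell_avg k g x" and ?b = "\<lambda>x. cell_avg (k - 1) g x"
  let ?D = "NI x. absdiff (?a x) (?b x) * absdiff (?a x) (?b x)" and ?I = "NI x. ?b x * g x"
  have If: "?I < top" by (rule cell_avg_L2_finite[OF assms])
  have less: "cell_avg j g x < top" for j x
    using cell_avg_le[of g "ennreal M" j x] M by (auto intro: le_less_trans)
  have bb: "(NI x. ?b x * ?b x) = ?I" by (rule nn_integral_cell_avg_product) auto
  have ba: "(NI x. ?b x * ?a x) = ?I" by (rule nn_integral_cell_avg_product) auto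
  have ab: "(NI x. ?a x * ?b x) = ?I" using ba by (simp only: mult.commute)
  have "?D + (?I + ?I) = (NI x. absdiff (?a x) (?b x) * absdiff (?a x) (?b x) + (?a x * ?b x + ?b x * ?a x))"
    by (subst nn_integral_add, measurable, subst nn_integral_add, measurable) (simp only: ab ba)
  also have "\<dots> = (NI x. ?a x * ?a x + ?b x * ?b x)"
    by (intro nn_integral_cong absdiff_square less)
  also have "\<dots> = (NI x. ?a x * ?a x) + ?I"
    by (subst nn_integral_add, measurable) (simp only: bb)
  finally have "?I + (?D + ?I) = ?I + (NI x. ?a x * ?a x)" by (simp only: add_ac)
  then have "?D + ?I = (NI x. ?a x * ?a x)"
    using If by (auto simp: ennreal_add_left_cancel)
  then show ?thesis by (simp only: bb)
qed

text \<open>The squares telescope over every finite range of scales. This allows the supremum over l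
  to be replaced by a sum over l.\<close>

lemma cell_avg_L2_sum:
  assumes [measurable]: "borel_fun g" and M: "\<And>x. g x \<le> ennreal M" and fin: "(NI x. g x) < top"
  shows "(\<integral>\<^sup>+k. (NI x. absdiff (cell_avg (k + j) g x) (cell_avg (k + j - 1) g x) * absdiff (cell_avg (k + j) g x) (cell_avg (k + j - 1) g x)) \<partial>count_space UNIV)
    \<le> (NI x. g x * g x)"
proof (rule nn_integral_int_le)
  fix N :: nat
  define D where "D k = (NI x. absdiff (cell_avg k g x) (cell_avg (k - 1) g x) * absdiff (cell_avg k g x) (cell_avg (k - 1) g x))" for k
  define I where "I k = (NI x. cell_avg k g x * cell_avg k g x)" for k
  have step: "D k + I (k - 1) = I k" for k unfolding D_def I_def by (rule cell_avg_L2_increment[OF assms])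
  have "(\<Sum>k\<in>{a..<a + int n}. D (k + j)) + I (a + j - 1) = I (a + j + int n - 1)" for a and n :: nat
  proof (induction n)
    case (Suc n)
    have "{a..<a + int (Suc n)} = insert (a + int n) {a..<a + int n}" by auto
    then have "(\<Sum>k\<in>{a..<a + int (Suc n)}. D (k + j)) + I (a + j - 1) = D (a + int n + j) + I (a + j + int n - 1)"
      using Suc by (simp add: add.assoc)
    also have "\<dots> = I (a + int n + j)" using step[of "a + int n + j"] by (simp add: add_ac)
    finally show ?case by (simp add: add_ac)
  qed simp
  from this[of "- int N" "2 * N + 1"] have "(\<Sum>k\<in>{- int N..<int N + 1}. D (k + j)) + I (- int N + j - 1) = I (j + int N)"
    by (simp add: algebra_simps)
  moreover have "{- int N..<int N + 1} = {- int N..int N}" by auto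
  ultimately have "(\<Sum>k\<in>{- int N..int N}. D (k + j)) \<le> I (j + int N)"
    by (metis add_increasing2 order_refl zero_le)
  also have "\<dots> \<le> (NI x. g x * g x)" unfolding I_def by (rule cell_avg_L2_le[OF assms])
  finally show "(\<Sum>k\<in>{- int N..int N}. (NI x. absdiff (cell_avg (k + j) g x) (cell_avg (k + j - 1) g x) * absdiff (cell_avg (k + j) g x) (cell_avg (k + j - 1) g x))) \<le> (NI x. g x * g x)"
    unfolding D_def .
qed

text \<open>Let \<phi> be the indicator of the ball and \<psi> its coarse cell average. Since \<psi>
  is constant on coarse cells, hence on fine ones, both averages of g have the same integral against
  \<psi> as g itself. And \<psi> equals \<phi> except within distance \<delta>, a bound for the
  diameter of a coarse cell, of the bounding sphere.\<close>

lemma nn_integral_ball_cell_avg_compare: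
  fixes g :: "'a::euclidean_space \<Rightarrow> ennreal"
  assumes [measurable]: "borel_fun g" and fin: "(NI x. g x) < top"
    and \<delta>: "\<delta> = real DIM('a) * 2 powi (- (k - 1))"
  shows "(NI y. indicator {..r} (dist x y) * cell_avg k g y) \<le>
      (NI y. indicator {..r} (dist x y) * cell_avg (k - 1) g y) + (NI y. indicator {..\<delta>} \<bar>dist x y - r\<bar> * absdiff (cell_avg k g y) (cell_avg (k - 1) g y))"
    "(NI y. indicator {..r} (dist x y) * cell_avg (k - 1) g y) \<le>
      (NI y. indicator {..r} (dist x y) * cell_avg k g y) + (NI y. indicator {..\<delta>} \<bar>dist x y - r\<bar> * absdiff (cell_avg k g y) (cell_avg (k - 1) g y))"
proof -
  define a where "a = cell_avg k g"
  define b where "b = cell_avg (k - 1) g"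
  define \<phi> :: "'a \<Rightarrow> ennreal" where "\<phi> y = indicator {..r} (dist x y)" for y
  define \<psi> where "\<psi> = cell_avg (k - 1) \<phi>"
  define S :: "'a \<Rightarrow> ennreal" where "S y = indicator {..\<delta>} \<bar>dist x y - r\<bar>" for y
  have [measurable]: "borel_fun a" "borel_fun b" "borel_fun \<phi>"
    "borel_fun \<psi>" "borel_fun S"
    unfolding a_def b_def \<phi>_def[abs_def] \<psi>_def S_def[abs_def] by measurable
  have \<phi>1: "\<phi> y \<le> 1" for y by (simp add: \<phi>_def indicator_def)
  have \<psi>1: "\<psi> y \<le> 1" for y unfolding \<psi>_def by (rule cell_avg_le[OF \<phi>1])
  have far: "\<psi> y = \<phi> y" if "\<delta> < \<bar>dist x y - r\<bar>" for y
    unfolding \<psi>_def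
  proof (rule cell_avg_of_cell_const)
    fix y' assume "cell_eq (k - 1) y y'"
    then have "dist y y' \<le> \<delta>" unfolding \<delta> by (rule cell_eq_dist)
    then have "\<bar>dist x y - dist x y'\<bar> \<le> \<delta>" using dist_triangle[of x y y'] dist_triangle[of x y' y] by (simp add: dist_commute)
    then have "dist x y' \<le> r \<longleftrightarrow> dist x y \<le> r" using that by linarith
    then show "\<phi> y' = \<phi> y" by (simp add: \<phi>_def indicator_def)
  qed measurable
  have S: "\<phi> y \<le> \<psi> y + S y" "\<psi> y \<le> \<phi> y + S y" for y
  proof -
    show "\<phi> y \<le> \<psi> y + S y"
    proof (cases "\<delta> < \<bar>dist x y - r\<bar>")
      case False
      then have "\<phi> y \<le> S y" using \<phi>1[of y] by (simp add: S_def)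
      then show ?thesis by (rule add_increasing[OF zero_le])
    qed (simp add: far)
    show "\<psi> y \<le> \<phi> y + S y"
    proof (cases "\<delta> < \<bar>dist x y - r\<bar>")
      case False
      then have "\<psi> y \<le> S y" using \<psi>1[of y] by (simp add: S_def)
      then show ?thesis by (rule add_increasing[OF zero_le])
    qed (simp add: far)
  qed
  have \<psi>a: "(NI y. \<psi> y * a y) = (NI y. \<psi> y * g y)"
    unfolding a_def by (rule cell_avg_adjoint_const, measurable) (simp add: \<psi>_def cell_avg_cong_cell[OF cell_eq_coarser[of "k - 1" k]])
  have \<psi>b: "(NI y. \<psi> y * b y) = (NI y. \<psi> y * g y)"
    unfolding b_def by (rule cell_avg_adjoint_const, measurable) (simp add: \<psi>_def cell_avg_cong_cell)
  have "(NI y. \<psi> y * g y) \<le> (NI y. 1 * g y)" by (intro nn_integral_mono mult_right_mono \<psi>1) simp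
  then have J: "(NI y. \<psi> y * g y) < top" using fin by (simp add: le_less_trans)
  have main: "(NI y. \<phi> y * f1 y) \<le> (NI y. \<phi> y * f2 y) + (NI y. S y * absdiff (f1 y) (f2 y))"
    if [measurable]: "borel_fun f1" "borel_fun f2"
      and eq: "(NI y. \<psi> y * f1 y) = (NI y. \<psi> y * g y)" "(NI y. \<psi> y * f2 y) = (NI y. \<psi> y * g y)" for f1 f2
  proof -
    have "(NI y. \<phi> y * f1 y) + (NI y. \<psi> y * f2 y) = (NI y. f1 y * \<phi> y + f2 y * \<psi> y)"
      by (subst nn_integral_add, measurable) (simp only: mult.commute)
    also have "\<dots> \<le> (NI y. (f1 y * \<psi> y + f2 y * \<phi> y) + absdiff (f1 y) (f2 y) * S y)"
      by (intro nn_integral_mono absdiff_rearrange S)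
    also have "\<dots> = (NI y. \<psi> y * f1 y) + (NI y. \<phi> y * f2 y) + (NI y. S y * absdiff (f1 y) (f2 y))"
      by (subst nn_integral_add, measurable, subst nn_integral_add, measurable) (simp only: mult.commute)
    finally have "(NI y. \<psi> y * g y) + (NI y. \<phi> y * f1 y) \<le> (NI y. \<psi> y * g y) + ((NI y. \<phi> y * f2 y) + (NI y. S y * absdiff (f1 y) (f2 y)))"
      unfolding eq by (simp only: add_ac)
    then show ?thesis using J
      ennreal_add_left_cancel_le[of "NI y. \<psi> y * g y" "NI y. \<phi> y * f1 y"] by auto
  qed
  show "(NI y. indicator {..r} (dist x y) * cell_avg k g y) \<le>
      (NI y. indicator {..r} (dist x y) * cell_avg (k - 1) g y) + (NI y. indicator {..\<delta>} \<bar>dist x y - r\<bar> * absdiff (cell_avg k g y) (cell_avg (k - 1) g y))"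
    using main[OF _ _ \<psi>a \<psi>b] unfolding \<phi>_def S_def a_def b_def by simp
  show "(NI y. indicator {..r} (dist x y) * cell_avg (k - 1) g y) \<le>
      (NI y. indicator {..r} (dist x y) * cell_avg k g y) + (NI y. indicator {..\<delta>} \<bar>dist x y - r\<bar> * absdiff (cell_avg k g y) (cell_avg (k - 1) g y))"
    using main[OF _ _ \<psi>b \<psi>a] unfolding \<phi>_def S_def a_def b_def absdiff_commute[of "cell_avg (k - 1) g _"] by simp
qed

lemma sph_nn_le:
  assumes "\<And>y. f y \<le> c"
  shows "sph_nn r f (x::'a::euclidean_space) \<le> emeasure lborel (unit_ball :: 'a set) * c"
proof -
  have "sph_nn r f x \<le> (NI z. indicator (unit_ball::'a set) z * c)"
    unfolding sph_nn_def by (intro nn_integral_mono mult_left_mono assms) simp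
  also have "\<dots> = emeasure lborel (unit_ball :: 'a set) * c" by (subst nn_integral_multc) simp_all
  finally show ?thesis .
qed

lemma nn_integral_sph_nn:
  fixes f :: "'a::euclidean_space \<Rightarrow> ennreal"
  assumes [measurable]: "borel_fun f"
  shows "(NI x. sph_nn r f x) = emeasure lborel (unit_ball :: 'a set) * (NI x. f x)"
proof -
  have "(NI x. sph_nn r f x) = (NI z. NI x. indicator (unit_ball::'a set) z * f (x - r *\<^sub>R sgn z))"
    unfolding sph_nn_def by (rule nn_integral_lborel_swap) measurable
  also have "\<dots> = (NI z. indicator (unit_ball::'a set) z * (NI x. f x))"
    by (intro nn_integral_cong, subst nn_integral_cmult, measurable, subst nn_integral_lborel_shift(3), measurable)
  also have "\<dots> = emeasure lborel (unit_ball :: 'a set) * (NI x. f x)" by (subst nn_integral_multc) simp_all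
  finally show ?thesis .
qed

lemma sph_nn_cell_difference:
  fixes g :: "'a::euclidean_space \<Rightarrow> ennreal" and k :: int
  assumes [measurable]: "borel_fun g" and M: "\<And>x. g x \<le> ennreal M" and fin: "(NI x. g x) < top"
    and d: "2 \<le> DIM('a)" and e: "norm (e::'a) = 1" and t: "0 < t"
  defines "D v x \<equiv> absdiff (sph_nn (t * norm (v::'a)) (cell_avg k g) x) (sph_nn (t * norm v) (cell_avg (k - 1) g) x)"
  shows "(NI x. NI v. indicator (unit_ball::'a set) v * (D v x * D v x))
    \<le> cap_const e * ennreal (sqrt (real DIM('a) * 2 powi (- (k - 1)) / t)) *
      (NI x. absdiff (cell_avg k g x) (cell_avg (k - 1) g x) * absdiff (cell_avg k g x) (cell_avg (k - 1) g x))"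
  unfolding D_def
proof (rule sph_nn_difference_L2[OF _ _ d e t])
  let ?m = "emeasure lborel (unit_ball :: 'a set)"
  have le: "sph_nn r (cell_avg j g) x \<le> ?m * ennreal M" for r j x by (intro sph_nn_le cell_avg_le M)
  have mM: "?m * ennreal M < top" using emeasure_unit_ball(2)[where 'a='a] by (simp add: ennreal_mult_less_top)
  show "sph_nn r (cell_avg k g) x < top" "sph_nn r (cell_avg (k - 1) g) x < top" for r x
    using le mM le_less_trans by blast+
  \<comment> \<open>Finiteness of the mixed form: one mean is bounded by a multiple of M, and the
    other one is integrated.\<close>
  have "(NI x. NI v. indicator (unit_ball::'a set) v * (sph_nn (t * norm v) (cell_avg k g) x * sph_nn (t * norm v) (cell_avg (k - 1) g) x))
    \<le> (NI x. NI v. indicator (unit_ball::'a set) v * (sph_nn (t * norm v) (cell_avg k g) x * (?m * ennreal M)))"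
    by (intro nn_integral_mono mult_left_mono le) simp_all
  also have "\<dots> = (NI v. NI x. indicator (unit_ball::'a set) v * (sph_nn (t * norm v) (cell_avg k g) x * (?m * ennreal M)))"
    by (rule nn_integral_lborel_swap) measurable
  also have "\<dots> = (NI v. indicator (unit_ball::'a set) v * (?m * (NI x. g x) * (?m * ennreal M)))"
    by (intro nn_integral_cong, subst nn_integral_cmult, measurable, subst nn_integral_multc, measurable,
        subst nn_integral_sph_nn, measurable, subst nn_integral_cell_avg, measurable)
  also have "\<dots> = ?m * (?m * (NI x. g x) * (?m * ennreal M))" by (subst nn_integral_multc) simp_all
  also have "\<dots> < top" using mM fin emeasure_unit_ball(2)[where 'a='a] by (simp add: ennreal_mult_less_top)
  finally show "(NI x. NI v. indicator (unit_ball::'a set) v * (sph_nn (t * norm v) (cell_avg k g) x * sph_nn (t * norm v) (cell_avg (k - 1) g) x)) < top" .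
  show "cell_avg k g \<in> borel_measurable borel" "cell_avg (k - 1) g \<in> borel_measurable borel" by measurable
  show "0 < real DIM('a) * 2 powi (- (k - 1))" by simp
qed (intro nn_integral_ball_cell_avg_compare[OF assms(1) fin refl])+

text \<open>The slice formula with the distance of two spherical means under the integral. It
  dominates the difference of the averages formed with a and with b, and a pointwise bound on f can
  be pulled out of it.\<close>

definition bisph_diff :: "real \<Rightarrow> ('a::euclidean_space \<Rightarrow> ennreal) \<Rightarrow> ('a \<Rightarrow> ennreal) \<Rightarrow> ('a \<Rightarrow> ennreal) \<Rightarrow> 'a \<Rightarrow> ennreal" where
  "bisph_diff t f a b x = ennreal (real DIM('a)) * (NI u. indicator (ball 0 1) u * ennreal (height u ^ (DIM('a) - 2)) *
     (f (x - t *\<^sub>R u) * absdiff (sph_nn (t * height u) a x) (sph_nn (t * height u) b x)))"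

lemma bisph_diff_measurable [measurable (raw)]:
  assumes [measurable]: "borel_fun f" "borel_fun a" "borel_fun b" "h \<in> borel_measurable M"
  shows "(\<lambda>w. bisph_diff t f a b (h w)) \<in> borel_measurable M"
  unfolding bisph_diff_def by measurable

lemma bisph_nn_le_diff:
  fixes f :: "'a::euclidean_space \<Rightarrow> ennreal"
  assumes [measurable]: "borel_fun f" "borel_fun a" "borel_fun b" and d: "2 \<le> DIM('a)"
  shows "bisph_nn t f a x \<le> bisph_nn t f b x + bisph_diff t f a b x" "bisph_diff t f a b x \<le> bisph_nn t f a x + bisph_nn t f b x"
proof -
  note S = bisph_nn_slice[OF assms(1) _ d]
  show "bisph_nn t f a x \<le> bisph_nn t f b x + bisph_diff t f a b x"
    unfolding S[OF assms(2)] S[OF assms(3)] bisph_diff_def distrib_left[symmetric]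
    by (subst nn_integral_add[symmetric], measurable)
       (intro mult_left_mono nn_integral_mono, unfold distrib_left[symmetric], intro mult_left_mono le_add_absdiff, auto)
  show "bisph_diff t f a b x \<le> bisph_nn t f a x + bisph_nn t f b x"
    unfolding S[OF assms(2)] S[OF assms(3)] bisph_diff_def distrib_left[symmetric]
    by (subst nn_integral_add[symmetric], measurable)
       (intro mult_left_mono nn_integral_mono, unfold distrib_left[symmetric], intro mult_left_mono absdiff_le_add, auto)
qed

text \<open>By the symmetry of the sphere: \<open>height u\<close> is the norm of the second
  component, and exchanging the components turns it into the norm of the first, whose distribution
  has bounded density.\<close>

lemma nn_integral_height_le:
  fixes D :: "real \<Rightarrow> ennreal"
  assumes [measurable]: "borel_fun D" and d: "2 \<le> DIM('a::euclidean_space)"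
  shows "(NI u. indicator (ball (0::'a) 1) u * ennreal (height u ^ (DIM('a) - 2)) * D (height u)) \<le> (NI u. indicator (unit_ball::'a set) u * D (norm u))"
proof -
  let ?m = "emeasure lborel (unit_ball :: 'a set)" and ?d = "ennreal (real DIM('a))"
  let ?L = "NI u. indicator (ball (0::'a) 1) u * ennreal (height u ^ (DIM('a) - 2)) * D (height u)"
  have "(\<integral>\<^sup>+w. D (norm (snd w)) \<partial>(sphere_measure :: ('a \<times> 'a) measure)) = ?d * (NI u. indicator (ball (0::'a) 1) u * ennreal (height u ^ (DIM('a) - 2)) *
     (NI z. indicator (unit_ball::'a set) z * D (norm (snd (u, height u *\<^sub>R sgn z)))))"
    by (rule nn_integral_sphere_slice[OF _ d]) measurable
  also have "\<dots> = ?d * (NI u. ?m * (indicator (ball (0::'a) 1) u * ennreal (height u ^ (DIM('a) - 2)) * D (height u)))"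
  proof (intro arg_cong[where f="\<lambda>x. ?d * x"] nn_integral_cong)
    fix u :: 'a
    have "(NI z. indicator (unit_ball::'a set) z * D (norm (snd (u, height u *\<^sub>R sgn z)))) = (NI z. indicator (unit_ball::'a set) z * D (height u))"
      if "norm u < 1"
    proof (rule nn_integral_cong_AE, use AE_lborel_singleton[of 0] in eventually_elim)
      fix z :: 'a assume "z \<noteq> 0"
      then have "norm (height u *\<^sub>R sgn z) = height u" using height_pos[OF that] by (rule sgn_polar(2)[rotated])
      then show "indicator (unit_ball::'a set) z * D (norm (snd (u, height u *\<^sub>R sgn z))) = indicator unit_ball z * D (height u)"
        by (simp only: snd_conv)
    qed
    also have "(NI z. indicator (unit_ball::'a set) z * D (height u)) = ?m * D (height u)" by (subst nn_integral_multc) simp_all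
    finally show "indicator (ball (0::'a) 1) u * ennreal (height u ^ (DIM('a) - 2)) *
       (NI z. indicator (unit_ball::'a set) z * D (norm (snd (u, height u *\<^sub>R sgn z))))
      = ?m * (indicator (ball (0::'a) 1) u * ennreal (height u ^ (DIM('a) - 2)) * D (height u))"
      by (cases "norm u < 1") (simp_all add: mult_ac)
  qed
  also have "\<dots> = ?d * ?m * ?L" by (subst nn_integral_cmult, measurable) (simp only: mult.assoc)
  finally have "?d * ?m * ?L = (\<integral>\<^sup>+w. D (norm (snd w)) \<partial>(sphere_measure :: ('a \<times> 'a) measure))" ..
  also have "\<dots> = (\<integral>\<^sup>+w. D (norm (fst w)) \<partial>(sphere_measure :: ('a \<times> 'a) measure))"
    by (subst nn_integral_sphere_swap[symmetric]) simp_all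
  also have "\<dots> \<le> ?d * ?m * (NI u. indicator (ball (0::'a) 1) u * D (norm u))"
    by (rule nn_integral_sphere_fst_le[OF _ d]) measurable
  also have "\<dots> \<le> ?d * ?m * (NI u. indicator (unit_ball::'a set) u * D (norm u))"
    by (intro mult_left_mono nn_integral_mono mult_right_mono indicator_leI) simp_all
  finally have "?d * ?m * ?L \<le> ?d * ?m * (NI u. indicator (unit_ball::'a set) u * D (norm u))" .
  moreover have "0 < ?d * ?m" "?d * ?m < top"
    using emeasure_unit_ball[where 'a='a] DIM_positive[where 'a='a] by (auto simp: ennreal_mult_less_top ennreal_zero_less_mult_iff)
  ultimately show ?thesis by (subst (asm) ennreal_mult_le_mult_iff) auto
qed

text \<open>The bound A is pulled out, \<open>nn_integral_height_le\<close> removes the slicing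
  weight, and Cauchy-Schwarz in v produces the square averaged over radii that the shell estimate
  controls.\<close>

lemma bisph_diff_L2:
  fixes f :: "'a::euclidean_space \<Rightarrow> ennreal" and t :: real
  assumes [measurable]: "borel_fun f" "borel_fun a" "borel_fun b" and d: "2 \<le> DIM('a)"
    and A: "\<And>y. f y \<le> A"
  defines "D v x \<equiv> absdiff (sph_nn (t * norm (v::'a)) a x) (sph_nn (t * norm v) b x)"
  shows "(NI x. bisph_diff t f a b x * bisph_diff t f a b x) \<le> slice_const TYPE('a) * ennreal (real DIM('a)) * (A * A) *
    (NI x. NI v. indicator (unit_ball::'a set) v * (D v x * D v x))"
proof -
  let ?m = "emeasure lborel (unit_ball :: 'a set)" and ?d = "ennreal (real DIM('a))"
  have [measurable]: "(\<lambda>(x, v). D v x) \<in> borel_measurable (borel \<Otimes>\<^sub>M borel)" "(\<lambda>v. D v x) \<in> borel_measurable borel" for x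
    unfolding D_def by measurable
  have pt: "bisph_diff t f a b x * bisph_diff t f a b x \<le> ?d * ?m * ?d * (A * A) * (NI v. indicator (unit_ball::'a set) v * (D v x * D v x))" for x
  proof -
    have "bisph_diff t f a b x \<le> ?d * (NI u. A * (indicator (ball (0::'a) 1) u * ennreal (height u ^ (DIM('a) - 2)) * absdiff (sph_nn (t * height u) a x) (sph_nn (t * height u) b x)))"
      unfolding bisph_diff_def
    proof (intro mult_left_mono nn_integral_mono)
      fix u :: 'a
      let ?i = "indicator (ball (0::'a) 1) u * ennreal (height u ^ (DIM('a) - 2))" and ?D = "absdiff (sph_nn (t * height u) a x) (sph_nn (t * height u) b x)"
      have "?i * (f (x - t *\<^sub>R u) * ?D) \<le> ?i * (A * ?D)" by (intro mult_left_mono mult_right_mono A) simp_all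
      then show "?i * (f (x - t *\<^sub>R u) * ?D) \<le> A * (?i * ?D)" by (simp only: mult_ac)
    qed simp
    also have "\<dots> = ?d * (A * (NI u. indicator (ball (0::'a) 1) u * ennreal (height u ^ (DIM('a) - 2)) * absdiff (sph_nn (t * height u) a x) (sph_nn (t * height u) b x)))"
      by (subst nn_integral_cmult, measurable)
    also have "\<dots> \<le> ?d * (A * (NI v. indicator (unit_ball::'a set) v * D v x))"
      unfolding D_def by (intro mult_left_mono nn_integral_height_le[where D="\<lambda>s. absdiff (sph_nn (t * s) a x) (sph_nn (t * s) b x)", OF _ d] zero_le) measurable
    finally have 1: "bisph_diff t f a b x \<le> ?d * (A * (NI v. indicator (unit_ball::'a set) v * D v x))" .
    have 2: "(NI v. indicator (unit_ball::'a set) v * D v x) * (NI v. indicator (unit_ball::'a set) v * D v x)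
      \<le> ?m * (NI v. indicator (unit_ball::'a set) v * (D v x * D v x))"
    proof -
      have sq: "(indicator (unit_ball::'a set) v :: ennreal)\<^sup>2 = indicator unit_ball v" for v by (simp add: indicator_def)
      have "(NI v. indicator (unit_ball::'a set) v * (indicator unit_ball v * D v x))\<^sup>2
        \<le> (NI v. (indicator (unit_ball::'a set) v)\<^sup>2) * (NI v. (indicator unit_ball v * D v x)\<^sup>2)"
        by (rule Cauchy_Schwarz_nn_integral) measurable
      moreover have "indicator (unit_ball::'a set) v * (indicator unit_ball v * D v x) = indicator unit_ball v * D v x" for v
        by (simp add: indicator_def)
      ultimately show ?thesis unfolding power_mult_distrib sq by (simp add: power2_eq_square)
    qed
    have "bisph_diff t f a b x * bisph_diff t f a b x \<le> (?d * (A * (NI v. indicator (unit_ball::'a set) v * D v x))) * (?d * (A * (NI v. indicator (unit_ball::'a set) v * D v x)))"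
      by (intro mult_mono 1) simp_all
    also have "\<dots> = ?d * ?d * (A * A) * ((NI v. indicator (unit_ball::'a set) v * D v x) * (NI v. indicator (unit_ball::'a set) v * D v x))"
      by (simp only: mult_ac)
    also have "\<dots> \<le> ?d * ?d * (A * A) * (?m * (NI v. indicator (unit_ball::'a set) v * (D v x * D v x)))"
      by (intro mult_left_mono 2) simp
    finally show ?thesis by (simp only: mult_ac)
  qed
  have "(NI x. bisph_diff t f a b x * bisph_diff t f a b x) \<le> (NI x. ?d * ?m * ?d * (A * A) * (NI v. indicator (unit_ball::'a set) v * (D v x * D v x)))"
    by (intro nn_integral_mono pt)
  also have "\<dots> = ?d * ?m * ?d * (A * A) * (NI x. NI v. indicator (unit_ball::'a set) v * (D v x * D v x))"
    by (rule nn_integral_cmult) measurable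
  finally show ?thesis unfolding slice_const_def .
qed

section \<open>The terms of the telescoping sum\<close>

text \<open>Relative to l, the second function passes from scale m - 1 to scale m while the first
  stays at scale n. Telescoping uses n = m and n = m - 1.\<close>

definition bisph_diff_max :: "nat \<Rightarrow> nat \<Rightarrow> ('a::euclidean_space \<Rightarrow> ennreal) \<Rightarrow> ('a \<Rightarrow> ennreal) \<Rightarrow> 'a \<Rightarrow> ennreal" where
  "bisph_diff_max n m f g x = (SUP l::int. bisph_diff (2 powi (- l)) (cell_avg (l + int n) f) (cell_avg (l + int m) g) (cell_avg (l + int m - 1) g) x)"

lemma bisph_diff_max_measurable [measurable (raw)]:
  assumes [measurable]: "borel_fun f" "borel_fun g" "h \<in> borel_measurable M"
  shows "(\<lambda>w. bisph_diff_max n m f g (h w)) \<in> borel_measurable M"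
  unfolding bisph_diff_max_def by measurable

lemma emeasure_less_square:
  assumes [measurable]: "X \<in> borel_measurable lborel" and \<kappa>: "0 < \<kappa>"
  shows "emeasure lborel {x. ennreal \<kappa> < X x} \<le> ennreal (1 / (\<kappa> * \<kappa>)) * (NI x. X x * X x)"
proof -
  have "emeasure lborel {x. ennreal \<kappa> < X x} = (NI x. indicator {x. ennreal \<kappa> < X x} x)" by simp
  also have "\<dots> \<le> (NI x. ennreal (1 / (\<kappa> * \<kappa>)) * (X x * X x))"
  proof (rule nn_integral_mono)
    fix x
    show "indicator {x. ennreal \<kappa> < X x} x \<le> ennreal (1 / (\<kappa> * \<kappa>)) * (X x * X x)"
    proof (cases "ennreal \<kappa> < X x")
      case True
      have "1 = ennreal (1 / (\<kappa> * \<kappa>)) * (ennreal \<kappa> * ennreal \<kappa>)" using \<kappa> by (simp add: ennreal_mult[symmetric])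
      also have "\<dots> \<le> ennreal (1 / (\<kappa> * \<kappa>)) * (X x * X x)" using True by (intro mult_left_mono mult_mono) auto
      finally show ?thesis using True by simp
    qed simp
  qed
  also have "\<dots> = ennreal (1 / (\<kappa> * \<kappa>)) * (NI x. X x * X x)" by (rule nn_integral_cmult) measurable
  finally show ?thesis .
qed

lemma emeasure_less_Markov:
  assumes [measurable]: "X \<in> borel_measurable lborel" and \<kappa>: "0 < \<kappa>"
  shows "emeasure lborel {x. ennreal \<kappa> < X x} \<le> ennreal (1 / \<kappa>) * (NI x. X x)"
proof -
  have "emeasure lborel {x. ennreal \<kappa> < X x} = (NI x. indicator {x. ennreal \<kappa> < X x} x)" by simp
  also have "\<dots> \<le> (NI x. ennreal (1 / \<kappa>) * X x)"
  proof (rule nn_integral_mono)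
    fix x
    show "indicator {x. ennreal \<kappa> < X x} x \<le> ennreal (1 / \<kappa>) * X x"
    proof (cases "ennreal \<kappa> < X x")
      case True
      have "1 = ennreal (1 / \<kappa>) * ennreal \<kappa>" using \<kappa> by (simp add: ennreal_mult[symmetric])
      also have "\<dots> \<le> ennreal (1 / \<kappa>) * X x" using True by (intro mult_left_mono) auto
      finally show ?thesis using True by simp
    qed simp
  qed
  also have "\<dots> = ennreal (1 / \<kappa>) * (NI x. X x)" by (rule nn_integral_cmult) measurable
  finally show ?thesis .
qed

text \<open>The form of the L^2 gain suited to a slice of g between two heights, with G the set
  where g exceeds the lower one. The level set of the supremum is covered by those of the single
  scales; Chebyshev with squares and \<open>cell_avg_L2_sum\<close> bound the total measure.\<close>

lemma bisph_diff_max_gain: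
  assumes d: "2 \<le> DIM('a::euclidean_space)"
  obtains K :: real where "0 < K"
    "\<And>n m f g G A b \<kappa>. f \<in> borel_measurable borel \<Longrightarrow> borel_fun g \<Longrightarrow> G \<in> sets borel \<Longrightarrow>
      (\<And>y. f y \<le> ennreal A) \<Longrightarrow> (\<And>y. g y \<le> ennreal b * indicator G y) \<Longrightarrow> 0 < A \<Longrightarrow> 0 < b \<Longrightarrow> 0 < \<kappa> \<Longrightarrow>
      emeasure lborel {x::'a. ennreal \<kappa> < bisph_diff_max n m f g x} \<le>
        ennreal (K * sqrt (1 / 2 ^ m) * (A * A * (b * b) / (\<kappa> * \<kappa>))) * emeasure lborel G"
proof -
  obtain e :: 'a where e: "norm e = 1" using vector_choose_size[of 1] by auto
  let ?S = "slice_const TYPE('a) * ennreal (real DIM('a)) * cap_const e"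
  have "?S < top" using slice_const_finite[where 'a='a] cap_const_finite[OF e] by (simp add: ennreal_mult_less_top)
  then obtain s where s: "?S = ennreal s" "0 \<le> s" using less_top_ennreal by blast
  define K where "K = (1 + s) * sqrt (2 * real DIM('a))"
  show thesis
  proof (rule that[of K])
    show K0: "0 < K" using s(2) by (simp add: K_def)
    fix n m :: nat and f g :: "'a \<Rightarrow> ennreal" and G A b and \<kappa> :: real
    assume [measurable]: "borel_fun f" "borel_fun g" "G \<in> sets borel"
      and f: "\<And>y. f y \<le> ennreal A" and g: "\<And>y. g y \<le> ennreal b * indicator G y" and pos: "0 < A" "0 < b" "0 < \<kappa>"
    let ?q = "sqrt (1 / 2 ^ m)"
    have cpos: "0 < K * ?q * (A * A * (b * b) / (\<kappa> * \<kappa>))" using K0 pos by simp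
    show "emeasure lborel {x. ennreal \<kappa> < bisph_diff_max n m f g x} \<le> ennreal (K * ?q * (A * A * (b * b) / (\<kappa> * \<kappa>))) * emeasure lborel G"
    proof (cases "emeasure lborel G = top")
      case True
      have "ennreal (K * ?q * (A * A * (b * b) / (\<kappa> * \<kappa>))) \<noteq> 0" using cpos by (simp only: ennreal_eq_0_iff not_le)
      then have "ennreal (K * ?q * (A * A * (b * b) / (\<kappa> * \<kappa>))) * emeasure lborel G = top" unfolding True by (simp only: ennreal_mult_top if_False)
      then show ?thesis by (simp only: top_greatest)
    next
      case False
      have gb: "g y \<le> ennreal b" for y using g[of y] by (rule order_trans) (simp add: indicator_def)
      have "(NI x. g x) \<le> (NI x. ennreal b * indicator G x)" by (intro nn_integral_mono g)
      also have "\<dots> = ennreal b * emeasure lborel G" by (rule nn_integral_cmult_indicator) simp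
      also have "\<dots> < top" using False by (simp add: ennreal_mult_less_top less_top)
      finally have gfin: "(NI x. g x) < top" .
      have "(NI x. g x * g x) \<le> (NI x. ennreal (b * b) * indicator G x)"
      proof (rule nn_integral_mono)
        fix x
        have "g x * g x \<le> (ennreal b * indicator G x) * (ennreal b * indicator G x)" by (intro mult_mono g) simp_all
        then show "g x * g x \<le> ennreal (b * b) * indicator G x" using pos by (cases "x \<in> G") (simp_all add: ennreal_mult)
      qed
      also have "\<dots> = ennreal (b * b) * emeasure lborel G" by (rule nn_integral_cmult_indicator) simp
      finally have g2: "(NI x. g x * g x) \<le> ennreal (b * b) * emeasure lborel G" .
      define X where "X l = bisph_diff (2 powi (- l)) (cell_avg (l + int n) f) (cell_avg (l + int m) g) (cell_avg (l + int m - 1) g)" for l :: int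
      have [measurable]: "X l \<in> borel_measurable borel" for l unfolding X_def by measurable
      define D where "D l = (NI x. absdiff (cell_avg (l + int m) g x) (cell_avg (l + int m - 1) g x) * absdiff (cell_avg (l + int m) g x) (cell_avg (l + int m - 1) g x))" for l :: int
      have "bisph_diff_max n m f g x = (SUP l. X l x)" for x unfolding bisph_diff_max_def X_def ..
      then have "{x. ennreal \<kappa> < bisph_diff_max n m f g x} = (\<Union>l. {x. ennreal \<kappa> < X l x})"
        by (auto simp: less_SUP_iff)
      then have "emeasure lborel {x. ennreal \<kappa> < bisph_diff_max n m f g x} \<le> (\<integral>\<^sup>+l. emeasure lborel {x. ennreal \<kappa> < X l x} \<partial>count_space UNIV)"
        using emeasure_UN_int_le[of "\<lambda>l. {x. ennreal \<kappa> < X l x}" lborel] by simp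
      also have "\<dots> \<le> (\<integral>\<^sup>+l. ennreal (1 / (\<kappa> * \<kappa>) * (A * A) * (s * (sqrt (2 * real DIM('a)) * ?q))) * D l \<partial>count_space UNIV)"
      proof (rule nn_integral_mono)
        fix l :: int
        let ?t = "(2::real) powi (- l)"
        \<comment> \<open>The ratio of the cell diameter bound to the radius is the same for all l.
          Its square root is the gain 2^(-m/2).\<close>
        have rat: "real DIM('a) * 2 powi (- (l + int m - 1)) / ?t = 2 * real DIM('a) * (1 / 2 ^ m)"
          by (simp add: power_int_minus power_int_add power_int_diff field_simps)
        have "(NI x. X l x * X l x) \<le> slice_const TYPE('a) * ennreal (real DIM('a)) * (ennreal A * ennreal A) *
          (NI x. NI v. indicator (unit_ball::'a set) v * (absdiff (sph_nn (?t * norm (v::'a)) (cell_avg (l + int m) g) x) (sph_nn (?t * norm v) (cell_avg (l + int m - 1) g) x)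
             * absdiff (sph_nn (?t * norm (v::'a)) (cell_avg (l + int m) g) x) (sph_nn (?t * norm v) (cell_avg (l + int m - 1) g) x)))"
          unfolding X_def by (rule bisph_diff_L2[OF _ _ _ d]) (measurable, intro cell_avg_le f)
        also have "\<dots> \<le> slice_const TYPE('a) * ennreal (real DIM('a)) * (ennreal A * ennreal A) * (cap_const e * ennreal (sqrt (2 * real DIM('a) * (1 / 2 ^ m))) * D l)"
          unfolding D_def rat[symmetric] by (intro mult_left_mono sph_nn_cell_difference[OF _ gb gfin d e]) simp_all
        also have "\<dots> = ?S * (ennreal A * ennreal A) * ennreal (sqrt (2 * real DIM('a) * (1 / 2 ^ m))) * D l" by (simp only: mult_ac)
        also have "sqrt (2 * real DIM('a) * (1 / 2 ^ m)) = sqrt (2 * real DIM('a)) * ?q" by (rule real_sqrt_mult)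
        finally have XX: "(NI x. X l x * X l x) \<le> ennreal s * (ennreal A * ennreal A) * ennreal (sqrt (2 * real DIM('a)) * ?q) * D l" unfolding s(1) .
        have "emeasure lborel {x. ennreal \<kappa> < X l x} \<le> ennreal (1 / (\<kappa> * \<kappa>)) * (NI x. X l x * X l x)"
          by (rule emeasure_less_square[OF _ pos(3)]) measurable
        also have "\<dots> \<le> ennreal (1 / (\<kappa> * \<kappa>)) * (ennreal s * (ennreal A * ennreal A) * ennreal (sqrt (2 * real DIM('a)) * ?q) * D l)"
          by (rule mult_left_mono[OF XX]) simp
        also have "\<dots> = (ennreal (1 / (\<kappa> * \<kappa>)) * (ennreal A * ennreal A) * (ennreal s * ennreal (sqrt (2 * real DIM('a)) * ?q))) * D l" by (simp only: mult_ac)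
        also have "ennreal (1 / (\<kappa> * \<kappa>)) * (ennreal A * ennreal A) * (ennreal s * ennreal (sqrt (2 * real DIM('a)) * ?q)) = ennreal (1 / (\<kappa> * \<kappa>) * (A * A) * (s * (sqrt (2 * real DIM('a)) * ?q)))"
          using pos s(2) by (simp add: ennreal_mult[symmetric] mult_ac del: ennreal_numeral)
        finally show "emeasure lborel {x. ennreal \<kappa> < X l x} \<le> ennreal (1 / (\<kappa> * \<kappa>) * (A * A) * (s * (sqrt (2 * real DIM('a)) * ?q))) * D l" .
      qed
      also have "\<dots> = ennreal (1 / (\<kappa> * \<kappa>) * (A * A) * (s * (sqrt (2 * real DIM('a)) * ?q))) * (\<integral>\<^sup>+l. D l \<partial>count_space UNIV)"
        by (rule nn_integral_cmult) simp
      also have "\<dots> \<le> ennreal (1 / (\<kappa> * \<kappa>) * (A * A) * (s * (sqrt (2 * real DIM('a)) * ?q))) * (ennreal (b * b) * emeasure lborel G)"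
        unfolding D_def by (intro mult_left_mono order_trans[OF cell_avg_L2_sum[OF _ gb gfin] g2]) simp_all
      also have "\<dots> = ennreal ((1 / (\<kappa> * \<kappa>) * (A * A) * (s * (sqrt (2 * real DIM('a)) * ?q))) * (b * b)) * emeasure lborel G"
        using pos s(2) by (subst ennreal_mult) (simp_all add: mult.assoc)
      also have "\<dots> \<le> ennreal (K * ?q * (A * A * (b * b) / (\<kappa> * \<kappa>))) * emeasure lborel G"
      proof (intro mult_right_mono ennreal_leI)
        have "s * (sqrt (2 * real DIM('a)) * (?q * (A * A * (b * b) / (\<kappa> * \<kappa>)))) \<le> (1 + s) * (sqrt (2 * real DIM('a)) * (?q * (A * A * (b * b) / (\<kappa> * \<kappa>))))"
          using pos by (intro mult_right_mono) simp_all
        then show "(1 / (\<kappa> * \<kappa>) * (A * A) * (s * (sqrt (2 * real DIM('a)) * ?q))) * (b * b) \<le> K * ?q * (A * A * (b * b) / (\<kappa> * \<kappa>))"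
          unfolding K_def by (simp add: mult_ac)
      qed simp
      finally show ?thesis .
    qed
  qed
qed

section \<open>Stopping times and exceptional sets\<close>

definition above :: "real \<Rightarrow> ('a \<Rightarrow> ennreal) \<Rightarrow> 'a \<Rightarrow> ennreal" where
  "above \<alpha> f x = (if ennreal \<alpha> < f x then f x else 0)"

lemma above_measurable [measurable (raw)]:
  assumes [measurable]: "borel_fun f" "g \<in> borel_measurable M"
  shows "(\<lambda>w. above \<alpha> f (g w)) \<in> borel_measurable M"
  unfolding above_def by measurable

lemma le_add_above: "f x \<le> ennreal \<alpha> + above \<alpha> f x"
  by (auto simp: above_def)

text \<open>The set where the maximal function over dyadic cells of side at least 2^(-k) exceeds
  \<alpha>.\<close>

definition stop_set :: "real \<Rightarrow> ('a::euclidean_space \<Rightarrow> ennreal) \<Rightarrow> int \<Rightarrow> 'a set" where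
  "stop_set \<alpha> f k = (\<Union>k'\<in>{..k}. {y. ennreal \<alpha> < cell_avg k' f y})"

text \<open>For integrable f the union of the maximal dyadic cells with average above \<alpha>, each
  enlarged by its neighbours. The cells that stop exactly at scale l are unions of whole cells of
  that scale, so the condition on the measure says that x is near one of them; stated by an integral
  it is visibly measurable.\<close>

definition exc_set :: "real \<Rightarrow> ('a::euclidean_space \<Rightarrow> ennreal) \<Rightarrow> 'a set" where
  "exc_set \<alpha> f = (\<Union>l. {x. ennreal (1 / (2 powi l) ^ DIM('a)) \<le>
     (NI y. indicator (stop_set \<alpha> f l - stop_set \<alpha> f (l - 1)) y * of_bool (cell_near l x y))})"

lemma stop_set_sets [measurable]: "borel_fun f \<Longrightarrow> stop_set \<alpha> f k \<in> sets borel"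
  unfolding stop_set_def by (intro sets.countable_UN'') auto

lemma stop_set_mono: "k \<le> k' \<Longrightarrow> stop_set \<alpha> f k \<subseteq> stop_set \<alpha> f k'"
  unfolding stop_set_def by (intro UN_mono) auto

lemma stop_set_cell: "cell_eq k y y' \<Longrightarrow> y \<in> stop_set \<alpha> f k \<longleftrightarrow> y' \<in> stop_set \<alpha> f k"
  unfolding stop_set_def using cell_avg_cong_cell[OF cell_eq_coarser[of _ k y y']] by auto

lemma not_stop_set: "y \<notin> stop_set \<alpha> f k \<Longrightarrow> cell_avg k f y \<le> ennreal \<alpha>"
  unfolding stop_set_def by (auto simp: not_less)

lemma of_bool_near_measurable [measurable]:
  "(\<lambda>(x, y). of_bool (cell_near l x y) :: ennreal) \<in> borel_measurable (borel \<Otimes>\<^sub>M borel)"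
  "(\<lambda>y. of_bool (cell_near l x y) :: ennreal) \<in> borel_measurable borel"
  unfolding of_bool_def by measurable

lemma exc_set_sets [measurable]: 
  assumes [measurable]: "borel_fun f" shows "exc_set \<alpha> f \<in> sets borel"
proof -
  have [measurable]: "(\<lambda>x. NI y. indicator (stop_set \<alpha> f l - stop_set \<alpha> f (l - 1)) y * of_bool (cell_near l x y)) \<in> borel_measurable borel" for l
    by measurable
  show ?thesis unfolding exc_set_def by measurable
qed

text \<open>The stopping sets increase, so each y enters them at most once and lies in at most m of
  the differences.\<close>

lemma stop_set_window:
  fixes f g :: "'a::euclidean_space \<Rightarrow> ennreal"
  assumes [measurable]: "borel_fun f" "borel_fun g"
  shows "(\<integral>\<^sup>+l. (NI y. indicator (stop_set \<alpha> f (l + int m) - stop_set \<alpha> f l) y * g y) \<partial>count_space UNIV) \<le> ennreal (real m) * (NI y. g y)"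
proof -
  have "(\<integral>\<^sup>+l. (NI y. indicator (stop_set \<alpha> f (l + int m) - stop_set \<alpha> f l) y * g y) \<partial>count_space UNIV)
    = (NI y. (\<integral>\<^sup>+l. indicator (stop_set \<alpha> f (l + int m) - stop_set \<alpha> f l) y * g y \<partial>count_space UNIV))"
    by (rule nn_integral_count_space_nn_integral[symmetric]) auto
  also have "\<dots> \<le> (NI y. ennreal (real m) * g y)"
  proof (rule nn_integral_mono)
    fix y
    have "(\<integral>\<^sup>+l. indicator {l. y \<in> stop_set \<alpha> f (l + int m) \<and> \<not> y \<in> stop_set \<alpha> f l} l \<partial>count_space UNIV) \<le> ennreal (real m)"
      by (rule count_int_window[of "\<lambda>k. y \<in> stop_set \<alpha> f k"]) (use stop_set_mono in blast)
    then have "(\<integral>\<^sup>+l. indicator {l. y \<in> stop_set \<alpha> f (l + int m) \<and> \<not> y \<in> stop_set \<alpha> f l} l \<partial>count_space UNIV) * g y \<le> ennreal (real m) * g y"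
      by (rule mult_right_mono) simp
    moreover have "(\<integral>\<^sup>+l. indicator (stop_set \<alpha> f (l + int m) - stop_set \<alpha> f l) y * g y \<partial>count_space UNIV)
      = (\<integral>\<^sup>+l. indicator {l. y \<in> stop_set \<alpha> f (l + int m) \<and> \<not> y \<in> stop_set \<alpha> f l} l \<partial>count_space UNIV) * g y"
      by (subst nn_integral_multc[symmetric]) (simp_all add: indicator_def)
    ultimately show "(\<integral>\<^sup>+l. indicator (stop_set \<alpha> f (l + int m) - stop_set \<alpha> f l) y * g y \<partial>count_space UNIV) \<le> ennreal (real m) * g y" by simp
  qed
  also have "\<dots> = ennreal (real m) * (NI y. g y)" by (rule nn_integral_cmult) measurable
  finally show ?thesis .
qed

text \<open>Calderon-Zygmund counting. On the points that stop at scale l the cell average exceeds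
  \<alpha>, so \<alpha> times their measure is at most the integral of f over them. These sets are
  disjoint for different l, and passing to the neighbouring cells costs the factor 3^d.\<close>

lemma emeasure_exc_set:
  fixes f :: "'a::euclidean_space \<Rightarrow> ennreal"
  assumes [measurable]: "borel_fun f" and \<alpha>: "0 < \<alpha>"
  shows "emeasure lborel (exc_set \<alpha> f) \<le> ennreal (3 ^ DIM('a)) * (ennreal (1 / \<alpha>) * (NI y. f y))"
proof -
  define S where "S l = stop_set \<alpha> f l - stop_set \<alpha> f (l - 1)" for l
  have S_sets[measurable]: "S l \<in> sets borel" for l unfolding S_def by measurable
  define N where "N l x = (NI y. indicator (S l) y * of_bool (cell_near l x y))" for l and x :: 'a
  have [measurable]: "N l \<in> borel_measurable borel" for l unfolding N_def by measurable
  have ex: "exc_set \<alpha> f = (\<Union>l. {x. ennreal (1 / (2 powi l) ^ DIM('a)) \<le> N l x})"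
    unfolding exc_set_def N_def S_def ..
  have "emeasure lborel (exc_set \<alpha> f) \<le> (\<integral>\<^sup>+l. emeasure lborel {x. ennreal (1 / (2 powi l) ^ DIM('a)) \<le> N l x} \<partial>count_space UNIV)"
    unfolding ex by (rule emeasure_UN_int_le) measurable
  also have "\<dots> \<le> (\<integral>\<^sup>+l. ennreal (3 ^ DIM('a) * (1 / \<alpha>)) * (NI y. indicator (S l) y * f y) \<partial>count_space UNIV)"
  proof (rule nn_integral_mono)
    fix l :: int
    let ?V = "(2 powi l :: real) ^ DIM('a)"
    have V: "0 < ?V" by simp
    have "emeasure lborel {x. ennreal (1 / ?V) \<le> N l x} = (NI x. indicator {x. ennreal (1 / ?V) \<le> N l x} x)" by simp
    also have "\<dots> \<le> (NI x. ennreal ?V * N l x)"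
    proof (rule nn_integral_mono)
      fix x
      show "indicator {x. ennreal (1 / ?V) \<le> N l x} x \<le> ennreal ?V * N l x"
      proof (cases "ennreal (1 / ?V) \<le> N l x")
        case True
        have "1 = ennreal ?V * ennreal (1 / ?V)" by (rule cell_volume_cancel[symmetric])
        also have "\<dots> \<le> ennreal ?V * N l x" using True by (rule mult_left_mono) simp
        finally show ?thesis using True by simp
      qed simp
    qed
    also have "\<dots> = ennreal ?V * (NI x. N l x)" by (rule nn_integral_cmult) measurable
    also have "(NI x. N l x) = (NI y. NI x. indicator (S l) y * of_bool (cell_near l x y))"
      unfolding N_def by (rule nn_integral_lborel_swap) measurable
    also have "\<dots> = (NI y. indicator (S l) y * ennreal (3 ^ DIM('a) / ?V))"
    proof (rule nn_integral_cong)
      fix y :: 'a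
      have [measurable]: "(\<lambda>x. of_bool (cell_near l x y) :: ennreal) \<in> borel_measurable borel" unfolding of_bool_def by measurable
      have "(NI x. of_bool (cell_near l x y)) = (NI x. indicator {x. cell_near l y x} x)"
        by (rule nn_integral_cong) (simp add: indicator_def cell_near_sym[of l y])
      then show "(NI x. indicator (S l) y * of_bool (cell_near l x y)) = indicator (S l) y * ennreal (3 ^ DIM('a) / ?V)"
        by (subst nn_integral_cmult, measurable) (simp only: emeasure_cells(2))
    qed
    also have "\<dots> = emeasure lborel (S l) * ennreal (3 ^ DIM('a) / ?V)" by (subst nn_integral_multc) simp_all
    also have "ennreal ?V * (emeasure lborel (S l) * ennreal (3 ^ DIM('a) / ?V)) = (ennreal ?V * ennreal (3 ^ DIM('a) / ?V)) * emeasure lborel (S l)"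
      by (simp only: mult_ac)
    also have "ennreal ?V * ennreal (3 ^ DIM('a) / ?V) = ennreal (3 ^ DIM('a))" using V by (subst ennreal_mult[symmetric]) simp_all
    also have "emeasure lborel (S l) \<le> ennreal (1 / \<alpha>) * (NI y. indicator (S l) y * f y)"
    proof -
      have "emeasure lborel (S l) = (NI y. indicator (S l) y)" by simp
      also have "\<dots> \<le> (NI y. ennreal (1 / \<alpha>) * (indicator (S l) y * cell_avg l f y))"
      proof (rule nn_integral_mono)
        fix y
        show "indicator (S l) y \<le> ennreal (1 / \<alpha>) * (indicator (S l) y * cell_avg l f y)"
        proof (cases "y \<in> S l")
          case True
          then obtain k' where k': "k' \<le> l" "ennreal \<alpha> < cell_avg k' f y" "y \<notin> stop_set \<alpha> f (l - 1)"
            by (auto simp: S_def stop_set_def)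
          then have "\<not> k' \<le> l - 1" by (auto simp: stop_set_def)
          then have "k' = l" using k'(1) by simp
          then have "ennreal \<alpha> \<le> cell_avg l f y" using k'(2) by simp
          then have "ennreal (1 / \<alpha>) * ennreal \<alpha> \<le> ennreal (1 / \<alpha>) * cell_avg l f y" by (rule mult_left_mono) simp
          moreover have "ennreal (1 / \<alpha>) * ennreal \<alpha> = 1" using \<alpha> by (simp add: ennreal_mult[symmetric])
          ultimately show ?thesis using True by simp
        qed simp
      qed
      also have "\<dots> = ennreal (1 / \<alpha>) * (NI y. indicator (S l) y * cell_avg l f y)" by (rule nn_integral_cmult) measurable
      also have "(NI y. indicator (S l) y * cell_avg l f y) = (NI y. indicator (S l) y * f y)"
      proof (rule cell_avg_adjoint_const)
        fix y y' :: 'a assume yy: "cell_eq l y y'"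
        have "cell_eq (l - 1) y y'" by (rule cell_eq_coarser[OF _ yy]) simp
        from stop_set_cell[OF this, of \<alpha> f] stop_set_cell[OF yy, of \<alpha> f]
        show "indicator (S l) y = (indicator (S l) y' :: ennreal)"
          unfolding S_def indicator_def Diff_iff by simp
      qed measurable
      finally show ?thesis .
    qed
    finally have "emeasure lborel {x. ennreal (1 / ?V) \<le> N l x} \<le> ennreal (3 ^ DIM('a)) * (ennreal (1 / \<alpha>) * (NI y. indicator (S l) y * f y))"
      by (simp add: mult_left_mono)
    also have "\<dots> = ennreal (3 ^ DIM('a) * (1 / \<alpha>)) * (NI y. indicator (S l) y * f y)"
      using \<alpha> by (subst ennreal_mult) (simp_all add: mult.assoc)
    finally show "emeasure lborel {x. ennreal (1 / ?V) \<le> N l x} \<le> ennreal (3 ^ DIM('a) * (1 / \<alpha>)) * (NI y. indicator (S l) y * f y)" .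
  qed
  also have "\<dots> = ennreal (3 ^ DIM('a) * (1 / \<alpha>)) * (\<integral>\<^sup>+l. (NI y. indicator (S l) y * f y) \<partial>count_space UNIV)"
    by (rule nn_integral_cmult) simp
  \<comment> \<open>An index shift by one, to reach the form of \<open>stop_set_window\<close> with
    m = 1.\<close>
  also have "(\<integral>\<^sup>+l. (NI y. indicator (S l) y * f y) \<partial>count_space UNIV) = (\<integral>\<^sup>+l. (NI y. indicator (S (l + 1)) y * f y) \<partial>count_space UNIV)"
    by (rule nn_integral_bij_count_space[of "\<lambda>l. l + 1" UNIV UNIV, symmetric]) (rule bij_plus_right)
  also have "\<dots> \<le> ennreal (real 1) * (NI y. f y)"
    using stop_set_window[OF assms(1,1), of \<alpha> 1] by (simp add: S_def)
  finally have "emeasure lborel (exc_set \<alpha> f) \<le> ennreal (3 ^ DIM('a) * (1 / \<alpha>)) * (NI y. f y)" by (simp add: mult_left_mono)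
  also have "ennreal (3 ^ DIM('a) * (1 / \<alpha>)) = ennreal (3 ^ DIM('a)) * ennreal (1 / \<alpha>)" using \<alpha> by (intro ennreal_mult) simp_all
  finally show ?thesis by (simp only: mult.assoc)
qed

text \<open>Integrability makes the averages over very large cells at most \<alpha>, so if y had
  stopped there would be a first scale k0 \<le> l at which it does. Its cell of scale k0 is still
  near x by coarsening, which would make x exceptional.\<close>

lemma not_exc_set:
  fixes f :: "'a::euclidean_space \<Rightarrow> ennreal"
  assumes [measurable]: "borel_fun f" and \<alpha>: "0 < \<alpha>" and fin: "(NI y. f y) < top"
    and x: "x \<notin> exc_set \<alpha> f" and near: "cell_near l x y"
  shows "y \<notin> stop_set \<alpha> f l"
proof
  assume "y \<in> stop_set \<alpha> f l"
  then obtain k1 where k1: "k1 \<le> l" "ennreal \<alpha> < cell_avg k1 f y" by (auto simp: stop_set_def)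
  obtain I where I: "(NI y. f y) = ennreal I" "0 \<le> I" using fin less_top_ennreal by blast
  \<comment> \<open>For k \<le> - N a cell has volume at least 2^N, so its average is at most I /
    2^N.\<close>
  obtain N :: nat where N: "I / \<alpha> < 2 ^ N" using real_arch_pow[of 2 "I / \<alpha>"] by auto
  have low: "cell_avg k f y \<le> ennreal \<alpha>" if k: "k \<le> - int N" for k
  proof -
    have p1: "(2::real) powi k \<le> 2 powi (- int N)" using k by (intro power_int_increasing) auto
    have p2: "(2::real) powi (- int N) = 1 / 2 ^ N" by (simp add: power_int_minus divide_inverse)
    have "(2::real) powi k \<le> 1" using p1 unfolding p2 by (rule order_trans) simp
    then have "((2::real) powi k) ^ DIM('a) \<le> (2 powi k) ^ 1" using DIM_positive[where 'a='a] by (intro power_decreasing) auto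
    then have "((2::real) powi k) ^ DIM('a) * I \<le> 1 / 2 ^ N * I" using p1 I(2) unfolding p2 by (intro mult_right_mono) auto
    also have "\<dots> \<le> \<alpha>" using N \<alpha> by (simp add: field_simps)
    finally have "ennreal (((2::real) powi k) ^ DIM('a) * I) \<le> ennreal \<alpha>" by (rule ennreal_leI)
    then show ?thesis using cell_avg_le_L1[of k f y] I by (simp add: ennreal_mult)
  qed
  define A where "A = {k\<in>{- int N..l}. ennreal \<alpha> < cell_avg k f y}"
  have "k1 \<in> A" using k1 low[of k1] by (auto simp: A_def not_le[symmetric] intro: le_cases)
  then have A: "A \<noteq> {}" by blast
  have "A \<subseteq> {- int N..l}" unfolding A_def by blast
  then have "finite A" by (rule finite_subset) simp
  note A = A this
  define k0 where "k0 = Min A"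
  have k0: "k0 \<le> l" "ennreal \<alpha> < cell_avg k0 f y" using Min_in[OF A(2,1)] by (auto simp: A_def k0_def)
  have before: "\<not> ennreal \<alpha> < cell_avg k f y" if "k < k0" for k
  proof
    assume a: "ennreal \<alpha> < cell_avg k f y"
    have "\<not> k \<le> - int N" using low[of k] a leD by blast
    then have "k \<in> A" using a that k0(1) by (auto simp: A_def)
    then show False using Min_le[OF A(2), of k] that by (simp add: k0_def)
  qed
  have y1: "y \<in> stop_set \<alpha> f k0" using k0(2) by (auto simp: stop_set_def)
  have y2: "y \<notin> stop_set \<alpha> f (k0 - 1)" using before by (auto simp: stop_set_def)
  have n0: "cell_near k0 x y" by (rule cell_near_coarser[OF k0(1) near])
  have "ennreal (1 / (2 powi k0) ^ DIM('a)) = (NI y'. indicator {y'. cell_eq k0 y y'} y')" by (rule emeasure_cells(1)[symmetric])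
  also have "\<dots> \<le> (NI y'. indicator (stop_set \<alpha> f k0 - stop_set \<alpha> f (k0 - 1)) y' * of_bool (cell_near k0 x y'))"
  proof (rule nn_integral_mono)
    fix y'
    have "y' \<in> stop_set \<alpha> f k0 - stop_set \<alpha> f (k0 - 1) \<and> cell_near k0 x y'" if c: "cell_eq k0 y y'"
    proof -
      have "cell_eq (k0 - 1) y y'" by (rule cell_eq_coarser[OF _ c]) simp
      then have "y' \<notin> stop_set \<alpha> f (k0 - 1)" using y2 stop_set_cell by blast
      moreover have "y' \<in> stop_set \<alpha> f k0" using y1 stop_set_cell[OF c] by blast
      ultimately show ?thesis using cell_near_trans[OF n0 c] by simp
    qed
    then show "indicator {y'. cell_eq k0 y y'} y' \<le> indicator (stop_set \<alpha> f k0 - stop_set \<alpha> f (k0 - 1)) y' * (of_bool (cell_near k0 x y') :: ennreal)"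
      by (cases "cell_eq k0 y y'") simp_all
  qed
  finally have "x \<in> exc_set \<alpha> f" unfolding exc_set_def by blast
  then show False using x by simp
qed

section \<open>Bilinearity, total mass and the weak type bound\<close>

lemma bisph_nn_add_left:
  fixes f f' g :: "'a::euclidean_space \<Rightarrow> ennreal"
  assumes [measurable]: "borel_fun f" "borel_fun f'" "borel_fun g"
  shows "bisph_nn t (\<lambda>y. f y + f' y) g x = bisph_nn t f g x + bisph_nn t f' g x"
  by (subst (1 2 3) bisph_nn_alt, measurable, subst distrib_left[symmetric], subst nn_integral_add[symmetric], measurable)
     (simp only: distrib_left distrib_right)

lemma bisph_nn_add_right:
  fixes f g g' :: "'a::euclidean_space \<Rightarrow> ennreal"
  assumes [measurable]: "borel_fun f" "borel_fun g" "borel_fun g'"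
  shows "bisph_nn t f (\<lambda>y. g y + g' y) x = bisph_nn t f g x + bisph_nn t f g' x"
  by (subst (1 2 3) bisph_nn_alt, measurable, subst distrib_left[symmetric], subst nn_integral_add[symmetric], measurable)
     (simp only: distrib_left distrib_right)

lemma bisph_nn_cmult_left:
  fixes f g :: "'a::euclidean_space \<Rightarrow> ennreal"
  assumes [measurable]: "borel_fun f" "borel_fun g"
  shows "bisph_nn t (\<lambda>y. c * f y) g x = c * bisph_nn t f g x"
proof -
  have "(NI w. indicator unit_ball w * (c * f (x - t *\<^sub>R fst (sgn w)) * g (x - t *\<^sub>R snd (sgn w))))
    = (NI w. c * (indicator unit_ball w * (f (x - t *\<^sub>R fst (sgn w)) * g (x - t *\<^sub>R snd (sgn w)))))"
    by (simp only: mult_ac)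
  also have "\<dots> = c * (NI w. indicator unit_ball w * (f (x - t *\<^sub>R fst (sgn w)) * g (x - t *\<^sub>R snd (sgn w))))"
    by (rule nn_integral_cmult) measurable
  finally show ?thesis by (subst (1 2) bisph_nn_alt, measurable) (simp only: mult_ac)
qed

lemma bisph_nn_cmult_right:
  fixes f g :: "'a::euclidean_space \<Rightarrow> ennreal"
  assumes [measurable]: "borel_fun f" "borel_fun g"
  shows "bisph_nn t f (\<lambda>y. c * g y) x = c * bisph_nn t f g x"
  using bisph_nn_cmult_left[OF assms(2,1), of t c x] bisph_nn_commute[of f "\<lambda>y. c * g y" t x] bisph_nn_commute[OF assms, of t x]
  by simp

definition sphere_mass :: "'a::euclidean_space itself \<Rightarrow> ennreal" where
  "sphere_mass _ = (\<integral>\<^sup>+w. 1 \<partial>(sphere_measure :: ('a \<times> 'a) measure))"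

lemma sphere_mass_finite: "sphere_mass TYPE('a::euclidean_space) < top"
proof -
  have "sphere_mass TYPE('a) = ennreal (2 * real DIM('a)) * (NI w. indicator (unit_ball::('a\<times>'a) set) w * 1)"
    unfolding sphere_mass_def by (subst nn_integral_sphere_measure) simp_all
  also have "\<dots> < top" using emeasure_unit_ball(2)[where 'a="'a \<times> 'a"] by (simp add: ennreal_mult_less_top)
  finally show ?thesis .
qed

lemma bisph_nn_one_one: "bisph_nn t (\<lambda>_. 1) (\<lambda>_. 1) (x::'a::euclidean_space) = sphere_mass TYPE('a)"
  unfolding bisph_nn_def sphere_mass_def by simp

lemma nn_integral_bisph_nn_one:
  fixes f :: "'a::euclidean_space \<Rightarrow> ennreal"
  assumes [measurable]: "borel_fun f"
  shows "(NI x. bisph_nn t f (\<lambda>_. 1) x) = sphere_mass TYPE('a) * (NI x. f x)"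
proof -
  have "(NI x. bisph_nn t f (\<lambda>_. 1) x) = (NI x. ennreal (2 * real DIM('a)) * (NI w. indicator (unit_ball::('a\<times>'a) set) w * (f (x - t *\<^sub>R fst (sgn w)) * 1)))"
    by (subst bisph_nn_alt) simp_all
  also have "\<dots> = ennreal (2 * real DIM('a)) * (NI x. NI w. indicator (unit_ball::('a\<times>'a) set) w * (f (x - t *\<^sub>R fst (sgn w)) * 1))"
    by (rule nn_integral_cmult) measurable
  also have "(NI x. NI w. indicator (unit_ball::('a\<times>'a) set) w * (f (x - t *\<^sub>R fst (sgn w)) * 1))
    = (NI w. NI x. indicator (unit_ball::('a\<times>'a) set) w * (f (x - t *\<^sub>R fst (sgn w)) * 1))"
    by (rule nn_integral_lborel_swap) measurable
  also have "\<dots> = (NI w. indicator (unit_ball::('a\<times>'a) set) w * (NI x. f x))"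
    by (intro nn_integral_cong, subst nn_integral_cmult, measurable, subst mult_1_right, subst nn_integral_lborel_shift(3), measurable)
  also have "\<dots> = emeasure lborel (unit_ball::('a\<times>'a) set) * (NI x. f x)" by (subst nn_integral_multc) simp_all
  also have "ennreal (2 * real DIM('a)) * (emeasure lborel (unit_ball::('a\<times>'a) set) * (NI x. f x)) = sphere_mass TYPE('a) * (NI x. f x)"
    unfolding sphere_mass_def by (subst nn_integral_sphere_measure) (simp_all add: mult.assoc)
  finally show ?thesis .
qed

definition cell_bisph_max :: "nat \<Rightarrow> nat \<Rightarrow> ('a::euclidean_space \<Rightarrow> ennreal) \<Rightarrow> ('a \<Rightarrow> ennreal) \<Rightarrow> 'a \<Rightarrow> ennreal" where
  "cell_bisph_max m n f g x = (SUP l::int. bisph_nn (2 powi (- l)) (cell_avg (l + int m) f) (cell_avg (l + int n) g) x)"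

lemma cell_bisph_max_measurable [measurable (raw)]:
  assumes [measurable]: "borel_fun f" "borel_fun g" "h \<in> borel_measurable M"
  shows "(\<lambda>w. cell_bisph_max m n f g (h w)) \<in> borel_measurable M"
  unfolding cell_bisph_max_def by measurable

text \<open>Near a point outside the exceptional set nothing has stopped by scale l. Hence the
  average at scale l + m can exceed \<alpha> only at points that stop at one of the m scales after
  l.\<close>

definition stopped :: "real \<Rightarrow> ('a::euclidean_space \<Rightarrow> ennreal) \<Rightarrow> nat \<Rightarrow> int \<Rightarrow> 'a \<Rightarrow> ennreal" where
  "stopped \<alpha> f m l y = indicator (stop_set \<alpha> f (l + int m) - stop_set \<alpha> f l) y * cell_avg (l + int m) f y"

lemma stopped_measurable [measurable (raw)]:
  assumes [measurable]: "borel_fun f" "g \<in> borel_measurable M"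
  shows "(\<lambda>w. stopped \<alpha> f m l (g w)) \<in> borel_measurable M"
  unfolding stopped_def by measurable

text \<open>The cut-off set is a union of cells of side 2^(-(l+m)), so the average may be replaced
  by f under the integral.\<close>

lemma nn_integral_stopped:
  fixes f :: "'a::euclidean_space \<Rightarrow> ennreal"
  assumes [measurable]: "borel_fun f"
  shows "(\<integral>\<^sup>+l. (NI y. stopped \<alpha> f m l y) \<partial>count_space UNIV) \<le> ennreal (real m) * (NI y. f y)"
proof -
  have "(NI y. stopped \<alpha> f m l y) = (NI y. indicator (stop_set \<alpha> f (l + int m) - stop_set \<alpha> f l) y * f y)" for l
    unfolding stopped_def
  proof (rule cell_avg_adjoint_const)
    fix y y' :: 'a assume yy: "cell_eq (l + int m) y y'"
    have "cell_eq l y y'" by (rule cell_eq_coarser[OF _ yy]) simp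
    from stop_set_cell[OF this, of \<alpha> f] stop_set_cell[OF yy, of \<alpha> f]
    show "indicator (stop_set \<alpha> f (l + int m) - stop_set \<alpha> f l) y = (indicator (stop_set \<alpha> f (l + int m) - stop_set \<alpha> f l) y' :: ennreal)"
      unfolding indicator_def Diff_iff by simp
  qed measurable
  then show ?thesis using stop_set_window[OF assms assms, of \<alpha> m] by simp
qed

text \<open>One \<alpha> comes from the part of f below that height, the other from the cells that
  have not stopped by scale l + m.\<close>

lemma cell_avg_le_stopped:
  fixes f :: "'a::euclidean_space \<Rightarrow> ennreal"
  assumes [measurable]: "borel_fun f" and \<alpha>: "0 < \<alpha>" and fin: "(NI y. above \<alpha> f y) < top"
    and x: "x \<notin> exc_set \<alpha> (above \<alpha> f)" and xy: "dist x y \<le> 2 powi (- l)"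
  shows "cell_avg (l + int m) f y \<le> ennreal (2 * \<alpha>) * 1 + stopped \<alpha> (above \<alpha> f) m l y"
proof -
  let ?fb = "above \<alpha> f"
  have ns: "y \<notin> stop_set \<alpha> ?fb l"
    by (rule not_exc_set[OF _ \<alpha> fin x cell_near_dist[OF xy]]) measurable
  have "cell_avg (l + int m) f y \<le> cell_avg (l + int m) (\<lambda>y. ennreal \<alpha> + ?fb y) y" by (intro cell_avg_mono le_add_above)
  also have "\<dots> = ennreal \<alpha> + cell_avg (l + int m) ?fb y" by (subst cell_avg_add) (simp_all add: cell_avg_const)
  also have "cell_avg (l + int m) ?fb y \<le> ennreal \<alpha> + stopped \<alpha> ?fb m l y"
  proof (cases "y \<in> stop_set \<alpha> ?fb (l + int m)")
    case True
    then show ?thesis using ns by (simp add: stopped_def)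
  next
    case False
    then show ?thesis using not_stop_set[OF False] by (simp add: stopped_def)
  qed
  finally have "cell_avg (l + int m) f y \<le> ennreal \<alpha> + (ennreal \<alpha> + stopped \<alpha> ?fb m l y)" by (simp add: add_left_mono)
  also have "\<dots> = ennreal (2 * \<alpha>) * 1 + stopped \<alpha> ?fb m l y"
  proof -
    have "ennreal (2 * \<alpha>) = ennreal \<alpha> + ennreal \<alpha>" using \<alpha> by (simp add: ennreal_plus[symmetric] del: ennreal_plus)
    then show ?thesis by (simp add: add.assoc)
  qed
  finally show ?thesis .
qed

text \<open>Outside the exceptional sets the two cell averages are majorised by 2 \<alpha> + F and 2
  \<beta> + G, and the product is expanded. The terms with one constant factor obey Chebyshev, the
  term with F and G obeys \<open>bisph_nn_weak\<close>. Both bounds are additive in the integrals of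
  F and G, whose sums over l are controlled with the factors m and n.\<close>

lemma cell_bisph_max_corner:
  assumes d: "2 \<le> DIM('a::euclidean_space)"
  obtains C B :: real where "0 < C" "0 < B"
    "\<And>m n \<alpha> \<beta> f g. 0 < \<alpha> \<Longrightarrow> 0 < \<beta> \<Longrightarrow> borel_fun f \<Longrightarrow> borel_fun g \<Longrightarrow>
      emeasure lborel {x::'a. ennreal (C * (\<alpha> * \<beta>)) < cell_bisph_max m n f g x} \<le>
        ennreal (B * (1 + real m + real n)) * (ennreal (1 / \<alpha>) * (NI x. above \<alpha> f x) + ennreal (1 / \<beta>) * (NI x. above \<beta> g x))"
proof -
  obtain K where K: "0 < K" "\<And>t \<alpha> \<beta> F G. 0 < t \<Longrightarrow> 0 < \<alpha> \<Longrightarrow> 0 < \<beta> \<Longrightarrow> borel_fun F \<Longrightarrow> borel_fun G \<Longrightarrow>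
      emeasure lborel {x::'a. ennreal (\<alpha> * \<beta>) < bisph_nn t F G x} \<le>
        ennreal K * (ennreal (1 / \<alpha>) * (NI x. F x) + ennreal (1 / \<beta>) * (NI x. G x))"
    using bisph_nn_weak[OF d] by metis
  obtain s where s: "sphere_mass TYPE('a) = ennreal s" "0 \<le> s"
    using sphere_mass_finite[where 'a='a] less_top_ennreal by blast
  \<comment> \<open>The product of the two constants contributes 4 s, with s the total mass; each of
    the other three terms is allowed \<alpha> \<beta>. In B, the power of 3 pays for the exceptional
    sets, 2 s for Chebyshev and K for the single scale bound.\<close>
  define C where "C = 4 * s + 3"
  define B where "B = 3 ^ DIM('a) + K + 2 * s"
  have B: "0 < B" using K(1) s(2) by (simp add: B_def add_pos_nonneg)
  show thesis
  proof (rule that[of C B])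
    show "0 < C" using s(2) by (simp add: C_def)
    show "0 < B" by (rule B)
    fix m n :: nat and \<alpha> \<beta> :: real and f g :: "'a \<Rightarrow> ennreal"
    assume a: "0 < \<alpha>" "0 < \<beta>" and [measurable]: "borel_fun f" "borel_fun g"
    let ?fb = "above \<alpha> f" and ?gb = "above \<beta> g"
    define X where "X = ennreal (1 / \<alpha>) * (NI x. ?fb x)"
    define Y where "Y = ennreal (1 / \<beta>) * (NI x. ?gb x)"
    let ?R = "ennreal (B * (1 + real m + real n)) * (X + Y)"
    let ?E = "{x. ennreal (C * (\<alpha> * \<beta>)) < cell_bisph_max m n f g x}"
    have Bc: "ennreal (B * (1 + real m + real n)) \<noteq> 0" using B by (simp add: ennreal_eq_0_iff not_le add_pos_nonneg)
    have "emeasure lborel ?E \<le> ?R"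
    proof (cases "(NI x. ?fb x) = top \<or> (NI x. ?gb x) = top")
      case True
      have "ennreal (1 / \<alpha>) \<noteq> 0" "ennreal (1 / \<beta>) \<noteq> 0" using a by (simp_all add: ennreal_eq_0_iff)
      then have "X + Y = top" using True unfolding X_def Y_def by (auto simp: ennreal_mult_top)
      then have "?R = top" using Bc by (simp only: ennreal_mult_top if_False)
      then show ?thesis by (simp only: top_greatest)
    next
      case False
      then have fin: "(NI x. ?fb x) < top" "(NI x. ?gb x) < top" by (simp_all add: less_top)
      define F where "F = stopped \<alpha> ?fb m"
      define G where "G = stopped \<beta> ?gb n"
      have [measurable]: "F l \<in> borel_measurable borel" "G l \<in> borel_measurable borel" for l
        unfolding F_def G_def by measurable
      define E1 where "E1 l = {x. ennreal (\<beta> / 2) < bisph_nn (2 powi (- l)) (G l) (\<lambda>_. 1) x}" for l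
      define E2 where "E2 l = {x. ennreal (\<alpha> / 2) < bisph_nn (2 powi (- l)) (F l) (\<lambda>_. 1) x}" for l
      define E3 where "E3 l = {x. ennreal (\<alpha> * \<beta>) < bisph_nn (2 powi (- l)) (F l) (G l) x}" for l
      have [measurable]: "E1 l \<in> sets borel" "E2 l \<in> sets borel" "E3 l \<in> sets borel" for l
        unfolding E1_def E2_def E3_def by measurable
      have sub: "?E \<subseteq> (exc_set \<alpha> ?fb \<union> exc_set \<beta> ?gb) \<union> (\<Union>l. E1 l \<union> E2 l \<union> E3 l)"
      proof
        fix x assume x: "x \<in> ?E"
        show "x \<in> (exc_set \<alpha> ?fb \<union> exc_set \<beta> ?gb) \<union> (\<Union>l. E1 l \<union> E2 l \<union> E3 l)"
        proof (rule ccontr)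
          assume "\<not> ?thesis"
          then have ne: "x \<notin> exc_set \<alpha> ?fb" "x \<notin> exc_set \<beta> ?gb" and nE: "\<And>l. x \<notin> E1 l" "\<And>l. x \<notin> E2 l" "\<And>l. x \<notin> E3 l" by auto
          have "bisph_nn (2 powi (- l)) (cell_avg (l + int m) f) (cell_avg (l + int n) g) x \<le> ennreal (C * (\<alpha> * \<beta>))" for l :: int
          proof -
            let ?t = "(2::real) powi (- l)"
            let ?T = "\<lambda>f g. bisph_nn ?t f g x"
            have "?T (cell_avg (l + int m) f) (cell_avg (l + int n) g) \<le> ?T (\<lambda>y. ennreal (2 * \<alpha>) * 1 + F l y) (\<lambda>y. ennreal (2 * \<beta>) * 1 + G l y)"
            proof (rule bisph_nn_mono_local)
              fix y assume "dist x y \<le> ?t"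
              then show "cell_avg (l + int m) f y \<le> ennreal (2 * \<alpha>) * 1 + F l y" "cell_avg (l + int n) g y \<le> ennreal (2 * \<beta>) * 1 + G l y"
                unfolding F_def G_def using cell_avg_le_stopped[OF _ a(1) fin(1) ne(1)] cell_avg_le_stopped[OF _ a(2) fin(2) ne(2)] by simp_all
            qed simp_all
            also have "\<dots> = (ennreal (2 * \<alpha>) * (ennreal (2 * \<beta>) * ?T (\<lambda>_. 1) (\<lambda>_. 1)) + ennreal (2 * \<alpha>) * ?T (\<lambda>_. 1) (G l))
               + (ennreal (2 * \<beta>) * ?T (F l) (\<lambda>_. 1) + ?T (F l) (G l))"
              by (simp only: bisph_nn_add_left bisph_nn_add_right bisph_nn_cmult_left bisph_nn_cmult_right borel_measurable_const
                  borel_measurable_add borel_measurable_times_ennreal \<open>F l \<in> borel_measurable borel\<close> \<open>G l \<in> borel_measurable borel\<close> distrib_left)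
            also have "?T (\<lambda>_. 1) (G l) = ?T (G l) (\<lambda>_. 1)" by (rule bisph_nn_commute) measurable
            also have "(ennreal (2 * \<alpha>) * (ennreal (2 * \<beta>) * ?T (\<lambda>_. 1) (\<lambda>_. 1)) + ennreal (2 * \<alpha>) * ?T (G l) (\<lambda>_. 1)) + (ennreal (2 * \<beta>) * ?T (F l) (\<lambda>_. 1) + ?T (F l) (G l))
              \<le> (ennreal (2 * \<alpha>) * (ennreal (2 * \<beta>) * ennreal s) + ennreal (2 * \<alpha>) * ennreal (\<beta> / 2)) + (ennreal (2 * \<beta>) * ennreal (\<alpha> / 2) + ennreal (\<alpha> * \<beta>))"
              unfolding bisph_nn_one_one s(1)
              using nE[of l] by (intro add_mono mult_left_mono) (simp_all add: E1_def E2_def E3_def not_less)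
            also have "\<dots> = ennreal (((2 * \<alpha>) * ((2 * \<beta>) * s) + (2 * \<alpha>) * (\<beta> / 2)) + ((2 * \<beta>) * (\<alpha> / 2) + \<alpha> * \<beta>))"
              using a s(2) by (simp only: ennreal_plus ennreal_mult mult_nonneg_nonneg add_nonneg_nonneg less_imp_le divide_nonneg_nonneg zero_le_numeral)
            also have "((2 * \<alpha>) * ((2 * \<beta>) * s) + (2 * \<alpha>) * (\<beta> / 2)) + ((2 * \<beta>) * (\<alpha> / 2) + \<alpha> * \<beta>) = C * (\<alpha> * \<beta>)"
              by (simp add: C_def algebra_simps)
            finally show ?thesis .
          qed
          then have "cell_bisph_max m n f g x \<le> ennreal (C * (\<alpha> * \<beta>))" unfolding cell_bisph_max_def by (intro SUP_least)
          then show False using x by (simp add: not_le[symmetric])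
        qed
      qed
      have "emeasure lborel ?E \<le> emeasure lborel ((exc_set \<alpha> ?fb \<union> exc_set \<beta> ?gb) \<union> (\<Union>l. E1 l \<union> E2 l \<union> E3 l))"
        by (rule emeasure_mono[OF sub]) simp
      also have "\<dots> \<le> (emeasure lborel (exc_set \<alpha> ?fb) + emeasure lborel (exc_set \<beta> ?gb)) + (\<integral>\<^sup>+l. emeasure lborel (E1 l \<union> E2 l \<union> E3 l) \<partial>count_space UNIV)"
        by (intro order_trans[OF emeasure_subadditive] add_mono emeasure_subadditive emeasure_UN_int_le) simp_all
      also have "\<dots> \<le> (ennreal (3 ^ DIM('a)) * X + ennreal (3 ^ DIM('a)) * Y) + ennreal ((2 * s + K) * (real m + real n)) * (X + Y)"
      proof (intro add_mono)
        show "emeasure lborel (exc_set \<alpha> ?fb) \<le> ennreal (3 ^ DIM('a)) * X" "emeasure lborel (exc_set \<beta> ?gb) \<le> ennreal (3 ^ DIM('a)) * Y"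
          unfolding X_def Y_def by (intro emeasure_exc_set a, measurable)+
        define x where "x l = ennreal (1 / \<alpha>) * (NI y. F l y)" for l
        define y where "y l = ennreal (1 / \<beta>) * (NI y. G l y)" for l
        have "(\<integral>\<^sup>+l. emeasure lborel (E1 l \<union> E2 l \<union> E3 l) \<partial>count_space UNIV) \<le> (\<integral>\<^sup>+l. ennreal (2 * s + K) * (x l + y l) \<partial>count_space UNIV)"
        proof (rule nn_integral_mono)
          fix l :: int
          let ?t = "(2::real) powi (- l)"
          have t: "0 < ?t" by simp
          have hs: "ennreal (1 / (\<gamma> / 2)) * (sphere_mass TYPE('a) * I) = ennreal (2 * s) * (ennreal (1 / \<gamma>) * I)" if "0 < \<gamma>" for \<gamma> I
          proof -
            have "ennreal (1 / (\<gamma> / 2)) * ennreal s = ennreal ((1 / (\<gamma> / 2)) * s)" using that s(2) by (intro ennreal_mult[symmetric]) simp_all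
            also have "(1 / (\<gamma> / 2)) * s = (2 * s) * (1 / \<gamma>)" by simp
            also have "ennreal ((2 * s) * (1 / \<gamma>)) = ennreal (2 * s) * ennreal (1 / \<gamma>)" using that s(2) by (intro ennreal_mult) simp_all
            finally show ?thesis unfolding s(1) by (simp only: mult.assoc[symmetric])
          qed
          have "emeasure lborel (E1 l) \<le> ennreal (1 / (\<beta> / 2)) * (NI x. bisph_nn ?t (G l) (\<lambda>_. 1) x)"
            unfolding E1_def using a by (intro emeasure_less_Markov) simp_all
          also have "\<dots> = ennreal (2 * s) * y l"
            unfolding y_def by (subst nn_integral_bisph_nn_one, measurable) (rule hs[OF a(2)])
          finally have e1: "emeasure lborel (E1 l) \<le> ennreal (2 * s) * y l" .
          have "emeasure lborel (E2 l) \<le> ennreal (1 / (\<alpha> / 2)) * (NI x. bisph_nn ?t (F l) (\<lambda>_. 1) x)"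
            unfolding E2_def using a by (intro emeasure_less_Markov) simp_all
          also have "\<dots> = ennreal (2 * s) * x l"
            unfolding x_def by (subst nn_integral_bisph_nn_one, measurable) (rule hs[OF a(1)])
          finally have e2: "emeasure lborel (E2 l) \<le> ennreal (2 * s) * x l" .
          have e3: "emeasure lborel (E3 l) \<le> ennreal K * (x l + y l)"
            unfolding E3_def x_def y_def by (rule K(2)[OF t a]) measurable
          have "emeasure lborel (E1 l \<union> E2 l \<union> E3 l) \<le> (emeasure lborel (E1 l) + emeasure lborel (E2 l)) + emeasure lborel (E3 l)"
            by (intro order_trans[OF emeasure_subadditive] add_mono emeasure_subadditive) simp_all
          also have "\<dots> \<le> (ennreal (2 * s) * y l + ennreal (2 * s) * x l) + ennreal K * (x l + y l)"
            by (intro add_mono e1 e2 e3)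
          also have "\<dots> = ennreal (2 * s + K) * (x l + y l)" using s(2) K(1) by (simp add: distrib_left distrib_right add_ac)
          finally show "emeasure lborel (E1 l \<union> E2 l \<union> E3 l) \<le> ennreal (2 * s + K) * (x l + y l)" .
        qed
        also have "\<dots> = ennreal (2 * s + K) * ((\<integral>\<^sup>+l. x l \<partial>count_space UNIV) + (\<integral>\<^sup>+l. y l \<partial>count_space UNIV))"
          by (rule nn_integral_cmult_add) simp_all
        also have "\<dots> \<le> ennreal (2 * s + K) * (ennreal (real m) * X + ennreal (real n) * Y)"
        proof (intro mult_left_mono add_mono)
          have "(\<integral>\<^sup>+l. x l \<partial>count_space UNIV) = ennreal (1 / \<alpha>) * (\<integral>\<^sup>+l. (NI y. F l y) \<partial>count_space UNIV)"
            unfolding x_def by (rule nn_integral_cmult) simp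
          also have "\<dots> \<le> ennreal (1 / \<alpha>) * (ennreal (real m) * (NI x. ?fb x))"
            unfolding F_def by (intro mult_left_mono nn_integral_stopped) simp_all
          finally show "(\<integral>\<^sup>+l. x l \<partial>count_space UNIV) \<le> ennreal (real m) * X" unfolding X_def by (simp only: mult_ac)
          have "(\<integral>\<^sup>+l. y l \<partial>count_space UNIV) = ennreal (1 / \<beta>) * (\<integral>\<^sup>+l. (NI y. G l y) \<partial>count_space UNIV)"
            unfolding y_def by (rule nn_integral_cmult) simp
          also have "\<dots> \<le> ennreal (1 / \<beta>) * (ennreal (real n) * (NI x. ?gb x))"
            unfolding G_def by (intro mult_left_mono nn_integral_stopped) simp_all
          finally show "(\<integral>\<^sup>+l. y l \<partial>count_space UNIV) \<le> ennreal (real n) * Y" unfolding Y_def by (simp only: mult_ac)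
        qed simp
        also have "\<dots> \<le> ennreal (2 * s + K) * (ennreal (real m + real n) * X + ennreal (real m + real n) * Y)"
          by (intro mult_left_mono add_mono mult_right_mono ennreal_leI) simp_all
        also have "\<dots> = ennreal ((2 * s + K) * (real m + real n)) * (X + Y)"
          using s(2) K(1) by (subst ennreal_mult) (simp_all only: distrib_left mult.assoc add_nonneg_nonneg mult_nonneg_nonneg less_imp_le zero_le_numeral of_nat_0_le_iff)
        finally show "(\<integral>\<^sup>+l. emeasure lborel (E1 l \<union> E2 l \<union> E3 l) \<partial>count_space UNIV) \<le> ennreal ((2 * s + K) * (real m + real n)) * (X + Y)" .
      qed
      also have "\<dots> = ennreal (3 ^ DIM('a) + (2 * s + K) * (real m + real n)) * (X + Y)"
        using s(2) K(1) by (subst ennreal_plus) (simp_all add: distrib_left distrib_right)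
      also have "\<dots> \<le> ?R"
      proof (intro mult_right_mono ennreal_leI)
        have "3 ^ DIM('a) + (2 * s + K) * (real m + real n) \<le> B + B * (real m + real n)"
        proof -
          have "3 ^ DIM('a) \<le> B" "2 * s + K \<le> B" using s(2) K(1) by (simp_all add: B_def)
          then show ?thesis by (intro add_mono mult_right_mono) simp_all
        qed
        then show "3 ^ DIM('a) + (2 * s + K) * (real m + real n) \<le> B * (1 + real m + real n)" by (simp add: algebra_simps)
      qed simp
      finally show ?thesis .
    qed
    then show "emeasure lborel ?E \<le> ennreal (B * (1 + real m + real n)) * (ennreal (1 / \<alpha>) * (NI x. ?fb x) + ennreal (1 / \<beta>) * (NI x. ?gb x))"
      unfolding X_def Y_def .
  qed
qed

section \<open>The maximal operator with one constant function\<close>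

definition bisph_max :: "('a::euclidean_space \<Rightarrow> ennreal) \<Rightarrow> ('a \<Rightarrow> ennreal) \<Rightarrow> 'a \<Rightarrow> ennreal" where
  "bisph_max f g x = (SUP l::int. bisph_nn (2 powi (- l)) f g x)"

lemma bisph_max_measurable [measurable (raw)]:
  assumes [measurable]: "borel_fun f" "borel_fun g" "h \<in> borel_measurable M"
  shows "(\<lambda>w. bisph_max f g (h w)) \<in> borel_measurable M"
  unfolding bisph_max_def by measurable

text \<open>With the second function equal to 1 the average is an average over a ball with bounded
  density. The stopping argument then applies to f itself: the ball of radius 2^(-l) is covered by
  the 3^d cells near x, and outside the exceptional set the averages over them are at most
  \<alpha>.\<close>

lemma bisph_max_one_weak:
  assumes d: "2 \<le> DIM('a::euclidean_space)"
  obtains C B :: real where "0 < C" "0 < B"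
    "\<And>\<alpha> f. 0 < \<alpha> \<Longrightarrow> borel_fun f \<Longrightarrow>
      emeasure lborel {x::'a. ennreal (C * \<alpha>) < bisph_max f (\<lambda>_. 1) x} \<le> ennreal B * (ennreal (1 / \<alpha>) * (NI x. above \<alpha> f x))"
proof -
  obtain s where s: "sphere_mass TYPE('a) = ennreal s" "0 \<le> s"
    using sphere_mass_finite[where 'a='a] less_top_ennreal by blast
  obtain c where c: "slice_const TYPE('a) = ennreal c" "0 \<le> c"
    using slice_const_finite[where 'a='a] less_top_ennreal by blast
  \<comment> \<open>s bounds the contribution of the part of f below \<alpha>, and c times the power
    of 3 that of the part above; the 1 makes the constant positive.\<close>
  define C where "C = 1 + s + c * 3 ^ DIM('a)"
  show thesis
  proof (rule that[of C "3 ^ DIM('a)"])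
    show "0 < C" using s(2) c(2) by (simp add: C_def add_pos_nonneg)
    fix \<alpha> :: real and f :: "'a \<Rightarrow> ennreal"
    assume a: "0 < \<alpha>" and [measurable]: "borel_fun f"
    let ?fb = "above \<alpha> f"
    show "emeasure lborel {x. ennreal (C * \<alpha>) < bisph_max f (\<lambda>_. 1) x} \<le> ennreal (3 ^ DIM('a)) * (ennreal (1 / \<alpha>) * (NI x. ?fb x))"
    proof (cases "(NI x. ?fb x) = top")
      case True
      have "ennreal (1 / \<alpha>) \<noteq> 0" "ennreal (3 ^ DIM('a)) \<noteq> 0" using a by (simp_all add: ennreal_eq_0_iff not_le)
      then have "ennreal (1 / \<alpha>) * top = top" "ennreal (3 ^ DIM('a)) * top = top" by (simp_all only: ennreal_mult_top if_False)
      then show ?thesis unfolding True by (simp only: top_greatest)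
    next
      case False
      then have fin: "(NI x. ?fb x) < top" by (simp add: less_top)
      have "{x. ennreal (C * \<alpha>) < bisph_max f (\<lambda>_. 1) x} \<subseteq> exc_set \<alpha> ?fb"
      proof
        fix x assume x: "x \<in> {x. ennreal (C * \<alpha>) < bisph_max f (\<lambda>_. 1) x}"
        show "x \<in> exc_set \<alpha> ?fb"
        proof (rule ccontr)
          assume ne: "x \<notin> exc_set \<alpha> ?fb"
          have "bisph_nn (2 powi (- l)) f (\<lambda>_. 1) x \<le> ennreal (C * \<alpha>)" for l :: int
          proof -
            let ?t = "(2::real) powi (- l)" and ?V = "(2 powi l :: real) ^ DIM('a)"
            have "bisph_nn ?t f (\<lambda>_. 1) x \<le> bisph_nn ?t (\<lambda>y. ennreal \<alpha> * 1 + ?fb y) (\<lambda>_. 1) x"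
              by (intro bisph_nn_mono) (simp_all add: le_add_above)
            also have "\<dots> = ennreal \<alpha> * ennreal s + bisph_nn ?t ?fb (\<lambda>_. 1) x"
              by (subst bisph_nn_add_left, measurable, subst bisph_nn_cmult_left, measurable) (simp only: bisph_nn_one_one s(1))
            also have "bisph_nn ?t ?fb (\<lambda>_. 1) x = (\<integral>\<^sup>+w. ?fb (x - ?t *\<^sub>R fst w) \<partial>(sphere_measure :: ('a \<times> 'a) measure))"
              by (simp add: bisph_nn_def)
            also have "\<dots> \<le> ennreal c * (NI u. indicator (ball 0 1) u * ?fb (x - ?t *\<^sub>R u))"
              unfolding c(1)[symmetric] slice_const_def by (rule nn_integral_sphere_fst_le[OF _ d]) measurable
            also have "(NI u. indicator (ball 0 1) u * ?fb (x - ?t *\<^sub>R u)) \<le> ennreal (3 ^ DIM('a) * \<alpha>)"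
            proof -
              have [measurable]: "(\<lambda>y. indicator {y. cell_near l x y} y :: ennreal) \<in> borel_measurable borel" by measurable
              have tV: "\<bar>- ?t\<bar> ^ DIM('a) = 1 / ?V" by (simp add: power_int_minus power_inverse divide_inverse)
              have "(NI u. indicator (ball 0 1) u * ?fb (x - ?t *\<^sub>R u)) \<le> (NI u. indicator {y. cell_near l x y} (x - ?t *\<^sub>R u) * ?fb (x - ?t *\<^sub>R u))"
              proof (intro nn_integral_mono mult_right_mono)
                fix u :: 'a
                have "cell_near l x (x - ?t *\<^sub>R u)" if "norm u < 1"
                  by (rule cell_near_dist) (use that in \<open>simp add: dist_norm mult_left_le\<close>)
                then show "indicator (ball 0 1) u \<le> (indicator {y. cell_near l x y} (x - ?t *\<^sub>R u) :: ennreal)"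
                  by (auto simp: indicator_def)
              qed simp
              also have "\<dots> = ennreal ?V * (ennreal (1 / ?V) * (NI u. indicator {y. cell_near l x y} (x + (- ?t) *\<^sub>R u) * ?fb (x + (- ?t) *\<^sub>R u)))"
                unfolding mult.assoc[symmetric] cell_volume_cancel by simp
              also have "ennreal (1 / ?V) * (NI u. indicator {y. cell_near l x y} (x + (- ?t) *\<^sub>R u) * ?fb (x + (- ?t) *\<^sub>R u))
                = (NI y. indicator {y. cell_near l x y} y * ?fb y)"
                unfolding tV[symmetric] by (rule nn_integral_lborel_affine[symmetric]) simp_all
              also have "\<dots> = (NI y. indicator {y. cell_near l x y} y * cell_avg l ?fb y)"
              proof (rule cell_avg_adjoint_const[symmetric])
                fix y y' :: 'a assume "cell_eq l y y'"
                then have "cell_near l x y \<longleftrightarrow> cell_near l x y'" using cell_near_trans cell_eq_sym by blast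
                then show "indicator {y. cell_near l x y} y = (indicator {y. cell_near l x y} y' :: ennreal)" by (simp add: indicator_def)
              qed measurable
              also have "\<dots> \<le> (NI y. indicator {y. cell_near l x y} y * ennreal \<alpha>)"
              proof (rule nn_integral_mono)
                fix y
                have "cell_avg l ?fb y \<le> ennreal \<alpha>" if n: "cell_near l x y"
                  by (rule not_stop_set[OF not_exc_set[OF _ a fin ne n]]) measurable
                then show "indicator {y. cell_near l x y} y * cell_avg l ?fb y \<le> indicator {y. cell_near l x y} y * ennreal \<alpha>"
                  by (cases "cell_near l x y") simp_all
              qed
              also have "\<dots> = ennreal (3 ^ DIM('a) / ?V) * ennreal \<alpha>"
                by (subst nn_integral_multc, measurable) (simp only: emeasure_cells(2))
              also have "ennreal ?V * (ennreal (3 ^ DIM('a) / ?V) * ennreal \<alpha>) = ennreal (?V * (3 ^ DIM('a) / ?V * \<alpha>))"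
                using a by (simp only: ennreal_mult[symmetric] zero_le_power divide_nonneg_nonneg mult_nonneg_nonneg less_imp_le zero_le_numeral zero_le_power_int)
              also have "?V * (3 ^ DIM('a) / ?V * \<alpha>) = 3 ^ DIM('a) * \<alpha>" by simp
              finally show ?thesis by (simp add: mult_left_mono)
            qed
            finally have "bisph_nn ?t f (\<lambda>_. 1) x \<le> ennreal \<alpha> * ennreal s + ennreal c * ennreal (3 ^ DIM('a) * \<alpha>)"
              by (simp add: add_left_mono mult_left_mono)
            also have "\<dots> = ennreal (\<alpha> * s + c * (3 ^ DIM('a) * \<alpha>))"
              using a s(2) c(2) by (simp only: ennreal_plus ennreal_mult mult_nonneg_nonneg less_imp_le zero_le_power zero_le_numeral)
            also have "\<dots> \<le> ennreal (C * \<alpha>)" using a by (intro ennreal_leI) (simp add: C_def algebra_simps)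
            finally show ?thesis .
          qed
          then have "bisph_max f (\<lambda>_. 1) x \<le> ennreal (C * \<alpha>)" unfolding bisph_max_def by (intro SUP_least)
          then show False using x by (simp add: not_le[symmetric])
        qed
      qed
      then have "emeasure lborel {x. ennreal (C * \<alpha>) < bisph_max f (\<lambda>_. 1) x} \<le> emeasure lborel (exc_set \<alpha> ?fb)"
        by (intro emeasure_mono) simp_all
      also have "\<dots> \<le> ennreal (3 ^ DIM('a)) * (ennreal (1 / \<alpha>) * (NI x. ?fb x))"
        by (rule emeasure_exc_set[OF _ a]) measurable
      finally show ?thesis .
    qed
  qed simp
qed

section \<open>Interpolation\<close>

lemma enn_powr_measurable [measurable (raw)]:
  assumes [measurable]: "f \<in> borel_measurable M"
  shows "(\<lambda>x. enn_powr (f x) a) \<in> borel_measurable M"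
  unfolding enn_powr_def by measurable

lemma enn_powr_ennreal: "0 \<le> v \<Longrightarrow> enn_powr (ennreal v) a = ennreal (v powr a)"
  by (simp add: enn_powr_def)

lemma enn_powr_top [simp]: "enn_powr top a = top"
  by (simp add: enn_powr_def)

lemma powr_inverse_less_iff:
  fixes P c \<tau> v :: real
  assumes "0 < P" "0 < c" "0 < \<tau>" "0 \<le> v"
  shows "c * \<tau> powr (1 / P) < v \<longleftrightarrow> \<tau> < (v / c) powr P"
proof -
  have "1 / P * P = 1" using assms(1) by simp
  then have e: "(\<tau> powr (1 / P)) powr P = \<tau>" using assms(3) by (simp only: powr_powr powr_one less_imp_le)
  have "c * \<tau> powr (1 / P) < v \<longleftrightarrow> \<tau> powr (1 / P) < v / c" using assms(2) by (simp add: pos_less_divide_eq mult.commute)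
  also have "\<dots> \<longleftrightarrow> (\<tau> powr (1 / P)) powr P < (v / c) powr P"
  proof
    assume "\<tau> powr (1 / P) < v / c"
    then show "(\<tau> powr (1 / P)) powr P < (v / c) powr P" by (rule powr_less_mono2[OF assms(1) powr_ge_zero])
  next
    assume a: "(\<tau> powr (1 / P)) powr P < (v / c) powr P"
    show "\<tau> powr (1 / P) < v / c"
    proof (rule ccontr)
      assume "\<not> \<tau> powr (1 / P) < v / c"
      then have "(v / c) powr P \<le> (\<tau> powr (1 / P)) powr P" using assms by (intro powr_mono2) auto
      then show False using a by simp
    qed
  qed
  finally show ?thesis unfolding e .
qed

lemma layer_cake_point:
  assumes "0 < P" "0 < c"
  shows "(NI \<tau>. indicator {0<..} \<tau> * of_bool (ennreal (c * \<tau> powr (1 / P)) < y)) = ennreal (c powr (- P)) * enn_powr y P"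
proof (cases y)
  case (real v)
  have "(NI \<tau>. indicator {0<..} \<tau> * of_bool (ennreal (c * \<tau> powr (1 / P)) < y)) = (NI \<tau>. indicator {0<..<(v / c) powr P} \<tau>)"
  proof (rule nn_integral_cong)
    fix \<tau> :: real
    show "indicator {0<..} \<tau> * of_bool (ennreal (c * \<tau> powr (1 / P)) < y) = (indicator {0<..<(v / c) powr P} \<tau> :: ennreal)"
    proof (cases "0 < \<tau>")
      case True
      then have "ennreal (c * \<tau> powr (1 / P)) < y \<longleftrightarrow> \<tau> < (v / c) powr P"
        using powr_inverse_less_iff[OF assms True real(1)] real assms by (simp add: ennreal_less_iff)
      then show ?thesis using True by (simp add: indicator_def)
    qed simp
  qed
  also have "\<dots> = ennreal ((v / c) powr P)" by simp
  also have "\<dots> = ennreal (c powr (- P)) * enn_powr y P"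
    using real assms by (simp add: enn_powr_ennreal powr_divide powr_minus_divide ennreal_mult[symmetric])
  finally show ?thesis .
next
  case top
  have "(NI \<tau>. indicator {0<..} \<tau> * of_bool (ennreal (c * \<tau> powr (1 / P)) < y)) = (NI \<tau>. indicator {0::real<..} \<tau>)"
    by (rule nn_integral_cong) (simp add: top)
  also have "\<dots> = top"
  proof -
    have "ennreal r \<le> (NI \<tau>. indicator {0::real<..} \<tau>)" if "0 \<le> r" for r
    proof -
      have "ennreal r = (NI \<tau>. indicator {0<..<r} \<tau>)" using that by simp
      also have "\<dots> \<le> (NI \<tau>. indicator {0::real<..} \<tau>)" by (intro nn_integral_mono) (simp add: indicator_def)
      finally show ?thesis .
    qed
    then show ?thesis 
    proof (cases "(NI \<tau>. indicator {0::real<..} \<tau>) :: ennreal")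
      case (real r)
      then show ?thesis using \<open>\<And>r. 0 \<le> r \<Longrightarrow> ennreal r \<le> _\<close>[of "r + 1"] by simp
    qed
  qed
  also have "\<dots> = ennreal (c powr (- P)) * enn_powr y P" using assms by (simp add: top ennreal_mult_top)
  finally show ?thesis .
qed

text \<open>Levels are parametrised as \<tau>^(1/P), because then the levels for P and for Q at the
  same \<tau> multiply to the level for R, and one integral over \<tau> serves all three
  exponents.\<close>

lemma layer_cake:
  fixes f :: "'a::euclidean_space \<Rightarrow> ennreal"
  assumes [measurable]: "borel_fun f" and "0 < P" "0 < c"
  shows "(NI \<tau>. indicator {0<..} \<tau> * emeasure lborel {x. ennreal (c * \<tau> powr (1 / P)) < f x}) =
    ennreal (c powr (- P)) * (NI x. enn_powr (f x) P)"
proof -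
  have "(NI \<tau>. indicator {0<..} \<tau> * emeasure lborel {x. ennreal (c * \<tau> powr (1 / P)) < f x})
    = (NI \<tau>. NI x. indicator {0<..} \<tau> * of_bool (ennreal (c * \<tau> powr (1 / P)) < f x))"
  proof (rule nn_integral_cong)
    fix \<tau> :: real
    have "(NI x. of_bool (ennreal (c * \<tau> powr (1 / P)) < f x)) = (NI x. indicator {x. ennreal (c * \<tau> powr (1 / P)) < f x} x)"
      by (simp add: indicator_def)
    also have "\<dots> = emeasure lborel {x. ennreal (c * \<tau> powr (1 / P)) < f x}" by simp
    finally show "indicator {0<..} \<tau> * emeasure lborel {x. ennreal (c * \<tau> powr (1 / P)) < f x} = (NI x. indicator {0<..} \<tau> * of_bool (ennreal (c * \<tau> powr (1 / P)) < f x))"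
      by (subst nn_integral_cmult) (simp_all add: of_bool_def)
  qed
  also have "\<dots> = (NI x. NI \<tau>. indicator {0<..} \<tau> * of_bool (ennreal (c * \<tau> powr (1 / P)) < f x))"
    unfolding of_bool_def by (rule nn_integral_lborel_swap) measurable
  also have "\<dots> = (NI x. ennreal (c powr (- P)) * enn_powr (f x) P)"
    by (intro nn_integral_cong layer_cake_point assms)
  also have "\<dots> = ennreal (c powr (- P)) * (NI x. enn_powr (f x) P)" by (rule nn_integral_cmult) measurable
  finally show ?thesis .
qed

text \<open>For a finite value v the integral is v / c times that of \<tau>^(-1/P) from 0 to
  (v/c)^P. Integrability at 0 requires P > 1 and produces the factor P / (P - 1).\<close>

lemma layer_cake_above_point:
  assumes P: "1 < P" and c: "0 < c"
  shows "(NI \<tau>. indicator {0<..} \<tau> * (ennreal (1 / (c * \<tau> powr (1 / P))) * (if ennreal (c * \<tau> powr (1 / P)) < y then y else 0)))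
    \<le> ennreal (P / (P - 1) * c powr (- P)) * enn_powr y P"
proof (cases y)
  case (real v)
  define T where "T = (v / c) powr P"
  have T: "0 \<le> T" by (simp add: T_def)
  have a: "- 1 < - (1 / P)" using P by simp
  have "(NI \<tau>. indicator {0<..} \<tau> * (ennreal (1 / (c * \<tau> powr (1 / P))) * (if ennreal (c * \<tau> powr (1 / P)) < y then y else 0)))
    \<le> (NI \<tau>. ennreal (v / c) * (indicator {0..T} \<tau> * ennreal (\<tau> powr (- (1 / P)))))"
  proof (rule nn_integral_mono)
    fix \<tau> :: real
    show "indicator {0<..} \<tau> * (ennreal (1 / (c * \<tau> powr (1 / P))) * (if ennreal (c * \<tau> powr (1 / P)) < y then y else 0))
      \<le> ennreal (v / c) * (indicator {0..T} \<tau> * ennreal (\<tau> powr (- (1 / P))))"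
    proof (cases "0 < \<tau> \<and> ennreal (c * \<tau> powr (1 / P)) < y")
      case True
      then have "\<tau> < T" unfolding T_def using powr_inverse_less_iff[of P c \<tau> v] P c real by (simp add: ennreal_less_iff)
      moreover have "ennreal (1 / (c * \<tau> powr (1 / P))) * y = ennreal (v / c) * ennreal (\<tau> powr (- (1 / P)))"
      proof -
        have "1 / (c * \<tau> powr (1 / P)) * v = v / c * \<tau> powr (- (1 / P))" by (simp add: powr_minus_divide)
        then show ?thesis unfolding real(2) using real(1) c by (simp add: ennreal_mult[symmetric] del: times_divide_eq_left times_divide_eq_right)
      qed
      ultimately show ?thesis using True by simp
    qed auto
  qed
  also have "\<dots> = ennreal (v / c) * (NI \<tau>. indicator {0..T} \<tau> * ennreal (\<tau> powr (- (1 / P))))"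
    by (rule nn_integral_cmult) measurable
  also have "(NI \<tau>. indicator {0..T} \<tau> * ennreal (\<tau> powr (- (1 / P)))) = ennreal (T powr (- (1 / P) + 1) / (- (1 / P) + 1))"
  proof -
    have "((\<lambda>\<tau>. if \<tau> \<in> {0..T} then \<tau> powr (- (1 / P)) else 0) has_integral T powr (- (1 / P) + 1) / (- (1 / P) + 1)) UNIV"
      unfolding has_integral_restrict_UNIV by (rule has_integral_powr_from_0[OF a T])
    then have "(NI \<tau>. ennreal (if \<tau> \<in> {0..T} then \<tau> powr (- (1 / P)) else 0)) = ennreal (T powr (- (1 / P) + 1) / (- (1 / P) + 1))"
      by (intro nn_integral_has_integral_lborel) auto
    moreover have "(NI \<tau>. ennreal (if \<tau> \<in> {0..T} then \<tau> powr (- (1 / P)) else 0)) = (NI \<tau>. indicator {0..T} \<tau> * ennreal (\<tau> powr (- (1 / P))))"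
      by (intro nn_integral_cong) (simp add: indicator_def)
    ultimately show ?thesis by simp
  qed
  also have "ennreal (v / c) * ennreal (T powr (- (1 / P) + 1) / (- (1 / P) + 1)) = ennreal (P / (P - 1) * c powr (- P)) * enn_powr y P"
  proof -
    have "P * (- (1 / P) + 1) = P - 1" using P by (simp add: right_diff_distrib)
    then have e1: "T powr (- (1 / P) + 1) = (v / c) powr (P - 1)" unfolding T_def powr_powr by (simp only:)
    have e2: "(v / c) * (v / c) powr (P - 1) = (v / c) powr P"
      using powr_mult_base[of "v / c" "P - 1"] real c by simp
    have e3: "1 / (- (1 / P) + 1) = P / (P - 1)" using P by (simp add: field_simps)
    have "(v / c) * (T powr (- (1 / P) + 1) / (- (1 / P) + 1)) = (1 / (- (1 / P) + 1)) * ((v / c) * (v / c) powr (P - 1))" unfolding e1 by simp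
    also have "\<dots> = (P / (P - 1) * c powr (- P)) * v powr P"
      unfolding e2 e3 using real c by (simp add: powr_divide powr_minus_divide)
    finally have e4: "(v / c) * (T powr (- (1 / P) + 1) / (- (1 / P) + 1)) = (P / (P - 1) * c powr (- P)) * v powr P" .
    have n: "0 \<le> v / c" "0 \<le> T powr (- (1 / P) + 1) / (- (1 / P) + 1)" "0 \<le> P / (P - 1) * c powr (- P)" "0 \<le> v powr P"
      using real c P by (auto simp: field_simps)
    show ?thesis unfolding real(2) enn_powr_ennreal[OF real(1)] ennreal_mult[OF n(1,2), symmetric] ennreal_mult[OF n(3,4), symmetric] e4 ..
  qed
  finally show ?thesis .
next
  case top
  have "ennreal (P / (P - 1) * c powr (- P)) \<noteq> 0" using P c by (simp add: ennreal_eq_0_iff not_le)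
  then have "ennreal (P / (P - 1) * c powr (- P)) * enn_powr y P = top" by (simp only: top enn_powr_top ennreal_mult_top if_False)
  then show ?thesis by (simp only: top_greatest)
qed

lemma layer_cake_above:
  fixes f :: "'a::euclidean_space \<Rightarrow> ennreal"
  assumes [measurable]: "borel_fun f" and P: "1 < P" and c: "0 < c"
  shows "(NI \<tau>. indicator {0<..} \<tau> * (ennreal (1 / (c * \<tau> powr (1 / P))) * (NI x. above (c * \<tau> powr (1 / P)) f x)))
    \<le> ennreal (P / (P - 1) * c powr (- P)) * (NI x. enn_powr (f x) P)"
proof -
  have "(NI \<tau>. indicator {0<..} \<tau> * (ennreal (1 / (c * \<tau> powr (1 / P))) * (NI x. above (c * \<tau> powr (1 / P)) f x)))
    = (NI \<tau>. NI x. indicator {0<..} \<tau> * (ennreal (1 / (c * \<tau> powr (1 / P))) * above (c * \<tau> powr (1 / P)) f x))"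
    by (intro nn_integral_cong) (subst nn_integral_cmult, measurable, subst nn_integral_cmult, measurable)
  also have "\<dots> = (NI x. NI \<tau>. indicator {0<..} \<tau> * (ennreal (1 / (c * \<tau> powr (1 / P))) * above (c * \<tau> powr (1 / P)) f x))"
    unfolding above_def by (rule nn_integral_lborel_swap) measurable
  also have "\<dots> \<le> (NI x. ennreal (P / (P - 1) * c powr (- P)) * enn_powr (f x) P)"
    unfolding above_def by (intro nn_integral_mono layer_cake_above_point P c)
  also have "\<dots> = ennreal (P / (P - 1) * c powr (- P)) * (NI x. enn_powr (f x) P)" by (rule nn_integral_cmult) measurable
  finally show ?thesis .
qed

definition upto :: "ennreal \<Rightarrow> ('a \<Rightarrow> ennreal) \<Rightarrow> 'a \<Rightarrow> ennreal" where
  "upto c f x = (if f x \<le> c then f x else 0)"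

lemma upto_measurable [measurable (raw)]:
  assumes [measurable]: "borel_fun f" "g \<in> borel_measurable M"
  shows "(\<lambda>w. upto c f (g w)) \<in> borel_measurable M"
  unfolding upto_def by measurable

text \<open>Marcinkiewicz interpolation with splitting heights shifted by \<open>A\<close> and \<open>k\<close>, so that every term except the
  last one decays in these parameters, and the last term decays in \<open>\<gamma>\<close>.\<close>

lemma interpolation:
  fixes U :: "('a::euclidean_space \<Rightarrow> ennreal) \<Rightarrow> ('a \<Rightarrow> ennreal) \<Rightarrow> 'a \<Rightarrow> ennreal"
  assumes P: "1 < P" and Q: "1 < Q" and R: "0 < R" "1 / R = 1 / P + 1 / Q"
    and C: "0 < C" and B: "0 \<le> B" and \<gamma>: "0 \<le> \<gamma>" and A: "1 \<le> A" and k: "1 \<le> k"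
    and meas: "\<And>f g. f \<in> borel_measurable borel \<Longrightarrow> borel_fun g \<Longrightarrow> U f g \<in> borel_measurable borel"
    and sub1: "\<And>f1 f2 g x. f1 \<in> borel_measurable borel \<Longrightarrow> borel_fun f2 \<Longrightarrow> borel_fun g \<Longrightarrow>
      U (\<lambda>y. f1 y + f2 y) g x \<le> U f1 g x + U f2 g x"
    and sub2: "\<And>f g1 g2 x. f \<in> borel_measurable borel \<Longrightarrow> borel_fun g1 \<Longrightarrow> borel_fun g2 \<Longrightarrow>
      U f (\<lambda>y. g1 y + g2 y) x \<le> U f g1 x + U f g2 x"
    and corner: "\<And>\<alpha> \<beta> f g. 0 < \<alpha> \<Longrightarrow> 0 < \<beta> \<Longrightarrow> borel_fun f \<Longrightarrow> borel_fun g \<Longrightarrow>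
      emeasure lborel {x. ennreal (C * (\<alpha> * \<beta>)) < U f g x} \<le>
        ennreal B * (ennreal (1 / \<alpha>) * (NI x. above \<alpha> f x) + ennreal (1 / \<beta>) * (NI x. above \<beta> g x))"
    and gain: "\<And>f g G a b \<kappa>. f \<in> borel_measurable borel \<Longrightarrow> borel_fun g \<Longrightarrow> G \<in> sets borel \<Longrightarrow>
      (\<And>y. f y \<le> ennreal a) \<Longrightarrow> (\<And>y. g y \<le> ennreal b * indicator G y) \<Longrightarrow> 0 < a \<Longrightarrow> 0 < b \<Longrightarrow> 0 < \<kappa> \<Longrightarrow>
      emeasure lborel {x. ennreal \<kappa> < U f g x} \<le> ennreal (\<gamma> * (a * a * (b * b) / (\<kappa> * \<kappa>))) * emeasure lborel G"
    and [measurable]: "borel_fun f" "borel_fun g"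
    and f1: "(NI x. enn_powr (f x) P) \<le> 1" and g1: "(NI x. enn_powr (g x) Q) \<le> 1"
  shows "(NI \<tau>. indicator {0<..} \<tau> * emeasure lborel {x. ennreal (4 * C * \<tau> powr (1 / R)) < U f g x}) \<le>
    ennreal (B * ((k * A * (P / (P - 1) * A powr (- P)) + Q / (Q - 1) * k powr (- Q)) +
      (P / (P - 1) * k powr (- P) + k * A * (Q / (Q - 1) * A powr (- Q)))) + \<gamma> * A ^ 4 / (C * C) * (1 / A) powr (- Q))"
proof -
  have Ak: "0 < A" "0 < k" using A k by simp_all
  note [measurable] = meas
  define \<alpha> where "\<alpha> \<tau> = \<tau> powr (1 / P)" for \<tau> :: real
  define \<beta> where "\<beta> \<tau> = \<tau> powr (1 / Q)" for \<tau> :: real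
  have [measurable]: "borel_fun \<alpha>" "borel_fun \<beta>" unfolding \<alpha>_def \<beta>_def by measurable
  define a where "a c \<tau> = ennreal (1 / (c * \<alpha> \<tau>)) * (NI x. above (c * \<alpha> \<tau>) f x)" for c \<tau>
  define b where "b c \<tau> = ennreal (1 / (c * \<beta> \<tau>)) * (NI x. above (c * \<beta> \<tau>) g x)" for c \<tau>
  have [measurable]: "(\<lambda>\<tau>. a c \<tau>) \<in> borel_measurable borel" "(\<lambda>\<tau>. b c \<tau>) \<in> borel_measurable borel" for c
    unfolding a_def b_def above_def by measurable
  define L where "L \<tau> = emeasure lborel {x. ennreal (1 / A * \<beta> \<tau>) < g x}" for \<tau>
  have L_eq: "L \<tau> = (NI x. of_bool (ennreal (1 / A * \<beta> \<tau>) < g x))" for \<tau>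
  proof -
    have "L \<tau> = (NI x. indicator {x. ennreal (1 / A * \<beta> \<tau>) < g x} x)" unfolding L_def by simp
    then show ?thesis by (simp add: indicator_def)
  qed
  have [measurable]: "borel_fun L" unfolding L_eq of_bool_def by measurable
  have split: "emeasure lborel {x. ennreal (4 * C * \<tau> powr (1 / R)) < U f g x}
    \<le> (ennreal B * (ennreal (k * A) * a A \<tau> + b k \<tau>) + ennreal B * (a k \<tau> + ennreal (k * A) * b A \<tau>)) + ennreal (\<gamma> * A ^ 4 / (C * C)) * L \<tau>"
    if \<tau>: "0 < \<tau>" for \<tau>
  proof -
    have pos: "0 < \<alpha> \<tau>" "0 < \<beta> \<tau>" using \<tau> by (simp_all add: \<alpha>_def \<beta>_def)
    have prod: "\<tau> powr (1 / R) = \<alpha> \<tau> * \<beta> \<tau>" unfolding \<alpha>_def \<beta>_def R(2) by (rule powr_add)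
    \<comment> \<open>f is cut at A \<alpha>, and g at A \<beta> and at \<beta> / A. The four
      resulting terms share the level 4 s equally.\<close>
    define s where "s = C * (\<alpha> \<tau> * \<beta> \<tau>)"
    have s: "0 < s" using C pos by (simp add: s_def)
    let ?fb = "above (A * \<alpha> \<tau>) f" and ?fu = "upto (ennreal (A * \<alpha> \<tau>)) f"
    let ?gb = "above (A * \<beta> \<tau>) g" and ?gu = "upto (ennreal (A * \<beta> \<tau>)) g"
    let ?gl = "upto (ennreal (1 / A * \<beta> \<tau>)) ?gu" and ?gm = "above (1 / A * \<beta> \<tau>) ?gu"
    have fs: "f = (\<lambda>y. ?fb y + ?fu y)" "g = (\<lambda>y. ?gb y + ?gu y)" "?gu = (\<lambda>y. ?gm y + ?gl y)"
      by (auto simp: above_def upto_def fun_eq_iff)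
    have le: "U f g x \<le> (U ?fb g x + U ?fu ?gb x) + (U ?fu ?gm x + U ?fu ?gl x)" for x
    proof -
      have "U f g x \<le> U ?fb g x + U ?fu g x" using sub1[of ?fb ?fu g x] fs(1) by simp
      also have "U ?fu g x \<le> U ?fu ?gb x + U ?fu ?gu x" using sub2[of ?fu ?gb ?gu x] fs(2) by simp
      also have "U ?fu ?gu x \<le> U ?fu ?gm x + U ?fu ?gl x" using sub2[of ?fu ?gm ?gl x] fs(3) by simp
      finally show ?thesis by (simp add: add_left_mono add.assoc)
    qed
    let ?E = "\<lambda>h. {x. ennreal s < h x}"
    have sub: "{x. ennreal (4 * C * \<tau> powr (1 / R)) < U f g x} \<subseteq> (?E (U ?fb g) \<union> ?E (U ?fu ?gb)) \<union> (?E (U ?fu ?gm) \<union> ?E (U ?fu ?gl))"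
    proof
      fix x assume x: "x \<in> {x. ennreal (4 * C * \<tau> powr (1 / R)) < U f g x}"
      show "x \<in> (?E (U ?fb g) \<union> ?E (U ?fu ?gb)) \<union> (?E (U ?fu ?gm) \<union> ?E (U ?fu ?gl))"
      proof (rule ccontr)
        assume "\<not> ?thesis"
        then have "U ?fb g x \<le> ennreal s" "U ?fu ?gb x \<le> ennreal s" "U ?fu ?gm x \<le> ennreal s" "U ?fu ?gl x \<le> ennreal s" by (auto simp: not_less)
        then have "U f g x \<le> (ennreal s + ennreal s) + (ennreal s + ennreal s)" by (intro order_trans[OF le] add_mono)
        also have "\<dots> = ennreal (4 * C * \<tau> powr (1 / R))"
        proof -
          have "(ennreal s + ennreal s) + (ennreal s + ennreal s) = ennreal ((s + s) + (s + s))" using s by (simp only: ennreal_plus[symmetric] add_nonneg_nonneg less_imp_le)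
          also have "(s + s) + (s + s) = 4 * C * \<tau> powr (1 / R)" by (simp add: s_def prod)
          finally show ?thesis .
        qed
        finally show False using x by (simp add: not_le[symmetric])
      qed
    qed
    \<comment> \<open>The weak type bound sees only the product of the two heights, so they can be
      traded: where f is large it is tested at the lower height \<alpha> / k, which is harmless
      above A \<alpha>, while g is tested at the higher k \<beta>. Symmetrically for g.\<close>
    have k1: "\<alpha> \<tau> / k * (k * \<beta> \<tau>) = \<alpha> \<tau> * \<beta> \<tau>" "k * \<alpha> \<tau> * (\<beta> \<tau> / k) = \<alpha> \<tau> * \<beta> \<tau>" "A * \<alpha> \<tau> * (1 / A * \<beta> \<tau>) = \<alpha> \<tau> * \<beta> \<tau>"
      using Ak by simp_all
    have e1: "emeasure lborel (?E (U ?fb g)) \<le> ennreal B * (ennreal (k * A) * a A \<tau> + b k \<tau>)"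
    proof -
      have "emeasure lborel (?E (U ?fb g)) \<le> ennreal B * (ennreal (1 / (\<alpha> \<tau> / k)) * (NI x. above (\<alpha> \<tau> / k) ?fb x) + ennreal (1 / (k * \<beta> \<tau>)) * (NI x. above (k * \<beta> \<tau>) g x))"
        unfolding s_def k1(1)[symmetric] using pos Ak by (intro corner) simp_all
      also have "\<dots> \<le> ennreal B * (ennreal (1 / (\<alpha> \<tau> / k)) * (NI x. ?fb x) + b k \<tau>)"
        unfolding b_def by (intro mult_left_mono add_mono nn_integral_mono order_refl) (simp_all add: above_def)
      also have "ennreal (1 / (\<alpha> \<tau> / k)) * (NI x. ?fb x) = ennreal (k * A) * a A \<tau>"
      proof -
        have "ennreal (k * A) * ennreal (1 / (A * \<alpha> \<tau>)) = ennreal (k * A * (1 / (A * \<alpha> \<tau>)))" using Ak pos by (intro ennreal_mult[symmetric]) simp_all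
        also have "k * A * (1 / (A * \<alpha> \<tau>)) = 1 / (\<alpha> \<tau> / k)" using Ak by simp
        finally show ?thesis unfolding a_def by (simp only: mult.assoc[symmetric])
      qed
      finally show ?thesis .
    qed
    have e2: "emeasure lborel (?E (U ?fu ?gb)) \<le> ennreal B * (a k \<tau> + ennreal (k * A) * b A \<tau>)"
    proof -
      have "emeasure lborel (?E (U ?fu ?gb)) \<le> ennreal B * (ennreal (1 / (k * \<alpha> \<tau>)) * (NI x. above (k * \<alpha> \<tau>) ?fu x) + ennreal (1 / (\<beta> \<tau> / k)) * (NI x. above (\<beta> \<tau> / k) ?gb x))"
        unfolding s_def k1(2)[symmetric] using pos Ak by (intro corner) simp_all
      also have "\<dots> \<le> ennreal B * (a k \<tau> + ennreal (1 / (\<beta> \<tau> / k)) * (NI x. ?gb x))"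
        unfolding a_def by (intro mult_left_mono add_mono nn_integral_mono order_refl) (simp_all add: above_def upto_def)
      also have "ennreal (1 / (\<beta> \<tau> / k)) * (NI x. ?gb x) = ennreal (k * A) * b A \<tau>"
      proof -
        have "ennreal (k * A) * ennreal (1 / (A * \<beta> \<tau>)) = ennreal (k * A * (1 / (A * \<beta> \<tau>)))" using Ak pos by (intro ennreal_mult[symmetric]) simp_all
        also have "k * A * (1 / (A * \<beta> \<tau>)) = 1 / (\<beta> \<tau> / k)" using Ak by simp
        finally show ?thesis unfolding b_def by (simp only: mult.assoc[symmetric])
      qed
      finally show ?thesis .
    qed
    \<comment> \<open>At the heights A \<alpha> and \<beta> / A neither function exceeds its own
      height, so both integrals in the bound vanish.\<close>
    have e3: "emeasure lborel (?E (U ?fu ?gl)) \<le> 0"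
    proof -
      have z: "above (A * \<alpha> \<tau>) ?fu = (\<lambda>x. 0)" "above (1 / A * \<beta> \<tau>) ?gl = (\<lambda>x. 0)" by (auto simp: above_def upto_def fun_eq_iff)
      have "emeasure lborel (?E (U ?fu ?gl)) \<le> ennreal B * (ennreal (1 / (A * \<alpha> \<tau>)) * (NI x. above (A * \<alpha> \<tau>) ?fu x) + ennreal (1 / (1 / A * \<beta> \<tau>)) * (NI x. above (1 / A * \<beta> \<tau>) ?gl x))"
        unfolding s_def k1(3)[symmetric] using pos Ak by (intro corner) simp_all
      then show ?thesis unfolding z by simp
    qed
    \<comment> \<open>The middle part of g lives where g exceeds \<beta> / A. Integrated over
      \<tau>, the measure of this set contributes at most (1/A)^(-Q) = A^Q.\<close>
    have e4: "emeasure lborel (?E (U ?fu ?gm)) \<le> ennreal (\<gamma> * A ^ 4 / (C * C)) * L \<tau>"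
    proof -
      have "emeasure lborel (?E (U ?fu ?gm)) \<le> ennreal (\<gamma> * ((A * \<alpha> \<tau>) * (A * \<alpha> \<tau>) * ((A * \<beta> \<tau>) * (A * \<beta> \<tau>)) / (s * s))) * emeasure lborel {x. ennreal (1 / A * \<beta> \<tau>) < g x}"
      proof (rule gain)
        show "?fu y \<le> ennreal (A * \<alpha> \<tau>)" for y by (simp add: upto_def)
        show "?gm y \<le> ennreal (A * \<beta> \<tau>) * indicator {x. ennreal (1 / A * \<beta> \<tau>) < g x} y" for y
          by (simp add: upto_def above_def indicator_def)
      qed (use pos Ak s in simp_all)
      also have "\<gamma> * ((A * \<alpha> \<tau>) * (A * \<alpha> \<tau>) * ((A * \<beta> \<tau>) * (A * \<beta> \<tau>)) / (s * s)) = \<gamma> * A ^ 4 / (C * C)"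
        unfolding s_def using pos C by (simp add: power4_eq_xxxx)
      finally show ?thesis unfolding L_def .
    qed
    have "emeasure lborel {x. ennreal (4 * C * \<tau> powr (1 / R)) < U f g x} \<le> emeasure lborel ((?E (U ?fb g) \<union> ?E (U ?fu ?gb)) \<union> (?E (U ?fu ?gm) \<union> ?E (U ?fu ?gl)))"
      by (rule emeasure_mono[OF sub]) simp
    also have "\<dots> \<le> (emeasure lborel (?E (U ?fb g)) + emeasure lborel (?E (U ?fu ?gb))) + (emeasure lborel (?E (U ?fu ?gm)) + emeasure lborel (?E (U ?fu ?gl)))"
      by (intro order_trans[OF emeasure_subadditive] add_mono emeasure_subadditive) simp_all
    also have "\<dots> \<le> (ennreal B * (ennreal (k * A) * a A \<tau> + b k \<tau>) + ennreal B * (a k \<tau> + ennreal (k * A) * b A \<tau>)) + (ennreal (\<gamma> * A ^ 4 / (C * C)) * L \<tau> + 0)"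
      by (intro add_mono e1 e2 e3 e4)
    finally show ?thesis by simp
  qed
  define P' where "P' = P / (P - 1)"
  define Q' where "Q' = Q / (Q - 1)"
  have PQ: "0 \<le> P'" "0 \<le> Q'" using P Q by (simp_all add: P'_def Q'_def)
  have Ia: "(NI \<tau>. indicator {0<..} \<tau> * a c \<tau>) \<le> ennreal (P' * c powr (- P))" if "0 < c" for c
  proof -
    have "(NI \<tau>. indicator {0<..} \<tau> * a c \<tau>) \<le> ennreal (P' * c powr (- P)) * (NI x. enn_powr (f x) P)"
      unfolding a_def \<alpha>_def P'_def by (rule layer_cake_above[OF _ P that]) measurable
    also have "\<dots> \<le> ennreal (P' * c powr (- P)) * 1" by (rule mult_left_mono[OF f1]) simp
    finally show ?thesis by simp
  qed
  have Ib: "(NI \<tau>. indicator {0<..} \<tau> * b c \<tau>) \<le> ennreal (Q' * c powr (- Q))" if "0 < c" for c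
  proof -
    have "(NI \<tau>. indicator {0<..} \<tau> * b c \<tau>) \<le> ennreal (Q' * c powr (- Q)) * (NI x. enn_powr (g x) Q)"
      unfolding b_def \<beta>_def Q'_def by (rule layer_cake_above[OF _ Q that]) measurable
    also have "\<dots> \<le> ennreal (Q' * c powr (- Q)) * 1" by (rule mult_left_mono[OF g1]) simp
    finally show ?thesis by simp
  qed
  have IL: "(NI \<tau>. indicator {0<..} \<tau> * L \<tau>) \<le> ennreal ((1 / A) powr (- Q))"
  proof -
    have "(NI \<tau>. indicator {0<..} \<tau> * L \<tau>) = ennreal ((1 / A) powr (- Q)) * (NI x. enn_powr (g x) Q)"
      unfolding L_def \<beta>_def using Q Ak by (intro layer_cake) simp_all
    also have "\<dots> \<le> ennreal ((1 / A) powr (- Q)) * 1" by (rule mult_left_mono[OF g1]) simp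
    finally show ?thesis by simp
  qed
  let ?i = "\<lambda>\<tau>. indicator {0<..} (\<tau>::real) :: ennreal"
  have "(NI \<tau>. ?i \<tau> * emeasure lborel {x. ennreal (4 * C * \<tau> powr (1 / R)) < U f g x})
    \<le> (NI \<tau>. ennreal B * ((ennreal (k * A) * (?i \<tau> * a A \<tau>) + ?i \<tau> * b k \<tau>) + (?i \<tau> * a k \<tau> + ennreal (k * A) * (?i \<tau> * b A \<tau>))) + ennreal (\<gamma> * A ^ 4 / (C * C)) * (?i \<tau> * L \<tau>))"
  proof (rule nn_integral_mono)
    fix \<tau> :: real
    show "?i \<tau> * emeasure lborel {x. ennreal (4 * C * \<tau> powr (1 / R)) < U f g x} \<le>
      ennreal B * ((ennreal (k * A) * (?i \<tau> * a A \<tau>) + ?i \<tau> * b k \<tau>) + (?i \<tau> * a k \<tau> + ennreal (k * A) * (?i \<tau> * b A \<tau>))) + ennreal (\<gamma> * A ^ 4 / (C * C)) * (?i \<tau> * L \<tau>)"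
      using split[of \<tau>] by (cases "0 < \<tau>") (simp_all add: distrib_left add.assoc)
  qed
  also have "\<dots> = ennreal B * ((ennreal (k * A) * (NI \<tau>. ?i \<tau> * a A \<tau>) + (NI \<tau>. ?i \<tau> * b k \<tau>)) + ((NI \<tau>. ?i \<tau> * a k \<tau>) + ennreal (k * A) * (NI \<tau>. ?i \<tau> * b A \<tau>))) + ennreal (\<gamma> * A ^ 4 / (C * C)) * (NI \<tau>. ?i \<tau> * L \<tau>)"
    by (subst nn_integral_add, measurable, subst nn_integral_cmult, measurable, subst nn_integral_add, measurable, subst nn_integral_add, measurable,
        subst nn_integral_add, measurable, subst nn_integral_cmult, measurable, subst nn_integral_cmult, measurable, subst nn_integral_cmult, measurable)
  also have "\<dots> \<le> ennreal B * ((ennreal (k * A) * ennreal (P' * A powr (- P)) + ennreal (Q' * k powr (- Q))) + (ennreal (P' * k powr (- P)) + ennreal (k * A) * ennreal (Q' * A powr (- Q)))) + ennreal (\<gamma> * A ^ 4 / (C * C)) * ennreal ((1 / A) powr (- Q))"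
    by (intro add_mono mult_left_mono Ia Ib IL Ak) simp_all
  also have "\<dots> = ennreal (B * ((k * A * (P' * A powr (- P)) + Q' * k powr (- Q)) + (P' * k powr (- P) + k * A * (Q' * A powr (- Q)))) + \<gamma> * A ^ 4 / (C * C) * (1 / A) powr (- Q))"
  proof -
    have n: "0 \<le> k * A" "0 \<le> P' * A powr (- P)" "0 \<le> Q' * k powr (- Q)" "0 \<le> P' * k powr (- P)" "0 \<le> Q' * A powr (- Q)" "0 \<le> \<gamma> * A ^ 4 / (C * C)" "0 \<le> (1 / A) powr (- Q)"
      using Ak PQ \<gamma> by simp_all
    show ?thesis using n B by (simp only: ennreal_plus ennreal_mult add_nonneg_nonneg mult_nonneg_nonneg)
  qed
  finally show ?thesis unfolding P'_def Q'_def .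
qed

section \<open>Powers of sums and subadditivity of the terms\<close>

lemma enn_powr_mono: "x \<le> y \<Longrightarrow> 0 \<le> a \<Longrightarrow> enn_powr x a \<le> enn_powr y a"
  by (cases x; cases y) (auto simp: enn_powr_ennreal intro!: ennreal_leI powr_mono2 simp: top_unique)

lemma enn_powr_cmult: "0 \<le> c \<Longrightarrow> 0 < a \<Longrightarrow> enn_powr (ennreal c * x) a = ennreal (c powr a) * enn_powr x a"
proof (cases x)
  case (real v)
  assume "0 \<le> c" "0 < a"
  then show ?thesis using real by (simp add: enn_powr_ennreal ennreal_mult[symmetric] powr_mult)
next
  case top
  assume c: "0 \<le> c" "0 < a"
  show ?thesis
  proof (cases "c = 0")
    case True
    then show ?thesis using c by (simp add: enn_powr_def)
  next
    case False
    then have "ennreal c \<noteq> 0" "ennreal (c powr a) \<noteq> 0" using c by (simp_all add: ennreal_eq_0_iff not_le)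
    then show ?thesis by (simp only: top enn_powr_top ennreal_mult_top if_False)
  qed
qed

lemma enn_powr_powr: "0 < b \<Longrightarrow> enn_powr (enn_powr x a) b = enn_powr x (a * b)"
  by (cases x) (simp_all add: enn_powr_ennreal powr_powr)

lemma enn_powr_one [simp]: "enn_powr x 1 = x"
  by (cases x) (simp_all add: enn_powr_ennreal)

lemma enn_powr_add_le:
  assumes "0 < R"
  shows "enn_powr (x + y) R \<le> ennreal (2 powr R) * (enn_powr x R + enn_powr y R)"
proof -
  have "x + y \<le> ennreal 2 * max x y" using add_mono[of x "max x y" y "max x y"] by (simp add: mult_2)
  then have "enn_powr (x + y) R \<le> enn_powr (ennreal 2 * max x y) R" using assms by (intro enn_powr_mono) auto
  also have "\<dots> = ennreal (2 powr R) * enn_powr (max x y) R" using assms by (intro enn_powr_cmult) auto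
  also have "\<dots> \<le> ennreal (2 powr R) * (enn_powr x R + enn_powr y R)" by (intro mult_left_mono) (auto simp: max_def add_increasing add_increasing2)
  finally show ?thesis .
qed

text \<open>A substitute for the triangle inequality, valid for every R > 0. The weighted sum S
  dominates each of its terms, hence W m \<le> \<omega>^m S^(1/R), and the geometric series is
  summed before the power R is taken.\<close>

lemma enn_powr_suminf_le:
  fixes W :: "nat \<Rightarrow> ennreal"
  assumes \<omega>: "0 < \<omega>" "\<omega> < 1" and R: "0 < R"
  shows "enn_powr (\<Sum>m. W m) R \<le> ennreal ((1 / (1 - \<omega>)) powr R) * (\<Sum>m. ennreal ((1 / \<omega> ^ m) powr R) * enn_powr (W m) R)"
proof -
  define S where "S = (\<Sum>m. ennreal ((1 / \<omega> ^ m) powr R) * enn_powr (W m) R)"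
  have W: "W m \<le> ennreal (\<omega> ^ m) * enn_powr S (1 / R)" for m
  proof -
    have "enn_powr (ennreal (1 / \<omega> ^ m) * W m) R \<le> S"
      unfolding S_def using \<omega> R sum_le_suminf[of "\<lambda>m. ennreal ((1 / \<omega> ^ m) powr R) * enn_powr (W m) R" "{m}"]
      by (simp add: enn_powr_cmult del: powr_divide)
    then have "enn_powr (enn_powr (ennreal (1 / \<omega> ^ m) * W m) R) (1 / R) \<le> enn_powr S (1 / R)"
      using R by (intro enn_powr_mono) auto
    then have "ennreal (1 / \<omega> ^ m) * W m \<le> enn_powr S (1 / R)" using R by (simp add: enn_powr_powr)
    then have "ennreal (\<omega> ^ m) * (ennreal (1 / \<omega> ^ m) * W m) \<le> ennreal (\<omega> ^ m) * enn_powr S (1 / R)" by (rule mult_left_mono) simp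
    moreover have "ennreal (\<omega> ^ m) * ennreal (1 / \<omega> ^ m) = 1" using \<omega> by (subst ennreal_mult[symmetric]) auto
    ultimately show ?thesis by (simp add: mult.assoc[symmetric])
  qed
  have "(\<Sum>m. W m) \<le> (\<Sum>m. ennreal (\<omega> ^ m) * enn_powr S (1 / R))" by (intro suminf_le W) auto
  also have "\<dots> = (\<Sum>m. ennreal (\<omega> ^ m)) * enn_powr S (1 / R)" by simp
  also have "(\<Sum>m. ennreal (\<omega> ^ m)) = ennreal (1 / (1 - \<omega>))"
    using \<omega> by (subst suminf_ennreal2) (simp_all add: suminf_geometric summable_geometric)
  finally have "enn_powr (\<Sum>m. W m) R \<le> enn_powr (ennreal (1 / (1 - \<omega>)) * enn_powr S (1 / R)) R"
    using R by (intro enn_powr_mono) auto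
  also have "\<dots> = ennreal ((1 / (1 - \<omega>)) powr R) * S"
    using \<omega> R by (subst enn_powr_cmult) (simp_all add: enn_powr_powr)
  finally show ?thesis unfolding S_def .
qed

lemma sph_nn_add:
  assumes [measurable]: "borel_fun f" "borel_fun g"
  shows "sph_nn r (\<lambda>y. f y + g y) x = sph_nn r f x + sph_nn r g x"
  unfolding sph_nn_def distrib_left by (rule nn_integral_add) measurable

lemma bisph_diff_add_left:
  fixes f f' a b :: "'a::euclidean_space \<Rightarrow> ennreal"
  assumes [measurable]: "borel_fun f" "borel_fun f'" "borel_fun a" "borel_fun b"
  shows "bisph_diff t (\<lambda>y. f y + f' y) a b x = bisph_diff t f a b x + bisph_diff t f' a b x"
  unfolding bisph_diff_def distrib_left[symmetric] distrib_right by (subst nn_integral_add[symmetric], measurable) (simp only: distrib_left distrib_right)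

lemma bisph_diff_add_right:
  fixes f a b a' b' :: "'a::euclidean_space \<Rightarrow> ennreal"
  assumes [measurable]: "borel_fun f" "borel_fun a" "borel_fun b" "borel_fun a'" "borel_fun b'"
  shows "bisph_diff t f (\<lambda>y. a y + a' y) (\<lambda>y. b y + b' y) x \<le> bisph_diff t f a b x + bisph_diff t f a' b' x"
proof -
  have "bisph_diff t f a b x + bisph_diff t f a' b' x = ennreal (real DIM('a)) * (NI u. indicator (ball 0 1) u * ennreal (height u ^ (DIM('a) - 2)) *
     (f (x - t *\<^sub>R u) * (absdiff (sph_nn (t * height u) a x) (sph_nn (t * height u) b x) + absdiff (sph_nn (t * height u) a' x) (sph_nn (t * height u) b' x))))"
    unfolding bisph_diff_def distrib_left[symmetric] by (subst nn_integral_add[symmetric], measurable) (simp only: distrib_left)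
  then show ?thesis
    unfolding bisph_diff_def sph_nn_add[OF assms(2,4)] sph_nn_add[OF assms(3,5)]
    by (simp only:) (intro mult_left_mono nn_integral_mono absdiff_triangle; simp)
qed

lemma bisph_diff_max_add_left:
  assumes [measurable]: "borel_fun f" "borel_fun f'" "borel_fun g"
  shows "bisph_diff_max n m (\<lambda>y. f y + f' y) g x \<le> bisph_diff_max n m f g x + bisph_diff_max n m f' g x"
proof -
  have e: "cell_avg k (\<lambda>y. f y + f' y) = (\<lambda>y. cell_avg k f y + cell_avg k f' y)" for k by (rule ext) (rule cell_avg_add; measurable)
  show ?thesis unfolding bisph_diff_max_def e
    by (intro SUP_least, subst bisph_diff_add_left, measurable) (intro add_mono SUP_upper UNIV_I)
qed

lemma bisph_diff_max_add_right:
  assumes [measurable]: "borel_fun f" "borel_fun g" "borel_fun g'"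
  shows "bisph_diff_max n m f (\<lambda>y. g y + g' y) x \<le> bisph_diff_max n m f g x + bisph_diff_max n m f g' x"
proof -
  have e: "cell_avg k (\<lambda>y. g y + g' y) = (\<lambda>y. cell_avg k g y + cell_avg k g' y)" for k by (rule ext) (rule cell_avg_add; measurable)
  show ?thesis unfolding bisph_diff_max_def e
    by (intro SUP_least, rule order_trans[OF bisph_diff_add_right], measurable) (intro add_mono SUP_upper UNIV_I)
qed

text \<open>A crude bound of the difference by the sum, through which the weak type bound reaches
  the terms of the telescoping sum.\<close>

lemma bisph_diff_max_le_cell:
  fixes f g :: "'a::euclidean_space \<Rightarrow> ennreal"
  assumes [measurable]: "borel_fun f" "borel_fun g" and d: "2 \<le> DIM('a)"
  shows "bisph_diff_max n (Suc m) f g x \<le> cell_bisph_max n (Suc m) f g x + cell_bisph_max n m f g x"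
  unfolding bisph_diff_max_def cell_bisph_max_def
proof (rule SUP_least)
  fix l :: int
  have e: "l + int (Suc m) - 1 = l + int m" by simp
  have "bisph_diff (2 powi - l) (cell_avg (l + int n) f) (cell_avg (l + int (Suc m)) g) (cell_avg (l + int m) g) x \<le>
    bisph_nn (2 powi - l) (cell_avg (l + int n) f) (cell_avg (l + int (Suc m)) g) x + bisph_nn (2 powi - l) (cell_avg (l + int n) f) (cell_avg (l + int m) g) x"
    by (rule bisph_nn_le_diff(2)[OF _ _ _ d]) measurable
  also have "\<dots> \<le> (SUP l::int. bisph_nn (2 powi (- l)) (cell_avg (l + int n) f) (cell_avg (l + int (Suc m)) g) x) +
      (SUP l::int. bisph_nn (2 powi (- l)) (cell_avg (l + int n) f) (cell_avg (l + int m) g) x)"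
    by (intro add_mono SUP_upper UNIV_I)
  finally show "bisph_diff (2 powi - l) (cell_avg (l + int n) f) (cell_avg (l + int (Suc m)) g) (cell_avg (l + int (Suc m) - 1) g) x \<le> \<dots>"
    unfolding e .
qed

lemma emeasure_less_add_le:
  fixes U V W :: "'a::euclidean_space \<Rightarrow> ennreal"
  assumes [measurable]: "borel_fun V" "borel_fun W" and le: "\<And>x. U x \<le> V x + W x" and c: "0 \<le> c"
  shows "emeasure lborel {x. ennreal (2 * c) < U x} \<le> emeasure lborel {x. ennreal c < V x} + emeasure lborel {x. ennreal c < W x}"
proof -
  have "{x. ennreal (2 * c) < U x} \<subseteq> {x. ennreal c < V x} \<union> {x. ennreal c < W x}"
  proof
    fix x assume "x \<in> {x. ennreal (2 * c) < U x}"
    then have "ennreal (2 * c) < V x + W x" using le[of x] by auto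
    moreover have "ennreal c + ennreal c = ennreal (2 * c)" using c by (simp add: ennreal_plus[symmetric] del: ennreal_plus)
    ultimately show "x \<in> {x. ennreal c < V x} \<union> {x. ennreal c < W x}"
      using add_mono[of "V x" "ennreal c" "W x" "ennreal c"] by (force simp: not_less)
  qed
  then have "emeasure lborel {x. ennreal (2 * c) < U x} \<le> emeasure lborel ({x. ennreal c < V x} \<union> {x. ennreal c < W x})"
    by (rule emeasure_mono) measurable
  also have "\<dots> \<le> emeasure lborel {x. ennreal c < V x} + emeasure lborel {x. ennreal c < W x}"
    by (rule emeasure_subadditive) measurable
  finally show ?thesis .
qed

text \<open>Each of the 1 + m copies of \<sigma>^m is dominated by a different term of the geometric
  series.\<close>

lemma linear_times_power_le:
  fixes \<sigma> :: real
  assumes "0 < \<sigma>" "\<sigma> < 1"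
  shows "(1 + real m) * \<sigma> ^ m \<le> 1 / (1 - \<sigma>)"
proof -
  have "(1 + real m) * \<sigma> ^ m = (\<Sum>j\<in>{..m}. \<sigma> ^ m)" by simp
  also have "\<dots> \<le> (\<Sum>j\<in>{..m}. \<sigma> ^ j)" using assms by (intro sum_mono power_decreasing) auto
  also have "\<dots> \<le> (\<Sum>j. \<sigma> ^ j)" using assms by (intro sum_le_suminf) (auto intro: summable_geometric)
  also have "\<dots> = 1 / (1 - \<sigma>)" using assms by (simp add: suminf_geometric)
  finally show ?thesis .
qed

text \<open>With \<open>A = 2\<^bsup>\<eta>m\<^esup>\<close> and \<open>k = A\<^bsup>s/2\<^esup>\<close> every term of the interpolation bound decays geometrically in \<open>m\<close>.\<close>

lemma interpolation_constant_decay: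
  fixes P Q :: real
  assumes P: "1 < P" and Q: "1 < Q" and C: "0 < C" and B: "0 < B" and K: "0 < K"
  obtains D \<theta> :: real where "0 < D" "0 < \<theta>" "\<theta> < 1"
    "\<And>m. \<exists>A k. 1 \<le> A \<and> 1 \<le> k \<and> B * (1 + real m) * ((k * A * (P / (P - 1) * A powr (- P)) + Q / (Q - 1) * k powr (- Q)) +
      (P / (P - 1) * k powr (- P) + k * A * (Q / (Q - 1) * A powr (- Q)))) + K * sqrt (1 / 2 ^ Suc m) * A ^ 4 / (C * C) * (1 / A) powr (- Q) \<le> D * \<theta> ^ m"
proof -
  \<comment> \<open>The smaller of the margins P - 1 and Q - 1, capped at 1. With k = A^(s/2) both k
    A A^(-P) = A^(s/2 + 1 - P) and k^(-P) are then at most A^(-s/2), and likewise for Q.\<close>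
  define s where "s = min 1 (min (P - 1) (Q - 1))"
  have s: "0 < s" "s \<le> 1" "s \<le> P - 1" "s \<le> Q - 1" using P Q by (auto simp: s_def)
  \<comment> \<open>Chosen so that A^(4 + Q) = 2^(m/4): the growth of the last term uses up only
    half of the gain 2^(-m/2).\<close>
  define \<eta> where "\<eta> = 1 / (4 * (4 + Q))"
  have \<eta>: "0 < \<eta>" "\<eta> \<le> 1 / 4" "\<eta> * (4 + Q) = 1 / 4" using Q by (auto simp: \<eta>_def field_simps)
  \<comment> \<open>The common decay A^(-s/2) is \<theta>^(2m). One factor \<theta>^m is kept and
    the other absorbs 1 + m.\<close>
  define \<theta> where "\<theta> = 2 powr (- (\<eta> * s / 4))"
  have \<theta>: "0 < \<theta>" "\<theta> < 1" using \<eta>(1) s(1) powr_less_mono[of "- (\<eta> * s / 4)" 0 2] by (auto simp: \<theta>_def)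
  define P' Q' where "P' = P / (P - 1)" and "Q' = Q / (Q - 1)"
  have PQ: "0 < P'" "0 < Q'" using P Q by (auto simp: P'_def Q'_def)
  define D where "D = (2 * B * (P' + Q') + K / (C * C)) / (1 - \<theta>)"
  have D: "0 < D" using B PQ C K \<theta> by (auto simp: D_def intro!: divide_pos_pos add_pos_pos mult_pos_pos)
  show thesis
  proof (rule that[OF D \<theta>])
    fix m :: nat
    define A where "A = 2 powr (\<eta> * real m)"
    define k where "k = 2 powr (\<eta> * real m * (s / 2))"
    have A1: "1 \<le> A" "1 \<le> k" using \<eta>(1) s(1) by (auto simp: A_def k_def intro!: ge_one_powr_ge_zero)
    define \<rho> where "\<rho> = 2 powr (- (\<eta> * s / 2 * real m))"
    have \<rho>: "0 \<le> \<rho>" by (simp add: \<rho>_def)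
    have \<rho>\<theta>: "\<rho> = \<theta> ^ m * \<theta> ^ m"
    proof -
      have "\<theta> ^ m = 2 powr (- (\<eta> * s / 4) * real m)" unfolding \<theta>_def by (simp only: powr_realpow[symmetric] powr_powr powr_gt_zero zero_less_numeral)
      then have "\<theta> ^ m * \<theta> ^ m = 2 powr (- (\<eta> * s / 4) * real m + - (\<eta> * s / 4) * real m)" by (simp only: powr_add)
      also have "- (\<eta> * s / 4) * real m + - (\<eta> * s / 4) * real m = - (\<eta> * s / 2 * real m)" by simp
      finally show ?thesis by (simp only: \<rho>_def)
    qed
    have em: "0 \<le> \<eta> * real m" using \<eta> by simp
    have e1: "k * A * A powr (- P) \<le> \<rho>" "k * A * A powr (- Q) \<le> \<rho>"
    proof -
      have "k * A * A powr (- X) \<le> \<rho>" if "s \<le> X - 1" for X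
      proof -
        have "k * A * A powr (- X) = 2 powr (\<eta> * real m * (s / 2 + 1 - X))"
          unfolding k_def A_def powr_powr powr_add[symmetric] by (simp add: algebra_simps)
        also have "\<eta> * real m * (s / 2 + 1 - X) \<le> \<eta> * real m * (- (s / 2))" using em that by (intro mult_left_mono) auto
        then have "2 powr (\<eta> * real m * (s / 2 + 1 - X)) \<le> \<rho>" unfolding \<rho>_def by (intro powr_mono) (auto simp: algebra_simps)
        finally show ?thesis .
      qed
      then show "k * A * A powr (- P) \<le> \<rho>" "k * A * A powr (- Q) \<le> \<rho>" using s by auto
    qed
    have e2: "k powr (- P) \<le> \<rho>" "k powr (- Q) \<le> \<rho>"
    proof -
      have "k powr (- X) \<le> \<rho>" if "1 < X" for X
      proof -
        have "k powr (- X) \<le> k powr (- 1)" using that A1 by (intro powr_mono) auto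
        also have "\<dots> = \<rho>" unfolding k_def \<rho>_def powr_powr by (rule arg_cong) (simp add: algebra_simps)
        finally show ?thesis .
      qed
      then show "k powr (- P) \<le> \<rho>" "k powr (- Q) \<le> \<rho>" using P Q by auto
    qed
    have e3: "sqrt (1 / 2 ^ Suc m) * A ^ 4 * (1 / A) powr (- Q) \<le> \<rho>"
    proof -
      have a: "(1 / A) powr (- Q) = A powr Q" using A1 by (simp add: powr_divide powr_minus_divide)
      have b: "A ^ 4 = A powr 4" using A1 powr_realpow[of A 4] by simp
      have "A ^ 4 * (1 / A) powr (- Q) = 2 powr (\<eta> * (4 + Q) * real m)"
        unfolding a b powr_add[symmetric] unfolding A_def powr_powr by (rule arg_cong) (simp add: algebra_simps)
      also have "\<dots> = 2 powr (real m / 4)" unfolding \<eta>(3) by simp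
      finally have c: "A ^ 4 * (1 / A) powr (- Q) = 2 powr (real m / 4)" .
      have "sqrt (1 / 2 ^ Suc m) \<le> sqrt (1 / 2 ^ m)" by (simp add: field_simps)
      also have "\<dots> = 2 powr (- (real m / 2))"
        by (simp add: powr_half_sqrt[symmetric] powr_realpow[symmetric] powr_divide powr_powr powr_minus_divide)
      finally have "sqrt (1 / 2 ^ Suc m) * (A ^ 4 * (1 / A) powr (- Q)) \<le> 2 powr (- (real m / 2)) * 2 powr (real m / 4)"
        unfolding c by (intro mult_right_mono) auto
      also have "\<dots> = 2 powr (- (real m / 4))" by (simp add: powr_add[symmetric])
      also have "\<dots> \<le> \<rho>"
      proof -
        have "\<eta> * s / 2 \<le> 1 / 4" using mult_mono[of \<eta> "1/4" s 1] \<eta> s by simp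
        then have "\<eta> * s / 2 * real m \<le> 1 / 4 * real m" by (intro mult_right_mono) auto
        then show ?thesis unfolding \<rho>_def by (intro powr_mono) auto
      qed
      finally show ?thesis by (simp add: mult.assoc)
    qed
    have "B * (1 + real m) * ((k * A * (P' * A powr (- P)) + Q' * k powr (- Q)) + (P' * k powr (- P) + k * A * (Q' * A powr (- Q))))
        + K * sqrt (1 / 2 ^ Suc m) * A ^ 4 / (C * C) * (1 / A) powr (- Q)
      = B * (1 + real m) * ((P' * (k * A * A powr (- P)) + Q' * k powr (- Q)) + (P' * k powr (- P) + Q' * (k * A * A powr (- Q))))
        + K / (C * C) * (sqrt (1 / 2 ^ Suc m) * A ^ 4 * (1 / A) powr (- Q))" by (simp add: mult_ac)
    also have "\<dots> \<le> B * (1 + real m) * ((P' * \<rho> + Q' * \<rho>) + (P' * \<rho> + Q' * \<rho>)) + K / (C * C) * \<rho>"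
      using B PQ K C by (intro add_mono mult_left_mono e1 e2 e3) auto
    also have "\<dots> \<le> B * (1 + real m) * ((P' * \<rho> + Q' * \<rho>) + (P' * \<rho> + Q' * \<rho>)) + (1 + real m) * (K / (C * C) * \<rho>)"
    proof -
      have "0 \<le> K / (C * C) * \<rho>" using K \<rho> by simp
      then have "1 * (K / (C * C) * \<rho>) \<le> (1 + real m) * (K / (C * C) * \<rho>)" by (intro mult_right_mono) auto
      then show ?thesis by simp
    qed
    also have "\<dots> = (2 * B * (P' + Q') + K / (C * C)) * \<theta> ^ m * ((1 + real m) * \<theta> ^ m)" unfolding \<rho>\<theta> by (simp add: algebra_simps add_divide_distrib)
    also have "\<dots> \<le> (2 * B * (P' + Q') + K / (C * C)) * \<theta> ^ m * (1 / (1 - \<theta>))"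
      using B PQ K \<theta> by (intro mult_left_mono linear_times_power_le) auto
    also have "\<dots> = D * \<theta> ^ m" by (simp add: D_def)
    finally show "\<exists>A k. 1 \<le> A \<and> 1 \<le> k \<and> B * (1 + real m) * ((k * A * (P / (P - 1) * A powr (- P)) + Q / (Q - 1) * k powr (- Q)) +
      (P / (P - 1) * k powr (- P) + k * A * (Q / (Q - 1) * A powr (- Q)))) + K * sqrt (1 / 2 ^ Suc m) * A ^ 4 / (C * C) * (1 / A) powr (- Q) \<le> D * \<theta> ^ m"
      unfolding P'_def Q'_def using A1 by blast
  qed
qed

text \<open>Interpolation between the weak type bound and the L^2 gain. The condition on n keeps the
  weak constant linear in m.\<close>

lemma bisph_diff_max_decay:
  assumes d: "2 \<le> DIM('a::euclidean_space)" and P: "1 < P" and Q: "1 < Q" and R: "0 < R" "1 / R = 1 / P + 1 / Q"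
  obtains D \<theta> :: real where "0 < D" "0 < \<theta>" "\<theta> < 1"
    "\<And>m n f g. n \<le> Suc m \<Longrightarrow> (f :: 'a \<Rightarrow> ennreal) \<in> borel_measurable borel \<Longrightarrow> borel_fun g \<Longrightarrow>
      (NI x. enn_powr (f x) P) \<le> 1 \<Longrightarrow> (NI x. enn_powr (g x) Q) \<le> 1 \<Longrightarrow>
      (NI x. enn_powr (bisph_diff_max n (Suc m) f g x) R) \<le> ennreal (D * \<theta> ^ m)"
proof -
  obtain C B where C: "0 < C" and B: "0 < B" and corner: "\<And>m n \<alpha> \<beta> f g. 0 < \<alpha> \<Longrightarrow> 0 < \<beta> \<Longrightarrow> borel_fun f \<Longrightarrow> borel_fun g \<Longrightarrow>
      emeasure lborel {x::'a. ennreal (C * (\<alpha> * \<beta>)) < cell_bisph_max m n f g x} \<le>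
        ennreal (B * (1 + real m + real n)) * (ennreal (1 / \<alpha>) * (NI x. above \<alpha> f x) + ennreal (1 / \<beta>) * (NI x. above \<beta> g x))"
    using cell_bisph_max_corner[OF d] by metis
  obtain K where K: "0 < K" and gain: "\<And>n m f g G A b \<kappa>. f \<in> borel_measurable borel \<Longrightarrow> borel_fun g \<Longrightarrow> G \<in> sets borel \<Longrightarrow>
      (\<And>y. f y \<le> ennreal A) \<Longrightarrow> (\<And>y. g y \<le> ennreal b * indicator G y) \<Longrightarrow> 0 < A \<Longrightarrow> 0 < b \<Longrightarrow> 0 < \<kappa> \<Longrightarrow>
      emeasure lborel {x::'a. ennreal \<kappa> < bisph_diff_max n m f g x} \<le>
        ennreal (K * sqrt (1 / 2 ^ m) * (A * A * (b * b) / (\<kappa> * \<kappa>))) * emeasure lborel G"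
    using bisph_diff_max_gain[OF d] by metis
  \<comment> \<open>2 C because the difference is dominated by two maximal functions, each at level
    C \<alpha> \<beta>. 6 B because their constants add up to B (3 + 2 n + 2 m), and n \<le> m +
    1.\<close>
  have C2: "0 < 2 * C" "0 < 6 * B" using C B by auto
  obtain D \<theta> where D: "0 < D" and \<theta>: "0 < \<theta>" "\<theta> < 1" and decay: "\<And>m. \<exists>A k. 1 \<le> A \<and> 1 \<le> k \<and> 6 * B * (1 + real m) * ((k * A * (P / (P - 1) * A powr (- P)) + Q / (Q - 1) * k powr (- Q)) +
      (P / (P - 1) * k powr (- P) + k * A * (Q / (Q - 1) * A powr (- Q)))) + K * sqrt (1 / 2 ^ Suc m) * A ^ 4 / (2 * C * (2 * C)) * (1 / A) powr (- Q) \<le> D * \<theta> ^ m"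
    using interpolation_constant_decay[OF P Q C2 K] by metis
  show thesis
  proof (rule that[of "(4 * (2 * C)) powr R * D" \<theta>])
    show "0 < (4 * (2 * C)) powr R * D" "0 < \<theta>" "\<theta> < 1" using C D \<theta> by auto
    fix m n :: nat and f g :: "'a \<Rightarrow> ennreal"
    assume n: "n \<le> Suc m" and [measurable]: "borel_fun f" "borel_fun g"
      and f1: "(NI x. enn_powr (f x) P) \<le> 1" and g1: "(NI x. enn_powr (g x) Q) \<le> 1"
    obtain A k where A: "1 \<le> A" "1 \<le> k" and dec: "6 * B * (1 + real m) * ((k * A * (P / (P - 1) * A powr (- P)) + Q / (Q - 1) * k powr (- Q)) +
      (P / (P - 1) * k powr (- P) + k * A * (Q / (Q - 1) * A powr (- Q)))) + K * sqrt (1 / 2 ^ Suc m) * A ^ 4 / (2 * C * (2 * C)) * (1 / A) powr (- Q) \<le> D * \<theta> ^ m"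
      using decay[of m] by blast
    have co: "emeasure lborel {x. ennreal (2 * C * (\<alpha> * \<beta>)) < bisph_diff_max n (Suc m) f g x} \<le>
        ennreal (6 * B * (1 + real m)) * (ennreal (1 / \<alpha>) * (NI x. above \<alpha> f x) + ennreal (1 / \<beta>) * (NI x. above \<beta> g x))"
      if [measurable]: "0 < \<alpha>" "0 < \<beta>" "borel_fun f" "borel_fun g" for \<alpha> \<beta> and f g :: "'a \<Rightarrow> ennreal"
    proof -
      let ?S = "ennreal (1 / \<alpha>) * (NI x. above \<alpha> f x) + ennreal (1 / \<beta>) * (NI x. above \<beta> g x)"
      have "emeasure lborel {x. ennreal (2 * (C * (\<alpha> * \<beta>))) < bisph_diff_max n (Suc m) f g x} \<le>
        emeasure lborel {x. ennreal (C * (\<alpha> * \<beta>)) < cell_bisph_max n (Suc m) f g x} + emeasure lborel {x. ennreal (C * (\<alpha> * \<beta>)) < cell_bisph_max n m f g x}"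
        using C that by (intro emeasure_less_add_le bisph_diff_max_le_cell d) auto
      also have "\<dots> \<le> ennreal (B * (1 + real n + real (Suc m))) * ?S + ennreal (B * (1 + real n + real m)) * ?S"
        by (intro add_mono corner that)
      also have "\<dots> = ennreal (B * (1 + real n + real (Suc m)) + B * (1 + real n + real m)) * ?S"
        using B by (simp add: distrib_right ennreal_plus)
      also have "\<dots> \<le> ennreal (6 * B * (1 + real m)) * ?S"
      proof (intro mult_right_mono ennreal_leI)
        have "B * (1 + real n + real (Suc m)) + B * (1 + real n + real m) = B * (3 + 2 * real n + 2 * real m)" by (simp add: algebra_simps)
        also have "\<dots> \<le> B * (6 * (1 + real m))" using n B by (intro mult_left_mono) auto
        finally show "B * (1 + real n + real (Suc m)) + B * (1 + real n + real m) \<le> 6 * B * (1 + real m)" by (simp only: mult.assoc mult.left_commute[of B 6])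
      qed simp
      finally show ?thesis by (simp add: mult.assoc)
    qed
    have "ennreal ((4 * (2 * C)) powr (- R)) * (NI x. enn_powr (bisph_diff_max n (Suc m) f g x) R)
      = (NI \<tau>. indicator {0<..} \<tau> * emeasure lborel {x. ennreal (4 * (2 * C) * \<tau> powr (1 / R)) < bisph_diff_max n (Suc m) f g x})"
      using C by (intro layer_cake[symmetric] R) auto
    also have "\<dots> \<le> ennreal (6 * B * (1 + real m) * ((k * A * (P / (P - 1) * A powr (- P)) + Q / (Q - 1) * k powr (- Q)) +
      (P / (P - 1) * k powr (- P) + k * A * (Q / (Q - 1) * A powr (- Q)))) + K * sqrt (1 / 2 ^ Suc m) * A ^ 4 / (2 * C * (2 * C)) * (1 / A) powr (- Q))"
    proof -
      have n0: "0 \<le> 6 * B * (1 + real m)" "0 \<le> K * sqrt (1 / 2 ^ Suc m)" using B K by auto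
      have ms: "bisph_diff_max n (Suc m) f g \<in> borel_measurable borel"
        if [measurable]: "borel_fun f" "borel_fun g" for f g :: "'a \<Rightarrow> ennreal" by measurable
      show ?thesis
        by (rule interpolation[OF P Q R C2(1) n0 A ms bisph_diff_max_add_left bisph_diff_max_add_right co gain _ _ f1 g1]) (assumption | fact)+
    qed
    also have "\<dots> \<le> ennreal (D * \<theta> ^ m)" by (rule ennreal_leI[OF dec])
    finally have "ennreal ((4 * (2 * C)) powr R) * (ennreal ((4 * (2 * C)) powr (- R)) * (NI x. enn_powr (bisph_diff_max n (Suc m) f g x) R))
      \<le> ennreal ((4 * (2 * C)) powr R) * ennreal (D * \<theta> ^ m)" by (rule mult_left_mono) simp
    moreover have "ennreal ((4 * (2 * C)) powr R) * ennreal ((4 * (2 * C)) powr (- R)) = 1"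
      using C by (subst ennreal_mult[symmetric]) (auto simp: powr_add[symmetric])
    moreover have "ennreal ((4 * (2 * C)) powr R) * ennreal (D * \<theta> ^ m) = ennreal ((4 * (2 * C)) powr R * D * \<theta> ^ m)"
      using D \<theta> by (subst ennreal_mult[symmetric]) (auto simp: mult.assoc)
    ultimately show "(NI x. enn_powr (bisph_diff_max n (Suc m) f g x) R) \<le> ennreal ((4 * (2 * C)) powr R * D * \<theta> ^ m)"
      by (simp only: mult.assoc[symmetric] mult_1_left)
  qed
qed

section \<open>Lower semicontinuous majorants and telescoping\<close>

lemma pow2_strict_floor:
  fixes v :: real
  assumes "0 < v"
  obtains n :: int where "2 powi n < v" "v \<le> 2 powi (n + 1)"
proof -
  define n where "n = \<lceil>log 2 v\<rceil> - 1"
  have "real_of_int n < log 2 v" "log 2 v \<le> real_of_int (n + 1)" unfolding n_def by linarith+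
  then have "2 powr real_of_int n < v" "v \<le> 2 powr real_of_int (n + 1)"
    using assms by (simp_all add: less_log_iff log_le_iff)
  then show thesis by (intro that[of n]) (simp_all add: powr_real_of_int' del: of_int_add)
qed

text \<open>The averages over dyadic cells of a lower semicontinuous function are eventually at least as large as the
  function itself, so the telescoping below needs no almost everywhere statement.\<close>

lemma lsc_majorant:
  fixes f :: "'a::euclidean_space \<Rightarrow> ennreal"
  assumes [measurable]: "borel_fun f" and fin: "\<And>x. f x < top" and P: "0 < P"
    and f1: "(NI x. enn_powr (f x) P) \<le> 1"
  obtains f' where "\<And>x. f x \<le> f' x" "\<And>c. open {x. c < f' x}" "borel_fun f'"
    "(NI x. enn_powr (f' x) P) \<le> ennreal (2 powr P + 1)"
proof -
  \<comment> \<open>The levels 2^i for all integers i, enumerated by the naturals; on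
    \<open>E j\<close> the value of f lies between a level and its double.\<close>
  define a :: "nat \<Rightarrow> real" where "a j = 2 powi int_decode j" for j
  have a: "0 < a j" for j by (simp add: a_def)
  define E where "E j = {x. ennreal (a j) < f x \<and> f x \<le> ennreal (2 * a j)}" for j
  have [measurable]: "E j \<in> sets borel" for j unfolding E_def by measurable
  \<comment> \<open>The errors of outer approximation are chosen to sum to 1 after weighting by the
    P-th power of the height 2 a j.\<close>
  define \<epsilon> where "\<epsilon> j = (1 / 2) ^ Suc j * (2 * a j) powr (- P)" for j
  have \<epsilon>: "0 < \<epsilon> j" for j using a[of j] by (simp add: \<epsilon>_def)
  have "\<exists>U. open U \<and> E j \<subseteq> U \<and> emeasure lborel U \<le> emeasure lborel (E j) + ennreal (\<epsilon> j)" for j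
  proof (cases "emeasure lborel (E j) = top")
    case True
    then show ?thesis by (intro exI[of _ UNIV]) (simp add: top_add)
  next
    case False
    have L: "emeasure lebesgue (E j) = emeasure lborel (E j)" by simp
    have "E j \<in> sets lebesgue" by (intro sets_completionI_sets) simp
    then obtain U where U: "open U" "E j \<subseteq> U" "(U - E j) \<in> lmeasurable" "emeasure lebesgue (U - E j) < ennreal (\<epsilon> j)"
      using sets_lebesgue_outer_open[OF _ \<epsilon>[of j]] by metis
    have [measurable]: "U \<in> sets borel" using U(1) by simp
    have "emeasure lborel U = emeasure lborel (E j \<union> (U - E j))" using U(2) by (simp add: Un_absorb1)
    also have "\<dots> \<le> emeasure lborel (E j) + emeasure lborel (U - E j)" by (rule emeasure_subadditive) measurable
    also have "emeasure lborel (U - E j) \<le> ennreal (\<epsilon> j)" using U(4) by simp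
    finally show ?thesis using U(1,2) by auto
  qed
  then obtain U where U: "\<And>j. open (U j)" "\<And>j. E j \<subseteq> U j" "\<And>j. emeasure lborel (U j) \<le> emeasure lborel (E j) + ennreal (\<epsilon> j)" by metis
  have [measurable]: "U j \<in> sets borel" for j using U(1) by simp
  define f' where "f' x = (SUP j. ennreal (2 * a j) * indicator (U j) x)" for x
  have lt: "c < f' x \<longleftrightarrow> (\<exists>j. x \<in> U j \<and> c < ennreal (2 * a j))" for c x
    unfolding f'_def less_SUP_iff by (auto simp: indicator_def split: if_splits)
  show thesis
  proof (rule that[of f'])
    show "f x \<le> f' x" for x
    proof (cases "f x = 0")
      case False
      obtain v where v: "f x = ennreal v" "0 \<le> v" using fin[of x] less_top_ennreal by blast
      then have "0 < v" using False by (cases "v = 0") auto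
      then obtain n where n: "2 powi n < v" "v \<le> 2 powi (n + 1)" by (rule pow2_strict_floor)
      define j where "j = int_encode n"
      have "x \<in> E j" using n v by (simp add: E_def a_def j_def ennreal_less_iff ennreal_leI power_int_add)
      then have "x \<in> U j" using U(2) by auto
      have "f x \<le> ennreal (2 * a j)" using \<open>x \<in> E j\<close> by (simp add: E_def)
      also have "\<dots> \<le> f' x" unfolding f'_def by (rule SUP_upper2[of j]) (use \<open>x \<in> U j\<close> in auto)
      finally show ?thesis .
    qed simp
    have "{x. c < f' x} = (\<Union>j\<in>{j. c < ennreal (2 * a j)}. U j)" for c unfolding lt by auto
    then show "open {x. c < f' x}" for c using U(1) by auto
    show [measurable]: "borel_fun f'" unfolding f'_def by measurable
    have pt: "enn_powr (f' x) P \<le> (\<Sum>j. ennreal ((2 * a j) powr P) * indicator (U j) x)" for x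
    proof -
      have le: "ennreal ((2 * a j) powr P) \<le> (\<Sum>j. ennreal ((2 * a j) powr P) * indicator (U j) x)" if "x \<in> U j" for j
        using sum_le_suminf[of "\<lambda>j. ennreal ((2 * a j) powr P) * indicator (U j) x" "{j}"] that by simp
      have "f' x \<le> enn_powr (\<Sum>j. ennreal ((2 * a j) powr P) * indicator (U j) x) (1 / P)" (is "_ \<le> enn_powr ?S _")
        unfolding f'_def
      proof (rule SUP_least)
        fix j show "ennreal (2 * a j) * indicator (U j) x \<le> enn_powr ?S (1 / P)"
        proof (cases "x \<in> U j")
          case True
          have "enn_powr (ennreal ((2 * a j) powr P)) (1 / P) \<le> enn_powr ?S (1 / P)" using P by (intro enn_powr_mono le True) auto
          then show ?thesis using True P a[of j] by (simp add: enn_powr_ennreal powr_powr)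
        qed simp
      qed
      then have "enn_powr (f' x) P \<le> enn_powr (enn_powr ?S (1 / P)) P" using P by (intro enn_powr_mono) auto
      then show ?thesis using P by (simp add: enn_powr_powr)
    qed
    have disj: "disjoint_family E"
    proof -
      have "\<not> (x \<in> E i \<and> x \<in> E j)" if "int_decode i < int_decode j" for i j x
      proof
        assume x: "x \<in> E i \<and> x \<in> E j"
        have "2 * a i = 2 powi (int_decode i + 1)" by (simp add: a_def power_int_add)
        also have "\<dots> \<le> a j" unfolding a_def using that by (intro power_int_increasing) auto
        finally have "ennreal (2 * a i) \<le> ennreal (a j)" by (rule ennreal_leI)
        then show False using x by (auto simp: E_def)
      qed
      moreover have "int_decode i < int_decode j \<or> int_decode j < int_decode i" if "i \<noteq> j" for i j
        using that by (metis int_decode_inverse linorder_neqE_linordered_idom)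
      ultimately show ?thesis unfolding disjoint_family_on_def by blast
    qed
    have "(NI x. enn_powr (f' x) P) \<le> (NI x. (\<Sum>j. ennreal ((2 * a j) powr P) * indicator (U j) x))"
      by (rule nn_integral_mono) (rule pt)
    also have "\<dots> = (\<Sum>j. ennreal ((2 * a j) powr P) * emeasure lborel (U j))"
      by (subst nn_integral_suminf) (simp_all add: nn_integral_cmult_indicator)
    also have "\<dots> \<le> (\<Sum>j. ennreal (2 powr P) * emeasure (density lborel (\<lambda>x. enn_powr (f x) P)) (E j) + ennreal ((1 / 2) ^ Suc j))"
    proof (rule suminf_le)
      fix j
      have "ennreal ((2 * a j) powr P) * emeasure lborel (E j) = (NI x. ennreal ((2 * a j) powr P) * indicator (E j) x)"
        by (simp add: nn_integral_cmult_indicator)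
      also have "\<dots> \<le> (NI x. ennreal (2 powr P) * (enn_powr (f x) P * indicator (E j) x))"
      proof (rule nn_integral_mono)
        fix x show "ennreal ((2 * a j) powr P) * indicator (E j) x \<le> ennreal (2 powr P) * (enn_powr (f x) P * indicator (E j) x)"
        proof (cases "x \<in> E j")
          case True
          then have "enn_powr (ennreal (a j)) P \<le> enn_powr (f x) P" using P by (intro enn_powr_mono) (auto simp: E_def)
          then have "ennreal (2 powr P) * ennreal (a j powr P) \<le> ennreal (2 powr P) * enn_powr (f x) P"
            using a[of j] by (intro mult_left_mono) (auto simp: enn_powr_ennreal)
          then show ?thesis using True a[of j] by (simp add: ennreal_mult[symmetric] powr_mult)
        qed simp
      qed
      also have "\<dots> = ennreal (2 powr P) * emeasure (density lborel (\<lambda>x. enn_powr (f x) P)) (E j)"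
        by (subst nn_integral_cmult) (simp_all add: emeasure_density)
      finally have 1: "ennreal ((2 * a j) powr P) * emeasure lborel (E j) \<le> ennreal (2 powr P) * emeasure (density lborel (\<lambda>x. enn_powr (f x) P)) (E j)" .
      have 2: "ennreal ((2 * a j) powr P) * ennreal (\<epsilon> j) = ennreal ((1 / 2) ^ Suc j)"
      proof -
        have "(2 * a j) powr P * \<epsilon> j = (1 / 2) ^ Suc j * ((2 * a j) powr P * (2 * a j) powr (- P))" by (simp add: \<epsilon>_def)
        also have "\<dots> = (1 / 2) ^ Suc j" using a[of j] by (simp add: powr_add[symmetric])
        finally show ?thesis using \<epsilon>[of j] by (simp add: ennreal_mult[symmetric])
      qed
      have "ennreal ((2 * a j) powr P) * emeasure lborel (U j) \<le> ennreal ((2 * a j) powr P) * (emeasure lborel (E j) + ennreal (\<epsilon> j))"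
        by (rule mult_left_mono[OF U(3)]) simp
      also have "\<dots> = ennreal ((2 * a j) powr P) * emeasure lborel (E j) + ennreal ((1 / 2) ^ Suc j)" unfolding distrib_left 2 ..
      also have "\<dots> \<le> ennreal (2 powr P) * emeasure (density lborel (\<lambda>x. enn_powr (f x) P)) (E j) + ennreal ((1 / 2) ^ Suc j)"
        by (intro add_right_mono 1)
      finally show "ennreal ((2 * a j) powr P) * emeasure lborel (U j) \<le> \<dots>" .
    qed auto
    also have "\<dots> = ennreal (2 powr P) * (\<Sum>j. emeasure (density lborel (\<lambda>x. enn_powr (f x) P)) (E j)) + (\<Sum>j. ennreal ((1 / 2) ^ Suc j))"
      by (subst suminf_add[symmetric]) auto
    also have "(\<Sum>j. emeasure (density lborel (\<lambda>x. enn_powr (f x) P)) (E j)) \<le> 1"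
    proof -
      have "(\<Sum>j. emeasure (density lborel (\<lambda>x. enn_powr (f x) P)) (E j)) = emeasure (density lborel (\<lambda>x. enn_powr (f x) P)) (\<Union>j. E j)"
        by (rule suminf_emeasure[OF _ disj]) auto
      also have "\<dots> \<le> (NI x. enn_powr (f x) P)"
        by (subst emeasure_density) (auto intro!: nn_integral_mono simp: indicator_def)
      finally show ?thesis using f1 by simp
    qed
    also have "(\<Sum>j. ennreal ((1 / 2) ^ Suc j)) = 1"
      using sums_unique[OF power_half_series] by (subst suminf_ennreal2) (simp_all add: sums_summable[OF power_half_series, simplified])
    finally show "(NI x. enn_powr (f' x) P) \<le> ennreal (2 powr P + 1)"
      by (simp add: ennreal_plus mult_left_mono)
  qed
qed

lemma le_cell_avg: "(\<And>y. cell_eq k x y \<Longrightarrow> c \<le> f y) \<Longrightarrow> c \<le> cell_avg k f x"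
  using cell_avg_const[of k c x] unfolding cell_avg_def
  by (metis (no_types, lifting) indicator_simps(2) mem_Collect_eq mult_left_mono mult_zero_left nn_integral_mono order_refl zero_le)

text \<open>f exceeds any c < f y in a neighbourhood of y, which contains the cell of y once k is
  large. The lower limit is written as a supremum of infima, so that monotone convergence applies to
  it.\<close>

lemma lsc_le_cell_avg:
  fixes f :: "'a::euclidean_space \<Rightarrow> ennreal"
  assumes lsc: "\<And>c. open {x. c < f x}"
  shows "f y \<le> (SUP M. INF k\<in>{M..}. cell_avg (l + int k) f y)"
proof (rule dense_le)
  fix c assume "c < f y"
  then obtain e where e: "0 < e" "\<And>z. dist z y < e \<Longrightarrow> c < f z"
    using lsc[of c] unfolding open_dist by auto
  have "\<exists>M::nat. real DIM('a) * 2 powi (- l) / e < 2 ^ M" using real_arch_pow[of 2] by simp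
  then obtain M :: nat where M: "real DIM('a) * 2 powi (- l) / e < 2 ^ M" by blast
  have "c \<le> cell_avg (l + int k) f y" if "M \<le> k" for k
  proof (rule le_cell_avg)
    fix z assume "cell_eq (l + int k) y z"
    then have "dist y z \<le> real DIM('a) * 2 powi (- (l + int k))" by (rule cell_eq_dist)
    also have "- (l + int k) = - l - int k" by simp
    also have "2 powi (- l - int k) = 2 powi (- l) / (2::real) ^ k" by (simp add: power_int_diff)
    also have "real DIM('a) * (2 powi (- l) / 2 ^ k) < e"
    proof -
      have "real DIM('a) * 2 powi (- l) / e < 2 ^ k" using M power_increasing[OF that, of "2::real"] by linarith
      then show ?thesis using e(1) by (simp add: field_simps)
    qed
    finally show "c \<le> f z" using e(2)[of z] by (simp add: dist_commute less_imp_le)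
  qed
  then have "c \<le> (INF k\<in>{M..}. cell_avg (l + int k) f y)" by (intro INF_greatest) auto
  also have "\<dots> \<le> (SUP M. INF k\<in>{M..}. cell_avg (l + int k) f y)" by (rule SUP_upper) simp
  finally show "c \<le> (SUP M. INF k\<in>{M..}. cell_avg (l + int k) f y)" .
qed

section \<open>Telescoping over the fineness of the cells\<close>

lemma bisph_nn_SUP_left:
  fixes \<phi> :: "nat \<Rightarrow> 'a::euclidean_space \<Rightarrow> ennreal"
  assumes [measurable]: "\<And>M. \<phi> M \<in> borel_measurable borel" "borel_fun g" and inc: "\<And>M y. \<phi> M y \<le> \<phi> (Suc M) y"
  shows "bisph_nn t (\<lambda>y. SUP M. \<phi> M y) g x = (SUP M. bisph_nn t (\<phi> M) g x)"
proof -
  let ?F = "\<lambda>M (w::'a\<times>'a). indicator unit_ball w * (\<phi> M (x - t *\<^sub>R fst (sgn w)) * g (x - t *\<^sub>R snd (sgn w)))"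
  have "incseq ?F" by (rule incseq_SucI, rule le_funI) (intro mult_left_mono mult_right_mono inc; simp)
  then have "(NI w. (SUP M. ?F M w)) = (SUP M. NI w. ?F M w)"
    by (intro nn_integral_monotone_convergence_SUP) measurable
  then show ?thesis
    by (subst (1 2) bisph_nn_alt, measurable) (simp only: SUP_mult_left_ennreal SUP_mult_right_ennreal)
qed

text \<open>The infima over k \<ge> M increase with M, so monotone convergence can be applied to one
  function after the other; the resulting double supremum is dominated by its diagonal.\<close>

lemma bisph_nn_lsc_le:
  fixes f g :: "'a::euclidean_space \<Rightarrow> ennreal"
  assumes [measurable]: "borel_fun f" "borel_fun g"
    and lsc: "\<And>c. open {x. c < f x}" "\<And>c. open {x. c < g x}"
  shows "bisph_nn t f g x \<le> (SUP M. bisph_nn t (cell_avg (l + int M) f) (cell_avg (l + int M) g) x)"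
proof -
  define \<phi> where "\<phi> f M y = (INF k\<in>{M..}. cell_avg (l + int k) f y)" for f :: "'a \<Rightarrow> ennreal" and M :: nat and y
  have [measurable]: "\<phi> f M \<in> borel_measurable borel" "\<phi> g M \<in> borel_measurable borel" for M unfolding \<phi>_def by measurable
  have inc: "\<phi> h M y \<le> \<phi> h N y" if "M \<le> N" for h M N y unfolding \<phi>_def by (rule INF_superset_mono) (use that in auto)
  have le: "\<phi> h M y \<le> cell_avg (l + int M) h y" for h M y unfolding \<phi>_def by (rule INF_lower) simp
  have "bisph_nn t f g x \<le> bisph_nn t (\<lambda>y. SUP M. \<phi> f M y) (\<lambda>y. SUP M. \<phi> g M y) x"
    unfolding \<phi>_def by (intro bisph_nn_mono lsc_le_cell_avg lsc)
  also have "\<dots> = (SUP M. bisph_nn t (\<phi> f M) (\<lambda>y. SUP M. \<phi> g M y) x)" by (rule bisph_nn_SUP_left) (measurable, rule inc, simp)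
  also have "\<dots> = (SUP M. SUP N. bisph_nn t (\<phi> f M) (\<phi> g N) x)"
  proof (rule SUP_cong[OF refl])
    fix M
    have "bisph_nn t (\<lambda>y. SUP N. \<phi> g N y) (\<phi> f M) x = (SUP N. bisph_nn t (\<phi> g N) (\<phi> f M) x)" by (rule bisph_nn_SUP_left) (measurable, rule inc, simp)
    moreover have "bisph_nn t (\<lambda>y. SUP N. \<phi> g N y) (\<phi> f M) x = bisph_nn t (\<phi> f M) (\<lambda>y. SUP N. \<phi> g N y) x" by (rule bisph_nn_commute) measurable
    moreover have "bisph_nn t (\<phi> g N) (\<phi> f M) x = bisph_nn t (\<phi> f M) (\<phi> g N) x" for N by (rule bisph_nn_commute) measurable
    ultimately show "bisph_nn t (\<phi> f M) (\<lambda>y. SUP M. \<phi> g M y) x = (SUP N. bisph_nn t (\<phi> f M) (\<phi> g N) x)" by simp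
  qed
  also have "\<dots> \<le> (SUP M. bisph_nn t (cell_avg (l + int M) f) (cell_avg (l + int M) g) x)"
  proof (intro SUP_least)
    fix M N
    have "bisph_nn t (\<phi> f M) (\<phi> g N) x \<le> bisph_nn t (\<phi> f (max M N)) (\<phi> g (max M N)) x" by (intro bisph_nn_mono inc) auto
    also have "\<dots> \<le> bisph_nn t (cell_avg (l + int (max M N)) f) (cell_avg (l + int (max M N)) g) x" by (intro bisph_nn_mono le)
    also have "\<dots> \<le> (SUP M. bisph_nn t (cell_avg (l + int M) f) (cell_avg (l + int M) g) x)" by (rule SUP_upper) simp
    finally show "bisph_nn t (\<phi> f M) (\<phi> g N) x \<le> \<dots>" .
  qed
  finally show ?thesis .
qed

text \<open>From m to m + 1 the functions are refined one at a time: g against f at scale m + 1,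
  then f against g at scale m. Commutativity of the average brings the second change into the form
  of \<open>bisph_diff_max\<close> with f and g exchanged.\<close>

lemma bisph_max_telescope:
  fixes f g :: "'a::euclidean_space \<Rightarrow> ennreal"
  assumes [measurable]: "borel_fun f" "borel_fun g" and d: "2 \<le> DIM('a)"
    and lsc: "\<And>c. open {x. c < f x}" "\<And>c. open {x. c < g x}"
  shows "bisph_max f g x \<le> cell_bisph_max 0 0 f g x + (\<Sum>m. bisph_diff_max (Suc m) (Suc m) f g x + bisph_diff_max m (Suc m) g f x)"
  unfolding bisph_max_def
proof (rule SUP_least)
  fix l :: int
  let ?t = "2 powi (- l) :: real"
  let ?F = "\<lambda>M. cell_avg (l + int M) f" and ?G = "\<lambda>M. cell_avg (l + int M) g"
  let ?W = "\<lambda>m. bisph_diff_max (Suc m) (Suc m) f g x + bisph_diff_max m (Suc m) g f x"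
  have step: "bisph_nn ?t (?F (Suc m)) (?G (Suc m)) x \<le> bisph_nn ?t (?F m) (?G m) x + ?W m" for m
  proof -
    have e: "l + int (Suc m) - 1 = l + int m" by simp
    have c: "bisph_nn ?t (?F k) (?G m) x = bisph_nn ?t (?G m) (?F k) x" for k by (rule bisph_nn_commute) measurable
    have "bisph_nn ?t (?F (Suc m)) (?G (Suc m)) x \<le> bisph_nn ?t (?F (Suc m)) (?G m) x + bisph_diff ?t (?F (Suc m)) (?G (Suc m)) (?G m) x"
      by (rule bisph_nn_le_diff(1)[OF _ _ _ d]) measurable
    also have "bisph_nn ?t (?F (Suc m)) (?G m) x \<le> bisph_nn ?t (?F m) (?G m) x + bisph_diff ?t (?G m) (?F (Suc m)) (?F m) x"
      unfolding c by (rule bisph_nn_le_diff(1)[OF _ _ _ d]) measurable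
    also have "bisph_diff ?t (?F (Suc m)) (?G (Suc m)) (?G m) x \<le> bisph_diff_max (Suc m) (Suc m) f g x"
      unfolding bisph_diff_max_def using SUP_upper[of l UNIV "\<lambda>l. bisph_diff (2 powi - l) (cell_avg (l + int (Suc m)) f) (cell_avg (l + int (Suc m)) g) (cell_avg (l + int (Suc m) - 1) g) x"] unfolding e by simp
    also have "bisph_diff ?t (?G m) (?F (Suc m)) (?F m) x \<le> bisph_diff_max m (Suc m) g f x"
      unfolding bisph_diff_max_def using SUP_upper[of l UNIV "\<lambda>l. bisph_diff (2 powi - l) (cell_avg (l + int m) g) (cell_avg (l + int (Suc m)) f) (cell_avg (l + int (Suc m) - 1) f) x"] unfolding e by simp
    finally show ?thesis by (simp add: add_mono add.assoc add.commute[of "bisph_diff_max m (Suc m) g f x"])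
  qed
  have part: "bisph_nn ?t (?F M) (?G M) x \<le> bisph_nn ?t (?F 0) (?G 0) x + (\<Sum>m<M. ?W m)" for M
  proof (induction M)
    case (Suc M)
    show ?case using order_trans[OF step[of M] add_right_mono[OF Suc.IH]] by (simp add: add.assoc)
  qed simp
  have "bisph_nn ?t f g x \<le> (SUP M. bisph_nn ?t (?F M) (?G M) x)" by (rule bisph_nn_lsc_le) (measurable, (rule lsc)+)
  also have "\<dots> \<le> bisph_nn ?t (?F 0) (?G 0) x + (\<Sum>m. ?W m)"
    by (intro SUP_least order_trans[OF part] add_left_mono sum_le_suminf) auto
  also have "\<dots> \<le> cell_bisph_max 0 0 f g x + (\<Sum>m. ?W m)"
    unfolding cell_bisph_max_def by (intro add_right_mono SUP_upper UNIV_I)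
  finally show "bisph_nn ?t f g x \<le> cell_bisph_max 0 0 f g x + (\<Sum>m. ?W m)" .
qed

lemma powr_cancel_ennreal:
  assumes "0 < c" "ennreal (c powr (- R)) * I \<le> D"
  shows "I \<le> ennreal (c powr R) * D"
proof -
  have "ennreal (c powr R) * (ennreal (c powr (- R)) * I) \<le> ennreal (c powr R) * D" by (rule mult_left_mono[OF assms(2)]) simp
  moreover have "ennreal (c powr R) * ennreal (c powr (- R)) = 1"
    using assms(1) by (subst ennreal_mult[symmetric]) (auto simp: powr_add[symmetric])
  ultimately show ?thesis by (simp only: mult.assoc[symmetric] mult_1_left)
qed

lemma bisph_max_bounded_lsc:
  assumes d: "2 \<le> DIM('a::euclidean_space)" and P: "1 < P" and Q: "1 < Q" and R: "0 < R" "1 / R = 1 / P + 1 / Q"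
  obtains K :: real where "0 \<le> K"
    "\<And>f g. (f :: 'a \<Rightarrow> ennreal) \<in> borel_measurable borel \<Longrightarrow> borel_fun g \<Longrightarrow> (\<And>c. open {x. c < f x}) \<Longrightarrow> (\<And>c. open {x. c < g x}) \<Longrightarrow>
      (NI x. enn_powr (f x) P) \<le> 1 \<Longrightarrow> (NI x. enn_powr (g x) Q) \<le> 1 \<Longrightarrow>
      (NI x. enn_powr (bisph_max f g x) R) \<le> ennreal K"
proof -
  have R': "1 / R = 1 / Q + 1 / P" using R(2) by simp
  obtain C B where C: "0 < C" and B: "0 < B" and corner: "\<And>m n \<alpha> \<beta> f g. 0 < \<alpha> \<Longrightarrow> 0 < \<beta> \<Longrightarrow> borel_fun f \<Longrightarrow> borel_fun g \<Longrightarrow>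
      emeasure lborel {x::'a. ennreal (C * (\<alpha> * \<beta>)) < cell_bisph_max m n f g x} \<le>
        ennreal (B * (1 + real m + real n)) * (ennreal (1 / \<alpha>) * (NI x. above \<alpha> f x) + ennreal (1 / \<beta>) * (NI x. above \<beta> g x))"
    using cell_bisph_max_corner[OF d] by metis
  obtain D1 \<theta>1 where D1: "0 < D1" "0 < \<theta>1" "\<theta>1 < 1" and dec1: "\<And>m n f g. n \<le> Suc m \<Longrightarrow> (f :: 'a \<Rightarrow> ennreal) \<in> borel_measurable borel \<Longrightarrow> borel_fun g \<Longrightarrow>
      (NI x. enn_powr (f x) P) \<le> 1 \<Longrightarrow> (NI x. enn_powr (g x) Q) \<le> 1 \<Longrightarrow>
      (NI x. enn_powr (bisph_diff_max n (Suc m) f g x) R) \<le> ennreal (D1 * \<theta>1 ^ m)"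
    using bisph_diff_max_decay[OF d P Q R] by metis
  obtain D2 \<theta>2 where D2: "0 < D2" "0 < \<theta>2" "\<theta>2 < 1" and dec2: "\<And>m n f g. n \<le> Suc m \<Longrightarrow> (f :: 'a \<Rightarrow> ennreal) \<in> borel_measurable borel \<Longrightarrow> borel_fun g \<Longrightarrow>
      (NI x. enn_powr (f x) Q) \<le> 1 \<Longrightarrow> (NI x. enn_powr (g x) P) \<le> 1 \<Longrightarrow>
      (NI x. enn_powr (bisph_diff_max n (Suc m) f g x) R) \<le> ennreal (D2 * \<theta>2 ^ m)"
    using bisph_diff_max_decay[OF d Q P R(1) R'] by metis
  define D where "D = 2 powr R * (D1 + D2)"
  define \<theta> where "\<theta> = max \<theta>1 \<theta>2"
  \<comment> \<open>The R-th power of \<omega> is sqrt \<theta>: half of the decay pays for the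
    weights in \<open>enn_powr_suminf_le\<close>, the other half remains summable.\<close>
  define \<omega> where "\<omega> = \<theta> powr (1 / (2 * R))"
  have D: "0 < D" "0 < \<theta>" "\<theta> < 1" using D1 D2 by (auto simp: D_def \<theta>_def)
  have \<omega>: "0 < \<omega>" "\<omega> < 1" using D R powr_less_mono2[of "1 / (2 * R)" \<theta> 1] by (auto simp: \<omega>_def)
  have w: "(1 / \<omega> ^ m) powr R * (D * \<theta> ^ m) = D * sqrt \<theta> ^ m" for m
  proof -
    have "(\<omega> ^ m) powr R = sqrt \<theta> ^ m"
    proof -
      have "\<omega> powr R = sqrt \<theta>" using R(1) D by (simp add: \<omega>_def powr_powr powr_half_sqrt)
      then have "sqrt \<theta> ^ m = (\<omega> powr R) ^ m" by simp
      also have "\<dots> = (\<omega> ^ m) powr R" using \<omega> by (simp add: powr_realpow[symmetric] powr_powr mult.commute)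
      finally show ?thesis by simp
    qed
    moreover have "\<theta> ^ m = sqrt \<theta> ^ m * sqrt \<theta> ^ m" using D by (simp add: power_mult_distrib[symmetric])
    moreover have "sqrt \<theta> ^ m > 0" using D by simp
    ultimately show ?thesis using \<omega> by (simp add: powr_divide)
  qed
  \<comment> \<open>The bound for the starting term of the telescoping sum: the weak type bound with
    m = n = 0, integrated over the levels \<tau>.\<close>
  define D0 where "D0 = C powr R * (B * (P / (P - 1) + Q / (Q - 1)))"
  have PQ: "0 < P / (P - 1)" "0 < Q / (Q - 1)" using P Q by auto
  have D0: "0 \<le> D0" using B PQ by (simp add: D0_def)
  define S where "S = (1 / (1 - \<omega>)) powr R * (D * (1 / (1 - sqrt \<theta>)))"
  have S: "0 \<le> S" using D by (simp add: S_def)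
  show thesis
  proof (rule that[of "2 powr R * (D0 + S)"])
    show "0 \<le> 2 powr R * (D0 + S)" using D0 S by simp
    fix f g :: "'a \<Rightarrow> ennreal"
    assume [measurable]: "borel_fun f" "borel_fun g"
      and lsc: "\<And>c. open {x. c < f x}" "\<And>c. open {x. c < g x}"
      and f1: "(NI x. enn_powr (f x) P) \<le> 1" and g1: "(NI x. enn_powr (g x) Q) \<le> 1"
    let ?U = "cell_bisph_max 0 0 f g" and ?W = "\<lambda>m x. bisph_diff_max (Suc m) (Suc m) f g x + bisph_diff_max m (Suc m) g f x"
    have U: "(NI x. enn_powr (?U x) R) \<le> ennreal D0"
    proof -
      let ?a = "\<lambda>\<tau>. ennreal (1 / (1 * \<tau> powr (1 / P))) * (NI x. above (1 * \<tau> powr (1 / P)) f x)"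
        and ?b = "\<lambda>\<tau>. ennreal (1 / (1 * \<tau> powr (1 / Q))) * (NI x. above (1 * \<tau> powr (1 / Q)) g x)"
      let ?i = "\<lambda>\<tau>. indicator {0<..} (\<tau>::real) :: ennreal"
      have [measurable]: "(\<lambda>\<tau>. NI x. above (1 * \<tau> powr (1 / P)) f x) \<in> borel_measurable borel"
        "(\<lambda>\<tau>. NI x. above (1 * \<tau> powr (1 / Q)) g x) \<in> borel_measurable borel" unfolding above_def by measurable
      have "ennreal (C powr (- R)) * (NI x. enn_powr (?U x) R) = (NI \<tau>. ?i \<tau> * emeasure lborel {x. ennreal (C * \<tau> powr (1 / R)) < ?U x})"
        using C by (intro layer_cake[symmetric] R) auto
      also have "\<dots> \<le> (NI \<tau>. ennreal B * (?i \<tau> * ?a \<tau> + ?i \<tau> * ?b \<tau>))"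
      proof (rule nn_integral_mono)
        fix \<tau> :: real
        show "?i \<tau> * emeasure lborel {x. ennreal (C * \<tau> powr (1 / R)) < ?U x} \<le> ennreal B * (?i \<tau> * ?a \<tau> + ?i \<tau> * ?b \<tau>)"
        proof (cases "0 < \<tau>")
          case True
          then have "emeasure lborel {x. ennreal (C * (\<tau> powr (1 / P) * \<tau> powr (1 / Q))) < ?U x} \<le> ennreal (B * (1 + real 0 + real 0)) * (ennreal (1 / \<tau> powr (1 / P)) * (NI x. above (\<tau> powr (1 / P)) f x) + ennreal (1 / \<tau> powr (1 / Q)) * (NI x. above (\<tau> powr (1 / Q)) g x))"
            by (intro corner) auto
          then show ?thesis using True unfolding R(2) powr_add by simp
        qed simp
      qed
      also have "\<dots> = ennreal B * ((NI \<tau>. ?i \<tau> * ?a \<tau>) + (NI \<tau>. ?i \<tau> * ?b \<tau>))"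
        by (subst nn_integral_cmult, measurable, subst nn_integral_add, measurable)
      also have "\<dots> \<le> ennreal B * (ennreal (P / (P - 1) * 1 powr (- P)) * 1 + ennreal (Q / (Q - 1) * 1 powr (- Q)) * 1)"
        by (intro mult_left_mono add_mono order_trans[OF layer_cake_above] mult_left_mono[OF f1] mult_left_mono[OF g1] P Q) auto
      also have "\<dots> = ennreal (B * (P / (P - 1) + Q / (Q - 1)))"
        using B PQ by (simp add: ennreal_mult ennreal_plus del: divide_divide_eq_right)
      finally have "(NI x. enn_powr (?U x) R) \<le> ennreal (C powr R) * ennreal (B * (P / (P - 1) + Q / (Q - 1)))" by (rule powr_cancel_ennreal[OF C])
      then show ?thesis using B PQ by (simp add: D0_def ennreal_mult)
    qed
    have W: "(NI x. enn_powr (?W m x) R) \<le> ennreal (D * \<theta> ^ m)" for m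
    proof -
      have "(NI x. enn_powr (?W m x) R) \<le> (NI x. ennreal (2 powr R) * (enn_powr (bisph_diff_max (Suc m) (Suc m) f g x) R + enn_powr (bisph_diff_max m (Suc m) g f x) R))"
        by (intro nn_integral_mono enn_powr_add_le R)
      also have "\<dots> = ennreal (2 powr R) * ((NI x. enn_powr (bisph_diff_max (Suc m) (Suc m) f g x) R) + (NI x. enn_powr (bisph_diff_max m (Suc m) g f x) R))"
        by (subst nn_integral_cmult, measurable, subst nn_integral_add, measurable)
      also have "\<dots> \<le> ennreal (2 powr R) * (ennreal (D1 * \<theta>1 ^ m) + ennreal (D2 * \<theta>2 ^ m))"
        by (intro mult_left_mono add_mono dec1 dec2 f1 g1) auto
      also have "\<dots> \<le> ennreal (2 powr R) * (ennreal (D1 * \<theta> ^ m) + ennreal (D2 * \<theta> ^ m))"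
        using D1 D2 by (intro mult_left_mono add_mono ennreal_leI power_mono) (auto simp: \<theta>_def)
      also have "\<dots> = ennreal (D * \<theta> ^ m)" using D1 D2 D by (simp add: D_def ennreal_plus[symmetric] ennreal_mult[symmetric] distrib_right mult.assoc del: ennreal_plus)
      finally show ?thesis .
    qed
    have "(NI x. enn_powr (\<Sum>m. ?W m x) R) \<le> (NI x. ennreal ((1 / (1 - \<omega>)) powr R) * (\<Sum>m. ennreal ((1 / \<omega> ^ m) powr R) * enn_powr (?W m x) R))"
      by (intro nn_integral_mono enn_powr_suminf_le \<omega> R)
    also have "\<dots> = ennreal ((1 / (1 - \<omega>)) powr R) * (\<Sum>m. ennreal ((1 / \<omega> ^ m) powr R) * (NI x. enn_powr (?W m x) R))"
      by (subst nn_integral_cmult, measurable, subst nn_integral_suminf, measurable, subst nn_integral_cmult, measurable)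
    also have "\<dots> \<le> ennreal ((1 / (1 - \<omega>)) powr R) * (\<Sum>m. ennreal ((1 / \<omega> ^ m) powr R) * ennreal (D * \<theta> ^ m))"
      by (intro mult_left_mono suminf_le W) auto
    also have "\<dots> = ennreal ((1 / (1 - \<omega>)) powr R) * (\<Sum>m. ennreal (D * sqrt \<theta> ^ m))"
      using D by (subst ennreal_mult[symmetric]) (auto simp only: w powr_ge_zero mult_nonneg_nonneg less_imp_le zero_le_power)
    also have "(\<Sum>m. ennreal (D * sqrt \<theta> ^ m)) = ennreal (D * (1 / (1 - sqrt \<theta>)))"
      using D by (subst suminf_ennreal2) (simp_all add: suminf_mult suminf_geometric summable_geometric summable_mult)
    also have "ennreal ((1 / (1 - \<omega>)) powr R) * \<dots> = ennreal S" unfolding S_def using D by (intro ennreal_mult[symmetric]) auto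
    finally have WS: "(NI x. enn_powr (\<Sum>m. ?W m x) R) \<le> ennreal S" .
    have "(NI x. enn_powr (bisph_max f g x) R) \<le> (NI x. ennreal (2 powr R) * (enn_powr (?U x) R + enn_powr (\<Sum>m. ?W m x) R))"
      using R by (intro nn_integral_mono order_trans[OF enn_powr_mono[OF bisph_max_telescope[OF _ _ d lsc]] enn_powr_add_le]) auto
    also have "\<dots> = ennreal (2 powr R) * ((NI x. enn_powr (?U x) R) + (NI x. enn_powr (\<Sum>m. ?W m x) R))"
      by (subst nn_integral_cmult, measurable, subst nn_integral_add, measurable)
    also have "\<dots> \<le> ennreal (2 powr R) * (ennreal D0 + ennreal S)" by (intro mult_left_mono add_mono U WS) simp
    also have "\<dots> = ennreal (2 powr R * (D0 + S))" using D0 S by (simp add: ennreal_mult ennreal_plus)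
    finally show "(NI x. enn_powr (bisph_max f g x) R) \<le> ennreal (2 powr R * (D0 + S))" .
  qed
qed

lemma bisph_max_le_cmult:
  fixes f g :: "'a::euclidean_space \<Rightarrow> ennreal"
  assumes [measurable]: "borel_fun f'" "borel_fun g'"
    and le: "\<And>y. f y \<le> a * f' y" "\<And>y. g y \<le> b * g' y"
  shows "bisph_max f g x \<le> a * b * bisph_max f' g' x"
  unfolding bisph_max_def
proof (rule SUP_least)
  fix l :: int
  let ?t = "2 powi (- l) :: real"
  have "bisph_nn ?t f g x \<le> bisph_nn ?t (\<lambda>y. a * f' y) (\<lambda>y. b * g' y) x" by (intro bisph_nn_mono le)
  also have "\<dots> = a * (b * bisph_nn ?t f' g' x)" by (subst bisph_nn_cmult_left, measurable, subst bisph_nn_cmult_right, measurable)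
  also have "\<dots> \<le> a * (b * (SUP l::int. bisph_nn (2 powi (- l)) f' g' x))" by (intro mult_left_mono SUP_upper UNIV_I) auto
  finally show "bisph_nn ?t f g x \<le> a * b * (SUP l::int. bisph_nn (2 powi (- l)) f' g' x)" by (simp only: mult.assoc)
qed

lemma bisph_max_commute:
  fixes f g :: "'a::euclidean_space \<Rightarrow> ennreal"
  assumes "borel_fun f" "borel_fun g"
  shows "bisph_max f g x = bisph_max g f x"
  unfolding bisph_max_def using bisph_nn_commute[OF assms] by simp

lemma ennreal_less_cmult_iff: "0 < a \<Longrightarrow> s < ennreal a * y \<longleftrightarrow> ennreal (1 / a) * s < y"
proof -
  assume a: "0 < a"
  have e: "ennreal a * ennreal (1 / a) = 1" "ennreal (1 / a) * ennreal a = 1" using a by (subst ennreal_mult[symmetric]; simp)+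
  show ?thesis
    using ennreal_mult_strict_left_mono[of s "ennreal a * y" "ennreal (1 / a)"] ennreal_mult_strict_left_mono[of "ennreal (1 / a) * s" y "ennreal a"] a
    by (auto simp: mult.assoc[symmetric] e)
qed

lemma lsc_majorant_scaled:
  assumes P: "0 < P"
  obtains c :: real where "0 < c"
    "\<And>f A. (f :: 'a::euclidean_space \<Rightarrow> ennreal) \<in> borel_measurable borel \<Longrightarrow> (\<And>x. f x < top) \<Longrightarrow> 0 < A \<Longrightarrow>
      (NI x. enn_powr (f x) P) \<le> ennreal (A powr P) \<Longrightarrow>
      \<exists>f'\<in>borel_measurable borel. (\<forall>c. open {x. c < f' x}) \<and> (NI x. enn_powr (f' x) P) \<le> 1 \<and> (\<forall>x. f x \<le> ennreal (c * A) * f' x)"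
proof -
  define c where "c = (2 powr P + 1) powr (1 / P)"
  have "(0::real) < 2 powr P + 1" by (rule add_pos_pos) simp_all
  then have c: "0 < c" "c powr P = 2 powr P + 1" using P by (simp_all add: c_def powr_powr)
  show thesis
  proof (rule that[OF c(1)])
    fix f :: "'a \<Rightarrow> ennreal" and A :: real
    assume [measurable]: "borel_fun f" and fin: "\<And>x. f x < top" and A: "0 < A"
      and f: "(NI x. enn_powr (f x) P) \<le> ennreal (A powr P)"
    have sc: "(NI x. enn_powr (ennreal a * h x) P) = ennreal (a powr P) * (NI x. enn_powr (h x) P)"
      if [measurable]: "borel_fun h" and "0 < a" for a and h :: "'a \<Rightarrow> ennreal"
      using that P by (simp add: enn_powr_cmult nn_integral_cmult)
    have inv: "ennreal ((1 / a) powr P) * ennreal (a powr P) = 1" if "0 < a" for a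
      using that by (subst ennreal_mult[symmetric]) (auto simp: powr_mult[symmetric])
    have "(NI x. enn_powr (ennreal (1 / A) * f x) P) \<le> ennreal ((1 / A) powr P) * ennreal (A powr P)"
      using A by (subst sc) (auto intro!: mult_left_mono f)
    then have "(NI x. enn_powr (ennreal (1 / A) * f x) P) \<le> 1" by (simp only: inv[OF A])
    moreover have "ennreal (1 / A) * f x < top" for x using fin[of x] by (simp add: ennreal_mult_less_top)
    ultimately obtain h where h: "\<And>x. ennreal (1 / A) * f x \<le> h x" "\<And>c. open {x. c < h x}" and [measurable]: "borel_fun h"
      and h1: "(NI x. enn_powr (h x) P) \<le> ennreal (2 powr P + 1)"
      using lsc_majorant[of "\<lambda>x. ennreal (1 / A) * f x" P] P by auto
    show "\<exists>f'\<in>borel_measurable borel. (\<forall>c. open {x. c < f' x}) \<and> (NI x. enn_powr (f' x) P) \<le> 1 \<and> (\<forall>x. f x \<le> ennreal (c * A) * f' x)"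
    proof (intro bexI[of _ "\<lambda>x. ennreal (1 / c) * h x"] conjI allI)
      show "open {x. s < ennreal (1 / c) * h x}" for s using c h(2) by (simp add: ennreal_less_cmult_iff)
      have "(NI x. enn_powr (ennreal (1 / c) * h x) P) \<le> ennreal ((1 / c) powr P) * ennreal (c powr P)"
        unfolding c(2) using c(1) by (subst sc) (auto intro!: mult_left_mono h1 simp del: ennreal_plus)
      then show "(NI x. enn_powr (ennreal (1 / c) * h x) P) \<le> 1" by (simp only: inv[OF c(1)])
      show "f x \<le> ennreal (c * A) * (ennreal (1 / c) * h x)" for x
      proof -
        have "ennreal A * (ennreal (1 / A) * f x) \<le> ennreal A * h x" by (rule mult_left_mono[OF h(1)]) simp
        moreover have "ennreal A * (ennreal (1 / A) * f x) = f x"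
          unfolding mult.assoc[symmetric] using A by (subst ennreal_mult[symmetric]) auto
        moreover have "ennreal (c * A) * (ennreal (1 / c) * h x) = ennreal A * h x"
          unfolding mult.assoc[symmetric] using c A by (subst ennreal_mult[symmetric]) auto
        ultimately show ?thesis by simp
      qed
    qed measurable
  qed
qed

lemma bisph_max_bounded:
  assumes d: "2 \<le> DIM('a::euclidean_space)" and P: "1 < P" and Q: "1 < Q" and R: "0 < R" "1 / R = 1 / P + 1 / Q"
  obtains K :: real where "0 < K"
    "\<And>f g A B. (f :: 'a \<Rightarrow> ennreal) \<in> borel_measurable borel \<Longrightarrow> borel_fun g \<Longrightarrow> (\<And>x. f x < top) \<Longrightarrow> (\<And>x. g x < top) \<Longrightarrow> 0 < A \<Longrightarrow> 0 < B \<Longrightarrow>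
      (NI x. enn_powr (f x) P) \<le> ennreal (A powr P) \<Longrightarrow> (NI x. enn_powr (g x) Q) \<le> ennreal (B powr Q) \<Longrightarrow>
      (NI x. enn_powr (bisph_max f g x) R) \<le> ennreal ((K * A * B) powr R)"
proof -
  obtain K where K: "0 \<le> K" and bd: "\<And>f g. (f :: 'a \<Rightarrow> ennreal) \<in> borel_measurable borel \<Longrightarrow> borel_fun g \<Longrightarrow> (\<And>c. open {x. c < f x}) \<Longrightarrow> (\<And>c. open {x. c < g x}) \<Longrightarrow>
      (NI x. enn_powr (f x) P) \<le> 1 \<Longrightarrow> (NI x. enn_powr (g x) Q) \<le> 1 \<Longrightarrow>
      (NI x. enn_powr (bisph_max f g x) R) \<le> ennreal K"
    using bisph_max_bounded_lsc[OF d P Q R] by metis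
  have PQ0: "0 < P" "0 < Q" using P Q by auto
  obtain c1 where c1: "0 < c1" and m1: "\<And>f A. (f :: 'a \<Rightarrow> ennreal) \<in> borel_measurable borel \<Longrightarrow> (\<And>x. f x < top) \<Longrightarrow> 0 < A \<Longrightarrow>
      (NI x. enn_powr (f x) P) \<le> ennreal (A powr P) \<Longrightarrow>
      \<exists>f'\<in>borel_measurable borel. (\<forall>c. open {x. c < f' x}) \<and> (NI x. enn_powr (f' x) P) \<le> 1 \<and> (\<forall>x. f x \<le> ennreal (c1 * A) * f' x)"
    by (rule lsc_majorant_scaled[OF PQ0(1), where 'a='a]) blast
  obtain c2 where c2: "0 < c2" and m2: "\<And>f A. (f :: 'a \<Rightarrow> ennreal) \<in> borel_measurable borel \<Longrightarrow> (\<And>x. f x < top) \<Longrightarrow> 0 < A \<Longrightarrow>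
      (NI x. enn_powr (f x) Q) \<le> ennreal (A powr Q) \<Longrightarrow>
      \<exists>f'\<in>borel_measurable borel. (\<forall>c. open {x. c < f' x}) \<and> (NI x. enn_powr (f' x) Q) \<le> 1 \<and> (\<forall>x. f x \<le> ennreal (c2 * A) * f' x)"
    by (rule lsc_majorant_scaled[OF PQ0(2), where 'a='a]) blast
  \<comment> \<open>K + 1 in place of K makes the constant positive.\<close>
  define k where "k = (K + 1) powr (1 / R)"
  have k: "0 < k" "k powr R = K + 1" using K R(1) by (simp_all add: k_def powr_powr)
  show thesis
  proof (rule that[of "c1 * c2 * k"])
    show "0 < c1 * c2 * k" using c1 c2 k by simp
    fix f g :: "'a \<Rightarrow> ennreal" and A B :: real
    assume fg [measurable]: "borel_fun f" "borel_fun g" and fin: "\<And>x. f x < top" "\<And>x. g x < top"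
      and AB: "0 < A" "0 < B" and f: "(NI x. enn_powr (f x) P) \<le> ennreal (A powr P)" and g: "(NI x. enn_powr (g x) Q) \<le> ennreal (B powr Q)"
    obtain f' where [measurable]: "borel_fun f'" and f': "\<And>c. open {x. c < f' x}" "(NI x. enn_powr (f' x) P) \<le> 1" "\<And>x. f x \<le> ennreal (c1 * A) * f' x"
      using m1[OF fg(1) fin(1) AB(1) f] by blast
    obtain g' where [measurable]: "borel_fun g'" and g': "\<And>c. open {x. c < g' x}" "(NI x. enn_powr (g' x) Q) \<le> 1" "\<And>x. g x \<le> ennreal (c2 * B) * g' x"
      using m2[OF fg(2) fin(2) AB(2) g] by blast
    let ?c = "c1 * A * (c2 * B)"
    have c: "0 < ?c" using c1 c2 AB by simp
    have "(NI x. enn_powr (bisph_max f g x) R) \<le> (NI x. ennreal (?c powr R) * enn_powr (bisph_max f' g' x) R)"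
    proof (rule nn_integral_mono)
      fix x
      have "bisph_max f g x \<le> ennreal (c1 * A) * ennreal (c2 * B) * bisph_max f' g' x" by (intro bisph_max_le_cmult f' g') measurable
      also have "ennreal (c1 * A) * ennreal (c2 * B) = ennreal ?c" using c1 c2 AB by (subst ennreal_mult[symmetric]) auto
      finally have "enn_powr (bisph_max f g x) R \<le> enn_powr (ennreal ?c * bisph_max f' g' x) R" using R by (intro enn_powr_mono) auto
      then show "enn_powr (bisph_max f g x) R \<le> ennreal (?c powr R) * enn_powr (bisph_max f' g' x) R" using c R by (simp add: enn_powr_cmult)
    qed
    also have "\<dots> = ennreal (?c powr R) * (NI x. enn_powr (bisph_max f' g' x) R)" by (rule nn_integral_cmult) measurable
    also have "\<dots> \<le> ennreal (?c powr R) * ennreal (k powr R)"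
    proof (rule mult_left_mono)
      have "(NI x. enn_powr (bisph_max f' g' x) R) \<le> ennreal K" by (intro bd f' g') measurable
      also have "\<dots> \<le> ennreal (k powr R)" unfolding k by (intro ennreal_leI) simp
      finally show "(NI x. enn_powr (bisph_max f' g' x) R) \<le> ennreal (k powr R)" .
    qed simp
    also have "\<dots> = ennreal ((c1 * c2 * k * A * B) powr R)"
    proof -
      have "(c1 * c2 * k * A * B) powr R = (?c * k) powr R" by (simp only: mult_ac)
      also have "\<dots> = ?c powr R * k powr R" by (rule powr_mult)
      finally show ?thesis by (simp add: ennreal_mult)
    qed
    finally show "(NI x. enn_powr (bisph_max f g x) R) \<le> ennreal ((c1 * c2 * k * A * B) powr R)" .
  qed
qed

lemma bisph_max_one_bounded:
  assumes d: "2 \<le> DIM('a::euclidean_space)" and P: "1 < P"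
  obtains K :: real where "0 < K"
    "\<And>f. (f :: 'a \<Rightarrow> ennreal) \<in> borel_measurable borel \<Longrightarrow>
      (NI x. enn_powr (bisph_max f (\<lambda>_. 1) x) P) \<le> ennreal K * (NI x. enn_powr (f x) P)"
proof -
  obtain C B where C: "0 < C" "0 < B" and weak: "\<And>\<alpha> f. 0 < \<alpha> \<Longrightarrow> borel_fun f \<Longrightarrow>
      emeasure lborel {x::'a. ennreal (C * \<alpha>) < bisph_max f (\<lambda>_. 1) x} \<le> ennreal B * (ennreal (1 / \<alpha>) * (NI x. above \<alpha> f x))"
    using bisph_max_one_weak[OF d] by metis
  have P': "0 < P / (P - 1)" using P by simp
  show thesis
  proof (rule that[of "C powr P * (B * (P / (P - 1)))"])
    show "0 < C powr P * (B * (P / (P - 1)))" using C P' by (intro mult_pos_pos) auto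
    fix f :: "'a \<Rightarrow> ennreal" assume [measurable]: "borel_fun f"
    let ?i = "\<lambda>\<tau>. indicator {0<..} (\<tau>::real) :: ennreal"
    let ?a = "\<lambda>\<tau>. ennreal (1 / (1 * \<tau> powr (1 / P))) * (NI x. above (1 * \<tau> powr (1 / P)) f x)"
    have [measurable]: "(\<lambda>\<tau>. NI x. above (1 * \<tau> powr (1 / P)) f x) \<in> borel_measurable borel" unfolding above_def by measurable
    have "ennreal (C powr (- P)) * (NI x. enn_powr (bisph_max f (\<lambda>_. 1) x) P)
      = (NI \<tau>. ?i \<tau> * emeasure lborel {x. ennreal (C * \<tau> powr (1 / P)) < bisph_max f (\<lambda>_. 1) x})"
      using C P by (intro layer_cake[symmetric]) auto
    also have "\<dots> \<le> (NI \<tau>. ennreal B * (?i \<tau> * ?a \<tau>))"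
    proof (rule nn_integral_mono)
      fix \<tau> :: real
      show "?i \<tau> * emeasure lborel {x. ennreal (C * \<tau> powr (1 / P)) < bisph_max f (\<lambda>_. 1) x} \<le> ennreal B * (?i \<tau> * ?a \<tau>)"
        using weak[of "\<tau> powr (1 / P)" f] by (cases "0 < \<tau>") simp_all
    qed
    also have "\<dots> = ennreal B * (NI \<tau>. ?i \<tau> * ?a \<tau>)" by (rule nn_integral_cmult) measurable
    also have "\<dots> \<le> ennreal B * (ennreal (P / (P - 1) * 1 powr (- P)) * (NI x. enn_powr (f x) P))"
      by (intro mult_left_mono layer_cake_above P) auto
    also have "\<dots> = ennreal (B * (P / (P - 1))) * (NI x. enn_powr (f x) P)"
      using C P' by (subst ennreal_mult) (simp_all add: mult.assoc)
    finally have "(NI x. enn_powr (bisph_max f (\<lambda>_. 1) x) P) \<le> ennreal (C powr P) * (ennreal (B * (P / (P - 1))) * (NI x. enn_powr (f x) P))"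
      by (rule powr_cancel_ennreal[OF C(1)])
    moreover have "0 \<le> B * (P / (P - 1))" using C P' by (intro mult_nonneg_nonneg) auto
    ultimately show "(NI x. enn_powr (bisph_max f (\<lambda>_. 1) x) P) \<le> ennreal (C powr P * (B * (P / (P - 1)))) * (NI x. enn_powr (f x) P)"
      by (simp only: ennreal_mult powr_ge_zero mult.assoc)
  qed
qed

lemma bisph_max_one_weak_L1:
  assumes d: "2 \<le> DIM('a::euclidean_space)"
  obtains K :: real where "0 < K"
    "\<And>f s. (f :: 'a \<Rightarrow> ennreal) \<in> borel_measurable borel \<Longrightarrow> 0 < s \<Longrightarrow>
      ennreal s * emeasure lborel {x. ennreal s < bisph_max f (\<lambda>_. 1) x} \<le> ennreal K * (NI x. f x)"
proof -
  obtain C B where C: "0 < C" "0 < B" and weak: "\<And>\<alpha> f. 0 < \<alpha> \<Longrightarrow> borel_fun f \<Longrightarrow>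
      emeasure lborel {x::'a. ennreal (C * \<alpha>) < bisph_max f (\<lambda>_. 1) x} \<le> ennreal B * (ennreal (1 / \<alpha>) * (NI x. above \<alpha> f x))"
    using bisph_max_one_weak[OF d] by metis
  show thesis
  proof (rule that[of "C * B"])
    show "0 < C * B" using C by simp
    fix f :: "'a \<Rightarrow> ennreal" and s :: real assume f: "borel_fun f" and s: "0 < s"
    have "emeasure lborel {x. ennreal s < bisph_max f (\<lambda>_. 1) x} \<le> ennreal B * (ennreal (1 / (s / C)) * (NI x. above (s / C) f x))"
      using weak[of "s / C" f] C s f by simp
    also have "\<dots> \<le> ennreal B * (ennreal (1 / (s / C)) * (NI x. f x))"
      by (intro mult_left_mono nn_integral_mono) (auto simp: above_def)
    finally have "ennreal s * emeasure lborel {x. ennreal s < bisph_max f (\<lambda>_. 1) x} \<le> ennreal s * (ennreal B * (ennreal (1 / (s / C)) * (NI x. f x)))"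
      by (rule mult_left_mono) simp
    also have "\<dots> = ennreal (s * (B * (1 / (s / C)))) * (NI x. f x)"
      using C s by (simp add: ennreal_mult mult.assoc del: divide_divide_eq_right times_divide_eq_right times_divide_eq_left)
    also have "s * (B * (1 / (s / C))) = C * B" using s C by simp
    finally show "ennreal s * emeasure lborel {x. ennreal s < bisph_max f (\<lambda>_. 1) x} \<le> ennreal (C * B) * (NI x. f x)" .
  qed
qed

section \<open>Passage to Lebesgue measurable complex functions\<close>

lemma borel_measurable_sphere:
  "(F :: 'a::euclidean_space \<Rightarrow> 'b::topological_space) \<in> borel_measurable borel \<Longrightarrow> F \<in> borel_measurable sphere_measure"
  "(H :: 'c::euclidean_space \<times> 'a \<Rightarrow> 'b) \<in> borel_measurable (borel \<Otimes>\<^sub>M borel) \<Longrightarrow> H \<in> borel_measurable (borel \<Otimes>\<^sub>M sphere_measure)"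
proof -
  have "(\<lambda>w. w) \<in> borel_measurable (restrict_space borel (sphere (0::'a) 1))" by (rule measurable_restrict_space1) simp
  then have id: "(\<lambda>w. w) \<in> borel_measurable (sphere_measure :: 'a measure)"
    unfolding sphere_measure_def by (intro measurable_completion) simp
  show "F \<in> borel_measurable sphere_measure" if "borel_fun F"
    using measurable_compose[OF id that] by simp
  have "(\<lambda>z. (fst z, snd z)) \<in> (borel :: 'c measure) \<Otimes>\<^sub>M (sphere_measure :: 'a measure) \<rightarrow>\<^sub>M borel \<Otimes>\<^sub>M borel"
    by (intro measurable_Pair measurable_fst measurable_compose[OF measurable_snd id])
  from measurable_compose[OF this] show "H \<in> borel_measurable (borel \<Otimes>\<^sub>M sphere_measure)" if "H \<in> borel_measurable (borel \<Otimes>\<^sub>M borel)"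
    using that by simp
qed

lemma finite_sphere_measure: "finite_measure (sphere_measure :: ('a::euclidean_space \<times> 'a) measure)"
proof (rule finite_measureI)
  show "emeasure sphere_measure (space (sphere_measure :: ('a \<times> 'a) measure)) \<noteq> \<infinity>"
    using sphere_mass_finite[where 'a='a] by (simp add: sphere_mass_def)
qed

text \<open>A sphere is itself a null set, so changing f on a null set N may alter an average at a
  particular x. It does so only for x in a null set, because the integral over x of the mass of the
  points that hit N is a multiple of the measure of N.\<close>

lemma AE_sphere_avoids_null_set:
  fixes N :: "'a::euclidean_space set"
  assumes N: "N \<in> null_sets lborel"
  shows "AE x in lborel. AE w in sphere_measure. x - t *\<^sub>R fst w \<notin> N \<and> x - t *\<^sub>R snd w \<notin> N"
proof -
  have [measurable]: "N \<in> sets borel" using N by auto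
  have [simp]: "(\<lambda>w. indicator N (x - t *\<^sub>R fst w) :: ennreal) \<in> borel_measurable (sphere_measure :: ('a \<times> 'a) measure)"
    "(\<lambda>w. indicator N (x - t *\<^sub>R snd w) :: ennreal) \<in> borel_measurable (sphere_measure :: ('a \<times> 'a) measure)" for x
    by (rule borel_measurable_sphere(1), measurable)+
  have "(NI x. bisph_nn t (indicator N) (\<lambda>_. 1) x) = 0"
    using N by (subst nn_integral_bisph_nn_one) auto
  then have "AE x in lborel. bisph_nn t (indicator N) (\<lambda>_. 1) x = 0"
    by (subst (asm) nn_integral_0_iff_AE) measurable
  then show ?thesis
  proof eventually_elim
    case (elim x)
    have "bisph_nn t (\<lambda>_. 1) (indicator N) x = 0" using elim bisph_nn_commute[of "indicator N" "\<lambda>_. 1" t x] by simp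
    then have "AE w in (sphere_measure :: ('a \<times> 'a) measure). (indicator N (x - t *\<^sub>R snd w) :: ennreal) = 0"
      unfolding bisph_nn_def by (subst (asm) nn_integral_0_iff_AE) simp_all
    moreover have "AE w in (sphere_measure :: ('a \<times> 'a) measure). (indicator N (x - t *\<^sub>R fst w) :: ennreal) = 0"
      using elim unfolding bisph_nn_def by (subst (asm) nn_integral_0_iff_AE) simp_all
    ultimately show ?case by eventually_elim (auto simp: indicator_def split: if_splits)
  qed
qed

lemma borel_measurable_completion_cong_AE:
  assumes f: "f \<in> borel_measurable (completion M)" and ae: "AE x in completion M. f x = g x"
  shows "g \<in> borel_measurable (completion M)"
proof (rule measurableI)
  fix A :: "'b set" assume "A \<in> sets borel"
  then have A: "f -` A \<inter> space (completion M) \<in> sets (completion M)" by (rule measurable_sets[OF f])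
  have "AE x in completion M. x \<in> f -` A \<inter> space (completion M) \<longleftrightarrow> x \<in> g -` A \<inter> space (completion M)"
    using ae by eventually_elim auto
  from completion.in_sets_AE[OF this A] show "g -` A \<inter> space (completion M) \<in> sets (completion M)" by simp
qed simp

lemma ex_borel_representative:
  assumes f: "(f :: 'a::euclidean_space \<Rightarrow> complex) \<in> borel_measurable lebesgue"
  obtains f0 where "borel_fun f0" "AE x in lborel. f x = f0 x"
proof -
  have "(\<lambda>x. Re (f x)) \<in> borel_measurable (completion lborel)" "(\<lambda>x. Im (f x)) \<in> borel_measurable (completion lborel)"
    using f by measurable
  then obtain a b where ab [measurable]: "a \<in> borel_measurable lborel" "b \<in> borel_measurable lborel"
    and ae: "AE x in lborel. Re (f x) = a x" "AE x in lborel. Im (f x) = b x"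
    using completion_ex_borel_measurable_real by metis
  from ae have "AE x in lborel. f x = of_real (a x) + \<i> * of_real (b x)" by eventually_elim (simp add: complex_eq_iff)
  then show thesis by (intro that[of "\<lambda>x. of_real (a x) + \<i> * of_real (b x)"]) measurable
qed

lemma AE_bisph_integrand_eq:
  fixes f g f0 g0 :: "'a::euclidean_space \<Rightarrow> complex"
  assumes "AE x in lborel. f x = f0 x" "AE x in lborel. g x = g0 x"
  shows "AE x in lborel. AE w in sphere_measure. bisph_integrand t f g x w = bisph_integrand t f0 g0 x w"
proof -
  obtain N where N: "{x \<in> space lborel. \<not> (f x = f0 x \<and> g x = g0 x)} \<subseteq> N" "emeasure lborel N = 0" "N \<in> sets lborel"
    using AE_conjI[OF assms] by (rule AE_E)
  then have "N \<in> null_sets lborel" and off: "\<And>y. y \<notin> N \<Longrightarrow> f y = f0 y \<and> g y = g0 y" by (auto intro!: null_setsI)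
  from AE_sphere_avoids_null_set[OF this(1), of t] show ?thesis
  proof eventually_elim
    case (elim x)
    then show ?case by eventually_elim (simp add: bisph_integrand_def split_beta off)
  qed
qed

lemma bisph_integrand_measurable:
  assumes [measurable]: "borel_fun f" "borel_fun g"
  shows "bisph_integrand t f g x \<in> borel_measurable sphere_measure"
  unfolding bisph_integrand_def split_beta by (rule borel_measurable_sphere(1)) measurable

lemma bisph_avg_measurable:
  fixes f g :: "'a::euclidean_space \<Rightarrow> complex"
  assumes [measurable]: "borel_fun f" "borel_fun g"
  shows "bisph_avg t f g \<in> borel_measurable borel"
proof -
  interpret finite_measure "sphere_measure :: ('a \<times> 'a) measure" by (rule finite_sphere_measure)
  show ?thesis unfolding bisph_avg_def bisph_integrand_def split_beta
    by (intro borel_measurable_lebesgue_integral borel_measurable_sphere(2)) measurable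
qed

lemma nn_integral_norm_bisph_integrand:
  "nn_integral sphere_measure (\<lambda>w. ennreal (norm (bisph_integrand t f g x w))) = bisph_nn t (\<lambda>y. ennreal (norm (f y))) (\<lambda>y. ennreal (norm (g y))) x"
  unfolding bisph_nn_def bisph_integrand_def split_beta by (simp add: norm_mult ennreal_mult)

lemma norm_bisph_avg_le:
  fixes f g :: "'a::euclidean_space \<Rightarrow> complex"
  shows "ennreal (norm (bisph_avg t f g x)) \<le> bisph_nn t (\<lambda>y. ennreal (norm (f y))) (\<lambda>y. ennreal (norm (g y))) x"
proof (cases "integrable sphere_measure (bisph_integrand t f g x)")
  case True
  then show ?thesis unfolding bisph_avg_def nn_integral_norm_bisph_integrand[symmetric] by (rule integral_norm_bound_ennreal)
qed (simp add: bisph_avg_def not_integrable_integral_eq)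

lemma bisph_integrable:
  fixes f g :: "'a::euclidean_space \<Rightarrow> complex"
  assumes "borel_fun f" "borel_fun g"
    and "bisph_nn t (\<lambda>y. ennreal (norm (f y))) (\<lambda>y. ennreal (norm (g y))) x < top"
  shows "integrable sphere_measure (bisph_integrand t f g x)"
  using assms by (intro integrableI_bounded bisph_integrand_measurable) (simp_all add: nn_integral_norm_bisph_integrand)

section \<open>Existence of the averages and Borel representatives\<close>

definition locally_integrable :: "('a::euclidean_space \<Rightarrow> ennreal) \<Rightarrow> bool" where
  "locally_integrable f \<longleftrightarrow> (\<forall>n::nat. (NI x. indicator (cball 0 (real n)) x * f x) < top)"

text \<open>The average at x sees only the ball of radius t about x, so both functions may be cut
  off at a large ball. The cut-off functions are integrable, their average is integrable in x by
  \<open>bisph_nn_L1\<close>, and countably many cut-offs suffice for all x.\<close>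

lemma AE_bisph_nn_finite:
  fixes f g :: "'a::euclidean_space \<Rightarrow> ennreal"
  assumes [measurable]: "borel_fun f" "borel_fun g" and d: "2 \<le> DIM('a)" and t: "0 < t"
    and loc: "locally_integrable f" "locally_integrable g"
  shows "AE x in lborel. bisph_nn t f g x < top"
proof -
  let ?r = "\<lambda>n (h :: 'a \<Rightarrow> ennreal) y. indicator (cball 0 (real n)) y * h y"
  have "AE x in lborel. bisph_nn t (?r n f) (?r n g) x \<noteq> \<infinity>" for n
  proof (rule nn_integral_PInf_AE)
    have "(NI x. bisph_nn t (?r n f) (?r n g) x) \<le> slice_const TYPE('a) * ennreal (1 / t ^ DIM('a)) * (NI x. ?r n f x) * (NI x. ?r n g x)"
      by (rule bisph_nn_L1[OF _ _ d t]) measurable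
    also have "\<dots> < top" using loc slice_const_finite[where 'a='a] by (simp add: locally_integrable_def ennreal_mult_less_top)
    finally show "(NI x. bisph_nn t (?r n f) (?r n g) x) \<noteq> \<infinity>" by simp
  qed measurable
  then have "AE x in lborel. \<forall>n. bisph_nn t (?r n f) (?r n g) x \<noteq> \<infinity>" by (simp add: AE_all_countable)
  then show ?thesis
  proof eventually_elim
    case (elim x)
    obtain n where n: "norm x + t \<le> real n" using real_arch_simple by blast
    have b: "indicator (cball 0 (real n)) y = (1 :: ennreal)" if "dist x y \<le> t" for y
      using that n norm_triangle_ineq2[of y x] by (simp add: dist_norm norm_minus_commute)
    have "bisph_nn t f g x \<le> bisph_nn t (?r n f) (?r n g) x"
      using t by (intro bisph_nn_mono_local) (simp_all add: b)
    then show ?case using elim by (auto simp: less_top[symmetric] top_unique)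
  qed
qed

text \<open>Only countably many radii enter the lacunary maximal function, so the null sets of bad
  points x can be united. This gives both the majorisation and the measurability almost
  everywhere.\<close>

lemma lac_max_transfer:
  fixes f g f0 g0 :: "'a::euclidean_space \<Rightarrow> complex"
  assumes [measurable]: "borel_fun f0" "borel_fun g0"
    and ae: "AE x in lborel. f x = f0 x" "AE x in lborel. g x = g0 x" and d: "2 \<le> DIM('a)"
  defines "F \<equiv> \<lambda>x. ennreal (norm (f0 x))" and "G \<equiv> \<lambda>x. ennreal (norm (g0 x))"
  shows "AE x in lborel. lac_max f g x \<le> bisph_max F G x"
    and "locally_integrable F \<Longrightarrow> locally_integrable G \<Longrightarrow> bisph_well_defined f g"
proof -
  have m: "bisph_integrand t f g x \<in> borel_measurable sphere_measure" if "AE w in sphere_measure. bisph_integrand t f g x w = bisph_integrand t f0 g0 x w" for t x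
    using borel_measurable_completion_cong_AE[OF bisph_integrand_measurable[OF assms(1,2), of t x, unfolded sphere_measure_def], of "bisph_integrand t f g x"] that
    unfolding sphere_measure_def by (simp add: eq_commute)
  have avg: "AE x in lborel. bisph_avg t f g x = bisph_avg t f0 g0 x" for t
    using AE_bisph_integrand_eq[OF ae, of t]
    by eventually_elim (unfold bisph_avg_def, intro integral_cong_AE m bisph_integrand_measurable assms)
  have all: "AE x in lborel. \<forall>l::int. bisph_avg (2 powi (- l)) f g x = bisph_avg (2 powi (- l)) f0 g0 x"
    using avg by (simp add: AE_all_countable)
  show "AE x in lborel. lac_max f g x \<le> bisph_max F G x"
    using all by eventually_elim (unfold lac_max_def bisph_max_def F_def G_def, simp, intro SUP_mono, use norm_bisph_avg_le in blast)
  assume loc: "locally_integrable F" "locally_integrable G"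
  have "AE x in lborel. integrable sphere_measure (bisph_integrand t f g x)" if t: "0 < t" for t
  proof -
    have "AE x in lborel. bisph_nn t F G x < top" by (rule AE_bisph_nn_finite[OF _ _ d t loc]) (simp_all add: F_def G_def)
    then show ?thesis using AE_bisph_integrand_eq[OF ae, of t]
    proof eventually_elim
      case (elim x)
      have "integrable sphere_measure (bisph_integrand t f0 g0 x)" using elim(1) unfolding F_def G_def by (intro bisph_integrable assms(1,2))
      then show ?case using integrable_cong_AE[OF m[OF elim(2)] bisph_integrand_measurable[OF assms(1,2)] elim(2)] by simp
    qed
  qed
  moreover have "lac_max f g \<in> borel_measurable lebesgue"
  proof (rule borel_measurable_completion_cong_AE)
    note [measurable] = bisph_avg_measurable[OF assms(1,2)]
    show "lac_max f0 g0 \<in> borel_measurable lebesgue" unfolding lac_max_def by (intro measurable_completion) measurable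
    show "AE x in lebesgue. lac_max f0 g0 x = lac_max f g x"
      using AE_completion[OF all] by eventually_elim (simp add: lac_max_def)
  qed
  ultimately show "bisph_well_defined f g" unfolding bisph_well_defined_def by (auto intro: AE_completion)
qed

text \<open>For p = \<infinity> the bound is imposed at every point, since spheres can see null sets
  and the averages are compared pointwise.\<close>

definition lp_bound :: "ennreal \<Rightarrow> real \<Rightarrow> ('a::euclidean_space \<Rightarrow> ennreal) \<Rightarrow> bool" where
  "lp_bound p A f \<longleftrightarrow> (if p = top then \<forall>x. f x \<le> ennreal A
    else (NI x. enn_powr (f x) (enn2real p)) \<le> ennreal (A powr enn2real p))"

lemma lp_bound_locally_integrable:
  fixes f :: "'a::euclidean_space \<Rightarrow> ennreal"
  assumes [measurable]: "borel_fun f" and p: "1 \<le> p" and b: "lp_bound p A f"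
  shows "locally_integrable f"
  unfolding locally_integrable_def
proof
  fix n :: nat
  have fin: "emeasure lborel (cball (0::'a) (real n)) < top" using emeasure_lborel_cball_finite[of "0::'a" "real n"] by simp
  show "(NI x. indicator (cball 0 (real n)) x * f x) < top"
  proof (cases "p = top")
    case True
    have "(NI x. indicator (cball 0 (real n)) x * f x) \<le> (NI x. indicator (cball (0::'a) (real n)) x * ennreal A)"
      using b True by (intro nn_integral_mono mult_left_mono) (auto simp: lp_bound_def)
    also have "\<dots> = emeasure lborel (cball (0::'a) (real n)) * ennreal A" by (subst nn_integral_multc) simp_all
    also have "\<dots> < top" using fin by (simp add: ennreal_mult_less_top)
    finally show ?thesis .
  next
    case False
    have P: "1 \<le> enn2real p" using p False enn2real_mono[of 1 p] by (simp add: less_top[symmetric])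
    have "f x \<le> 1 + enn_powr (f x) (enn2real p)" for x
    proof (cases "f x \<le> 1")
      case False
      have "f x \<le> enn_powr (f x) (enn2real p)"
      proof (cases "f x")
        case (real v)
        then have "1 \<le> v" using False by (simp add: ennreal_le_1)
        then have "v powr 1 \<le> v powr enn2real p" using P by (intro powr_mono) auto
        then show ?thesis using real \<open>1 \<le> v\<close> by (simp add: enn_powr_ennreal ennreal_leI)
      qed simp
      then show ?thesis by (rule order_trans) simp
    qed (simp add: add_increasing2)
    then have "(NI x. indicator (cball 0 (real n)) x * f x) \<le> (NI x. indicator (cball (0::'a) (real n)) x + enn_powr (f x) (enn2real p))"
      by (intro nn_integral_mono) (auto simp: indicator_def)
    also have "\<dots> = emeasure lborel (cball (0::'a) (real n)) + (NI x. enn_powr (f x) (enn2real p))"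
      by (subst nn_integral_add) simp_all
    also have "\<dots> < top" using fin b False by (simp add: lp_bound_def le_less_trans[OF _ ennreal_less_top])
    finally show ?thesis .
  qed
qed

text \<open>The strict inequality makes A positive even for a function that vanishes almost
  everywhere. For p = \<infinity> the representative is set to 0 where it exceeds A, so that the
  bound holds everywhere.\<close>

lemma Lp_representative:
  fixes f :: "'a::euclidean_space \<Rightarrow> complex"
  assumes f: "f \<in> Lp p" and p: "1 \<le> p" and A: "fun_Lnorm p f < ennreal A"
  obtains f0 where "borel_fun f0" "AE x in lborel. f x = f0 x" "lp_bound p A (\<lambda>x. ennreal (norm (f0 x)))"
proof -
  have A0: "0 < A" using A by (metis ennreal_neg not_less not_less_zero linorder_linear)
  obtain f1 where f1 [measurable]: "borel_fun f1" and ae: "AE x in lborel. f x = f1 x"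
    using f by (auto simp: Lp_def elim: ex_borel_representative)
  show thesis
  proof (cases "p = top")
    case True
    have "AE x in lebesgue. ennreal (norm (f x)) \<le> ennreal A"
      using esssup_AE[of "\<lambda>x. ennreal (norm (f x))" lebesgue] by eventually_elim (use A True in \<open>auto simp: Lnorm_def\<close>)
    then have "AE x in lborel. norm (f x) \<le> A" using A0 by (simp add: AE_completion_iff)
    then have "AE x in lborel. f x = (if norm (f1 x) \<le> A then f1 x else 0)" using ae by eventually_elim auto
    then show thesis using A0 True by (intro that[of "\<lambda>x. if norm (f1 x) \<le> A then f1 x else 0"]) (auto simp: lp_bound_def)
  next
    case False
    have P: "0 < enn2real p" using p False by (intro enn2real_positive_iff[THEN iffD2]) (auto simp: less_top[symmetric] intro: less_le_trans[OF zero_less_one])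
    let ?I = "NI x. enn_powr (ennreal (norm (f1 x))) (enn2real p)"
    have "(\<integral>\<^sup>+x. enn_powr (ennreal (norm (f x))) (enn2real p) \<partial>lebesgue) = ?I"
      unfolding nn_integral_completion by (rule nn_integral_cong_AE) (use ae in eventually_elim, simp)
    then have "enn_powr ?I (1 / enn2real p) \<le> ennreal A" using A False by (simp add: Lnorm_def)
    then have "enn_powr (enn_powr ?I (1 / enn2real p)) (enn2real p) \<le> enn_powr (ennreal A) (enn2real p)" using P by (intro enn_powr_mono) auto
    then have "?I \<le> ennreal (A powr enn2real p)" using P A0 by (simp add: enn_powr_powr enn_powr_ennreal)
    then show thesis using ae False by (intro that[of f1]) (auto simp: lp_bound_def)
  qed
qed

lemma bisph_well_defined_Lp:
  fixes f g :: "'a::euclidean_space \<Rightarrow> complex"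
  assumes f: "f \<in> Lp p" "1 \<le> p" and g: "g \<in> Lp q" "1 \<le> q" and d: "2 \<le> DIM('a)"
  shows "bisph_well_defined f g"
proof -
  have ex: "\<exists>A. x < ennreal A" if x: "x < top" for x :: ennreal   proof -
    obtain v where v: "x = ennreal v" "0 \<le> v" using x by (cases x) auto
    then have "x < ennreal (v + 1)" by (simp add: ennreal_less_iff del: ennreal_plus)
    then show ?thesis ..
  qed
  have fin: "fun_Lnorm p f < top" "fun_Lnorm q g < top" using f g by (auto simp: Lp_def)
  obtain A where A: "fun_Lnorm p f < ennreal A" using ex[OF fin(1)] ..
  obtain B where B: "fun_Lnorm q g < ennreal B" using ex[OF fin(2)] ..
  obtain f0 where f0: "borel_fun f0" "AE x in lborel. f x = f0 x" "lp_bound p A (\<lambda>x. ennreal (norm (f0 x)))"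
    using Lp_representative[OF f A] .
  obtain g0 where g0: "borel_fun g0" "AE x in lborel. g x = g0 x" "lp_bound q B (\<lambda>x. ennreal (norm (g0 x)))"
    using Lp_representative[OF g B] .
  show ?thesis
    by (rule lac_max_transfer(2)[OF f0(1) g0(1) f0(2) g0(2) d]; rule lp_bound_locally_integrable[OF _ _ f0(3)] lp_bound_locally_integrable[OF _ _ g0(3)])
      (use f0 g0 f g in auto)
qed

text \<open>Boundedness in terms of nonnegative Borel representatives with positive upper bounds A
  and B for their norms. The function h stands for the maximal function of the original pair, which
  is compared with the majorant only almost everywhere.\<close>

definition borel_bounded :: "ennreal \<Rightarrow> ennreal \<Rightarrow> (('a::euclidean_space \<Rightarrow> ennreal) \<Rightarrow> ennreal) \<Rightarrow> bool" where
  "borel_bounded p q N \<longleftrightarrow> (\<exists>K\<ge>0. \<forall>F\<in>borel_measurable borel. \<forall>G\<in>borel_measurable borel. \<forall>A B h.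
    (\<forall>x. F x < top) \<longrightarrow> (\<forall>x. G x < top) \<longrightarrow> 0 < A \<longrightarrow> 0 < B \<longrightarrow> lp_bound p A F \<longrightarrow> lp_bound q B G \<longrightarrow>
    (AE x in lborel. h x \<le> bisph_max F G x) \<longrightarrow> N h \<le> ennreal (K * A * B))"

lemma borel_bounded_commute: "borel_bounded p q N \<Longrightarrow> borel_bounded q p N"
  unfolding borel_bounded_def
proof (elim exE conjE, intro exI conjI ballI allI impI)
  fix K A B :: real and F G h :: "'a \<Rightarrow> ennreal"
  assume bd: "\<forall>F\<in>borel_measurable borel. \<forall>G\<in>borel_measurable borel. \<forall>A B h.
    (\<forall>x. F x < top) \<longrightarrow> (\<forall>x. G x < top) \<longrightarrow> 0 < A \<longrightarrow> 0 < B \<longrightarrow> lp_bound p A F \<longrightarrow> lp_bound q B G \<longrightarrow>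
    (AE x in lborel. h x \<le> bisph_max F G x) \<longrightarrow> N h \<le> ennreal (K * A * B)"
    and FG: "borel_fun F" "borel_fun G" and o: "\<forall>x. F x < top" "\<forall>x. G x < top" "0 < A" "0 < B" "lp_bound q A F" "lp_bound p B G"
      "AE x in lborel. h x \<le> bisph_max F G x"
  have "N h \<le> ennreal (K * B * A)" using bd FG o bisph_max_commute[OF FG] by simp
  then show "N h \<le> ennreal (K * A * B)" by (simp add: mult_ac)
qed assumption

lemma bounded_bilin_lac_max:
  fixes N :: "('a::euclidean_space \<Rightarrow> ennreal) \<Rightarrow> ennreal"
  assumes d: "2 \<le> DIM('a)" and p: "1 \<le> p" "1 \<le> q" and bd: "borel_bounded p q N"
  shows "bounded_bilin (lac_max :: 'a bilin_op) p q N"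
proof -
  obtain K where K: "0 \<le> K" and bd: "\<forall>F\<in>borel_measurable borel. \<forall>G\<in>borel_measurable borel. \<forall>A B h.
    (\<forall>x. F x < top) \<longrightarrow> (\<forall>x. G x < top) \<longrightarrow> 0 < A \<longrightarrow> 0 < B \<longrightarrow> lp_bound p A F \<longrightarrow> lp_bound q B G \<longrightarrow>
    (AE x in lborel. h x \<le> bisph_max F G x) \<longrightarrow> N h \<le> ennreal (K * A * B)"
    using bd unfolding borel_bounded_def by (elim exE conjE) (rule that)
  show ?thesis unfolding bounded_bilin_def
  proof (intro exI[of _ K] ballI)
    fix f g :: "'a \<Rightarrow> complex" assume f: "f \<in> Lp p" and g: "g \<in> Lp q"
    obtain a where a: "fun_Lnorm p f = ennreal a" "0 \<le> a" using f less_top_ennreal by (auto simp: Lp_def)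
    obtain b where b: "fun_Lnorm q g = ennreal b" "0 \<le> b" using g less_top_ennreal by (auto simp: Lp_def)
    have le: "N (lac_max f g) \<le> ennreal (K * (a + e) * (b + e))" if e: "0 < e" for e
    proof -
      have ab: "fun_Lnorm p f < ennreal (a + e)" "fun_Lnorm q g < ennreal (b + e)" using a b e by (simp_all add: ennreal_less_iff del: ennreal_plus)
      obtain f0 where f0: "borel_fun f0" "AE x in lborel. f x = f0 x" "lp_bound p (a + e) (\<lambda>x. ennreal (norm (f0 x)))"
        using Lp_representative[OF f p(1) ab(1)] .
      obtain g0 where g0: "borel_fun g0" "AE x in lborel. g x = g0 x" "lp_bound q (b + e) (\<lambda>x. ennreal (norm (g0 x)))"
        using Lp_representative[OF g p(2) ab(2)] .
      have "AE x in lborel. lac_max f g x \<le> bisph_max (\<lambda>x. ennreal (norm (f0 x))) (\<lambda>x. ennreal (norm (g0 x))) x"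
        by (rule lac_max_transfer(1)[OF f0(1) g0(1) f0(2) g0(2) d])
      then show ?thesis using f0 g0 a b e
        by (intro bd[rule_format, of "\<lambda>x. ennreal (norm (f0 x))" "\<lambda>x. ennreal (norm (g0 x))" "a + e" "b + e" "lac_max f g"]) simp_all
    qed
    \<comment> \<open>The bounds a + e and b + e are strict; letting e tend to 0 reaches the norms
      themselves, including norms equal to 0.\<close>
    have "((\<lambda>e. ennreal (K * (a + e) * (b + e))) \<longlongrightarrow> ennreal (K * (a + 0) * (b + 0))) (at_right 0)"
      by (intro tendsto_intros)
    moreover have "\<forall>\<^sub>F e in at_right 0. N (lac_max f g) \<le> ennreal (K * (a + e) * (b + e))"
      unfolding eventually_at_right_field using le by (intro exI[of _ 1]) auto
    ultimately have "N (lac_max f g) \<le> ennreal (K * (a + 0) * (b + 0))" by (rule tendsto_lowerbound) simp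
    also have "\<dots> = ennreal K * fun_Lnorm p f * fun_Lnorm q g" using K a b by (simp add: ennreal_mult)
    finally show "N (lac_max f g) \<le> ennreal K * fun_Lnorm p f * fun_Lnorm q g" .
  qed
qed

lemma Lnorm_le_bisph_max:
  assumes R: "0 < R" and ae: "AE x in lborel. h x \<le> H x" and X: "0 \<le> X"
    and H: "(NI x. enn_powr (H x) R) \<le> ennreal (X powr R)"
  shows "Lnorm (ennreal R) h \<le> ennreal X"
proof -
  have "(\<integral>\<^sup>+x. enn_powr (h x) R \<partial>lebesgue) \<le> (NI x. enn_powr (H x) R)"
    unfolding nn_integral_completion by (rule nn_integral_mono_AE) (use ae R in \<open>auto elim!: eventually_mono intro: enn_powr_mono\<close>)
  also note H
  finally have "enn_powr (\<integral>\<^sup>+x. enn_powr (h x) R \<partial>lebesgue) (1 / R) \<le> enn_powr (ennreal (X powr R)) (1 / R)" using R by (intro enn_powr_mono) auto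
  then show ?thesis using R X by (simp add: Lnorm_def enn_powr_ennreal powr_powr)
qed

lemma borel_bounded_finite:
  assumes d: "2 \<le> DIM('a::euclidean_space)" and P: "1 < P" and Q: "1 < Q" and R: "0 < R" "1 / R = 1 / P + 1 / Q"
  shows "borel_bounded (ennreal P) (ennreal Q) (Lnorm (ennreal R) :: ('a \<Rightarrow> ennreal) \<Rightarrow> ennreal)"
proof -
  obtain K where K: "0 < K" and bd: "\<And>f g A B. (f :: 'a \<Rightarrow> ennreal) \<in> borel_measurable borel \<Longrightarrow> borel_fun g \<Longrightarrow> (\<And>x. f x < top) \<Longrightarrow> (\<And>x. g x < top) \<Longrightarrow> 0 < A \<Longrightarrow> 0 < B \<Longrightarrow>
      (NI x. enn_powr (f x) P) \<le> ennreal (A powr P) \<Longrightarrow> (NI x. enn_powr (g x) Q) \<le> ennreal (B powr Q) \<Longrightarrow>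
      (NI x. enn_powr (bisph_max f g x) R) \<le> ennreal ((K * A * B) powr R)"
    using bisph_max_bounded[OF d P Q R] by metis
  show ?thesis unfolding borel_bounded_def
    using K P Q R by (intro exI[of _ K] conjI ballI allI impI) (auto simp: lp_bound_def intro!: Lnorm_le_bisph_max bd)
qed

lemma bisph_max_bounded_right:
  fixes F G :: "'a::euclidean_space \<Rightarrow> ennreal"
  assumes "borel_fun F" "\<forall>x. G x \<le> ennreal B"
  shows "bisph_max F G x \<le> ennreal B * bisph_max F (\<lambda>_. 1) x"
  using bisph_max_le_cmult[of F "\<lambda>_. 1" F 1 G "ennreal B" x] assms by simp

lemma borel_bounded_top:
  assumes d: "2 \<le> DIM('a::euclidean_space)" and P: "1 < P"
  shows "borel_bounded (ennreal P) top (Lnorm (ennreal P) :: ('a \<Rightarrow> ennreal) \<Rightarrow> ennreal)"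
proof -
  obtain K where K: "0 < K" and bd: "\<And>f. (f :: 'a \<Rightarrow> ennreal) \<in> borel_measurable borel \<Longrightarrow>
      (NI x. enn_powr (bisph_max f (\<lambda>_. 1) x) P) \<le> ennreal K * (NI x. enn_powr (f x) P)"
    using bisph_max_one_bounded[OF d P] by metis
  define k where "k = K powr (1 / P)"
  have k: "0 \<le> k" "k powr P = K" using K P by (simp_all add: k_def powr_powr)
  show ?thesis unfolding borel_bounded_def
  proof (intro exI[of _ k] conjI ballI allI impI)
    fix F G h :: "'a \<Rightarrow> ennreal" and A B :: real
    assume [measurable]: "borel_fun F" "borel_fun G" and AB: "0 < A" "0 < B" and F: "lp_bound (ennreal P) A F" and G: "lp_bound top B G"
      and h: "AE x in lborel. h x \<le> bisph_max F G x"
    have "(NI x. enn_powr (bisph_max F G x) P) \<le> (NI x. ennreal (B powr P) * enn_powr (bisph_max F (\<lambda>_. 1) x) P)"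
    proof (rule nn_integral_mono)
      fix x
      have "enn_powr (bisph_max F G x) P \<le> enn_powr (ennreal B * bisph_max F (\<lambda>_. 1) x) P"
        using P G by (intro enn_powr_mono bisph_max_bounded_right) (auto simp: lp_bound_def)
      then show "enn_powr (bisph_max F G x) P \<le> ennreal (B powr P) * enn_powr (bisph_max F (\<lambda>_. 1) x) P" using AB P by (simp add: enn_powr_cmult)
    qed
    also have "\<dots> = ennreal (B powr P) * (NI x. enn_powr (bisph_max F (\<lambda>_. 1) x) P)" by (rule nn_integral_cmult) measurable
    also have "\<dots> \<le> ennreal (B powr P) * (ennreal K * ennreal (A powr P))"
      using F P by (intro mult_left_mono order_trans[OF bd]) (auto simp: lp_bound_def)
    also have "\<dots> = ennreal ((k * A * B) powr P)" using AB K k by (simp add: powr_mult ennreal_mult mult_ac)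
    finally show "Lnorm (ennreal P) h \<le> ennreal (k * A * B)" using k AB P by (intro Lnorm_le_bisph_max[OF _ h]) auto
  qed (fact k)
qed

lemma borel_bounded_weak:
  assumes d: "2 \<le> DIM('a::euclidean_space)"
  shows "borel_bounded 1 top (weak_L1_norm :: ('a \<Rightarrow> ennreal) \<Rightarrow> ennreal)"
proof -
  obtain K where K: "0 < K" and bd: "\<And>f s. (f :: 'a \<Rightarrow> ennreal) \<in> borel_measurable borel \<Longrightarrow> 0 < s \<Longrightarrow>
      ennreal s * emeasure lborel {x. ennreal s < bisph_max f (\<lambda>_. 1) x} \<le> ennreal K * (NI x. f x)"
    using bisph_max_one_weak_L1[OF d] by metis
  show ?thesis unfolding borel_bounded_def
  proof (intro exI[of _ K] conjI ballI allI impI)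
    fix F G h :: "'a \<Rightarrow> ennreal" and A B :: real
    assume [measurable]: "borel_fun F" "borel_fun G" and AB: "0 < A" "0 < B" and F: "lp_bound 1 A F" and G: "lp_bound top B G"
      and h: "AE x in lborel. h x \<le> bisph_max F G x"
    show "weak_L1_norm h \<le> ennreal (K * A * B)" unfolding weak_L1_norm_def
    proof (rule SUP_least)
      fix s :: real assume "s \<in> {0<..}"
      then have s: "0 < s" by simp
      have "emeasure lebesgue {x. ennreal s < h x} \<le> emeasure lebesgue {x. ennreal (s / B) < bisph_max F (\<lambda>_. 1) x}"
      proof (rule emeasure_mono_AE)
        show "AE x in lebesgue. x \<in> {x. ennreal s < h x} \<longrightarrow> x \<in> {x. ennreal (s / B) < bisph_max F (\<lambda>_. 1) x}"
          using AE_completion[OF h]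
        proof eventually_elim
          case (elim x)
          have "h x \<le> ennreal B * bisph_max F (\<lambda>_. 1) x" using elim bisph_max_bounded_right[of F G B x] G by (auto simp: lp_bound_def)
          then have "ennreal s < ennreal B * bisph_max F (\<lambda>_. 1) x" if "ennreal s < h x" using that by simp
          then show ?case using AB s by (auto simp: ennreal_less_cmult_iff ennreal_mult[symmetric])
        qed
        show "{x. ennreal (s / B) < bisph_max F (\<lambda>_. 1) x} \<in> sets lebesgue" by (intro sets_completionI_sets) simp
      qed
      also have "\<dots> = emeasure lborel {x. ennreal (s / B) < bisph_max F (\<lambda>_. 1) x}" by simp
      finally have "ennreal s * emeasure lebesgue {x. ennreal s < h x} \<le> ennreal s * emeasure lborel {x. ennreal (s / B) < bisph_max F (\<lambda>_. 1) x}" by (rule mult_left_mono) simp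
      also have "\<dots> = ennreal B * (ennreal (s / B) * emeasure lborel {x. ennreal (s / B) < bisph_max F (\<lambda>_. 1) x})"
        using AB s unfolding mult.assoc[symmetric] by (subst ennreal_mult[symmetric]) auto
      also have "\<dots> \<le> ennreal B * (ennreal K * ennreal A)"
        using AB s F by (intro mult_left_mono order_trans[OF bd]) (auto simp: lp_bound_def)
      also have "\<dots> = ennreal (K * A * B)" using AB K by (simp add: ennreal_mult mult_ac)
      finally show "ennreal s * emeasure lebesgue {x. ennreal s < h x} \<le> ennreal (K * A * B)" .
    qed
  qed (use K in simp)
qed

lemma lac_max_strong_bound:
  fixes p q r :: ennreal
  assumes d: "2 \<le> DIM('a::euclidean_space)" and pq: "1 < p" "1 < q" "0 < r" "r < top" "1 / r = 1 / p + 1 / q"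
  shows "borel_bounded p q (Lnorm r :: ('a \<Rightarrow> ennreal) \<Rightarrow> ennreal)"
proof -
  obtain R where R: "r = ennreal R" "0 < R" using pq(3,4) less_top_ennreal by (metis ennreal_less_zero_iff)
  have real: "\<exists>X>1. x = ennreal X" if "1 < x" "x \<noteq> top" for x :: ennreal
    using that by (cases x) (auto simp: ennreal_less_iff simp flip: ennreal_1)
  have inv: "1 / ennreal X = ennreal (1 / X)" if "0 < X" for X using that divide_ennreal[of 1 X] by simp
  \<comment> \<open>If exactly one exponent is infinite, r equals the other one. Two infinite
    exponents would give 1/r = 0, against r < \<infinity>.\<close>
  consider (ff) P Q where "p = ennreal P" "q = ennreal Q" "1 < P" "1 < Q" | (ft) P where "p = ennreal P" "q = top" "1 < P"
    | (tf) Q where "p = top" "q = ennreal Q" "1 < Q" | (tt) "p = top" "q = top"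
    using real[OF pq(1)] real[OF pq(2)] by blast
  then show ?thesis
  proof cases
    case ff
    then have "ennreal (1 / R) = ennreal (1 / P + 1 / Q)" using pq(5) R by (simp add: inv)
    then have "1 / R = 1 / P + 1 / Q" using ff R by (subst (asm) ennreal_inj) auto
    then show ?thesis using borel_bounded_finite[OF d ff(3,4) R(2)] ff R by simp
  next
    case ft
    then have "ennreal (1 / R) = ennreal (1 / P)" using pq(5) R by (simp add: inv)
    then have "R = P" using ft R by (subst (asm) ennreal_inj) auto
    then show ?thesis using borel_bounded_top[OF d ft(3)] ft R by simp
  next
    case tf
    then have "ennreal (1 / R) = ennreal (1 / Q)" using pq(5) R by (simp add: inv)
    then have "R = Q" using tf R by (subst (asm) ennreal_inj) auto
    then show ?thesis using borel_bounded_commute[OF borel_bounded_top[OF d tf(3)]] tf R by simp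
  next
    case tt
    then have "ennreal (1 / R) = 0" using pq(5) R by (simp add: inv)
    then show ?thesis using R by (simp add: ennreal_eq_0_iff)
  qed
qed

section \<open>Failure of the strong endpoint bounds\<close>

text \<open>Nonnegative integrands cannot cancel, and boundedness keeps the Bochner integral from
  taking its default value 0. Lower bounds for the nonnegative average therefore carry over to the
  complex one.\<close>

lemma norm_bisph_avg_of_real:
  fixes f g :: "'a::euclidean_space \<Rightarrow> real"
  assumes [measurable]: "borel_fun f" "borel_fun g"
    and f: "\<And>y. 0 \<le> f y" "\<And>y. f y \<le> 1" and g: "\<And>y. 0 \<le> g y" "\<And>y. g y \<le> 1"
  shows "ennreal (norm (bisph_avg t (\<lambda>y. complex_of_real (f y)) (\<lambda>y. complex_of_real (g y)) x)) = bisph_nn t (\<lambda>y. ennreal (f y)) (\<lambda>y. ennreal (g y)) x"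
proof -
  let ?h = "\<lambda>w. f (x - t *\<^sub>R fst w) * g (x - t *\<^sub>R snd w)"
  have h: "0 \<le> ?h w" for w using f g by simp
  have e: "bisph_nn t (\<lambda>y. ennreal (f y)) (\<lambda>y. ennreal (g y)) x = nn_integral sphere_measure (\<lambda>w. ennreal (?h w))"
    unfolding bisph_nn_def using f g by (simp add: ennreal_mult)
  have "bisph_nn t (\<lambda>y. ennreal (f y)) (\<lambda>y. ennreal (g y)) x \<le> bisph_nn t (\<lambda>_. 1) (\<lambda>_. 1) x"
    using f g by (intro bisph_nn_mono) (auto simp: ennreal_le_1)
  also have "\<dots> < top" unfolding bisph_nn_one_one by (rule sphere_mass_finite)
  finally have "integrable sphere_measure ?h"
    using h by (intro integrableI_nonneg borel_measurable_sphere(1)) (simp_all add: e)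
  then have "nn_integral sphere_measure (\<lambda>w. ennreal (?h w)) = ennreal (integral\<^sup>L sphere_measure ?h)"
    using h by (intro nn_integral_eq_integral) simp_all
  moreover have "bisph_avg t (\<lambda>y. complex_of_real (f y)) (\<lambda>y. complex_of_real (g y)) x = complex_of_real (integral\<^sup>L sphere_measure ?h)"
    unfolding bisph_avg_def bisph_integrand_def split_beta of_real_mult[symmetric] by (rule integral_complex_of_real)
  moreover have "0 \<le> integral\<^sup>L sphere_measure ?h" using h by (intro integral_nonneg_AE) simp
  ultimately show ?thesis by (simp add: e)
qed

text \<open>The u with x - t u in the unit ball form a set of measure proportional to t^(-d). For
  them |u| \<le> 1/2 + 1/t \<le> 3/4, so \<open>height u\<close> is at least 1/4 and the slicing
  weight is bounded below.\<close>

lemma bisph_nn_ball_ge: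
  assumes d: "2 \<le> DIM('a::euclidean_space)"
  obtains c :: real where "0 < c"
    "\<And>t x. 4 \<le> t \<Longrightarrow> norm (x :: 'a) \<le> t / 2 \<Longrightarrow> ennreal (c / t ^ DIM('a)) \<le> bisph_nn t (indicator unit_ball) (\<lambda>_. 1) x"
proof -
  let ?d = "DIM('a)"
  obtain b where b: "emeasure lborel (unit_ball :: 'a set) = ennreal b" "0 < b"
    using emeasure_unit_ball[where 'a='a] less_top_ennreal by (metis ennreal_less_zero_iff)
  show thesis
  proof (rule that[of "real ?d * ((1 / 4) ^ (?d - 2) * b * b)"])
    show "0 < real ?d * ((1 / 4) ^ (?d - 2) * b * b)" using b by simp
    fix t :: real and x :: 'a assume t: "4 \<le> t" and x: "norm x \<le> t / 2"
    let ?J = "NI u. indicator (unit_ball :: 'a set) (x - t *\<^sub>R u)"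
    have "ennreal b = ennreal (\<bar>- t\<bar> ^ ?d) * (NI u. indicator (unit_ball :: 'a set) (x + (- t) *\<^sub>R u))"
      using nn_integral_lborel_affine[of "indicator (unit_ball :: 'a set)" "- t" x] t b by simp
    then have J: "ennreal b = ennreal (t ^ ?d) * ?J" using t by simp
    have s: "sph_nn r (\<lambda>_. 1) y = ennreal b" for r and y :: 'a unfolding sph_nn_def using b by simp
    have "ennreal (real ?d * ((1 / 4) ^ (?d - 2) * b * b) / t ^ ?d) = ennreal (real ?d * ((1 / 4) ^ (?d - 2) * b) / t ^ ?d) * ennreal b"
      using b t by (subst ennreal_mult[symmetric]) auto
    also have "\<dots> = ennreal (real ?d * ((1 / 4) ^ (?d - 2) * b) / t ^ ?d) * ennreal (t ^ ?d) * ?J"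
      by (simp only: J mult.assoc)
    also have "\<dots> = ennreal (real ?d * ((1 / 4) ^ (?d - 2) * b)) * ?J"
      using b t by (subst ennreal_mult[symmetric]) auto
    also have "\<dots> = ennreal (real ?d) * (NI u. ennreal ((1 / 4) ^ (?d - 2) * b) * indicator (unit_ball :: 'a set) (x - t *\<^sub>R u))"
      using b by (subst nn_integral_cmult, measurable) (simp only: ennreal_mult mult.assoc of_nat_0_le_iff mult_nonneg_nonneg zero_le_power zero_le_divide_1_iff zero_le_numeral less_imp_le)
    also have "\<dots> \<le> ennreal (real ?d) * (NI u. indicator (ball 0 1) u * ennreal (height u ^ (?d - 2)) * (indicator (unit_ball :: 'a set) (x - t *\<^sub>R u) * sph_nn (t * height u) (\<lambda>_. 1) x))"
    proof (intro mult_left_mono nn_integral_mono)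
      fix u :: 'a
      show "ennreal ((1 / 4) ^ (?d - 2) * b) * indicator (unit_ball :: 'a set) (x - t *\<^sub>R u) \<le> indicator (ball 0 1) u * ennreal (height u ^ (?d - 2)) * (indicator (unit_ball :: 'a set) (x - t *\<^sub>R u) * sph_nn (t * height u) (\<lambda>_. 1) x)"
      proof (cases "x - t *\<^sub>R u \<in> unit_ball")
        case True
        have "norm (t *\<^sub>R u) \<le> norm x + norm (x - t *\<^sub>R u)" using norm_triangle_sub[of "t *\<^sub>R u" x] by (simp add: norm_minus_commute)
        also have "\<dots> \<le> t / 2 + t / 4" using x True t by (intro add_mono) auto
        finally have "t * norm u \<le> t * (3 / 4)" using t by simp
        then have u: "norm u \<le> 3 / 4" using t by simp
        then have "norm u ^ 2 \<le> (3 / 4) ^ 2" by (intro power_mono) auto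
        then have "sqrt ((1 / 4) ^ 2) \<le> height u" by (intro real_sqrt_le_mono) (simp add: power2_eq_square)
        then have "(1 / 4) ^ (?d - 2) \<le> height u ^ (?d - 2)" by (intro power_mono) auto
        then have "ennreal ((1 / 4) ^ (?d - 2)) * ennreal b \<le> ennreal (height u ^ (?d - 2)) * ennreal b" by (intro mult_right_mono ennreal_leI) auto
        then show ?thesis using True u b by (simp add: s ennreal_mult)
      qed simp
    qed simp
    also have "\<dots> = bisph_nn t (indicator unit_ball) (\<lambda>_. 1) x" by (rule bisph_nn_slice[symmetric, OF _ _ d]) measurable
    finally show "ennreal (real ?d * ((1 / 4) ^ (?d - 2) * b * b) / t ^ ?d) \<le> bisph_nn t (indicator unit_ball) (\<lambda>_. 1) x" .
  qed
qed

text \<open>Since \<open>\<M>\<^bsub>lac\<^esub>(1\<^bsub>B\<^esub>, 1)(x)\<close> is at least a multiple of \<open>\<bar>x\<bar>\<^sup>-\<^sup>d\<close>, every dyadic shell contributes the same amount to the integral.\<close>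

lemma nn_integral_bisph_max_ball:
  fixes h :: "'a::euclidean_space \<Rightarrow> ennreal"
  assumes d: "2 \<le> DIM('a)" and h: "\<And>l x. bisph_nn (2 powi (- l)) (indicator unit_ball) (\<lambda>_. 1) x \<le> h x"
  shows "(NI x. h x) = top"
proof -
  let ?d = "DIM('a)"
  obtain c where c: "0 < c" and lower: "\<And>t x. 4 \<le> t \<Longrightarrow> norm (x :: 'a) \<le> t / 2 \<Longrightarrow> ennreal (c / t ^ ?d) \<le> bisph_nn t (indicator unit_ball) (\<lambda>_. 1) x"
    using bisph_nn_ball_ge[OF d] by metis
  obtain b where b: "emeasure lborel (unit_ball :: 'a set) = ennreal b" "0 < b"
    using emeasure_unit_ball[where 'a='a] less_top_ennreal by (metis ennreal_less_zero_iff)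
  define S where "S n = {x::'a. 2 ^ n < norm x \<and> norm x \<le> 2 ^ Suc n}" for n :: nat
  have [measurable]: "S n \<in> sets borel" for n unfolding S_def by measurable
  have dbl: "norm y \<le> 2 * 2 ^ n" if "norm y \<le> 2 ^ n" for y :: 'a and n :: nat
    using that zero_le_power[of "2::real" n] by linarith
  have ball: "emeasure lborel (cball (0::'a) (2 ^ n)) = ennreal ((2 ^ n) ^ ?d * b)" for n :: nat
    using emeasure_ball_scale[of "2 ^ n" "0::'a"] b by (simp add: ennreal_mult)
  \<comment> \<open>The lower bound at radius t = 2^(n + 2), that is l = - (n + 2): every x in
    \<open>S n\<close> satisfies |x| \<le> t / 2, and t \<ge> 4.\<close>
  define a where "a n = ennreal (c / (2 ^ (n + 2)) ^ ?d)" for n :: nat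
  have shell: "ennreal (c * b / 4 ^ ?d) \<le> (NI x. a n * indicator (S n) x)" for n
  proof -
    have "ennreal ((2 ^ Suc n) ^ ?d * b) = emeasure lborel (cball (0::'a) (2 ^ n) \<union> S n)"
      unfolding ball[symmetric] by (rule arg_cong[where f = "emeasure lborel"]) (auto simp: S_def dbl)
    also have "\<dots> \<le> ennreal ((2 ^ n) ^ ?d * b) + emeasure lborel (S n)" unfolding ball[symmetric] by (rule emeasure_subadditive) measurable
    finally have 1: "ennreal ((2 ^ Suc n) ^ ?d * b) \<le> ennreal ((2 ^ n) ^ ?d * b) + emeasure lborel (S n)" .
    have "2 * (2 ^ n) ^ ?d * b \<le> (2 ^ Suc n) ^ ?d * b"
    proof -
      have "2 * (2 ^ n) ^ ?d \<le> (2::real) ^ ?d * (2 ^ n) ^ ?d" using self_le_power[of "2::real" ?d] by (intro mult_right_mono) auto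
      also have "\<dots> = (2 ^ Suc n) ^ ?d" by (simp add: power_mult_distrib)
      finally show ?thesis using b by (intro mult_right_mono) auto
    qed
    then have "ennreal ((2 ^ n) ^ ?d * b) + ennreal ((2 ^ n) ^ ?d * b) \<le> ennreal ((2 ^ Suc n) ^ ?d * b)"
      using b by (subst ennreal_plus[symmetric]) (auto intro!: ennreal_leI)
    from order_trans[OF this 1] have S: "ennreal ((2 ^ n) ^ ?d * b) \<le> emeasure lborel (S n)" by (subst (asm) ennreal_add_left_cancel_le) auto
    have "c * b / 4 ^ ?d = c / (2 ^ (n + 2)) ^ ?d * ((2 ^ n) ^ ?d * b)" by (simp add: power_add power_mult_distrib)
    then have "ennreal (c * b / 4 ^ ?d) = ennreal (c / (2 ^ (n + 2)) ^ ?d) * ennreal ((2 ^ n) ^ ?d * b)"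
      using b c by (subst ennreal_mult[symmetric]) auto
    also have "\<dots> \<le> ennreal (c / (2 ^ (n + 2)) ^ ?d) * emeasure lborel (S n)" by (rule mult_left_mono[OF S]) simp
    also have "\<dots> = (NI x. a n * indicator (S n) x)" by (simp add: a_def nn_integral_cmult_indicator)
    finally show ?thesis .
  qed
  have low: "a n \<le> h x" if "x \<in> S n" for n x
  proof -
    have "(2::real) powi (- (- int (n + 2))) = 2 ^ (n + 2)" by (simp only: minus_minus power_int_of_nat)
    then have "bisph_nn (2 ^ (n + 2)) (indicator unit_ball) (\<lambda>_. 1) x \<le> h x" using h[of "- int (n + 2)" x] by (simp only:)
    moreover have "a n \<le> bisph_nn (2 ^ (n + 2)) (indicator unit_ball) (\<lambda>_. 1) x"
      unfolding a_def using that by (intro lower) (auto simp: S_def)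
    ultimately show ?thesis by (rule order_trans[rotated])
  qed
  have disj: "disjoint_family S"
  proof -
    have "S i \<inter> S j = {}" if "i < j" for i j
      using power_increasing[of "Suc i" j "2::real"] that by (auto simp: S_def)
    then show ?thesis unfolding disjoint_family_on_def by (metis Int_commute linorder_neqE_nat)
  qed
  have le: "of_nat n * ennreal (c * b / 4 ^ ?d) \<le> (NI x. h x)" for n :: nat
  proof -
    have "of_nat n * ennreal (c * b / 4 ^ ?d) = (\<Sum>i<n. ennreal (c * b / 4 ^ ?d))" by simp
    also have "\<dots> \<le> (\<Sum>i<n. NI x. a i * indicator (S i) x)" by (intro sum_mono shell)
    also have "\<dots> = (NI x. (\<Sum>i<n. a i * indicator (S i) x))" by (rule nn_integral_sum[symmetric]) simp
    also have "\<dots> \<le> (NI x. h x)"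
    proof (rule nn_integral_mono)
      fix x
      show "(\<Sum>i<n. a i * indicator (S i) x) \<le> h x"
      proof (cases "\<exists>j<n. x \<in> S j")
        case True
        then obtain j where j: "j < n" "x \<in> S j" by blast
        have "(\<Sum>i<n. a i * indicator (S i) x) = (\<Sum>i<n. if i = j then a j else 0)"
          using disj j(2) by (intro sum.cong) (auto simp: disjoint_family_on_def indicator_def)
        also have "\<dots> = a j" using j(1) by simp
        finally show ?thesis using low[OF j(2)] by simp
      qed (simp add: indicator_def)
    qed
    finally show ?thesis .
  qed
  show ?thesis
  proof (rule ccontr)
    assume "(NI x. h x) \<noteq> top"
    then obtain v where v: "(NI x. h x) = ennreal v" "0 \<le> v" by (metis ennreal_cases)
    obtain n :: nat where "v / (c * b / 4 ^ ?d) < real n" using reals_Archimedean2 by blast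
    moreover have "0 < c * b / 4 ^ ?d" using c b by simp
    ultimately have "v < real n * (c * b / 4 ^ ?d)" by (simp only: pos_divide_less_eq)
    moreover have "of_nat n * ennreal (c * b / 4 ^ ?d) = ennreal (real n * (c * b / 4 ^ ?d))"
      using c b by (subst ennreal_mult) (auto simp: ennreal_of_nat_eq_real_of_nat)
    then have "real n * (c * b / 4 ^ ?d) \<le> v" using le[of n] v by (simp del: times_divide_eq_right)
    ultimately show False by simp
  qed
qed

lemma not_bounded_bilin_L1:
  assumes d: "2 \<le> DIM('a::euclidean_space)"
  shows "\<not> bounded_bilin (lac_max :: 'a bilin_op) 1 top (Lnorm 1)" "\<not> bounded_bilin (lac_max :: 'a bilin_op) top 1 (Lnorm 1)"
proof -
  let ?f = "\<lambda>y::'a. complex_of_real (indicator unit_ball y)" and ?g = "\<lambda>y::'a. complex_of_real 1"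
  have ind: "(\<lambda>y. ennreal (indicator unit_ball y)) = (indicator unit_ball :: 'a \<Rightarrow> ennreal)" by (auto simp: indicator_def)
  have fm: "?f \<in> borel_measurable lebesgue" "?g \<in> borel_measurable lebesgue" by (intro measurable_completion; measurable)+
  have "fun_Lnorm 1 ?f = emeasure lborel (unit_ball :: 'a set)"
    unfolding Lnorm_def nn_integral_completion by (simp add: indicator_def[symmetric] ind)
  then have f: "?f \<in> Lp 1" "fun_Lnorm 1 ?f < top" using emeasure_unit_ball(2)[where 'a='a] fm by (auto simp: Lp_def)
  have "fun_Lnorm top ?g \<le> 1" unfolding Lnorm_def by (simp, intro esssup_I) auto
  then have g: "?g \<in> Lp top" "fun_Lnorm top ?g < top" using fm by (auto simp: Lp_def intro: le_less_trans)
  have inf: "Lnorm 1 h = top" if "\<And>l x. bisph_nn (2 powi (- l)) (indicator unit_ball) (\<lambda>_. 1) x \<le> h x" for h :: "'a \<Rightarrow> ennreal"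
    using nn_integral_bisph_max_ball[OF d that] by (simp add: Lnorm_def nn_integral_completion)
  have up: "ennreal (norm (bisph_avg (2 powi - l) f g x)) \<le> lac_max f g x" for l x and f g :: "'a \<Rightarrow> complex"
    unfolding lac_max_def by (rule SUP_upper) simp
  have 1: "Lnorm 1 (lac_max ?f ?g) = top"
  proof (rule inf)
    show "bisph_nn (2 powi (- l)) (indicator unit_ball) (\<lambda>_. 1) x \<le> lac_max ?f ?g x" for l x
      using norm_bisph_avg_of_real[of "indicator unit_ball" "\<lambda>_. 1" "2 powi (- l)" x] up[of l ?f ?g x] by (simp add: ind)
  qed
  have 2: "Lnorm 1 (lac_max ?g ?f) = top"
  proof (rule inf)
    have "bisph_nn t (indicator unit_ball) (\<lambda>_. 1) x = bisph_nn t (\<lambda>_. 1) (indicator unit_ball) x" for t and x :: 'a by (rule bisph_nn_commute) measurable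
    then show "bisph_nn (2 powi (- l)) (indicator unit_ball) (\<lambda>_. 1) x \<le> lac_max ?g ?f x" for l x
      using norm_bisph_avg_of_real[of "\<lambda>_. 1" "indicator unit_ball" "2 powi (- l)" x] up[of l ?g ?f x] by (simp add: ind)
  qed
  show "\<not> bounded_bilin (lac_max :: 'a bilin_op) 1 top (Lnorm 1)"
  proof
    assume "bounded_bilin (lac_max :: 'a bilin_op) 1 top (Lnorm 1)"
    then obtain C where "Lnorm 1 (lac_max ?f ?g) \<le> ennreal C * fun_Lnorm 1 ?f * fun_Lnorm top ?g" using f g unfolding bounded_bilin_def by blast
    also have "\<dots> < top" using f g by (simp add: ennreal_mult_less_top)
    finally show False using 1 by simp
  qed
  show "\<not> bounded_bilin (lac_max :: 'a bilin_op) top 1 (Lnorm 1)"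
  proof
    assume "bounded_bilin (lac_max :: 'a bilin_op) top 1 (Lnorm 1)"
    then obtain C where "Lnorm 1 (lac_max ?g ?f) \<le> ennreal C * fun_Lnorm top ?g * fun_Lnorm 1 ?f" using f g unfolding bounded_bilin_def by blast
    also have "\<dots> < top" using f g by (simp add: ennreal_mult_less_top)
    finally show False using 2 by simp
  qed
qed

theorem theorem1:
  assumes "CARD('d::finite) \<ge> 2"
  shows
    "(\<forall>p q r :: ennreal. 1 < p \<and> 1 < q \<and> 0 < r \<and> r < top \<and> 1 / r = 1 / p + 1 / q \<longrightarrow>
        (\<forall>f\<in>Lp p. \<forall>g\<in>Lp q. bisph_well_defined f (g :: real ^ 'd \<Rightarrow> complex)) \<and>
        bounded_bilin (lac_max :: (real ^ 'd) bilin_op) p q (Lnorm r)) \<and>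
     \<not> bounded_bilin (lac_max :: (real ^ 'd) bilin_op) 1 top (Lnorm 1) \<and>
     \<not> bounded_bilin (lac_max :: (real ^ 'd) bilin_op) top 1 (Lnorm 1) \<and>
     (\<forall>f\<in>Lp 1. \<forall>g\<in>Lp top. bisph_well_defined f (g :: real ^ 'd \<Rightarrow> complex)) \<and>
     bounded_bilin (lac_max :: (real ^ 'd) bilin_op) 1 top weak_L1_norm \<and>
     (\<forall>f\<in>Lp top. \<forall>g\<in>Lp 1. bisph_well_defined f (g :: real ^ 'd \<Rightarrow> complex)) \<and>
     bounded_bilin (lac_max :: (real ^ 'd) bilin_op) top 1 weak_L1_norm"
proof -
  have d: "2 \<le> DIM(real ^ 'd)" using assms by simp
  have wd: "\<forall>f\<in>Lp p. \<forall>g\<in>Lp q. bisph_well_defined f (g :: real ^ 'd \<Rightarrow> complex)" if "1 \<le> p" "1 \<le> q" for p q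
    using that by (intro ballI bisph_well_defined_Lp[OF _ _ _ _ d])
  have strong: "bounded_bilin (lac_max :: (real ^ 'd) bilin_op) p q (Lnorm r)"
    if "1 < p" "1 < q" "0 < r" "r < top" "1 / r = 1 / p + 1 / q" for p q r
    using that by (intro bounded_bilin_lac_max d lac_max_strong_bound) auto
  have weak: "bounded_bilin (lac_max :: (real ^ 'd) bilin_op) 1 top weak_L1_norm" "bounded_bilin (lac_max :: (real ^ 'd) bilin_op) top 1 weak_L1_norm"
    using borel_bounded_weak[OF d] borel_bounded_commute[OF borel_bounded_weak[OF d]] by (intro bounded_bilin_lac_max d; simp)+
  show ?thesis
    by (intro conjI weak not_bounded_bilin_L1[OF d] wd[of 1 top] wd[of top 1] allI impI; (elim conjE)?; (intro wd strong)?; simp add: less_imp_le)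
qed

end
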